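(* Suppose that the minimal operator $T_{\min}$ is strictly positive in the sense that there exists $\varepsilon>0$ such that $\langle T_{\min}f,f\rangle\ge\varepsilon\langle f,f\rangle$ for all $f\in\operatorname{dom}(T_{\min})$. Then the Krein–von Neumann extension $S_K$ of $T_{\min}$ is given by $S_Kf=\tau f$ for $$f\in\operatorname{dom}(S_K)=\left\{g\in\operatorname{dom}(T_{\max})\,\middle|\,\begin{pmatrix} g(b) \\ g^{[1]}(b) \end{pmatrix}=R_K\begin{pmatrix} g(a) \\ g^{[1]}(a) \end{pmatrix}\right\},$$ where $$R_K=\frac1{u_1^{[1]}(a)}\begin{pmatrix} -u_2^{[1]}(a) & 1 \\ u_1^{[1]}(a)u_2^{[1]}(b)-u_1^{[1]}(b)u_2^{[1]}(a) & u_1^{[1]}(b) \end{pmatrix}\in \mathrm{SL}_2(\mathbb R).$$ Here $u_1,u_2$ are the positive solutions (on $(a,b)$) of $\tau u=0$ determined by the conditions $$u_1(a)=0,\quad u_1(b)=1,\qquad u_2(a)=1,\quad u_2(b)=0.$$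
   Context: Setting (regular case). $(a,b)\subseteq\mathbb R$ is an open interval; $p,q,r,s$ are Lebesgue measurable and real-valued a.e. on $(a,b)$, with $p^{-1},q,r,s\in L^1((a,b);dx)$ and $p>0$, $r>0$ a.e. on $(a,b)$. For $f\in AC_{\mathrm{loc}}((a,b))$ put $f^{[1]}=p(f'+sf)$, $\mathfrak D_\tau=\{f\in AC_{\mathrm{loc}}((a,b)) : f^{[1]}\in AC_{\mathrm{loc}}((a,b))\}$, and $\tau f=\frac1r\big(-(f^{[1]})'+sf^{[1]}+qf\big)$ for $f\in\mathfrak D_\tau$. In $L^2((a,b);r(x)dx)$ (inner product $\langle\cdot,\cdot\rangle$) the maximal operator is $T_{\max}f=\tau f$, $\operatorname{dom}(T_{\max})=\{g\in L^2((a,b);r\,dx): g\in\mathfrak D_\tau,\ \tau g\in L^2((a,b);r\,dx)\}$; $T_0$ is the restriction of $T_{\max}$ to functions with compact support in $(a,b)$, and $T_{\min}=\overline{T_0}$, $T_{\min}^*=T_{\max}$. For $f\in\operatorname{dom}(T_{\max})$ (in particular for solutions of $\tau u=0$) the limits of $f$ and $f^{[1]}$ at $a$ and $b$ exist and are denoted $f(a),f^{[1]}(a),f(b),f^{[1]}(b)$. The Krein–von Neumann extension $S_K$ of a densely defined nonnegative symmetric operator $S_0$ is its smallest nonnegative self-adjoint extension (in the sense of form order); if $S_0$ is closed and $S_0\ge\varepsilon I$ for some $\varepsilon>0$, then $\operatorname{dom}(S_K)=\operatorname{dom}(S_0)\dotplus\ker(S_0^* )$ and $S_K$ is the restriction of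 $S_0^*$ to this domain. *)

theory Defs
  imports "HOL-Analysis.Analysis"
begin

section \<open>Unbounded operators in $L^2$\<close>

text \<open>
  Elements of the Hilbert space $L^2(M)$ are represented by square-integrable functions; two
  functions represent the same element iff they agree \<open>M\<close>-almost everywhere. An operator is given
  by its graph, i.e. the set of all pairs of representatives. All graphs below are closed under
  changing either component on an \<open>M\<close>-null set, so equality of graphs is equality of operators.
\<close>

type_synonym 'a L2_graph = "(('a \<Rightarrow> complex) \<times> ('a \<Rightarrow> complex)) set"

definition L2 :: "'a measure \<Rightarrow> ('a \<Rightarrow> complex) set" where
  "L2 M = {f \<in> borel_measurable M. integrable M (\<lambda>x. (cmod (f x))\<^sup>2)}"

definition L2_inner :: "'a measure \<Rightarrow> ('a \<Rightarrow> complex) \<Rightarrow> ('a \<Rightarrow> complex) \<Rightarrow> complex" where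
  "L2_inner M f g = (\<integral>x. cnj (f x) * g x \<partial>M)"

definition L2_norm :: "'a measure \<Rightarrow> ('a \<Rightarrow> complex) \<Rightarrow> real" where
  "L2_norm M f = sqrt (\<integral>x. (cmod (f x))\<^sup>2 \<partial>M)"

definition op_closure :: "'a measure \<Rightarrow> 'a L2_graph \<Rightarrow> 'a L2_graph" where
  "op_closure M T = {(f, h). f \<in> L2 M \<and> h \<in> L2 M \<and>
     (\<forall>e>0. \<exists>(f', h')\<in>T. L2_norm M (\<lambda>x. f x - f' x) < e \<and> L2_norm M (\<lambda>x. h x - h' x) < e)}"

definition densely_defined :: "'a measure \<Rightarrow> 'a L2_graph \<Rightarrow> bool" where
  "densely_defined M T \<longleftrightarrow> (\<forall>f\<in>L2 M. \<forall>e>0. \<exists>(g, h)\<in>T. L2_norm M (\<lambda>x. f x - g x) < e)"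

definition op_adjoint :: "'a measure \<Rightarrow> 'a L2_graph \<Rightarrow> 'a L2_graph" where
  "op_adjoint M T = {(g, k). g \<in> L2 M \<and> k \<in> L2 M \<and>
     (\<forall>(f, h)\<in>T. L2_inner M h g = L2_inner M f k)}"

text \<open>
  A graph of the form \<open>op_adjoint M T\<close> is a linear subspace closed under almost everywhere equality,
  and it is single-valued (up to null sets) if \<open>T\<close> is densely defined. Hence linearity and
  single-valuedness need not be demanded separately here.
\<close>

definition self_adjoint :: "'a measure \<Rightarrow> 'a L2_graph \<Rightarrow> bool" where
  "self_adjoint M T \<longleftrightarrow> densely_defined M T \<and> op_adjoint M T = T"

text \<open>
  Applied to symmetric operators only, for which \<open>L2_inner M h f\<close> is real.
\<close>

definition nonneg_op :: "'a measure \<Rightarrow> 'a L2_graph \<Rightarrow> bool" where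
  "nonneg_op M T \<longleftrightarrow> (\<forall>(f, h)\<in>T. 0 \<le> Re (L2_inner M h f))"

definition strictly_positive_op :: "'a measure \<Rightarrow> 'a L2_graph \<Rightarrow> bool" where
  "strictly_positive_op M T \<longleftrightarrow>
     (\<exists>\<epsilon>>0. \<forall>(f, h)\<in>T. \<epsilon> * Re (L2_inner M f f) \<le> Re (L2_inner M h f))"

text \<open>
  The closed quadratic form of a nonnegative self-adjoint operator \<open>A\<close> is the closure of the form
  $u \mapsto \langle A u, u\rangle$ on the domain of \<open>A\<close> (equivalently, $u \mapsto \|A^{1/2}u\|^2$ on
  the domain of $A^{1/2}$). A sequence in the graph is form convergent to \<open>u\<close> if its first components
  converge to \<open>u\<close> in $L^2$ and are Cauchy for the form.
\<close>

definition form_convergent ::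
  "'a measure \<Rightarrow> 'a L2_graph \<Rightarrow> (nat \<Rightarrow> ('a \<Rightarrow> complex) \<times> ('a \<Rightarrow> complex)) \<Rightarrow> ('a \<Rightarrow> complex) \<Rightarrow> bool" where
  "form_convergent M A w u \<longleftrightarrow> (\<forall>n. w n \<in> A) \<and>
     (\<lambda>n. L2_norm M (\<lambda>x. fst (w n) x - u x)) \<longlonglongrightarrow> 0 \<and>
     (\<forall>e>0. \<exists>N. \<forall>m\<ge>N. \<forall>n\<ge>N.
        Re (L2_inner M (\<lambda>x. snd (w m) x - snd (w n) x) (\<lambda>x. fst (w m) x - fst (w n) x)) < e)"

definition form_domain :: "'a measure \<Rightarrow> 'a L2_graph \<Rightarrow> ('a \<Rightarrow> complex) set" where
  "form_domain M A = {u \<in> L2 M. \<exists>w. form_convergent M A w u}"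

definition form_value :: "'a measure \<Rightarrow> 'a L2_graph \<Rightarrow> ('a \<Rightarrow> complex) \<Rightarrow> real" where
  "form_value M A u = (THE c. \<forall>w. form_convergent M A w u \<longrightarrow>
     (\<lambda>n. Re (L2_inner M (snd (w n)) (fst (w n)))) \<longlonglongrightarrow> c)"

definition form_le :: "'a measure \<Rightarrow> 'a L2_graph \<Rightarrow> 'a L2_graph \<Rightarrow> bool" where
  "form_le M A B \<longleftrightarrow> form_domain M B \<subseteq> form_domain M A \<and>
     (\<forall>u\<in>form_domain M B. form_value M A u \<le> form_value M B u)"

definition is_Krein_von_Neumann_extension ::
  "'a measure \<Rightarrow> 'a L2_graph \<Rightarrow> 'a L2_graph \<Rightarrow> bool" where
  "is_Krein_von_Neumann_extension M T S \<longleftrightarrow>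
     self_adjoint M S \<and> nonneg_op M S \<and> T \<subseteq> S \<and>
     (\<forall>A. self_adjoint M A \<and> nonneg_op M A \<and> T \<subseteq> A \<longrightarrow> form_le M S A)"


section \<open>Local absolute continuity and boundary values\<close>

definition abs_cont_on :: "real \<Rightarrow> real \<Rightarrow> (real \<Rightarrow> complex) \<Rightarrow> bool" where
  "abs_cont_on c d f \<longleftrightarrow> (\<forall>e>0. \<exists>\<delta>>0. \<forall>J::(real \<times> real) set.
     finite J \<and> (\<forall>(x, y)\<in>J. c \<le> x \<and> x \<le> y \<and> y \<le> d) \<and>
     pairwise (\<lambda>(x, y) (x', y'). {x<..<y} \<inter> {x'<..<y'} = {}) J \<and>
     (\<Sum>(x, y)\<in>J. y - x) < \<delta> \<longrightarrow> (\<Sum>(x, y)\<in>J. cmod (f y - f x)) < e)"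

definition AC_loc :: "ereal \<Rightarrow> ereal \<Rightarrow> (real \<Rightarrow> complex) set" where
  "AC_loc a b = {f. \<forall>c d. a < ereal c \<and> c \<le> d \<and> ereal d < b \<longrightarrow> abs_cont_on c d f}"

text \<open>
  The endpoints may be infinite, so boundary values are one-sided limits at extended reals.
\<close>

definition left_value :: "ereal \<Rightarrow> (real \<Rightarrow> complex) \<Rightarrow> complex" where
  "left_value a f = Lim (at_right a) (f \<circ> real_of_ereal)"

definition right_value :: "ereal \<Rightarrow> (real \<Rightarrow> complex) \<Rightarrow> complex" where
  "right_value b f = Lim (at_left b) (f \<circ> real_of_ereal)"


section \<open>The Sturm--Liouville expression\<close>

text \<open>
  $p(f'+sf)$ is only defined almost everywhere, and $f^{[1]}$ stands for its locally absolutely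
  continuous representative, which is unique on $(a,b)$.
\<close>

definition is_quasi_deriv ::
  "ereal \<Rightarrow> ereal \<Rightarrow> (real \<Rightarrow> real) \<Rightarrow> (real \<Rightarrow> real) \<Rightarrow>
   (real \<Rightarrow> complex) \<Rightarrow> (real \<Rightarrow> complex) \<Rightarrow> bool" where
  "is_quasi_deriv a b p s f g \<longleftrightarrow> g \<in> AC_loc a b \<and>
     (AE x in lebesgue_on (einterval a b).
        g x = of_real (p x) * (vector_derivative f (at x) + of_real (s x) * f x))"

definition quasi_deriv ::
  "ereal \<Rightarrow> ereal \<Rightarrow> (real \<Rightarrow> real) \<Rightarrow> (real \<Rightarrow> real) \<Rightarrow> (real \<Rightarrow> complex) \<Rightarrow> (real \<Rightarrow> complex)" where
  "quasi_deriv a b p s f = (SOME g. is_quasi_deriv a b p s f g)"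

definition D_tau ::
  "ereal \<Rightarrow> ereal \<Rightarrow> (real \<Rightarrow> real) \<Rightarrow> (real \<Rightarrow> real) \<Rightarrow> (real \<Rightarrow> complex) set" where
  "D_tau a b p s = {f \<in> AC_loc a b. \<exists>g. is_quasi_deriv a b p s f g}"

definition tau ::
  "ereal \<Rightarrow> ereal \<Rightarrow> (real \<Rightarrow> real) \<Rightarrow> (real \<Rightarrow> real) \<Rightarrow> (real \<Rightarrow> real) \<Rightarrow> (real \<Rightarrow> real) \<Rightarrow>
   (real \<Rightarrow> complex) \<Rightarrow> (real \<Rightarrow> complex)" where
  "tau a b p q r s f = (\<lambda>x. of_real (1 / r x) *
     (- vector_derivative (quasi_deriv a b p s f) (at x)
      + of_real (s x) * quasi_deriv a b p s f x + of_real (q x) * f x))"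

definition weighted_measure :: "ereal \<Rightarrow> ereal \<Rightarrow> (real \<Rightarrow> real) \<Rightarrow> real measure" where
  "weighted_measure a b r = density (lebesgue_on (einterval a b)) (\<lambda>x. ennreal (r x))"

definition dom_max ::
  "ereal \<Rightarrow> ereal \<Rightarrow> (real \<Rightarrow> real) \<Rightarrow> (real \<Rightarrow> real) \<Rightarrow> (real \<Rightarrow> real) \<Rightarrow> (real \<Rightarrow> real) \<Rightarrow>
   (real \<Rightarrow> complex) set" where
  "dom_max a b p q r s = {g \<in> L2 (weighted_measure a b r).
     g \<in> D_tau a b p s \<and> tau a b p q r s g \<in> L2 (weighted_measure a b r)}"

definition compactly_supported_in :: "ereal \<Rightarrow> ereal \<Rightarrow> (real \<Rightarrow> complex) \<Rightarrow> bool" where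
  "compactly_supported_in a b g \<longleftrightarrow>
     (\<exists>K. compact K \<and> K \<subseteq> einterval a b \<and> (\<forall>x\<in>einterval a b - K. g x = 0))"

text \<open>
  The operator $f \mapsto \tau f$ with domain the set of classes of functions in \<open>D\<close>.
\<close>

definition tau_op ::
  "ereal \<Rightarrow> ereal \<Rightarrow> (real \<Rightarrow> real) \<Rightarrow> (real \<Rightarrow> real) \<Rightarrow> (real \<Rightarrow> real) \<Rightarrow> (real \<Rightarrow> real) \<Rightarrow>
   (real \<Rightarrow> complex) set \<Rightarrow> real L2_graph" where
  "tau_op a b p q r s D = {(f, h).
     f \<in> L2 (weighted_measure a b r) \<and> h \<in> L2 (weighted_measure a b r) \<and>
     (\<exists>g\<in>D. (AE x in weighted_measure a b r. f x = g x) \<and>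
            (AE x in weighted_measure a b r. h x = tau a b p q r s g x))}"

definition T_min ::
  "ereal \<Rightarrow> ereal \<Rightarrow> (real \<Rightarrow> real) \<Rightarrow> (real \<Rightarrow> real) \<Rightarrow> (real \<Rightarrow> real) \<Rightarrow> (real \<Rightarrow> real) \<Rightarrow>
   real L2_graph" where
  "T_min a b p q r s = op_closure (weighted_measure a b r)
     (tau_op a b p q r s {g \<in> dom_max a b p q r s. compactly_supported_in a b g})"

definition solves_bvp ::
  "ereal \<Rightarrow> ereal \<Rightarrow> (real \<Rightarrow> real) \<Rightarrow> (real \<Rightarrow> real) \<Rightarrow> (real \<Rightarrow> real) \<Rightarrow> (real \<Rightarrow> real) \<Rightarrow>
   complex \<Rightarrow> complex \<Rightarrow> (real \<Rightarrow> complex) \<Rightarrow> bool" where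
  "solves_bvp a b p q r s \<alpha> \<beta> u \<longleftrightarrow> u \<in> D_tau a b p s \<and>
     (AE x in lebesgue_on (einterval a b). tau a b p q r s u x = 0) \<and>
     left_value a u = \<alpha> \<and> right_value b u = \<beta>"

definition positive_on :: "ereal \<Rightarrow> ereal \<Rightarrow> (real \<Rightarrow> complex) \<Rightarrow> bool" where
  "positive_on a b u \<longleftrightarrow> (\<forall>x\<in>einterval a b. u x \<in> \<real> \<and> 0 < Re (u x))"

definition SL2_real :: "(complex^2^2) set" where
  "SL2_real = {map_matrix complex_of_real A | A :: real^2^2. det A = 1}"

definition Krein_matrix ::
  "ereal \<Rightarrow> ereal \<Rightarrow> (real \<Rightarrow> real) \<Rightarrow> (real \<Rightarrow> real) \<Rightarrow>
   (real \<Rightarrow> complex) \<Rightarrow> (real \<Rightarrow> complex) \<Rightarrow> complex^2^2" where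
  "Krein_matrix a b p s u1 u2 =
     (let u1a = left_value a (quasi_deriv a b p s u1); u1b = right_value b (quasi_deriv a b p s u1);
          u2a = left_value a (quasi_deriv a b p s u2); u2b = right_value b (quasi_deriv a b p s u2)
      in map_matrix (\<lambda>z. 1 / u1a * z)
         (vector [vector [- u2a, 1], vector [u1a * u2b - u1b * u2a, u1b]]))"

definition dom_Krein ::
  "ereal \<Rightarrow> ereal \<Rightarrow> (real \<Rightarrow> real) \<Rightarrow> (real \<Rightarrow> real) \<Rightarrow> (real \<Rightarrow> real) \<Rightarrow> (real \<Rightarrow> real) \<Rightarrow>
   complex^2^2 \<Rightarrow> (real \<Rightarrow> complex) set" where
  "dom_Krein a b p q r s R = {g \<in> dom_max a b p q r s.
     vector [right_value b g, right_value b (quasi_deriv a b p s g)] =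
     R *v (vector [left_value a g, left_value a (quasi_deriv a b p s g)] :: complex^2)}"

end

theory Submission
  imports Defs
begin

text \<open>
  Let $y_1, y_2$ be the real fundamental system of $\tau u = 0$ normalised at $a$. By variation of
  constants a solution of $\tau f = h$ is determined by $\alpha = f(a)$, $\beta = f^{[1]}(a)$ and $h$, and
  its values at $b$ depend on $h$ only through the two moments $\int r y_i h$. In these
  data $T_{\min}$ is given by $\alpha = \beta = 0$ and vanishing moments, its adjoint by no
  condition at all, and the boundary condition with $R_K$ says exactly that the moments vanish;
  self-adjointness of the latter operator $S$ is then the Lagrange identity.

  The rest rests on approximate point sources $h$, whose solutions approach multiples of the Green
  kernel, corrected so that their moments are prescribed exactly. Two sources at conjugate points would
  give a null vector of the form of $T_{\min}$; hence strict positivity makes the Dirichlet solutions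
  $u_1, u_2$ nonvanishing. Two sources at the endpoints realise arbitrary moments with arbitrarily small
  Dirichlet energy. Therefore any nonnegative self-adjoint extension dominates the Dirichlet
  energy of its source term, and its form-convergent sequences can be moved into $S$ without increasing the
  form, so $S$ is the smallest such extension.
\<close>

section \<open>Absolutely continuous functions\<close>

text \<open>The difficulty is minimality: of an arbitrary extension \<open>A\<close> nothing is
  known but nonnegativity on its graph, and its form is accessible only through sequences in that
  graph. Both are handled on the level of sources. Subtracting from a pair \<open>(f, h)\<close> of
  \<open>A\<close> a pair of the minimal operator replaces \<open>h\<close> by any source with the
  same moments and leaves the data at \<open>a\<close> unchanged. A source placed at the endpoints
  is the best replacement: the Dirichlet Green kernel vanishes there, so its Dirichlet energy tends
  to 0 and only a term in the data and the moments survives, whose sign nonnegativity decides. The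
  Dirichlet energy is the right yardstick because it agrees with the form of \<open>S\<close> when
  the moments vanish and yet makes sense for every source. Moments are matched exactly, and not just
  in the limit, because only then does the difference of two sources belong to the minimal operator.
  Point sources blow up in norm, so estimates go through their solutions; the Lagrange identity
  moves the pairing there.\<close>

definition interval_family :: "real \<Rightarrow> real \<Rightarrow> (real \<times> real) set \<Rightarrow> bool" where
  "interval_family c d J \<longleftrightarrow> finite J \<and> (\<forall>(x, y)\<in>J. c \<le> x \<and> x \<le> y \<and> y \<le> d) \<and>
     pairwise (\<lambda>(x, y) (x', y'). {x<..<y} \<inter> {x'<..<y'} = {}) J"

text \<open>A general normed target lets one notion serve complex functions, real variation
  functions and primitives.\<close>

definition AC_on :: "real \<Rightarrow> real \<Rightarrow> (real \<Rightarrow> 'a::real_normed_vector) \<Rightarrow> bool" where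
  "AC_on c d f \<longleftrightarrow> (\<forall>e>0. \<exists>\<delta>>0. \<forall>J. interval_family c d J \<and> (\<Sum>(x, y)\<in>J. y - x) < \<delta> \<longrightarrow>
     (\<Sum>(x, y)\<in>J. norm (f y - f x)) < e)"

lemma abs_cont_on_iff_AC_on: "abs_cont_on c d f \<longleftrightarrow> AC_on c d f"
  by (simp add: abs_cont_on_def AC_on_def interval_family_def conj_assoc)

text \<open>Families of intervals are sets of pairs, so distinct indices may yield the same pair.
  Disjointness then makes that interval degenerate, and it contributes nothing to any of the sums;
  this is what permits reindexing.\<close>

lemma AC_on_indexed:
  fixes l u :: "'i \<Rightarrow> real" and f :: "real \<Rightarrow> 'a::real_normed_vector"
  assumes J: "\<forall>J. interval_family c d J \<and> (\<Sum>(x, y)\<in>J. y - x) < \<delta> \<longrightarrow> (\<Sum>(x, y)\<in>J. norm (f y - f x)) < e"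
    and A: "finite A" "\<And>i. i \<in> A \<Longrightarrow> c \<le> l i \<and> l i \<le> u i \<and> u i \<le> d"
    and disj: "\<And>i j. i \<in> A \<Longrightarrow> j \<in> A \<Longrightarrow> i \<noteq> j \<Longrightarrow> {l i<..<u i} \<inter> {l j<..<u j} = {}"
    and small: "(\<Sum>i\<in>A. u i - l i) < \<delta>"
  shows "(\<Sum>i\<in>A. norm (f (u i) - f (l i))) < e"
proof -
  let ?p = "\<lambda>i. (l i, u i)"
  have degenerate: "l i = u i" if "i \<in> A" "j \<in> A" "i \<noteq> j" "?p i = ?p j" for i j
    using disj[OF that(1,2,3)] A(2)[OF that(1)] that(4)
    by (metis Int_absorb Pair_inject greaterThanLessThan_empty_iff order_antisym)
  have sum_eq: "(\<Sum>(x, y)\<in>?p ` A. g x y) = (\<Sum>i\<in>A. g (l i) (u i))"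
    if "\<And>x. g x x = 0" for g :: "real \<Rightarrow> real \<Rightarrow> real"
  proof -
    have "sum (\<lambda>(x, y). g x y) (?p ` A) = sum ((\<lambda>(x, y). g x y) \<circ> ?p) A"
    proof (rule sum.reindex_nontrivial[OF A(1)])
      fix i j assume "i \<in> A" "j \<in> A" "i \<noteq> j" "?p i = ?p j"
      from degenerate[OF this] show "(case ?p i of (x, y) \<Rightarrow> g x y) = 0" by (simp add: that)
    qed
    then show ?thesis by simp
  qed
  have "{x<..<y} \<inter> {x'<..<y'} = {}" if "(x, y) \<in> ?p ` A" "(x', y') \<in> ?p ` A" "(x, y) \<noteq> (x', y')" for x y x' y'
  proof -
    from that(1) obtain i where i: "i \<in> A" "(x, y) = ?p i" by (elim imageE)
    from that(2) obtain j where j: "j \<in> A" "(x', y') = ?p j" by (elim imageE)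
    note ij = i(1) j(1) i(2) j(2)
    then have "i \<noteq> j" using that(3) by metis
    then show ?thesis using disj[OF ij(1,2)] ij(3,4) by simp
  qed
  moreover have "\<forall>(x, y)\<in>?p ` A. c \<le> x \<and> x \<le> y \<and> y \<le> d" using A(2) by auto
  ultimately have "interval_family c d (?p ` A)"
    unfolding interval_family_def pairwise_def using A(1) by (simp add: case_prod_beta)
  moreover have "(\<Sum>(x, y)\<in>?p ` A. y - x) < \<delta>"
    using small sum_eq[of "\<lambda>x y. y - x"] by simp
  ultimately have "(\<Sum>(x, y)\<in>?p ` A. norm (f y - f x)) < e" using J by blast
  then show ?thesis using sum_eq[of "\<lambda>x y. norm (f y - f x)"] by simp
qed

text \<open>One source for the closure properties: differences, products, real and imaginary parts
  and clamped functions all have increments dominated by those of two absolutely continuous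
  functions.\<close>

lemma AC_on_dominated:
  fixes f :: "real \<Rightarrow> 'a::real_normed_vector" and g :: "real \<Rightarrow> 'b::real_normed_vector"
    and h :: "real \<Rightarrow> 'c::real_normed_vector"
  assumes f: "AC_on c d f" and g: "AC_on c d g"
    and B: "\<And>x y. c \<le> x \<Longrightarrow> x \<le> y \<Longrightarrow> y \<le> d \<Longrightarrow> norm (h y - h x) \<le> B * (norm (f y - f x) + norm (g y - g x))"
  shows "AC_on c d h"
  unfolding AC_on_def
proof (intro allI impI)
  fix e :: real assume "e > 0"
  \<comment> \<open>\<open>B\<close> may be zero or negative; \<open>k\<close> keeps the denominator
    in \<open>e'\<close> positive.\<close>
  define k where "k = \<bar>B\<bar> + 1"
  have "k > 0" by (simp add: k_def add_nonneg_pos)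
  define e' where "e' = e / (2 * k)"
  have "e' > 0" using \<open>e > 0\<close> \<open>k > 0\<close> by (simp add: e'_def)
  obtain d1 where d1: "d1 > 0" "\<And>J. interval_family c d J \<Longrightarrow> (\<Sum>(x, y)\<in>J. y - x) < d1 \<Longrightarrow> (\<Sum>(x, y)\<in>J. norm (f y - f x)) < e'"
    using f \<open>e' > 0\<close> unfolding AC_on_def by blast
  obtain d2 where d2: "d2 > 0" "\<And>J. interval_family c d J \<Longrightarrow> (\<Sum>(x, y)\<in>J. y - x) < d2 \<Longrightarrow> (\<Sum>(x, y)\<in>J. norm (g y - g x)) < e'"
    using g \<open>e' > 0\<close> unfolding AC_on_def by blast
  have "(\<Sum>(x, y)\<in>J. norm (h y - h x)) < e"
    if J: "interval_family c d J" "(\<Sum>(x, y)\<in>J. y - x) < min d1 d2" for J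
  proof -
    have "(\<Sum>(x, y)\<in>J. norm (h y - h x)) \<le> (\<Sum>(x, y)\<in>J. (\<bar>B\<bar>+1) * (norm (f y - f x) + norm (g y - g x)))"
    proof (rule sum_mono, clarify)
      fix x y assume "(x, y) \<in> J"
      then have "c \<le> x" "x \<le> y" "y \<le> d" using J(1) by (auto simp: interval_family_def)
      then have "norm (h y - h x) \<le> B * (norm (f y - f x) + norm (g y - g x))" by (rule B)
      also have "\<dots> \<le> (\<bar>B\<bar>+1) * (norm (f y - f x) + norm (g y - g x))"
        by (intro mult_right_mono) auto
      finally show "norm (h y - h x) \<le> (\<bar>B\<bar>+1) * (norm (f y - f x) + norm (g y - g x))" .
    qed
    also have "\<dots> = (\<bar>B\<bar>+1) * ((\<Sum>(x, y)\<in>J. norm (f y - f x)) + (\<Sum>(x, y)\<in>J. norm (g y - g x)))"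
      by (simp add: case_prod_beta sum_distrib_left sum.distrib distrib_left)
    also have "\<dots> < (\<bar>B\<bar>+1) * (e' + e')"
      using d1(2)[OF J(1)] d2(2)[OF J(1)] J(2) by (intro mult_strict_left_mono add_strict_mono) auto
    also have "\<dots> = e" unfolding e'_def k_def[symmetric] using \<open>k > 0\<close> by (simp add: field_simps)
    finally show ?thesis .
  qed
  moreover have "min d1 d2 > 0" using d1(1) d2(1) by simp
  ultimately show "\<exists>\<delta>>0. \<forall>J. interval_family c d J \<and> (\<Sum>(x, y)\<in>J. y - x) < \<delta> \<longrightarrow> (\<Sum>(x, y)\<in>J. norm (h y - h x)) < e"
    by blast
qed

lemma AC_on_continuous_on:
  fixes f :: "real \<Rightarrow> 'a::real_normed_vector"
  assumes "AC_on c d f"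
  shows "continuous_on {c..d} f"
  unfolding continuous_on_iff
proof (intro ballI allI impI)
  fix x e :: real assume x: "x \<in> {c..d}" and "e > 0"
  then obtain \<delta> where \<delta>: "\<delta> > 0" "\<And>J. interval_family c d J \<Longrightarrow> (\<Sum>(x, y)\<in>J. y - x) < \<delta> \<Longrightarrow> (\<Sum>(x, y)\<in>J. norm (f y - f x)) < e"
    using assms unfolding AC_on_def by blast
  have *: "norm (f v - f u) < e" if "c \<le> u" "u \<le> v" "v \<le> d" "v - u < \<delta>" for u v
    using \<delta>(2)[of "{(u, v)}"] that by (auto simp: interval_family_def)
  have "dist (f x') (f x) < e" if "x' \<in> {c..d}" "dist x' x < \<delta>" for x'
  proof (cases "x' \<le> x")
    case True then show ?thesis using *[of x' x] x that by (auto simp: dist_norm norm_minus_commute)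
  next
    case False then show ?thesis using *[of x x'] x that by (auto simp: dist_norm)
  qed
  then show "\<exists>d'>0. \<forall>x'\<in>{c..d}. dist x' x < d' \<longrightarrow> dist (f x') (f x) < e" using \<delta>(1) by blast
qed

lemma AC_on_diff:
  assumes "AC_on c d f" "AC_on c d g"
  shows "AC_on c d (\<lambda>x. f x - g x)"
proof (rule AC_on_dominated[OF assms, where B=1])
  fix x y
  have "f y - g y - (f x - g x) = (f y - f x) - (g y - g x)" by simp
  then show "norm (f y - g y - (f x - g x)) \<le> 1 * (norm (f y - f x) + norm (g y - g x))"
    by (metis mult_1 norm_triangle_ineq4)
qed

lemma AC_on_mult:
  fixes f g :: "real \<Rightarrow> 'a::real_normed_algebra"
  assumes f: "AC_on c d f" and g: "AC_on c d g"
  shows "AC_on c d (\<lambda>x. f x * g x)"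
proof -
  obtain B1 where B1: "\<And>x. x \<in> {c..d} \<Longrightarrow> norm (f x) \<le> B1"
    using compact_imp_bounded[OF compact_continuous_image[OF AC_on_continuous_on[OF f] compact_Icc]]
    unfolding bounded_iff by blast
  obtain B2 where B2: "\<And>x. x \<in> {c..d} \<Longrightarrow> norm (g x) \<le> B2"
    using compact_imp_bounded[OF compact_continuous_image[OF AC_on_continuous_on[OF g] compact_Icc]]
    unfolding bounded_iff by blast
  show ?thesis
  proof (rule AC_on_dominated[OF f g, where B="max \<bar>B1\<bar> \<bar>B2\<bar>"])
    fix x y assume xy: "c \<le> x" "x \<le> y" "y \<le> d"
    have "f y * g y - f x * g x = f y * (g y - g x) + (f y - f x) * g x" by (simp add: algebra_simps)
    then have "norm (f y * g y - f x * g x) \<le> norm (f y * (g y - g x)) + norm ((f y - f x) * g x)"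
      by (metis norm_triangle_ineq)
    also have "\<dots> \<le> norm (f y) * norm (g y - g x) + norm (f y - f x) * norm (g x)"
      by (intro add_mono norm_mult_ineq)
    also have "\<dots> \<le> max \<bar>B1\<bar> \<bar>B2\<bar> * norm (g y - g x) + norm (f y - f x) * max \<bar>B1\<bar> \<bar>B2\<bar>"
      using B1[of y] B2[of x] xy by (intro add_mono mult_right_mono mult_left_mono) auto
    finally show "norm (f y * g y - f x * g x) \<le> max \<bar>B1\<bar> \<bar>B2\<bar> * (norm (f y - f x) + norm (g y - g x))"
      by (simp add: algebra_simps)
  qed
qed

section \<open>Indefinite integrals are absolutely continuous\<close>

lemma sum_set_integral_le:
  fixes v :: "real \<Rightarrow> real"
  assumes v: "integrable lebesgue v" "\<And>x. 0 \<le> v x" and J: "interval_family c d J"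
  shows "(\<Sum>(x, y)\<in>J. LINT t:{x<..<y}|lebesgue. v t) \<le> (LINT t|lebesgue. v t)"
proof -
  have fin: "finite J" using J by (simp add: interval_family_def)
  have ind: "(\<Sum>(x, y)\<in>J. indicator {x<..<y} t :: real) \<le> 1" for t
  proof -
    \<comment> \<open>The pairs of \<open>J\<close> whose open interval contains \<open>t\<close>;
      pairwise disjointness leaves at most one.\<close>
    let ?A = "{p\<in>J. t \<in> {fst p<..<snd p}}"
    have one: "p = p'" if "p \<in> ?A" "p' \<in> ?A" for p p'
    proof (rule ccontr)
      assume "p \<noteq> p'"
      then have "{fst p<..<snd p} \<inter> {fst p'<..<snd p'} = {}"
        using J that unfolding interval_family_def pairwise_def by (auto simp: case_prod_beta)
      then show False using that by blast
    qed
    have "(\<Sum>(x, y)\<in>J. indicator {x<..<y} t :: real) = real (card ?A)"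
      unfolding case_prod_beta indicator_def using fin by (simp add: sum.If_cases Int_def)
    also have "card ?A \<le> Suc 0"
    proof (subst card_le_Suc0_iff_eq)
      show "finite ?A" using fin by simp
      show "\<forall>p\<in>?A. \<forall>p'\<in>?A. p = p'" using one by blast
    qed
    finally show ?thesis by simp
  qed
  have int: "integrable lebesgue (\<lambda>t. indicator {x<..<y} t * v t)" for x y
    using integrable_mult_indicator[OF _ v(1), of "{x<..<y}"] by simp
  have "(\<Sum>(x, y)\<in>J. LINT t:{x<..<y}|lebesgue. v t) = (LINT t|lebesgue. (\<Sum>(x, y)\<in>J. indicator {x<..<y} t * v t))"
    unfolding case_prod_beta set_lebesgue_integral_def using int by (simp add: Bochner_Integration.integral_sum)
  also have "\<dots> \<le> (LINT t|lebesgue. v t)"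
  proof (rule integral_mono)
    show "integrable lebesgue (\<lambda>t. \<Sum>(x, y)\<in>J. indicator {x<..<y} t * v t)"
      unfolding case_prod_beta using int by (intro Bochner_Integration.integrable_sum) auto
    show "(\<Sum>(x, y)\<in>J. indicator {x<..<y} t * v t) \<le> v t" for t
      using mult_right_mono[OF ind v(2), of t t] by (simp add: case_prod_beta sum_distrib_right)
  qed (rule v)
  finally show ?thesis .
qed

text \<open>Truncate the density at height \<open>n\<close>. The excess \<open>w n\<close> has small
  integral for large \<open>n\<close> by dominated convergence, and disjoint intervals cannot see
  more than all of it; the bounded rest contributes at most a constant times the total
  length.\<close>

lemma AC_on_indefinite_integral:
  fixes v :: "real \<Rightarrow> 'a::{banach, second_countable_topology}"
  assumes v: "integrable lebesgue v"
    and F: "\<And>x y. c \<le> x \<Longrightarrow> x \<le> y \<Longrightarrow> y \<le> d \<Longrightarrow> F y - F x = (LINT t:{x<..<y}|lebesgue. v t)"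
  shows "AC_on c d F"
  unfolding AC_on_def
proof (intro allI impI)
  fix e :: real assume "e > 0"
  define w where "w = (\<lambda>n t. max 0 (norm (v t) - real n))"
  have w_int: "integrable lebesgue (w n)" for n
    unfolding w_def
    by (rule Bochner_Integration.integrable_bound[OF integrable_norm[OF v]]) (use v in auto)
  have "(\<lambda>n. LINT t|lebesgue. w n t) \<longlonglongrightarrow> (LINT t::real|lebesgue. (0::real))"
  proof (rule Bochner_Integration.integral_dominated_convergence)
    show "AE t in lebesgue. (\<lambda>n. w n t) \<longlonglongrightarrow> 0"
    proof (rule AE_I2)
      fix t
      obtain N where N: "norm (v t) \<le> real N" using real_arch_simple by blast
      then have "eventually (\<lambda>n. w n t = 0) sequentially"
        unfolding w_def eventually_sequentially by (intro exI[of _ N]) auto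
      then show "(\<lambda>n. w n t) \<longlonglongrightarrow> 0" by (rule tendsto_eventually)
    qed
    show "integrable lebesgue (\<lambda>t. norm (v t))" using v by simp
    show "AE t in lebesgue. norm (w n t) \<le> norm (v t)" for n by (simp add: w_def)
    show "w n \<in> borel_measurable lebesgue" for n using w_int by (rule borel_measurable_integrable)
  qed auto
  then have "(\<lambda>n. LINT t|lebesgue. w n t) \<longlonglongrightarrow> 0" by simp
  from order_tendstoD(2)[OF this, of "e / 2"] obtain n where n: "(LINT t|lebesgue. w n t) < e / 2"
    using \<open>e > 0\<close> by (auto simp: eventually_sequentially)
  have "(\<Sum>(x, y)\<in>J. norm (F y - F x)) < e"
    if J: "interval_family c d J" "(\<Sum>(x, y)\<in>J. y - x) < e / (2 * (real n + 1))" for J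
  proof -
    have ord: "c \<le> x \<and> x \<le> y \<and> y \<le> d" if "(x, y) \<in> J" for x y
      using J(1) that by (auto simp: interval_family_def)

    have sub: "set_integrable lebesgue {x<..<y} g" if "integrable lebesgue g"
      for x y and g :: "real \<Rightarrow> 'b::{banach, second_countable_topology}"
      unfolding set_integrable_def using that by (intro integrable_mult_indicator) auto
    have const: "set_integrable lebesgue {x<..<y} (\<lambda>_. k)" for x y k :: real
    proof -
      have "integrable lebesgue (indicat_real {x<..<y})"
        using lmeasurable_box[of x y] by (simp add: lmeasurable_iff_integrable)
      then show ?thesis unfolding set_integrable_def by simp
    qed
    \<comment> \<open>The height \<open>real n + 1\<close> instead of \<open>real n\<close> keeps
      the denominator in the admissible total length positive when \<open>n\<close> is 0.\<close>
    have "norm (F y - F x) \<le> (real n + 1) * (y - x) + (LINT t:{x<..<y}|lebesgue. w n t)" if xy: "(x, y) \<in> J" for x y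
    proof -
      have "norm (F y - F x) = norm (LINT t:{x<..<y}|lebesgue. v t)" using F ord[OF xy] by simp
      also have "\<dots> \<le> (LINT t:{x<..<y}|lebesgue. norm (v t))"
        by (rule set_integral_norm_bound[OF sub[OF v]])
      also have "\<dots> \<le> (LINT t:{x<..<y}|lebesgue. (real n + 1) + w n t)"
        by (rule set_integral_mono[OF sub[OF integrable_norm[OF v]] set_integral_add(1)[OF const sub[OF w_int]]])
           (simp add: w_def)
      also have "\<dots> = (LINT t:{x<..<y}|lebesgue. (real n + 1)) + (LINT t:{x<..<y}|lebesgue. w n t)"
        by (rule set_integral_add(2)[OF const sub[OF w_int]])
      also have "(LINT t:{x<..<y}|lebesgue. (real n + 1)) = (real n + 1) * (y - x)"
        using ord[OF xy] by (simp add: set_lebesgue_integral_def)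
      finally show ?thesis .
    qed
    then have "(\<Sum>(x, y)\<in>J. norm (F y - F x)) \<le> (\<Sum>(x, y)\<in>J. (real n + 1) * (y - x) + (LINT t:{x<..<y}|lebesgue. w n t))"
      by (intro sum_mono) auto
    also have "\<dots> = (real n + 1) * (\<Sum>(x, y)\<in>J. y - x) + (\<Sum>(x, y)\<in>J. (LINT t:{x<..<y}|lebesgue. w n t))"
      by (simp add: case_prod_beta sum.distrib sum_distrib_left)
    also have "(\<Sum>(x, y)\<in>J. (LINT t:{x<..<y}|lebesgue. w n t)) < e / 2"
      using sum_set_integral_le[OF w_int _ J(1), of n] n by (simp add: w_def)
    also have "(real n + 1) * (\<Sum>(x, y)\<in>J. y - x) \<le> (real n + 1) * (e / (2 * (real n + 1)))"
      using J(2) by (intro mult_left_mono) auto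
    also have "\<dots> = e / 2" by (simp add: field_simps)
    finally show ?thesis by simp
  qed
  moreover have "e / (2 * (real n + 1)) > 0" using \<open>e > 0\<close> by (simp add: add_nonneg_pos)
  ultimately show "\<exists>\<delta>>0. \<forall>J. interval_family c d J \<and> (\<Sum>(x, y)\<in>J. y - x) < \<delta> \<longrightarrow> (\<Sum>(x, y)\<in>J. norm (F y - F x)) < e"
    by blast
qed

section \<open>Lebesgue differentiation\<close>

lemma lebesgue_differentiation_right:
  fixes v :: "real \<Rightarrow> 'b::euclidean_space"
  assumes v: "integrable lebesgue v"
  obtains N where "negligible N"
    "\<And>x e. x \<notin> N \<Longrightarrow> e > 0 \<Longrightarrow> \<exists>d>0. \<forall>h. 0 < h \<and> h < d \<longrightarrow> norm (integral {x..x + h} v /\<^sub>R h - v x) < e"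
proof -
  have "v absolutely_integrable_on UNIV" using v by (simp add: set_integrable_def)
  then have "v absolutely_integrable_on cbox s t" for s t
    by (rule absolutely_integrable_on_subcbox) auto
  then have "v integrable_on cbox s t" for s t
    by (simp add: set_lebesgue_integral_eq_integral(1))
  \<comment> \<open>On the line, differentiation along cubes concerns averages over
    \<open>{x..x + h}\<close> with positive \<open>h\<close>, that is, right derivatives.\<close>
  then obtain N where "negligible N"
    "\<And>x e. x \<notin> N \<Longrightarrow> e > 0 \<Longrightarrow> \<exists>d>0. \<forall>h. 0 < h \<and> h < d \<longrightarrow> norm (integral (cbox x (x + h *\<^sub>R One)) v /\<^sub>R h ^ DIM(real) - v x) < e"
    by (rule integrable_ccontinuous_explicit) blast
  then show ?thesis using that by simp
qed

text \<open>The right-sided statement is applied to \<open>v\<close> and to its reflection, whose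
  right averages at \<open>- x\<close> are the left averages of \<open>v\<close> at
  \<open>x\<close>. The exceptional set is independent of \<open>F\<close> and \<open>S\<close>, so
  local primitives qualify as well as global ones.\<close>

theorem lebesgue_differentiation:
  fixes v :: "real \<Rightarrow> 'b::euclidean_space"
  assumes v: "integrable lebesgue v"
  obtains N where "negligible N"
    "\<And>F x S. x \<notin> N \<Longrightarrow> open S \<Longrightarrow> x \<in> S \<Longrightarrow>
       (\<And>s t. s \<in> S \<Longrightarrow> t \<in> S \<Longrightarrow> s \<le> t \<Longrightarrow> F t - F s = integral {s..t} v) \<Longrightarrow> (F has_vector_derivative v x) (at x)"
proof -
  obtain N1 where N1: "negligible N1"
    "\<And>x e. x \<notin> N1 \<Longrightarrow> e > 0 \<Longrightarrow> \<exists>d>0. \<forall>h. 0 < h \<and> h < d \<longrightarrow> norm (integral {x..x + h} v /\<^sub>R h - v x) < e"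
    using lebesgue_differentiation_right[OF v] by metis
  have "integrable lebesgue (\<lambda>t. v (- t))"
    using lebesgue_integrable_real_affine[OF v, of "-1" 0] by simp
  then obtain N2 where N2: "negligible N2"
    "\<And>x e. x \<notin> N2 \<Longrightarrow> e > 0 \<Longrightarrow> \<exists>d>0. \<forall>h. 0 < h \<and> h < d \<longrightarrow> norm (integral {x..x + h} (\<lambda>t. v (- t)) /\<^sub>R h - v (- x)) < e"
    using lebesgue_differentiation_right by metis
  have "negligible (uminus ` N2)"
    by (rule negligible_differentiable_image_negligible[OF _ N2(1)]) (auto intro!: derivative_intros simp: differentiable_on_def)
  with N1(1) have N: "negligible (N1 \<union> uminus ` N2)" by simp
  have "(F has_vector_derivative v x) (at x)"
    if x: "x \<notin> N1 \<union> uminus ` N2" and S: "open S" "x \<in> S"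
      and F: "\<And>s t. s \<in> S \<Longrightarrow> t \<in> S \<Longrightarrow> s \<le> t \<Longrightarrow> F t - F s = integral {s..t} v" for F x S
  proof -
    obtain \<rho> where \<rho>: "\<rho> > 0" "ball x \<rho> \<subseteq> S" using S by (metis openE)
    have "(\<lambda>h. norm (F (x + h) - F x - h *\<^sub>R v x) / norm h) \<midarrow>0\<rightarrow> 0"
    proof (rule LIM_I)
      fix e :: real assume "e > 0"
      obtain d1 where d1: "d1 > 0" "\<And>h. 0 < h \<Longrightarrow> h < d1 \<Longrightarrow> norm (integral {x..x + h} v /\<^sub>R h - v x) < e"
        using N1(2)[of x e] x \<open>e > 0\<close> by blast
      have "- x \<notin> N2" using x by force
      then obtain d2 where d2: "d2 > 0" "\<And>h. 0 < h \<Longrightarrow> h < d2 \<Longrightarrow> norm (integral {- x..- x + h} (\<lambda>t. v (- t)) /\<^sub>R h - v x) < e"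
        using N2(2)[of "- x" e] \<open>e > 0\<close> by auto
      have "norm (F (x + h) - F x - h *\<^sub>R v x) / norm h < e" if h: "h \<noteq> 0" "\<bar>h\<bar> < min \<rho> (min d1 d2)" for h
      proof -
        have S: "x + h \<in> S" using \<rho> h by (auto simp: dist_norm)
        have "norm (F (x + h) - F x - h *\<^sub>R v x) = norm h * norm ((F (x + h) - F x) /\<^sub>R h - v x)"
        proof -
          have "F (x + h) - F x - h *\<^sub>R v x = h *\<^sub>R ((F (x + h) - F x) /\<^sub>R h - v x)"
            using h(1) by (simp add: scaleR_diff_right)
          then show ?thesis by (metis norm_scaleR real_norm_def)
        qed
        moreover have "norm ((F (x + h) - F x) /\<^sub>R h - v x) < e"
        proof (cases "h > 0")
          case True
          then show ?thesis using F[OF \<open>x \<in> S\<close> S] d1(2)[of h] h by simp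
        next
          case False
          then have "h < 0" using h(1) by simp
          have "integral {- x..- x - h} (\<lambda>t. v (- t)) = integral {x + h..x} v"
            using Henstock_Kurzweil_Integration.integral_reflect_real[of x "x + h" v] by simp
          moreover have "F x - F (x + h) = integral {x + h..x} v"
            using F[OF S \<open>x \<in> S\<close>] \<open>h < 0\<close> by simp
          then have "F (x + h) - F x = - integral {x + h..x} v" by (metis minus_diff_eq)
          ultimately have "(F (x + h) - F x) /\<^sub>R h = integral {- x..- x + (- h)} (\<lambda>t. v (- t)) /\<^sub>R (- h)"
            by simp
          then show ?thesis using d2(2)[of "- h"] h \<open>h < 0\<close> by simp
        qed
        ultimately show ?thesis using h(1) by simp
      qed
      then show "\<exists>s>0. \<forall>h. h \<noteq> 0 \<and> norm (h - 0) < s \<longrightarrow> norm (norm (F (x + h) - F x - h *\<^sub>R v x) / norm h - 0) < e"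
        using d1(1) d2(1) \<rho>(1) by (intro exI[of _ "min \<rho> (min d1 d2)"]) auto
    qed
    then show ?thesis
      unfolding has_vector_derivative_def has_derivative_at by (auto intro: bounded_linear_scaleR_left)
  qed
  then show ?thesis using that[OF N] by blast
qed

subsection \<open>The variation of a function of bounded variation\<close>

text \<open>Chains are only weakly increasing and may stop short of either endpoint. Clipping a
  chain at a point by \<open>min\<close> or \<open>max\<close> therefore gives a chain again, and no
  partition points have to be inserted.\<close>

definition chain_sums :: "(real \<Rightarrow> real) \<Rightarrow> real \<Rightarrow> real \<Rightarrow> real set" where
  "chain_sums f c x = {\<Sum>i<n. \<bar>f (t (Suc i)) - f (t i)\<bar> | (t :: nat \<Rightarrow> real) n. mono t \<and> c \<le> t 0 \<and> t n \<le> x}"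

definition variation :: "(real \<Rightarrow> real) \<Rightarrow> real \<Rightarrow> real \<Rightarrow> real" where
  "variation f c x = Sup (chain_sums f c x)"

lemma chain_sumsI:
  assumes "mono t" "c \<le> t 0" "t n \<le> x"
  shows "(\<Sum>i<n. \<bar>f (t (Suc i)) - f (t i)\<bar>) \<in> chain_sums f c x"
  unfolding chain_sums_def
  by (rule CollectI, rule exI[of _ t], rule exI[of _ n], intro conjI refl assms)

lemma chain_sums_nonempty: "c \<le> x \<Longrightarrow> chain_sums f c x \<noteq> {}"
  using chain_sumsI[of "\<lambda>_. c" c 0 x f] by (force simp: mono_def)

lemma mono_chain_disjoint:
  fixes t :: "nat \<Rightarrow> real"
  assumes "mono t" "i \<noteq> j"
  shows "{t i<..<t (Suc i)} \<inter> {t j<..<t (Suc j)} = {}"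
proof -
  have "t (Suc i) \<le> t j \<or> t (Suc j) \<le> t i" using assms by (metis Suc_leI linorder_neqE_nat monoD)
  then show ?thesis by auto
qed

text \<open>One \<delta> of absolute continuity bounds all chain sums over a short interval at once.
  The steps enter as an indexed family because they may coincide.\<close>

lemma AC_on_chain_sums_less:
  assumes J: "\<forall>J. interval_family c d J \<and> (\<Sum>(x, y)\<in>J. y - x) < \<delta> \<longrightarrow> (\<Sum>(x, y)\<in>J. norm (f y - f x)) < e"
    and xy: "c \<le> x" "x \<le> y" "y \<le> d" "y - x < \<delta>" and s: "s \<in> chain_sums f x y"
  shows "s < e"
proof -
  obtain t n where t: "s = (\<Sum>i<n. \<bar>f (t (Suc i)) - f (t i)\<bar>)" "mono t" "x \<le> t 0" "t n \<le> y"
    using s by (auto simp: chain_sums_def)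
  have in_xy: "x \<le> t i \<and> t i \<le> y" if "i \<le> n" for i
    using t monoD[OF t(2), of 0 i] monoD[OF t(2), of i n] that by auto
  have "(\<Sum>i<n. t (Suc i) - t i) = t n - t 0" by (rule sum_lessThan_telescope)
  also have "\<dots> < \<delta>" using in_xy[of n] in_xy[of 0] xy by simp
  finally have small: "(\<Sum>i<n. t (Suc i) - t i) < \<delta>" .
  have "(\<Sum>i<n. norm (f (t (Suc i)) - f (t i))) < e"
  proof (rule AC_on_indexed[OF J _ _ _ small])
    show "c \<le> t i \<and> t i \<le> t (Suc i) \<and> t (Suc i) \<le> d" if "i \<in> {..<n}" for i
      using in_xy[of i] in_xy[of "Suc i"] monoD[OF t(2), of i "Suc i"] that xy by auto
  qed (use mono_chain_disjoint[OF t(2)] in auto)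
  then show ?thesis by (simp add: t(1))
qed

text \<open>Clip the chain at \<open>x\<close> from both sides. At each point \<open>f\<close>
  equals its value at the minimum plus its value at the maximum minus \<open>f x\<close>, so the
  increments split up to the triangle inequality.\<close>

lemma chain_sum_split:
  fixes t :: "nat \<Rightarrow> real"
  assumes "mono t" "c \<le> t 0" "t n \<le> y" "c \<le> x" "x \<le> y"
  obtains s1 s2 where "s1 \<in> chain_sums f c x" "s2 \<in> chain_sums f x y"
    "(\<Sum>i<n. \<bar>f (t (Suc i)) - f (t i)\<bar>) \<le> s1 + s2"
proof
  let ?l = "\<lambda>i. min x (t i)" and ?u = "\<lambda>i. max x (t i)"
  have "mono ?l" "mono ?u" using assms(1) by (auto simp: mono_def min_def max_def intro: order_trans)
  then show "(\<Sum>i<n. \<bar>f (?l (Suc i)) - f (?l i)\<bar>) \<in> chain_sums f c x"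
    "(\<Sum>i<n. \<bar>f (?u (Suc i)) - f (?u i)\<bar>) \<in> chain_sums f x y"
    using assms by (auto intro!: chain_sumsI[of "\<lambda>i. min x (t i)"] chain_sumsI[of "\<lambda>i. max x (t i)"])
  have "f (t i) = f (?l i) + f (?u i) - f x" for i by (simp add: min_def max_def)
  then have "\<bar>f (t (Suc i)) - f (t i)\<bar> \<le> \<bar>f (?l (Suc i)) - f (?l i)\<bar> + \<bar>f (?u (Suc i)) - f (?u i)\<bar>" for i
    by (smt (verit))
  then show "(\<Sum>i<n. \<bar>f (t (Suc i)) - f (t i)\<bar>) \<le>
      (\<Sum>i<n. \<bar>f (?l (Suc i)) - f (?l i)\<bar>) + (\<Sum>i<n. \<bar>f (?u (Suc i)) - f (?u i)\<bar>)"
    by (simp add: sum_mono flip: sum.distrib)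
qed

text \<open>Cut the interval into pieces shorter than the \<delta> that belongs to the bound 1;
  every further piece adds less than 1. The bound is uniform in the right endpoint.\<close>

lemma bounded_chain_sums:
  assumes f: "AC_on c d f"
  obtains B where "\<And>x s. c \<le> x \<Longrightarrow> x \<le> d \<Longrightarrow> s \<in> chain_sums f c x \<Longrightarrow> s \<le> B"
proof -
  obtain \<delta> where \<delta>: "\<delta> > 0" and J: "\<forall>J. interval_family c d J \<and> (\<Sum>(x, y)\<in>J. y - x) < \<delta> \<longrightarrow> (\<Sum>(x, y)\<in>J. norm (f y - f x)) < 1"
    using f unfolding AC_on_def by (meson zero_less_one)
  \<comment> \<open>Half of \<delta>, because the pieces must be strictly shorter than
    \<delta>.\<close>
  define h where "h = \<delta> / 2"
  have h: "0 < h" "h < \<delta>" using \<delta> by (auto simp: h_def)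
  have bound: "s \<le> real k + 1" if "c \<le> x" "x \<le> d" "x \<le> c + real k * h" "s \<in> chain_sums f c x" for k x s
    using that
  proof (induction k arbitrary: x s)
    case 0
    then show ?case using AC_on_chain_sums_less[OF J, of c x s] \<delta> by simp
  next
    case (Suc k)
    show ?case
    proof (cases "x \<le> c + real k * h")
      case True
      then show ?thesis using Suc.IH[of x s] Suc.prems by simp
    next
      case False
      let ?x = "c + real k * h"
      have x: "c \<le> ?x" "?x \<le> x" using False h by auto
      obtain t n where t: "s = (\<Sum>i<n. \<bar>f (t (Suc i)) - f (t i)\<bar>)" "mono t" "c \<le> t 0" "t n \<le> x"
        using Suc.prems(4) by (auto simp: chain_sums_def)
      obtain s1 s2 where s: "s1 \<in> chain_sums f c ?x" "s2 \<in> chain_sums f ?x x" "s \<le> s1 + s2"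
        using chain_sum_split[OF t(2-4) x] t(1) by metis
      have "s1 \<le> real k + 1" using Suc.IH[of ?x s1] x Suc.prems s by simp
      moreover have "s2 < 1"
        using AC_on_chain_sums_less[OF J, of ?x x s2] x Suc.prems h s by (simp add: algebra_simps)
      ultimately show ?thesis using s(3) by simp
    qed
  qed
  obtain k :: nat where k: "(d - c) / h \<le> real k" using real_arch_simple by blast
  then have "d \<le> c + real k * h" using h(1) by (simp add: field_simps)
  then show ?thesis using that[of "real k + 1"] bound by (meson order_trans)
qed

text \<open>Superadditivity: a chain up to \<open>x\<close> followed by a chain from
  \<open>x\<close> on is a chain up to \<open>y\<close>, and the joining increment is
  nonnegative.\<close>

lemma variation_step:
  assumes f: "AC_on c d f" and xy: "c \<le> x" "x \<le> y" "y \<le> d" and s: "s \<in> chain_sums f x y"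
  shows "variation f c x + s \<le> variation f c y"
proof -
  obtain B where B: "\<And>x s. c \<le> x \<Longrightarrow> x \<le> d \<Longrightarrow> s \<in> chain_sums f c x \<Longrightarrow> s \<le> B" using bounded_chain_sums[OF f] by metis
  have bdd: "bdd_above (chain_sums f c y)" using B[of y] xy by (intro bdd_aboveI[of _ B]) auto
  have "s' \<le> variation f c y - s" if s': "s' \<in> chain_sums f c x" for s'
  proof -
    obtain t n where t: "s' = (\<Sum>i<n. \<bar>f (t (Suc i)) - f (t i)\<bar>)" "mono t" "c \<le> t 0" "t n \<le> x"
      using s' by (auto simp: chain_sums_def)
    obtain t' n' where t': "s = (\<Sum>i<n'. \<bar>f (t' (Suc i)) - f (t' i)\<bar>)" "mono t'" "x \<le> t' 0" "t' n' \<le> y"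
      using s by (auto simp: chain_sums_def)
    \<comment> \<open>The first chain occupies the indices up to \<open>n\<close>, the second starts
      at \<open>Suc n\<close>; the combined chain has \<open>Suc n + n'\<close> increments, and the
      one at index \<open>n\<close> is the joint.\<close>
    define T where "T = (\<lambda>i. if i \<le> n then t i else t' (i - Suc n))"
    have "T i \<le> T (Suc i)" for i
    proof -
      consider "i < n" | "i = n" | "i > n" by linarith
      then show ?thesis
        using t t' monoD[OF t(2), of i "Suc i"] monoD[OF t'(2), of "i - Suc n" "Suc i - Suc n"]
        by cases (auto simp: T_def)
    qed
    then have "mono T" by (simp add: mono_iff_le_Suc)
    then have "(\<Sum>i<Suc n + n'. \<bar>f (T (Suc i)) - f (T i)\<bar>) \<in> chain_sums f c y"
      using t t' by (intro chain_sumsI) (auto simp: T_def)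
    then have bound: "(\<Sum>i<Suc n + n'. \<bar>f (T (Suc i)) - f (T i)\<bar>) \<le> variation f c y"
      unfolding variation_def by (intro cSup_upper bdd)
    have split: "(\<Sum>i<Suc n + n'. g i) = (\<Sum>i<n. g i) + g n + (\<Sum>i<n'. g (Suc n + i))" for g :: "nat \<Rightarrow> real"
      by (induction n') (simp_all add: add.assoc)
    have "(\<Sum>i<n. \<bar>f (T (Suc i)) - f (T i)\<bar>) + \<bar>f (T (Suc n)) - f (T n)\<bar>
        + (\<Sum>i<n'. \<bar>f (T (Suc (Suc n + i))) - f (T (Suc n + i))\<bar>) \<le> variation f c y"
      using bound unfolding split .
    then have "(\<Sum>i<n. \<bar>f (T (Suc i)) - f (T i)\<bar>) + (\<Sum>i<n'. \<bar>f (T (Suc (Suc n + i))) - f (T (Suc n + i))\<bar>) \<le> variation f c y"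
      using abs_ge_zero[of "f (T (Suc n)) - f (T n)"] by linarith
    moreover have "(\<Sum>i<n. \<bar>f (T (Suc i)) - f (T i)\<bar>) = s'"
      unfolding t(1) by (intro sum.cong) (auto simp: T_def)
    moreover have "(\<Sum>i<n'. \<bar>f (T (Suc (Suc n + i))) - f (T (Suc n + i))\<bar>) = s"
      unfolding t'(1) by (intro sum.cong) (auto simp: T_def)
    ultimately show ?thesis by simp
  qed
  then have "variation f c x \<le> variation f c y - s"
    unfolding variation_def using chain_sums_nonempty[OF xy(1)] by (intro cSup_least) auto
  then show ?thesis by simp
qed

lemma variation_increment_ge:
  assumes f: "AC_on c d f" and xy: "c \<le> x" "x \<le> y" "y \<le> d"
  shows "\<bar>f y - f x\<bar> \<le> variation f c y - variation f c x"
proof -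
  have "(\<Sum>i<1. \<bar>f ((\<lambda>i::nat. if i = 0 then x else y) (Suc i)) - f ((\<lambda>i. if i = 0 then x else y) i)\<bar>) \<in> chain_sums f x y"
    by (rule chain_sumsI) (use xy in \<open>auto simp: mono_def\<close>)
  from variation_step[OF f xy this] show ?thesis by simp
qed

text \<open>The reverse of superadditivity: a nearly optimal chain up to \<open>y\<close> is split
  at \<open>x\<close>, and its part before \<open>x\<close> cannot exceed the variation
  there.\<close>

lemma variation_increment_approx:
  assumes f: "AC_on c d f" and xy: "c \<le> x" "x \<le> y" "y \<le> d" and "e > 0"
  obtains t n where "mono t" "x \<le> t 0" "t n \<le> y" "variation f c y - variation f c x < (\<Sum>i<n. \<bar>f (t (Suc i)) - f (t i)\<bar>) + e"
proof -
  obtain B where B: "\<And>x s. c \<le> x \<Longrightarrow> x \<le> d \<Longrightarrow> s \<in> chain_sums f c x \<Longrightarrow> s \<le> B" using bounded_chain_sums[OF f] by metis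
  obtain s where s: "s \<in> chain_sums f c y" "variation f c y - e < s"
    using less_cSupE[of "variation f c y - e" "chain_sums f c y"] chain_sums_nonempty[of c y f] xy \<open>e > 0\<close>
    unfolding variation_def by auto
  then obtain t n where t: "s = (\<Sum>i<n. \<bar>f (t (Suc i)) - f (t i)\<bar>)" "mono t" "c \<le> t 0" "t n \<le> y"
    by (auto simp: chain_sums_def)
  obtain s1 s2 where s12: "s1 \<in> chain_sums f c x" "s2 \<in> chain_sums f x y" "s \<le> s1 + s2"
    using chain_sum_split[OF t(2-4) xy(1,2)] t(1) by metis
  have "s1 \<le> variation f c x"
    unfolding variation_def using B[of x] xy s12(1) by (intro cSup_upper bdd_aboveI[of _ B]) auto
  moreover obtain t' n' where "s2 = (\<Sum>i<n'. \<bar>f (t' (Suc i)) - f (t' i)\<bar>)" "mono t'" "x \<le> t' 0" "t' n' \<le> y"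
    using s12(2) by (auto simp: chain_sums_def)
  ultimately show ?thesis using that[of t' n'] s s12 by simp
qed

text \<open>In each interval of a short family take a nearly optimal chain. The steps of all these
  chains together are still disjoint and no longer in total, so absolute continuity of
  \<open>f\<close> applies to all of them at once.\<close>

lemma AC_on_variation:
  assumes f: "AC_on c d f"
  shows "AC_on c d (variation f c)"
  unfolding AC_on_def
proof (intro allI impI)
  fix e :: real assume "e > 0"
  then obtain \<delta> where \<delta>: "\<delta> > 0" and fJ: "\<forall>J. interval_family c d J \<and> (\<Sum>(x, y)\<in>J. y - x) < \<delta> \<longrightarrow> (\<Sum>(x, y)\<in>J. norm (f y - f x)) < e / 2"
    using f unfolding AC_on_def by (meson half_gt_zero)
  have "(\<Sum>(x, y)\<in>J. norm (variation f c y - variation f c x)) < e"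
    if J: "interval_family c d J" "(\<Sum>(x, y)\<in>J. y - x) < \<delta>" for J
  proof -
    \<comment> \<open>The errors over all intervals of \<open>J\<close> add up to at most half of
      \<open>e\<close>; the added 1 covers the empty family.\<close>
    define \<eta> where "\<eta> = e / (2 * (real (card J) + 1))"
    have "\<eta> > 0" using \<open>e > 0\<close> by (simp add: \<eta>_def add_nonneg_pos)
    have fin: "finite J" and ord: "\<And>p. p \<in> J \<Longrightarrow> c \<le> fst p \<and> fst p \<le> snd p \<and> snd p \<le> d"
      and dis: "\<And>p p'. p \<in> J \<Longrightarrow> p' \<in> J \<Longrightarrow> p \<noteq> p' \<Longrightarrow> {fst p<..<snd p} \<inter> {fst p'<..<snd p'} = {}"
      using J(1) by (auto simp: interval_family_def pairwise_def case_prod_beta)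
    have "\<forall>p\<in>J. \<exists>t n. mono t \<and> fst p \<le> t 0 \<and> t n \<le> snd p \<and>
        variation f c (snd p) - variation f c (fst p) < (\<Sum>i<n. \<bar>f (t (Suc i)) - f (t i)\<bar>) + \<eta>"
    proof
      fix p assume "p \<in> J"
      from ord[OF this] obtain t n where "mono t" "fst p \<le> t 0" "t n \<le> snd p"
        "variation f c (snd p) - variation f c (fst p) < (\<Sum>i<n. \<bar>f (t (Suc i)) - f (t i)\<bar>) + \<eta>"
        using variation_increment_approx[OF f _ _ _ \<open>\<eta> > 0\<close>, of "fst p" "snd p"] by blast
      then show "\<exists>t n. mono t \<and> fst p \<le> t 0 \<and> t n \<le> snd p \<and>
        variation f c (snd p) - variation f c (fst p) < (\<Sum>i<n. \<bar>f (t (Suc i)) - f (t i)\<bar>) + \<eta>" by blast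
    qed
    from bchoice[OF this] obtain t where "\<forall>p\<in>J. \<exists>n. mono (t p) \<and> fst p \<le> t p 0 \<and> t p n \<le> snd p \<and>
        variation f c (snd p) - variation f c (fst p) < (\<Sum>i<n. \<bar>f (t p (Suc i)) - f (t p i)\<bar>) + \<eta>" by blast
    from bchoice[OF this] obtain n where n: "\<forall>p\<in>J. mono (t p) \<and> fst p \<le> t p 0 \<and> t p (n p) \<le> snd p \<and>
        variation f c (snd p) - variation f c (fst p) < (\<Sum>i<n p. \<bar>f (t p (Suc i)) - f (t p i)\<bar>) + \<eta>" by blast
    then have t: "\<And>p. p \<in> J \<Longrightarrow> mono (t p)" "\<And>p. p \<in> J \<Longrightarrow> fst p \<le> t p 0" "\<And>p. p \<in> J \<Longrightarrow> t p (n p) \<le> snd p"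
      "\<And>p. p \<in> J \<Longrightarrow> variation f c (snd p) - variation f c (fst p) < (\<Sum>i<n p. \<bar>f (t p (Suc i)) - f (t p i)\<bar>) + \<eta>"
      by auto
    let ?A = "SIGMA p:J. {..<n p}"
    have in_p: "fst p \<le> t p i \<and> t p i \<le> snd p" if "p \<in> J" "i \<le> n p" for p i
      using t(2,3)[OF that(1)] monoD[OF t(1)[OF that(1)], of 0 i] monoD[OF t(1)[OF that(1)], of i "n p"] that(2) by auto
    have step: "t p i \<le> t p (Suc i)" if "p \<in> J" for p i using monoD[OF t(1)[OF that], of i "Suc i"] by simp
    have small: "(\<Sum>q\<in>?A. t (fst q) (Suc (snd q)) - t (fst q) (snd q)) < \<delta>"
    proof -
      have "(\<Sum>q\<in>?A. t (fst q) (Suc (snd q)) - t (fst q) (snd q)) = (\<Sum>p\<in>J. \<Sum>i<n p. t p (Suc i) - t p i)"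
        using fin by (simp add: sum.Sigma case_prod_beta)
      also have "\<dots> = (\<Sum>p\<in>J. t p (n p) - t p 0)" by (simp add: sum_lessThan_telescope)
      also have "\<dots> \<le> (\<Sum>p\<in>J. snd p - fst p)" using t(2,3) by (intro sum_mono) (simp add: diff_mono)
      also have "\<dots> < \<delta>" using J(2) by (simp add: case_prod_beta)
      finally show ?thesis .
    qed
    have "(\<Sum>q\<in>?A. norm (f (t (fst q) (Suc (snd q))) - f (t (fst q) (snd q)))) < e / 2"
    proof (rule AC_on_indexed[OF fJ _ _ _ small])
      show "finite ?A" using fin by auto
      show "c \<le> t (fst q) (snd q) \<and> t (fst q) (snd q) \<le> t (fst q) (Suc (snd q)) \<and> t (fst q) (Suc (snd q)) \<le> d"
        if "q \<in> ?A" for q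
        using that in_p[of "fst q" "snd q"] in_p[of "fst q" "Suc (snd q)"] step[of "fst q" "snd q"] ord[of "fst q"] by auto
      show "{t (fst q) (snd q)<..<t (fst q) (Suc (snd q))} \<inter> {t (fst q') (snd q')<..<t (fst q') (Suc (snd q'))} = {}"
        if q: "q \<in> ?A" "q' \<in> ?A" "q \<noteq> q'" for q q'
      proof (cases "fst q = fst q'")
        case True
        then have "snd q \<noteq> snd q'" using q(3) by (simp add: prod_eq_iff)
        then show ?thesis using mono_chain_disjoint[OF t(1)[of "fst q"]] q True by auto
      next
        case False
        have "{t (fst q) (snd q)<..<t (fst q) (Suc (snd q))} \<subseteq> {fst (fst q)<..<snd (fst q)}"
          using q(1) in_p[of "fst q" "snd q"] in_p[of "fst q" "Suc (snd q)"] by auto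
        moreover have "{t (fst q') (snd q')<..<t (fst q') (Suc (snd q'))} \<subseteq> {fst (fst q')<..<snd (fst q')}"
          using q(2) in_p[of "fst q'" "snd q'"] in_p[of "fst q'" "Suc (snd q')"] by auto
        moreover have "{fst (fst q)<..<snd (fst q)} \<inter> {fst (fst q')<..<snd (fst q')} = {}"
          using q by (intro dis False) auto
        ultimately show ?thesis by blast
      qed
    qed
    then have half: "(\<Sum>p\<in>J. \<Sum>i<n p. \<bar>f (t p (Suc i)) - f (t p i)\<bar>) < e / 2"
      using fin by (simp add: sum.Sigma case_prod_beta)
    have "(\<Sum>(x, y)\<in>J. norm (variation f c y - variation f c x)) = (\<Sum>p\<in>J. variation f c (snd p) - variation f c (fst p))"
      unfolding case_prod_beta
    proof (rule sum.cong)
      fix p assume "p \<in> J"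
      then have "\<bar>f (snd p) - f (fst p)\<bar> \<le> variation f c (snd p) - variation f c (fst p)"
        using variation_increment_ge[OF f] ord by simp
      then have "0 \<le> variation f c (snd p) - variation f c (fst p)" by (meson abs_ge_zero order_trans)
      then show "norm (variation f c (snd p) - variation f c (fst p)) = variation f c (snd p) - variation f c (fst p)" by simp
    qed simp
    also have "\<dots> \<le> (\<Sum>p\<in>J. (\<Sum>i<n p. \<bar>f (t p (Suc i)) - f (t p i)\<bar>) + \<eta>)"
      using t(4) by (intro sum_mono) (simp add: less_imp_le)
    also have "\<dots> = (\<Sum>p\<in>J. \<Sum>i<n p. \<bar>f (t p (Suc i)) - f (t p i)\<bar>) + real (card J) * \<eta>"
      by (simp add: sum.distrib)
    also have "real (card J) * \<eta> \<le> (real (card J) + 1) * \<eta>" using \<open>\<eta> > 0\<close> by (intro mult_right_mono) auto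
    also have "(real (card J) + 1) * \<eta> = e / 2" by (simp add: \<eta>_def field_simps)
    finally show ?thesis using half by simp
  qed
  then show "\<exists>\<delta>>0. \<forall>J. interval_family c d J \<and> (\<Sum>(x, y)\<in>J. y - x) < \<delta> \<longrightarrow> (\<Sum>(x, y)\<in>J. norm (variation f c y - variation f c x)) < e"
    using \<delta> by blast
qed

section \<open>Stieltjes measures and densities of absolutely continuous functions\<close>

lemma emeasure_UN_le_sum_interval:
  fixes D :: "real set set" and \<mu> :: "real measure"
  assumes cD: "countable D" and meas: "\<And>K. K \<in> D \<Longrightarrow> K \<in> sets \<mu>"
    and le: "\<And>\<F>. finite \<F> \<Longrightarrow> \<F> \<subseteq> D \<Longrightarrow> (\<Sum>K\<in>\<F>. emeasure \<mu> K) \<le> e"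
  shows "emeasure \<mu> (\<Union>D) \<le> e"
proof (cases "D = {}")
  case False
  define K where "K = from_nat_into D"
  have range: "range K = D" using False cD by (simp add: K_def range_from_nat_into)
  have K: "K i \<in> sets \<mu>" for i using range meas by blast
  have "\<Union>D = (\<Union>n. \<Union>i\<le>n. K i)" using range by auto
  moreover have "emeasure \<mu> (\<Union>n. \<Union>i\<le>n. K i) = (SUP n. emeasure \<mu> (\<Union>i\<le>n. K i))"
    by (rule SUP_emeasure_incseq[symmetric]) (use K in \<open>auto simp: incseq_def intro!: order_trans\<close>)
  moreover have "emeasure \<mu> (\<Union>i\<le>n. K i) \<le> e" for n
  proof -
    have "emeasure \<mu> (\<Union>i\<le>n. K i) \<le> (\<Sum>k\<in>K ` {..n}. emeasure \<mu> k)"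
      using emeasure_subadditive_finite[of "K ` {..n}" "\<lambda>k. k" \<mu>] K by auto
    also have "\<dots> \<le> e" by (rule le) (use range in auto)
    finally show ?thesis .
  qed
  ultimately show ?thesis by (simp add: SUP_least)
qed simp

text \<open>A null set lies in a countable union of nonoverlapping intervals of total length below
  \<delta>. On finite subfamilies the Stieltjes measure is a sum of increments of \<open>F\<close>,
  small by absolute continuity, and continuity from below extends the bound to the whole
  cover.\<close>

lemma AC_on_mono_null_set:
  fixes F :: "real \<Rightarrow> real"
  assumes mono: "\<And>x y. x \<le> y \<Longrightarrow> F x \<le> F y" and cont: "continuous_on UNIV F"
    and F: "AC_on c d F" and N: "N \<in> null_sets lborel" and cd: "c \<le> d"
  shows "emeasure (interval_measure F) (N \<inter> {c..d}) = 0"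
proof -
  have "emeasure (interval_measure F) (N \<inter> {c..d}) \<le> ennreal e" if "e > 0" for e
  proof -
    obtain \<delta> where \<delta>: "\<delta> > 0" "\<And>J. interval_family c d J \<Longrightarrow> (\<Sum>(x, y)\<in>J. y - x) < \<delta> \<Longrightarrow> (\<Sum>(x, y)\<in>J. norm (F y - F x)) < e"
      using F \<open>e > 0\<close> unfolding AC_on_def by blast
    have neg: "negligible (N \<inter> {c..d})"
      using N by (meson Int_lower1 negligible_iff_null_sets negligible_subset null_sets_completionI)
    obtain D where D: "countable D" "\<And>K. K \<in> D \<Longrightarrow> K \<subseteq> cbox c d \<and> K \<noteq> {} \<and> (\<exists>x y. K = cbox x y)"
        "pairwise (\<lambda>A B. interior A \<inter> interior B = {}) D" "N \<inter> {c..d} \<subseteq> \<Union>D" "\<Union>D \<in> lmeasurable"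
        "measure lebesgue (\<Union>D) \<le> measure lebesgue (N \<inter> {c..d}) + \<delta> / 2"
    proof (rule measurable_outer_intervals_bounded[OF negligible_imp_measurable[OF neg], of c d "\<delta> / 2"])
      fix D assume "countable D" "\<And>K. K \<in> D \<Longrightarrow> K \<subseteq> cbox c d \<and> K \<noteq> {} \<and> (\<exists>x y. K = cbox x y)"
        "pairwise (\<lambda>A B. interior A \<inter> interior B = {}) D" "N \<inter> {c..d} \<subseteq> \<Union>D" "\<Union>D \<in> lmeasurable"
        "measure lebesgue (\<Union>D) \<le> measure lebesgue (N \<inter> {c..d}) + \<delta> / 2"
      then show thesis by (rule that)
    qed (use \<delta>(1) in auto)
    have int: "\<exists>x y. K = {x..y} \<and> c \<le> x \<and> x \<le> y \<and> y \<le> d" if "K \<in> D" for K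
    proof -
      from D(2)[OF that] obtain x y where xy: "K = {x..y}" "{x..y} \<noteq> {}" "{x..y} \<subseteq> {c..d}"
        unfolding cbox_interval by blast
      then have "x \<le> y" by simp
      then show ?thesis using xy by (intro exI[of _ x] exI[of _ y]) simp
    qed
    define l where "l = (\<lambda>K::real set. Inf K)"
    define u where "u = (\<lambda>K::real set. Sup K)"
    have lu: "{l K..u K} = K \<and> c \<le> l K \<and> l K \<le> u K \<and> u K \<le> d" if "K \<in> D" for K
      using int[OF that] by (auto simp: l_def u_def)
    have meas: "K \<in> sets borel" "K \<in> lmeasurable" if "K \<in> D" for K
      using int[OF that] by auto
    have fin: "(\<Sum>K\<in>\<F>. emeasure (interval_measure F) K) \<le> ennreal e" if \<F>: "finite \<F>" "\<F> \<subseteq> D" for \<F>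
    proof -
      have disj: "{l K<..<u K} \<inter> {l K'<..<u K'} = {}" if "K \<in> \<F>" "K' \<in> \<F>" "K \<noteq> K'" for K K'
      proof -
        have "interior K \<inter> interior K' = {}" using D(3) that \<F>(2) unfolding pairwise_def by blast
        moreover have "interior K = {l K<..<u K}" "interior K' = {l K'<..<u K'}"
          using lu[of K] lu[of K'] that \<F>(2) by (metis interior_atLeastAtMost_real in_mono)+
        ultimately show ?thesis by simp
      qed
      have small: "(\<Sum>K\<in>\<F>. u K - l K) < \<delta>"
      proof -
        have "(\<Sum>K\<in>\<F>. u K - l K) = (\<Sum>K\<in>\<F>. measure lebesgue K)"
        proof (rule sum.cong)
          fix K assume "K \<in> \<F>"
          then have "K \<in> D" using \<F>(2) by blast
          with lu[of K] have "{l K..u K} = K" "l K \<le> u K" by blast+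
          then have "measure lebesgue K = measure lebesgue {l K..u K}" by simp
          then show "u K - l K = measure lebesgue K" using \<open>l K \<le> u K\<close> by simp
        qed simp
        also have "\<dots> = measure lebesgue (\<Union>\<F>)"
        proof (rule measure_negligible_finite_Union[symmetric])
          show "\<And>S. S \<in> \<F> \<Longrightarrow> S \<in> lmeasurable" using meas \<F>(2) by blast
          show "pairwise (\<lambda>S T. negligible (S \<inter> T)) \<F>"
            unfolding pairwise_def
          proof (intro ballI impI)
            fix K K' assume K: "K \<in> \<F>" "K' \<in> \<F>" "K \<noteq> K'"
            \<comment> \<open>Closed intervals with disjoint interiors meet at most in their
              endpoints.\<close>
            have "K \<inter> K' \<subseteq> {l K, u K, l K', u K'}"
            proof
              fix t assume t: "t \<in> K \<inter> K'"
              have "t \<notin> {l K<..<u K} \<inter> {l K'<..<u K'}" using disj[OF K] by simp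
              moreover have "t \<in> {l K..u K}" using t lu[of K] K(1) \<F>(2) by blast
              moreover have "t \<in> {l K'..u K'}" using t lu[of K'] K(2) \<F>(2) by blast
              ultimately show "t \<in> {l K, u K, l K', u K'}" by auto
            qed
            then show "negligible (K \<inter> K')" by (rule negligible_subset[rotated]) simp
          qed
        qed fact
        also have "\<dots> \<le> measure lebesgue (\<Union>D)"
        proof (rule measure_mono_fmeasurable[OF _ _ D(5)])
          show "\<Union>\<F> \<in> sets lebesgue" using \<F> meas by (intro sets.finite_Union) auto
        qed (use \<F>(2) in blast)
        also have "\<dots> \<le> \<delta> / 2" using D(6) negligible_imp_measure0[OF neg] by simp
        finally show ?thesis using \<delta>(1) by simp
      qed
      have J: "\<forall>J. interval_family c d J \<and> (\<Sum>(x, y)\<in>J. y - x) < \<delta> \<longrightarrow> (\<Sum>(x, y)\<in>J. norm (F y - F x)) < e"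
        using \<delta>(2) by blast
      have "(\<Sum>K\<in>\<F>. norm (F (u K) - F (l K))) < e"
      proof (rule AC_on_indexed[OF J \<F>(1) _ disj small])
        fix K assume "K \<in> \<F>"
        then have "K \<in> D" using \<F>(2) by blast
        from lu[OF this] show "c \<le> l K \<and> l K \<le> u K \<and> u K \<le> d" by blast
      qed
      moreover have "(\<Sum>K\<in>\<F>. emeasure (interval_measure F) K) = (\<Sum>K\<in>\<F>. ennreal (norm (F (u K) - F (l K))))"
      proof (rule sum.cong)
        fix K assume "K \<in> \<F>"
        then have "K \<in> D" using \<F>(2) by blast
        with lu[of K] have K: "{l K..u K} = K" "l K \<le> u K" by blast+
        have "emeasure (interval_measure F) {l K..u K} = ennreal (F (u K) - F (l K))"
          by (rule emeasure_interval_measure_Icc[OF K(2) _ cont]) (rule mono)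
        then have "emeasure (interval_measure F) K = ennreal (F (u K) - F (l K))" by (simp only: K(1))
        then show "emeasure (interval_measure F) K = ennreal (norm (F (u K) - F (l K)))" using mono[OF K(2)] by simp
      qed simp
      ultimately show ?thesis by (simp add: ennreal_leI)
    qed
    have "emeasure (interval_measure F) (N \<inter> {c..d}) \<le> emeasure (interval_measure F) (\<Union>D)"
    proof (rule emeasure_mono[OF D(4)])
      show "\<Union>D \<in> sets (interval_measure F)"
        using meas by (intro sets.countable_Union D(1)) auto
    qed
    also have "\<dots> \<le> ennreal e"
      by (rule emeasure_UN_le_sum_interval[OF D(1) _ fin]) (use meas in auto)
    finally show ?thesis .
  qed
  then have "emeasure (interval_measure F) (N \<inter> {c..d}) \<le> 0"
    by - (rule ennreal_le_epsilon, simp)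
  then show ?thesis by simp
qed

text \<open>Absolute continuity of the function becomes absolute continuity of its Stieltjes
  measure, and the density is the Radon-Nikodym derivative.\<close>

lemma AC_on_mono_density:
  fixes F :: "real \<Rightarrow> real"
  assumes mono: "\<And>x y. c \<le> x \<Longrightarrow> x \<le> y \<Longrightarrow> y \<le> d \<Longrightarrow> F x \<le> F y" and F: "AC_on c d F" and cd: "c \<le> d"
  obtains g where "integrable lborel g" "\<And>x y. c \<le> x \<Longrightarrow> x \<le> y \<Longrightarrow> y \<le> d \<Longrightarrow> F y - F x = (LINT t:{x<..<y}|lborel. g t)"
proof -
  \<comment> \<open>Clamping the argument gives a function that is monotone and continuous on the
    whole line, as the Stieltjes measure demands.\<close>
  define G where "G = (\<lambda>x. F (max c (min d x)))"
  have G_eq: "G x = F x" if "c \<le> x" "x \<le> d" for x using that by (simp add: G_def)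
  have G_mono: "G x \<le> G y" if "x \<le> y" for x y
    unfolding G_def by (rule mono) (use that cd in auto)
  have G_cont: "continuous_on UNIV G"
    unfolding G_def by (rule continuous_on_compose2[OF AC_on_continuous_on[OF F]]) (use cd in \<open>auto intro!: continuous_intros\<close>)
  have "AC_on c d G" by (rule AC_on_dominated[OF F F, where B=1]) (simp add: G_eq)
  have null: "emeasure (interval_measure G) (N \<inter> {c..d}) = 0" if "N \<in> null_sets lborel" for N
    by (rule AC_on_mono_null_set[OF _ G_cont \<open>AC_on c d G\<close> that cd]) (rule G_mono)
  \<comment> \<open>The null set property is available on \<open>{c..d}\<close> only, so the measure
    is cut down to this interval.\<close>
  define \<nu> where "\<nu> = density (interval_measure G) (indicator {c..d})"
  have \<nu>: "emeasure \<nu> A = emeasure (interval_measure G) (A \<inter> {c..d})" if "A \<in> sets borel" for A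
    unfolding \<nu>_def using that
    by (subst emeasure_density) (auto simp: indicator_inter_arith[symmetric] Int_commute)
  have sets: "sets \<nu> = sets lborel" by (simp add: \<nu>_def)
  have "absolutely_continuous lborel \<nu>"
    unfolding absolutely_continuous_def
  proof
    fix N :: "real set" assume N: "N \<in> null_sets lborel"
    then show "N \<in> null_sets \<nu>" using null[OF N] \<nu>[of N] sets by (auto simp: null_sets_def)
  qed
  then obtain f where f: "f \<in> borel_measurable lborel" "density lborel f = \<nu>"
    using sigma_finite_measure.Radon_Nikodym[OF sigma_finite_lborel] sets by blast
  define g where "g = (\<lambda>t. enn2real (f t))"
  have f_int: "(\<integral>\<^sup>+t. f t * indicator A t \<partial>lborel) = emeasure \<nu> A" if "A \<in> sets borel" for A
    using emeasure_density[OF f(1), of A] f(2) that by simp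
  have "(\<integral>\<^sup>+t. f t \<partial>lborel) = emeasure \<nu> UNIV" using f_int[of UNIV] by simp
  also have "\<dots> = ennreal (G d - G c)"
    using \<nu>[of UNIV] emeasure_interval_measure_Icc[where F=G, OF cd G_mono G_cont] by simp
  finally have fin: "(\<integral>\<^sup>+t. f t \<partial>lborel) \<noteq> \<infinity>" by simp
  have "AE t in lborel. f t \<noteq> \<infinity>" by (rule nn_integral_PInf_AE[OF f(1) fin])
  then have fg: "AE t in lborel. ennreal (g t) = f t" by eventually_elim (simp add: g_def less_top)
  have g_meas: "g \<in> borel_measurable lborel" using f(1) by (simp add: g_def)
  have g_int: "integrable lborel g"
  proof (rule integrableI_nonneg[OF g_meas])
    show "(\<integral>\<^sup>+t. ennreal (g t) \<partial>lborel) < \<infinity>"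
      using fin nn_integral_cong_AE[OF fg] by (simp add: less_top)
  qed (simp add: g_def)
  have "F y - F x = (LINT t:{x<..<y}|lborel. g t)" if xy: "c \<le> x" "x \<le> y" "y \<le> d" for x y
  proof -
    have "(LINT t:{x<..<y}|lborel. g t) = (LINT t:{x<..y}|lborel. g t)"
    proof (rule set_integral_null_delta[OF g_int])
      have "{x<..<y} - {x<..y} \<union> ({x<..y} - {x<..<y}) \<subseteq> {y}" by auto
      then show "{x<..<y} - {x<..y} \<union> ({x<..y} - {x<..<y}) \<in> null_sets lborel"
        by (intro finite_imp_null_set_lborel) (rule finite_subset, auto)
    qed auto
    also have "\<dots> = enn2real (\<integral>\<^sup>+t. ennreal (indicator {x<..y} t * g t) \<partial>lborel)"
      unfolding set_lebesgue_integral_def real_scaleR_def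
      by (rule integral_eq_nn_integral) (use g_meas in \<open>auto simp: g_def\<close>)
    also have "(\<integral>\<^sup>+t. ennreal (indicator {x<..y} t * g t) \<partial>lborel) = (\<integral>\<^sup>+t. f t * indicator {x<..y} t \<partial>lborel)"
      by (rule nn_integral_cong_AE) (use fg in \<open>eventually_elim, auto simp: indicator_def\<close>)
    also have "\<dots> = emeasure (interval_measure G) ({x<..y} \<inter> {c..d})" using f_int \<nu> by simp
    also have "{x<..y} \<inter> {c..d} = {x<..y}" using xy by auto
    also have "emeasure (interval_measure G) {x<..y} = ennreal (G y - G x)"
      using G_cont by (intro emeasure_interval_measure_Ioc xy G_mono) (auto simp: continuous_on_eq_continuous_within intro: continuous_within_subset)
    finally show ?thesis using G_eq xy G_mono[OF xy(2)] by simp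
  qed
  then show ?thesis using that g_int by blast
qed

text \<open>Jordan decomposition: \<open>f\<close> is its variation minus the function "variation
  minus \<open>f\<close>", and both of these are nondecreasing and absolutely continuous.\<close>

lemma AC_on_real_density:
  fixes f :: "real \<Rightarrow> real"
  assumes f: "AC_on c d f" and cd: "c \<le> d"
  obtains g where "integrable lborel g" "\<And>x y. c \<le> x \<Longrightarrow> x \<le> y \<Longrightarrow> y \<le> d \<Longrightarrow> f y - f x = (LINT t:{x<..<y}|lborel. g t)"
proof -
  let ?V = "variation f c"
  note V = AC_on_variation[OF f]
  have inc: "\<bar>f y - f x\<bar> \<le> ?V y - ?V x" if "c \<le> x" "x \<le> y" "y \<le> d" for x y
    using variation_increment_ge[OF f that] .
  have "?V x \<le> ?V y" "?V x - f x \<le> ?V y - f y" if "c \<le> x" "x \<le> y" "y \<le> d" for x y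
    using inc[OF that] by linarith+
  note incV = this
  obtain g1 where g1: "integrable lborel g1"
    "\<And>x y. c \<le> x \<Longrightarrow> x \<le> y \<Longrightarrow> y \<le> d \<Longrightarrow> ?V y - ?V x = (LINT t:{x<..<y}|lborel. g1 t)"
    using AC_on_mono_density[OF incV(1) V cd] by blast
  obtain g2 where g2: "integrable lborel g2"
    "\<And>x y. c \<le> x \<Longrightarrow> x \<le> y \<Longrightarrow> y \<le> d \<Longrightarrow> (?V y - f y) - (?V x - f x) = (LINT t:{x<..<y}|lborel. g2 t)"
    using AC_on_mono_density[OF incV(2) AC_on_diff[OF V f] cd] by blast
  note g = g1(1) g2(1) g1(2) g2(2)
  have sub: "set_integrable lborel {x<..<y} g" if "integrable lborel g" for x y and g :: "real \<Rightarrow> real"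
    unfolding set_integrable_def using that by (intro integrable_mult_indicator) auto
  show ?thesis
  proof
    show "integrable lborel (\<lambda>t. g1 t - g2 t)" using g by simp
    show "f y - f x = (LINT t:{x<..<y}|lborel. g1 t - g2 t)" if "c \<le> x" "x \<le> y" "y \<le> d" for x y
      using set_integral_diff(2)[OF sub[OF g(1)] sub[OF g(2)], of x y] g(3)[OF that] g(4)[OF that] by simp
  qed
qed

theorem AC_on_density:
  fixes f :: "real \<Rightarrow> complex"
  assumes f: "AC_on c d f" and cd: "c \<le> d"
  obtains v where "integrable lebesgue v" "\<And>x y. c \<le> x \<Longrightarrow> x \<le> y \<Longrightarrow> y \<le> d \<Longrightarrow> f y - f x = integral {x..y} v"
proof -
  have "AC_on c d (\<lambda>x. Re (f x))" "AC_on c d (\<lambda>x. Im (f x))"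
    by (rule AC_on_dominated[OF f f, where B=1],
        simp add: add_increasing2 flip: minus_complex.sel, smt (verit) abs_Re_le_cmod abs_Im_le_cmod norm_ge_zero)+
  note ReIm = this
  obtain g1 where g1: "integrable lborel g1"
    "\<And>x y. c \<le> x \<Longrightarrow> x \<le> y \<Longrightarrow> y \<le> d \<Longrightarrow> Re (f y) - Re (f x) = (LINT t:{x<..<y}|lborel. g1 t)"
    by (rule AC_on_real_density[OF ReIm(1) cd]) blast
  obtain g2 where g2: "integrable lborel g2"
    "\<And>x y. c \<le> x \<Longrightarrow> x \<le> y \<Longrightarrow> y \<le> d \<Longrightarrow> Im (f y) - Im (f x) = (LINT t:{x<..<y}|lborel. g2 t)"
    by (rule AC_on_real_density[OF ReIm(2) cd]) blast
  note g = g1(1) g2(1) g1(2) g2(2)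
  define v where "v = (\<lambda>t. Complex (g1 t) (g2 t))"
  have v_eq: "v = (\<lambda>t. complex_of_real (g1 t) + \<i> * complex_of_real (g2 t))"
    by (simp add: v_def complex_eq_iff fun_eq_iff)
  have v: "integrable lborel v" unfolding v_eq using g by (intro Bochner_Integration.integrable_add integrable_mult_right integrable_of_real)
  have v': "integrable lebesgue v" using v by (simp add: integrable_completion)
  have "f y - f x = integral {x..y} v" if xy: "c \<le> x" "x \<le> y" "y \<le> d" for x y
  proof -
    have vi: "set_integrable lborel {x<..<y} v" unfolding set_integrable_def using v by (intro integrable_mult_indicator) auto
    have "Re (LINT t:{x<..<y}|lborel. v t) = (LINT t:{x<..<y}|lborel. g1 t)"
      "Im (LINT t:{x<..<y}|lborel. v t) = (LINT t:{x<..<y}|lborel. g2 t)"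
      using integral_Re[OF vi[unfolded set_integrable_def]] integral_Im[OF vi[unfolded set_integrable_def]]
      by (simp_all add: set_lebesgue_integral_def v_def)
    then have "f y - f x = (LINT t:{x<..<y}|lborel. v t)"
      using g(3)[OF xy] g(4)[OF xy] by (simp add: complex_eq_iff)
    also have "\<dots> = integral {x<..<y} v" using set_borel_integral_eq_integral(2)[OF vi] .
    finally show ?thesis by (simp add: integral_open_interval_real)
  qed
  then show ?thesis using that v' by blast
qed

subsection \<open>Primitives on an interval\<close>

lemma AE_lebesgue_on_einterval:
  "(AE x in lebesgue_on (einterval a b). P x) \<longleftrightarrow> (\<exists>N. negligible N \<and> (\<forall>x\<in>einterval a b - N. P x))"
proof -
  have "(AE x in lebesgue_on (einterval a b). P x) \<longleftrightarrow> (AE x in lebesgue. x \<in> einterval a b \<longrightarrow> P x)"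
    by (rule AE_restrict_space_iff) simp
  also have "\<dots> \<longleftrightarrow> (\<exists>N. negligible N \<and> {x. \<not> (x \<in> einterval a b \<longrightarrow> P x)} \<subseteq> N)"
    by (rule eventually_ae_filter_negligible)
  also have "\<dots> \<longleftrightarrow> (\<exists>N. negligible N \<and> (\<forall>x\<in>einterval a b - N. P x))" by blast
  finally show ?thesis .
qed

lemma Icc_subset_einterval: "x \<in> einterval a b \<Longrightarrow> y \<in> einterval a b \<Longrightarrow> {x..y} \<subseteq> einterval a b"
  by (auto simp: einterval_iff) (metis ereal_less_eq(3) less_le_trans, metis ereal_less_eq(3) le_less_trans)

lemma AC_locD: "f \<in> AC_loc a b \<Longrightarrow> x \<in> einterval a b \<Longrightarrow> y \<in> einterval a b \<Longrightarrow> x \<le> y \<Longrightarrow> AC_on x y f"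
  by (simp add: AC_loc_def abs_cont_on_iff_AC_on einterval_iff)

lemma AC_locI:
  assumes "\<And>x y. x \<in> einterval a b \<Longrightarrow> y \<in> einterval a b \<Longrightarrow> x \<le> y \<Longrightarrow> AC_on x y f"
  shows "f \<in> AC_loc a b"
  unfolding AC_loc_def abs_cont_on_iff_AC_on mem_Collect_eq
proof (intro allI impI)
  fix c d :: real assume cd: "a < ereal c \<and> c \<le> d \<and> ereal d < b"
  then have "a < ereal d" "ereal c < b" using less_le_trans[of a "ereal c" "ereal d"] le_less_trans[of "ereal c" "ereal d" b] by auto
  then show "AC_on c d f" using cd by (intro assms) (auto simp: einterval_iff)
qed

lemma einterval_neighbourhood:
  assumes "x \<in> einterval a b"
  obtains c d where "c \<in> einterval a b" "d \<in> einterval a b" "c < x" "x < d"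
proof -
  obtain e where "e > 0" "ball x e \<subseteq> einterval a b" using assms open_einterval by (metis openE)
  then have "x - e / 2 \<in> einterval a b" "x + e / 2 \<in> einterval a b" by (auto simp: subset_iff dist_norm)
  then show ?thesis using that \<open>e > 0\<close> by force
qed

lemma AC_loc_continuous_on:
  assumes "f \<in> AC_loc a b"
  shows "continuous_on (einterval a b) f"
proof (rule continuous_at_imp_continuous_on, rule ballI)
  fix x assume "x \<in> einterval a b"
  then obtain c d where cd: "c \<in> einterval a b" "d \<in> einterval a b" "c < x" "x < d" by (rule einterval_neighbourhood)
  then have "continuous_on {c..d} f" using assms by (intro AC_on_continuous_on AC_locD) auto
  then show "isCont f x" using cd by (intro continuous_on_interior) auto
qed

text \<open>Densities exist on compact subintervals only, so the interval is exhausted by countably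
  many of them. Their endpoints join the exceptional set because differentiation is available in the
  interiors.\<close>

lemma AC_loc_has_vector_derivative:
  fixes f :: "real \<Rightarrow> complex"
  assumes f: "f \<in> AC_loc a b" and ab: "a < b"
  shows "AE x in lebesgue_on (einterval a b). (f has_vector_derivative vector_derivative f (at x)) (at x)"
proof -
  obtain u l :: "nat \<Rightarrow> real" where ul: "einterval a b = (\<Union>i. {l i..u i})" "\<And>i. l i < u i" "\<And>i. a < l i" "\<And>i. u i < b"
    by (rule einterval_Icc_approximation[OF ab]) blast
  have in_I: "l i \<in> einterval a b" "u i \<in> einterval a b" for i
    unfolding ul(1) using ul(2)[of i] by (auto intro!: exI[of _ i])
  have "\<exists>N. negligible N \<and> (\<forall>x\<in>{l i<..<u i} - N. f differentiable (at x))" for i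
  proof -
    have lu: "l i \<le> u i" using ul(2)[of i] by simp
    obtain v where v: "integrable lebesgue v" "\<And>x y. l i \<le> x \<Longrightarrow> x \<le> y \<Longrightarrow> y \<le> u i \<Longrightarrow> f y - f x = integral {x..y} v"
      by (rule AC_on_density[OF AC_locD[OF f in_I lu] lu]) blast
    obtain N where N: "negligible N"
      "\<And>F x S. x \<notin> N \<Longrightarrow> open S \<Longrightarrow> x \<in> S \<Longrightarrow>
       (\<And>s t. s \<in> S \<Longrightarrow> t \<in> S \<Longrightarrow> s \<le> t \<Longrightarrow> F t - F s = integral {s..t} v) \<Longrightarrow> (F has_vector_derivative v x) (at x)"
      by (rule lebesgue_differentiation[OF v(1)]) blast
    have "(f has_vector_derivative v x) (at x)" if "x \<in> {l i<..<u i} - N" for x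
      by (rule N(2)[of x "{l i<..<u i}"]) (use that v(2) in auto)
    then show ?thesis using N(1) by (meson differentiableI_vector)
  qed
  then have "\<exists>N. \<forall>i. negligible (N i) \<and> (\<forall>x\<in>{l i<..<u i} - N i. f differentiable (at x))" by (intro choice allI)
  then obtain N where N: "\<And>i. negligible (N i)" "\<And>i x. x \<in> {l i<..<u i} - N i \<Longrightarrow> f differentiable (at x)" by blast
  have "negligible ((\<Union>i. N i) \<union> (range l \<union> range u))"
  proof -
    have "negligible (range l \<union> range u)"
      unfolding negligible_iff_null_sets by (intro null_sets_completionI countable_imp_null_set_lborel) auto
    then show ?thesis using N(1) by (intro negligible_Un) auto
  qed
  moreover have "(f has_vector_derivative vector_derivative f (at x)) (at x)"
    if x: "x \<in> einterval a b - ((\<Union>i. N i) \<union> (range l \<union> range u))" for x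
  proof -
    obtain i where i: "x \<in> {l i..u i}" using x unfolding ul(1) by blast
    have "x \<noteq> l i" "x \<noteq> u i" "x \<notin> N i" using x by blast+
    then have "x \<in> {l i<..<u i} - N i" using i by simp
    from N(2)[OF this] show ?thesis unfolding vector_derivative_works .
  qed
  ultimately show ?thesis unfolding AE_lebesgue_on_einterval by blast
qed

text \<open>The primitive vanishing at the left endpoint, written with an indicator so that infinite
  endpoints and arbitrary real \<open>x\<close> need no separate treatment.\<close>

definition prim :: "ereal \<Rightarrow> ereal \<Rightarrow> (real \<Rightarrow> 'a::{banach, second_countable_topology}) \<Rightarrow> real \<Rightarrow> 'a" where
  "prim a b u x = (LINT t|lebesgue_on (einterval a b). indicator {..<x} t *\<^sub>R u t)"

locale nonempty_einterval =
  fixes a b :: ereal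
  assumes ab: "a < b"
begin

abbreviation (input) "I \<equiv> einterval a b"
abbreviation (input) "leb \<equiv> lebesgue_on (einterval a b)"

lemma lebesgue_on_einterval_integrable_iff:
  fixes u :: "real \<Rightarrow> 'a::{banach, second_countable_topology}"
  shows "integrable leb u \<longleftrightarrow> integrable lebesgue (\<lambda>t. indicator I t *\<^sub>R u t)"
  by (rule integrable_restrict_space) simp

lemma prim_integrable:
  fixes u :: "real \<Rightarrow> 'a::{banach, second_countable_topology}"
  assumes "integrable leb u"
  shows "integrable leb (\<lambda>t. indicator {..<x} t *\<^sub>R u t)"
proof -
  have "integrable lebesgue (\<lambda>t. indicator {..<x} t *\<^sub>R (indicator I t *\<^sub>R u t))"
    using assms unfolding lebesgue_on_einterval_integrable_iff by (rule integrable_mult_indicator[rotated]) simp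
  then show ?thesis by (simp only: lebesgue_on_einterval_integrable_iff scaleR_left_commute)
qed

lemma prim_diff:
  fixes u :: "real \<Rightarrow> 'a::{banach, second_countable_topology}"
  assumes u: "integrable leb u" and xy: "x \<le> y"
  shows "prim a b u y - prim a b u x = (LINT t:{x<..<y}|lebesgue. indicator I t *\<^sub>R u t)"
proof -
  have "prim a b u y - prim a b u x = (LINT t|leb. indicator {..<y} t *\<^sub>R u t - indicator {..<x} t *\<^sub>R u t)"
    unfolding prim_def by (rule Bochner_Integration.integral_diff[symmetric]) (rule prim_integrable[OF u])+
  also have "\<dots> = (LINT t|leb. indicator {x..<y} t *\<^sub>R u t)"
    using xy by (intro Bochner_Integration.integral_cong) (auto simp: indicator_def)
  also have "\<dots> = (LINT t:{x..<y}|lebesgue. indicator I t *\<^sub>R u t)"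
    unfolding set_lebesgue_integral_def
    by (subst integral_restrict_space) (auto intro!: Bochner_Integration.integral_cong simp: scaleR_left_commute)
  also have "\<dots> = (LINT t:{x<..<y}|lebesgue. indicator I t *\<^sub>R u t)"
  proof (rule set_integral_null_delta)
    show "integrable lebesgue (\<lambda>t. indicator I t *\<^sub>R u t)" using u by (simp add: lebesgue_on_einterval_integrable_iff)
    have "{x..<y} - {x<..<y} \<union> ({x<..<y} - {x..<y}) \<subseteq> {x}" by auto
    then show "{x..<y} - {x<..<y} \<union> ({x<..<y} - {x..<y}) \<in> null_sets lebesgue"
      by (meson negligible_iff_null_sets negligible_sing negligible_subset)
  qed auto
  finally show ?thesis .
qed

lemma prim_diff_integral:
  fixes u :: "real \<Rightarrow> 'a::euclidean_space"
  assumes u: "integrable leb u" and xy: "x \<le> y"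
  shows "prim a b u y - prim a b u x = integral {x..y} (\<lambda>t. indicator I t *\<^sub>R u t)"
proof -
  have "set_integrable lebesgue {x<..<y} (\<lambda>t. indicator I t *\<^sub>R u t)"
    unfolding set_integrable_def
    by (rule integrable_mult_indicator) (use u in \<open>auto simp: lebesgue_on_einterval_integrable_iff\<close>)
  from set_lebesgue_integral_eq_integral(2)[OF this] show ?thesis
    using prim_diff[OF assms] by (simp only: integral_open_interval_real)
qed

lemma prim_AC_on:
  fixes u :: "real \<Rightarrow> 'a::{banach, second_countable_topology}"
  assumes u: "integrable leb u"
  shows "AC_on x y (prim a b u)"
  by (rule AC_on_indefinite_integral[OF u[unfolded lebesgue_on_einterval_integrable_iff]]) (rule prim_diff[OF u])

lemma prim_AC_loc: "integrable leb u \<Longrightarrow> prim a b u \<in> AC_loc a b"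
  by (rule AC_locI) (rule prim_AC_on)

lemma prim_has_vector_derivative:
  fixes u :: "real \<Rightarrow> 'a::euclidean_space"
  assumes u: "integrable leb u"
  shows "AE x in leb. (prim a b u has_vector_derivative u x) (at x)"
proof -
  let ?v = "\<lambda>t. indicator I t *\<^sub>R u t"
  have "integrable lebesgue ?v" using u by (simp add: lebesgue_on_einterval_integrable_iff)
  then obtain N where N: "negligible N"
      "\<And>F x S. x \<notin> N \<Longrightarrow> open S \<Longrightarrow> x \<in> S \<Longrightarrow>
       (\<And>s t. s \<in> S \<Longrightarrow> t \<in> S \<Longrightarrow> s \<le> t \<Longrightarrow> F t - F s = integral {s..t} ?v) \<Longrightarrow> (F has_vector_derivative ?v x) (at x)"
    by (rule lebesgue_differentiation) blast
  have "(prim a b u has_vector_derivative u x) (at x)" if "x \<in> I - N" for x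
    using N(2)[of x UNIV "prim a b u"] prim_diff_integral[OF u] that by simp
  then show ?thesis using N(1) unfolding AE_lebesgue_on_einterval by blast
qed

text \<open>Fundamental theorem of calculus: a local density of \<open>f\<close> and the given
  \<open>u\<close> are both the derivative of \<open>f\<close> almost everywhere, hence agree there
  and have equal integrals.\<close>

theorem AC_loc_increment:
  fixes f :: "real \<Rightarrow> complex"
  assumes f: "f \<in> AC_loc a b" and deriv: "AE x in leb. (f has_vector_derivative u x) (at x)"
    and u: "integrable leb u" and xy: "x \<in> I" "y \<in> I"
  shows "f y - f x = prim a b u y - prim a b u x"
proof -
  have *: "f y - f x = prim a b u y - prim a b u x" if xy: "x \<in> I" "y \<in> I" "x \<le> y" for x y
  proof -
    obtain v where v: "integrable lebesgue v" "\<And>s t. x \<le> s \<Longrightarrow> s \<le> t \<Longrightarrow> t \<le> y \<Longrightarrow> f t - f s = integral {s..t} v"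
      by (rule AC_on_density[OF AC_locD[OF f xy] xy(3)]) blast
    obtain N where N: "negligible N"
      "\<And>F x S. x \<notin> N \<Longrightarrow> open S \<Longrightarrow> x \<in> S \<Longrightarrow>
       (\<And>s t. s \<in> S \<Longrightarrow> t \<in> S \<Longrightarrow> s \<le> t \<Longrightarrow> F t - F s = integral {s..t} v) \<Longrightarrow> (F has_vector_derivative v x) (at x)"
      by (rule lebesgue_differentiation[OF v(1)]) blast
    have dv: "(f has_vector_derivative v t) (at t)" if "t \<in> {x<..<y} - N" for t
      by (rule N(2)[of t "{x<..<y}"]) (use that v(2) in auto)
    obtain N' where N': "negligible N'" "\<And>t. t \<in> I - N' \<Longrightarrow> (f has_vector_derivative u t) (at t)"
      using deriv unfolding AE_lebesgue_on_einterval by blast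
    have "integral {x..y} v = integral {x..y} (\<lambda>t. indicator I t *\<^sub>R u t)"
    proof (rule integral_spike)
      show "negligible (N \<union> N' \<union> {x, y})" using N(1) N'(1) by auto
      show "indicator I t *\<^sub>R u t = v t" if t: "t \<in> {x..y} - (N \<union> N' \<union> {x, y})" for t
      proof -
        have "t \<in> {x<..<y} - N" "t \<in> I - N'" using t Icc_subset_einterval[OF xy(1,2)] by auto
        then have "v t = u t" "t \<in> I" using dv N'(2) vector_derivative_unique_at by blast+
        then show ?thesis by simp
      qed
    qed
    then show ?thesis using v(2)[of x y] xy(3) prim_diff_integral[OF u xy(3)] by simp
  qed
  show ?thesis
  proof (cases "x \<le> y")
    case False
    then have "f x - f y = prim a b u x - prim a b u y" by (intro *) (use xy in auto)
    then show ?thesis by (metis minus_diff_eq)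
  qed (use * xy in blast)
qed

text \<open>Along any sequence tending to the endpoint the indicators tend to 0 pointwise, and
  \<open>norm (u t)\<close> dominates. The limit runs over extended reals since \<open>a\<close> may
  be infinite.\<close>

lemma prim_at_left_end:
  fixes u :: "real \<Rightarrow> 'a::{banach, second_countable_topology}"
  assumes u: "integrable leb u"
  shows "((prim a b u \<circ> real_of_ereal) \<longlongrightarrow> 0) (at_right a)"
proof (rule tendsto_at_right_sequentially[OF ab])
  fix S assume S: "\<And>n. a < S n" "\<And>n. S n < b" "decseq S" "S \<longlonglongrightarrow> a"
  have "(\<lambda>n. LINT t|leb. indicator {..<real_of_ereal (S n)} t *\<^sub>R u t) \<longlonglongrightarrow> (LINT t|leb. 0)"
  proof (rule Bochner_Integration.integral_dominated_convergence)
    show "integrable leb (\<lambda>t. norm (u t))" using u by simp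
    show "AE t in leb. (\<lambda>n. indicator {..<real_of_ereal (S n)} t *\<^sub>R u t) \<longlonglongrightarrow> 0"
    proof (rule AE_I2)
      fix t assume "t \<in> space leb"
      then have "a < ereal t" by (simp add: einterval_iff)
      then have "eventually (\<lambda>n. S n < ereal t) sequentially" using S(4) by (rule order_tendstoD(2)[rotated])
      then have "eventually (\<lambda>n. indicator {..<real_of_ereal (S n)} t *\<^sub>R u t = 0) sequentially"
      proof eventually_elim
        case (elim n)
        have "ereal (real_of_ereal (S n)) = S n" using S(1,2)[of n] by (intro ereal_real') auto
        then have "real_of_ereal (S n) < t" using elim by (metis ereal_less_eq(3) not_less)
        then show ?case by simp
      qed
      then show "(\<lambda>n. indicator {..<real_of_ereal (S n)} t *\<^sub>R u t) \<longlonglongrightarrow> 0" by (rule tendsto_eventually)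
    qed
    show "(\<lambda>t. indicator {..<real_of_ereal (S n)} t *\<^sub>R u t) \<in> borel_measurable leb" for n
      using prim_integrable[OF u] by (rule borel_measurable_integrable)
    show "AE t in leb. norm (indicator {..<real_of_ereal (S n)} t *\<^sub>R u t) \<le> norm (u t)" for n
      by (rule AE_I2) (auto simp: indicator_def)
  qed auto
  then show "(\<lambda>n. (prim a b u \<circ> real_of_ereal) (S n)) \<longlonglongrightarrow> 0" by (simp add: prim_def)
qed

lemma prim_at_right_end:
  fixes u :: "real \<Rightarrow> 'a::{banach, second_countable_topology}"
  assumes u: "integrable leb u"
  shows "((prim a b u \<circ> real_of_ereal) \<longlongrightarrow> (LINT t|leb. u t)) (at_left b)"
proof (rule tendsto_at_left_sequentially[OF ab])
  fix S assume S: "\<And>n. S n < b" "\<And>n. a < S n" "incseq S" "S \<longlonglongrightarrow> b"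
  have "(\<lambda>n. LINT t|leb. indicator {..<real_of_ereal (S n)} t *\<^sub>R u t) \<longlonglongrightarrow> (LINT t|leb. u t)"
  proof (rule Bochner_Integration.integral_dominated_convergence)
    show "integrable leb (\<lambda>t. norm (u t))" using u by simp
    show "AE t in leb. (\<lambda>n. indicator {..<real_of_ereal (S n)} t *\<^sub>R u t) \<longlonglongrightarrow> u t"
    proof (rule AE_I2)
      fix t assume "t \<in> space leb"
      then have "ereal t < b" by (simp add: einterval_iff)
      then have "eventually (\<lambda>n. ereal t < S n) sequentially" using S(4) by (rule order_tendstoD(1)[rotated])
      then have "eventually (\<lambda>n. indicator {..<real_of_ereal (S n)} t *\<^sub>R u t = u t) sequentially"
      proof eventually_elim
        case (elim n)
        have "ereal (real_of_ereal (S n)) = S n" using S(1,2)[of n] by (intro ereal_real') auto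
        then have "t < real_of_ereal (S n)" using elim by (metis ereal_less_eq(3) not_less)
        then show ?case by simp
      qed
      then show "(\<lambda>n. indicator {..<real_of_ereal (S n)} t *\<^sub>R u t) \<longlonglongrightarrow> u t" by (rule tendsto_eventually)
    qed
    show "(\<lambda>t. indicator {..<real_of_ereal (S n)} t *\<^sub>R u t) \<in> borel_measurable leb" for n
      using prim_integrable[OF u] by (rule borel_measurable_integrable)
    show "u \<in> borel_measurable leb" using u by (rule borel_measurable_integrable)
    show "AE t in leb. norm (indicator {..<real_of_ereal (S n)} t *\<^sub>R u t) \<le> norm (u t)" for n
      by (rule AE_I2) (auto simp: indicator_def)
  qed
  then show "(\<lambda>n. (prim a b u \<circ> real_of_ereal) (S n)) \<longlonglongrightarrow> (LINT t|leb. u t)" by (simp add: prim_def)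
qed

lemma at_ends_nontrivial: "at_right a \<noteq> bot" "at_left b \<noteq> bot"
  unfolding trivial_limit_def eventually_at_right[OF ab] eventually_at_left[OF ab] using dense by blast+

lemma eventually_in_einterval:
  "eventually (\<lambda>z. real_of_ereal z \<in> I) (at_right a)" "eventually (\<lambda>z. real_of_ereal z \<in> I) (at_left b)"
proof -
  have *: "real_of_ereal z \<in> I" if "a < z" "z < b" for z
  proof -
    have "ereal (real_of_ereal z) = z" using that by (intro ereal_real') auto
    then show ?thesis using that by (simp add: einterval_iff)
  qed
  show "eventually (\<lambda>z. real_of_ereal z \<in> I) (at_right a)"
    unfolding eventually_at_right[OF ab] using ab * by blast
  show "eventually (\<lambda>z. real_of_ereal z \<in> I) (at_left b)"
    unfolding eventually_at_left[OF ab] using ab * by blast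
qed

text \<open>\<open>f\<close> and the primitive differ by a constant, which the limit at the left
  endpoint identifies as \<alpha>.\<close>

theorem AC_loc_eq_prim:
  fixes f :: "real \<Rightarrow> complex"
  assumes f: "f \<in> AC_loc a b" and deriv: "AE x in leb. (f has_vector_derivative u x) (at x)"
    and u: "integrable leb u" and lim: "((f \<circ> real_of_ereal) \<longlongrightarrow> \<alpha>) (at_right a)" and x: "x \<in> I"
  shows "f x = \<alpha> + prim a b u x"
proof -
  have "((\<lambda>z. (f \<circ> real_of_ereal) z - (prim a b u \<circ> real_of_ereal) z) \<longlongrightarrow> \<alpha> - 0) (at_right a)"
    by (intro tendsto_diff lim prim_at_left_end u)
  moreover have "((\<lambda>z. (f \<circ> real_of_ereal) z - (prim a b u \<circ> real_of_ereal) z) \<longlongrightarrow> f x - prim a b u x) (at_right a)"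
  proof (rule tendsto_eventually, rule eventually_mono[OF eventually_in_einterval(1)])
    fix z assume "real_of_ereal z \<in> I"
    from AC_loc_increment[OF f deriv u this x]
    show "(f \<circ> real_of_ereal) z - (prim a b u \<circ> real_of_ereal) z = f x - prim a b u x" by (simp add: algebra_simps)
  qed
  ultimately have "\<alpha> - 0 = f x - prim a b u x" using at_ends_nontrivial(1) tendsto_unique by blast
  then show ?thesis by (simp add: algebra_simps)
qed

end

section \<open>The space $L^2$\<close>

lemma borel_measurable_cnj [measurable (raw)]:
  "f \<in> borel_measurable M \<Longrightarrow> (\<lambda>x. cnj (f x)) \<in> borel_measurable M"
  by (rule measurable_compose[OF _ borel_measurable_continuous_onI[OF continuous_on_cnj[OF continuous_on_id]]])

lemma L2_measurable: "f \<in> L2 M \<Longrightarrow> f \<in> borel_measurable M"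
  by (simp add: L2_def)

lemma L2_integrable_square: "f \<in> L2 M \<Longrightarrow> integrable M (\<lambda>x. (cmod (f x))\<^sup>2)"
  by (simp add: L2_def)

lemma L2_scale: "f \<in> L2 M \<Longrightarrow> (\<lambda>x. c * f x) \<in> L2 M"
  by (auto simp: L2_def norm_mult power_mult_distrib)

lemma L2_zero: "(\<lambda>x. 0) \<in> L2 M"
  by (simp add: L2_def)

lemma L2_add:
  assumes f: "f \<in> L2 M" and g: "g \<in> L2 M"
  shows "(\<lambda>x. f x + g x) \<in> L2 M"
proof -
  have [measurable]: "f \<in> borel_measurable M" "g \<in> borel_measurable M" using f g by (auto simp: L2_def)
  have "integrable M (\<lambda>x. (cmod (f x + g x))\<^sup>2)"
  proof (rule Bochner_Integration.integrable_bound)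
    show "integrable M (\<lambda>x. 2 * (cmod (f x))\<^sup>2 + 2 * (cmod (g x))\<^sup>2)" using f g by (simp add: L2_def)
    have "(cmod (f x + g x))\<^sup>2 \<le> 2 * (cmod (f x))\<^sup>2 + 2 * (cmod (g x))\<^sup>2" for x
    proof -
      have "(cmod (f x + g x))\<^sup>2 \<le> (cmod (f x) + cmod (g x))\<^sup>2" by (intro power_mono norm_triangle_ineq) simp
      also have "\<dots> \<le> 2 * (cmod (f x))\<^sup>2 + 2 * (cmod (g x))\<^sup>2"
        using zero_le_power2[of "cmod (f x) - cmod (g x)"] by (simp add: power2_sum power2_diff)
      finally show ?thesis .
    qed
    then show "AE x in M. norm ((cmod (f x + g x))\<^sup>2) \<le> norm (2 * (cmod (f x))\<^sup>2 + 2 * (cmod (g x))\<^sup>2)" by simp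
  qed simp
  then show ?thesis by (simp add: L2_def)
qed

lemma L2_diff: "f \<in> L2 M \<Longrightarrow> g \<in> L2 M \<Longrightarrow> (\<lambda>x. f x - g x) \<in> L2 M"
  using L2_add[of f M "\<lambda>x. (- 1) * g x"] L2_scale[of g M "- 1"] by simp

lemma L2_AE_cong: "f \<in> L2 M \<Longrightarrow> g \<in> borel_measurable M \<Longrightarrow> AE x in M. f x = g x \<Longrightarrow> g \<in> L2 M"
  unfolding L2_def mem_Collect_eq
  by (auto intro: integrable_cong_AE_imp)

lemma L2_mult_integrable:
  assumes f: "f \<in> L2 M" and g: "g \<in> L2 M"
  shows "integrable M (\<lambda>x. cnj (f x) * g x)"
proof (rule Bochner_Integration.integrable_bound)
  have [measurable]: "f \<in> borel_measurable M" "g \<in> borel_measurable M" using f g by (auto simp: L2_def)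
  show "(\<lambda>x. cnj (f x) * g x) \<in> borel_measurable M" by simp
  show "integrable M (\<lambda>x. (cmod (f x))\<^sup>2 + (cmod (g x))\<^sup>2)" using f g by (simp add: L2_def)
  have "cmod (f x) * cmod (g x) \<le> (cmod (f x))\<^sup>2 + (cmod (g x))\<^sup>2" for x
    using sum_squares_bound[of "cmod (f x)" "cmod (g x)"] mult_nonneg_nonneg[OF norm_ge_zero norm_ge_zero, of "f x" "g x"]
    by linarith
  then show "AE x in M. norm (cnj (f x) * g x) \<le> norm ((cmod (f x))\<^sup>2 + (cmod (g x))\<^sup>2)"
    by (simp add: norm_mult)
qed

lemma L2_inner_cong_AE:
  assumes "f \<in> L2 M" "f' \<in> L2 M" "g \<in> L2 M" "g' \<in> L2 M" "AE x in M. f x = f' x" "AE x in M. g x = g' x"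
  shows "L2_inner M f g = L2_inner M f' g'"
proof -
  have [measurable]: "f \<in> borel_measurable M" "g \<in> borel_measurable M" "f' \<in> borel_measurable M" "g' \<in> borel_measurable M"
    using assms by (auto simp: L2_def)
  show ?thesis unfolding L2_inner_def by (rule integral_cong_AE) (use assms(5,6) in auto)
qed

lemma L2_norm_cong_AE:
  assumes "f \<in> borel_measurable M" "f' \<in> borel_measurable M" "AE x in M. f x = f' x"
  shows "L2_norm M f = L2_norm M f'"
  unfolding L2_norm_def using assms by (intro arg_cong[where f=sqrt] integral_cong_AE) auto

lemma L2_inner_cnj: "L2_inner M g f = cnj (L2_inner M f g)"
  unfolding L2_inner_def by (subst Bochner_Integration.integral_cnj[symmetric]) (simp add: mult.commute)

lemma L2_inner_add_right: "f \<in> L2 M \<Longrightarrow> g \<in> L2 M \<Longrightarrow> h \<in> L2 M \<Longrightarrow>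
    L2_inner M f (\<lambda>x. g x + h x) = L2_inner M f g + L2_inner M f h"
  unfolding L2_inner_def by (simp add: distrib_left L2_mult_integrable)

lemma L2_inner_diff_right: "f \<in> L2 M \<Longrightarrow> g \<in> L2 M \<Longrightarrow> h \<in> L2 M \<Longrightarrow>
    L2_inner M f (\<lambda>x. g x - h x) = L2_inner M f g - L2_inner M f h"
  unfolding L2_inner_def by (simp add: right_diff_distrib L2_mult_integrable)

lemma L2_inner_add_left: "f \<in> L2 M \<Longrightarrow> g \<in> L2 M \<Longrightarrow> h \<in> L2 M \<Longrightarrow>
    L2_inner M (\<lambda>x. g x + h x) f = L2_inner M g f + L2_inner M h f"
  unfolding L2_inner_def by (simp add: distrib_right L2_mult_integrable)

lemma L2_inner_diff_left: "f \<in> L2 M \<Longrightarrow> g \<in> L2 M \<Longrightarrow> h \<in> L2 M \<Longrightarrow>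
    L2_inner M (\<lambda>x. g x - h x) f = L2_inner M g f - L2_inner M h f"
  unfolding L2_inner_def by (simp add: left_diff_distrib L2_mult_integrable)

lemma L2_inner_scale_right: "L2_inner M f (\<lambda>x. c * g x) = c * L2_inner M f g"
  unfolding L2_inner_def by (subst integral_mult_right_zero[symmetric]) (simp add: mult.left_commute)

lemma L2_inner_scale_left: "L2_inner M (\<lambda>x. c * g x) f = cnj c * L2_inner M g f"
  unfolding L2_inner_def by (subst integral_mult_right_zero[symmetric]) (simp add: mult.assoc)

lemmas L2_inner_linear = L2_inner_add_right L2_inner_diff_right L2_inner_add_left L2_inner_diff_left
  L2_inner_scale_right L2_inner_scale_left

lemma L2_inner_zero [simp]: "L2_inner M (\<lambda>x. 0) f = 0" "L2_inner M f (\<lambda>x. 0) = 0"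
  by (simp_all add: L2_inner_def)

lemma L2_norm_nonneg [simp]: "0 \<le> L2_norm M f"
  by (simp add: L2_norm_def)

lemma L2_norm_square: "(L2_norm M f)\<^sup>2 = (\<integral>x. (cmod (f x))\<^sup>2 \<partial>M)"
  by (simp add: L2_norm_def)

lemma L2_inner_self: "L2_inner M f f = complex_of_real ((L2_norm M f)\<^sup>2)"
  unfolding L2_inner_def L2_norm_square
  by (subst integral_complex_of_real[symmetric]) (simp add: complex_norm_square mult.commute del: of_real_power)

lemma L2_norm_scale: "L2_norm M (\<lambda>x. c * f x) = cmod c * L2_norm M f"
  unfolding L2_norm_def by (simp add: norm_mult power_mult_distrib real_sqrt_mult)

lemma L2_norm_minus_commute: "L2_norm M (\<lambda>x. f x - g x) = L2_norm M (\<lambda>x. g x - f x)"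
  unfolding L2_norm_def by (simp add: norm_minus_commute)

lemma L2_norm_eq_0_AE:
  assumes "f \<in> L2 M" "L2_norm M f = 0"
  shows "AE x in M. f x = 0"
proof -
  have "(\<integral>x. (cmod (f x))\<^sup>2 \<partial>M) = 0" using assms(2) by (metis L2_norm_square zero_power2)
  then show ?thesis using assms(1) by (subst (asm) integral_nonneg_eq_0_iff_AE) (auto simp: L2_def)
qed

text \<open>A negative \<gamma> is refuted by a large \<open>s\<close>, and \<gamma> = 0 forces
  \<beta> = 0. The inequality serves both for Cauchy-Schwarz and, with \<alpha> = 0, to derive
  orthogonality from minimality.\<close>

lemma quadratic_nonneg_discriminant:
  fixes \<alpha> \<beta> \<gamma> :: real
  assumes "\<And>s. 0 \<le> \<alpha> + 2 * s * \<beta> + s\<^sup>2 * \<gamma>"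
  shows "\<beta>\<^sup>2 \<le> \<alpha> * \<gamma>"
proof (cases "\<gamma> = 0")
  case True
  have "\<beta> = 0"
  proof (rule ccontr)
    assume "\<beta> \<noteq> 0"
    then show False using assms[of "- (\<alpha> + 1) / (2 * \<beta>)"] True by (simp add: field_simps)
  qed
  then show ?thesis using True by simp
next
  case False
  have "\<gamma> \<ge> 0"
  proof (rule ccontr)
    assume "\<not> \<gamma> \<ge> 0"
    then have g: "\<gamma> < 0" by simp
    \<comment> \<open>Chosen so that \<open>s\<close> is at least 1 and \<open>s * \<gamma>\<close>
      is at most \<open>- (\<bar>\<alpha>\<bar> + 2 * \<bar>\<beta>\<bar> + 1)\<close>; the
      quadratic is then at most \<open>- s\<close>.\<close>
    define s where "s = (\<bar>\<alpha>\<bar> + 2 * \<bar>\<beta>\<bar> + 1) / - \<gamma> + 1"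
    have s1: "s \<ge> 1" unfolding s_def using g by (simp add: divide_nonneg_neg)
    have "s * \<gamma> = - (\<bar>\<alpha>\<bar> + 2 * \<bar>\<beta>\<bar> + 1) + \<gamma>" unfolding s_def using g by (simp add: field_simps)
    then have "s * \<gamma> \<le> - (\<bar>\<alpha>\<bar> + 2 * \<bar>\<beta>\<bar> + 1)" using g by simp
    then have "s * (s * \<gamma>) \<le> s * - (\<bar>\<alpha>\<bar> + 2 * \<bar>\<beta>\<bar> + 1)" using s1 by (intro mult_left_mono) auto
    moreover have "2 * s * \<beta> \<le> s * (2 * \<bar>\<beta>\<bar>)" using s1 by (simp add: mult_left_mono)
    moreover have "\<bar>\<alpha>\<bar> \<le> s * \<bar>\<alpha>\<bar>" using s1 mult_right_mono[of 1 s "\<bar>\<alpha>\<bar>"] by simp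
    ultimately have "\<alpha> + 2 * s * \<beta> + s\<^sup>2 * \<gamma> \<le> - s" by (simp add: power2_eq_square algebra_simps)
    then show False using assms[of s] s1 by simp
  qed
  then have "\<gamma> > 0" using False by simp
  have "0 \<le> \<alpha> + 2 * (- \<beta> / \<gamma>) * \<beta> + (- \<beta> / \<gamma>)\<^sup>2 * \<gamma>" by (rule assms)
  also have "\<dots> = \<alpha> - \<beta>\<^sup>2 / \<gamma>" using \<open>\<gamma> > 0\<close> by (simp add: power2_eq_square field_simps)
  finally show ?thesis using \<open>\<gamma> > 0\<close> by (simp add: field_simps)
qed

lemma L2_norm_square_add:
  assumes "f \<in> L2 M" "g \<in> L2 M"
  shows "(L2_norm M (\<lambda>x. f x + g x))\<^sup>2 = (L2_norm M f)\<^sup>2 + 2 * Re (L2_inner M f g) + (L2_norm M g)\<^sup>2"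
proof -
  have *: "(L2_norm M h)\<^sup>2 = Re (L2_inner M h h)" for h by (simp add: L2_inner_self)
  have "Re (L2_inner M g f) = Re (L2_inner M f g)" by (subst L2_inner_cnj) simp
  then show ?thesis unfolding * using assms by (simp add: L2_inner_linear L2_add)
qed

lemma L2_norm_square_diff:
  assumes "f \<in> L2 M" "g \<in> L2 M"
  shows "(L2_norm M (\<lambda>x. f x - g x))\<^sup>2 = (L2_norm M f)\<^sup>2 - 2 * Re (L2_inner M f g) + (L2_norm M g)\<^sup>2"
proof -
  have *: "(L2_norm M h)\<^sup>2 = Re (L2_inner M h h)" for h by (simp add: L2_inner_self)
  have "Re (L2_inner M g f) = Re (L2_inner M f g)" by (subst L2_inner_cnj) simp
  then show ?thesis unfolding * using assms by (simp add: L2_inner_linear L2_diff)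
qed

text \<open>A unimodular factor makes the inner product real and nonnegative, so that only its real
  part enters the quadratic in \<open>s\<close>.\<close>

lemma L2_Cauchy_Schwarz:
  assumes f: "f \<in> L2 M" and g: "g \<in> L2 M"
  shows "cmod (L2_inner M f g) \<le> L2_norm M f * L2_norm M g"
proof -
  obtain c where c: "cmod c = 1" "c * L2_inner M f g = complex_of_real (cmod (L2_inner M f g))"
  proof (cases "L2_inner M f g = 0")
    case False
    then show ?thesis
      using that[of "cnj (L2_inner M f g) / cmod (L2_inner M f g)"]
      by (simp add: norm_divide mult.commute complex_norm_square power2_eq_square flip: complex_norm_square)
  qed (use that[of 1] in simp)
  let ?g = "\<lambda>x. c * g x"
  have "(Re (L2_inner M f ?g))\<^sup>2 \<le> (L2_norm M f)\<^sup>2 * (L2_norm M ?g)\<^sup>2"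
  proof (rule quadratic_nonneg_discriminant)
    fix s :: real
    have "0 \<le> (L2_norm M (\<lambda>x. f x + complex_of_real s * (c * g x)))\<^sup>2" by simp
    also have "\<dots> = (L2_norm M f)\<^sup>2 + 2 * s * Re (L2_inner M f ?g) + s\<^sup>2 * (L2_norm M ?g)\<^sup>2"
      by (subst L2_norm_square_add) (auto intro!: L2_scale f g simp: L2_inner_scale_right L2_norm_scale power_mult_distrib)
    finally show "0 \<le> (L2_norm M f)\<^sup>2 + 2 * s * Re (L2_inner M f ?g) + s\<^sup>2 * (L2_norm M ?g)\<^sup>2" .
  qed
  moreover have "Re (L2_inner M f ?g) = cmod (L2_inner M f g)" using c(2) by (simp add: L2_inner_scale_right)
  moreover have "L2_norm M ?g = L2_norm M g" using c(1) by (simp add: L2_norm_scale)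
  ultimately have "(cmod (L2_inner M f g))\<^sup>2 \<le> (L2_norm M f * L2_norm M g)\<^sup>2" by (simp add: power_mult_distrib)
  then show ?thesis by (rule power2_le_imp_le) simp
qed

lemma L2_triangle:
  assumes f: "f \<in> L2 M" and g: "g \<in> L2 M"
  shows "L2_norm M (\<lambda>x. f x + g x) \<le> L2_norm M f + L2_norm M g"
proof (rule power2_le_imp_le)
  have "Re (L2_inner M f g) \<le> L2_norm M f * L2_norm M g"
    using L2_Cauchy_Schwarz[OF assms] complex_Re_le_cmod order_trans by blast
  then show "(L2_norm M (\<lambda>x. f x + g x))\<^sup>2 \<le> (L2_norm M f + L2_norm M g)\<^sup>2"
    unfolding L2_norm_square_add[OF assms] by (simp add: power2_sum)
qed simp

lemma L2_triangle_diff: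
  assumes "f \<in> L2 M" "g \<in> L2 M" "h \<in> L2 M"
  shows "L2_norm M (\<lambda>x. f x - h x) \<le> L2_norm M (\<lambda>x. f x - g x) + L2_norm M (\<lambda>x. g x - h x)"
  using L2_triangle[OF L2_diff[OF assms(1,2)] L2_diff[OF assms(2,3)]] by simp

lemma L2_inner_tendsto_right:
  assumes f: "f \<in> L2 M" and g: "\<And>n. g n \<in> L2 M" "u \<in> L2 M"
    and lim: "(\<lambda>n. L2_norm M (\<lambda>x. g n x - u x)) \<longlonglongrightarrow> 0"
  shows "(\<lambda>n. L2_inner M f (g n)) \<longlonglongrightarrow> L2_inner M f u"
proof (rule LIM_zero_cancel, rule Lim_null_comparison)
  show "eventually (\<lambda>n. norm (L2_inner M f (g n) - L2_inner M f u) \<le> L2_norm M f * L2_norm M (\<lambda>x. g n x - u x)) sequentially"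
    using L2_Cauchy_Schwarz[OF f L2_diff[OF g(1,2)]] by (simp add: L2_inner_diff_right f g)
  show "(\<lambda>n. L2_norm M f * L2_norm M (\<lambda>x. g n x - u x)) \<longlonglongrightarrow> 0"
    using tendsto_mult_right_zero[OF lim] by simp
qed

section \<open>Square integrable functions for a finite measure\<close>

lemma (in finite_measure) L2_const: "(\<lambda>x. c) \<in> L2 M"
  by (simp add: L2_def)

lemma (in finite_measure) L2_bounded:
  assumes [measurable]: "f \<in> borel_measurable M" and "AE x in M. cmod (f x) \<le> B"
  shows "f \<in> L2 M"
proof -
  have "integrable M (\<lambda>x. (cmod (f x))\<^sup>2)"
  proof (rule integrable_const_bound[where B="B\<^sup>2"])
    show "AE x in M. norm ((cmod (f x))\<^sup>2) \<le> B\<^sup>2" using assms(2) by eventually_elim (simp add: power_mono)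
  qed simp
  then show ?thesis by (simp add: L2_def)
qed

lemma (in finite_measure) L2_integrable:
  assumes f: "f \<in> L2 M"
  shows "integrable M f"
  using L2_mult_integrable[OF L2_const[of 1] f] by simp

lemma (in finite_measure) L2_L1_bound:
  assumes f: "f \<in> L2 M"
  shows "(\<integral>x. cmod (f x) \<partial>M) \<le> L2_norm M (\<lambda>_. 1) * L2_norm M f"
proof -
  have c: "(\<lambda>x. complex_of_real (cmod (f x))) \<in> L2 M" using f by (auto simp: L2_def)
  have "(\<integral>x. cmod (f x) \<partial>M) = Re (L2_inner M (\<lambda>_. 1) (\<lambda>x. complex_of_real (cmod (f x))))"
    by (simp add: L2_inner_def)
  also have "\<dots> \<le> L2_norm M (\<lambda>_. 1) * L2_norm M (\<lambda>x. complex_of_real (cmod (f x)))"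
    using L2_Cauchy_Schwarz[OF L2_const c] complex_Re_le_cmod order_trans by blast
  also have "L2_norm M (\<lambda>x. complex_of_real (cmod (f x))) = L2_norm M f" by (simp add: L2_norm_def)
  finally show ?thesis .
qed

lemma L2_norm_le_of_nn_integral:
  assumes "f \<in> borel_measurable M" "(\<integral>\<^sup>+x. ennreal ((cmod (f x))\<^sup>2) \<partial>M) \<le> ennreal (e\<^sup>2)" "0 \<le> e"
  shows "f \<in> L2 M" "L2_norm M f \<le> e"
proof -
  have meas: "(\<lambda>x. (cmod (f x))\<^sup>2) \<in> borel_measurable M" using assms(1) by simp
  have "(\<integral>\<^sup>+x. ennreal ((cmod (f x))\<^sup>2) \<partial>M) < \<infinity>" using assms(2) by (simp add: le_less_trans)
  then have int: "integrable M (\<lambda>x. (cmod (f x))\<^sup>2)" by (intro integrableI_nonneg[OF meas]) auto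
  then show "f \<in> L2 M" using assms(1) by (simp add: L2_def)
  have "(L2_norm M f)\<^sup>2 \<le> e\<^sup>2"
    using assms(2) nn_integral_eq_integral[OF int] by (simp add: L2_norm_square ennreal_le_iff)
  then show "L2_norm M f \<le> e" using assms(3) by (rule power2_le_imp_le)
qed

text \<open>For a finite measure a Cauchy sequence in L2 is Cauchy in L1, so a subsequence converges
  almost everywhere; Fatou's lemma turns the pointwise limit into a limit in norm.\<close>

theorem (in finite_measure) L2_complete:
  assumes f: "\<And>n. f n \<in> L2 M"
    and Cauchy: "\<And>e. e > 0 \<Longrightarrow> \<exists>N. \<forall>m\<ge>N. \<forall>n\<ge>N. L2_norm M (\<lambda>x. f m x - f n x) < e"
  obtains g where "g \<in> L2 M" "(\<lambda>n. L2_norm M (\<lambda>x. f n x - g x)) \<longlonglongrightarrow> 0"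
proof -
  have [measurable]: "f n \<in> borel_measurable M" for n using f by (simp add: L2_def)
  define K where "K = L2_norm M (\<lambda>_. 1) + 1"
  have K: "K > 0" by (simp add: K_def add_nonneg_pos)
  have L1: "\<exists>N. \<forall>i\<ge>N. \<forall>j\<ge>N. LINT x|M. norm (f i x - f j x) < e" if "e > 0" for e
  proof -
    have "e / K > 0" using that K by simp
    then obtain N where N: "\<And>m n. m \<ge> N \<Longrightarrow> n \<ge> N \<Longrightarrow> L2_norm M (\<lambda>x. f m x - f n x) < e / K" using Cauchy by blast
    have "(LINT x|M. norm (f i x - f j x)) < e" if ij: "i \<ge> N" "j \<ge> N" for i j
    proof -
      have "(LINT x|M. norm (f i x - f j x)) \<le> L2_norm M (\<lambda>_. 1) * L2_norm M (\<lambda>x. f i x - f j x)"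
        using L2_L1_bound[OF L2_diff[OF f f]] .
      also have "\<dots> \<le> K * L2_norm M (\<lambda>x. f i x - f j x)" by (intro mult_right_mono) (auto simp: K_def)
      also have "\<dots> < K * (e / K)" using N[OF ij] K by (intro mult_strict_left_mono)
      finally show ?thesis using K by simp
    qed
    then show ?thesis by blast
  qed
  obtain r :: "nat \<Rightarrow> nat" where r: "strict_mono r" "AE x in M. Cauchy (\<lambda>i. f (r i) x)"
    by (rule cauchy_L1_AE_cauchy_subseq[OF _ L1]) (use L2_integrable[OF f] in auto)
  define g where "g = (\<lambda>x. lim (\<lambda>i. f (r i) x))"
  have [measurable]: "g \<in> borel_measurable M" unfolding g_def by (rule borel_measurable_lim_metric) simp
  have lim: "AE x in M. (\<lambda>i. f (r i) x) \<longlonglongrightarrow> g x"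
    using r(2) by eventually_elim (simp add: g_def Cauchy_convergent_iff convergent_LIMSEQ_iff)
  have key: "(\<lambda>x. f n x - g x) \<in> L2 M \<and> L2_norm M (\<lambda>x. f n x - g x) \<le> e"
    if e: "e > 0" and N: "\<And>m n. m \<ge> N \<Longrightarrow> n \<ge> N \<Longrightarrow> L2_norm M (\<lambda>x. f m x - f n x) < e" and n: "n \<ge> N" for e N n
  proof -
    have "(\<integral>\<^sup>+x. ennreal ((cmod (f n x - g x))\<^sup>2) \<partial>M) = (\<integral>\<^sup>+x. liminf (\<lambda>i. ennreal ((cmod (f n x - f (r i) x))\<^sup>2)) \<partial>M)"
    proof (rule nn_integral_cong_AE)
      show "AE x in M. ennreal ((cmod (f n x - g x))\<^sup>2) = liminf (\<lambda>i. ennreal ((cmod (f n x - f (r i) x))\<^sup>2))"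
        using lim
      proof eventually_elim
        case (elim x)
        then have "(\<lambda>i. ennreal ((cmod (f n x - f (r i) x))\<^sup>2)) \<longlonglongrightarrow> ennreal ((cmod (f n x - g x))\<^sup>2)"
          by (intro tendsto_intros)
        then show ?case by (metis lim_imp_Liminf trivial_limit_sequentially)
      qed
    qed
    also have "\<dots> \<le> liminf (\<lambda>i. (\<integral>\<^sup>+x. ennreal ((cmod (f n x - f (r i) x))\<^sup>2) \<partial>M))"
      by (rule nn_integral_liminf) simp
    also have "\<dots> \<le> ennreal (e\<^sup>2)"
    proof (rule Liminf_le)
      show "eventually (\<lambda>i. (\<integral>\<^sup>+x. ennreal ((cmod (f n x - f (r i) x))\<^sup>2) \<partial>M) \<le> ennreal (e\<^sup>2)) sequentially"
        unfolding eventually_sequentially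
      proof (intro exI allI impI)
        fix i assume "N \<le> i"
        then have "r i \<ge> N" using strict_mono_imp_increasing[OF r(1), of i] by simp
        then have "L2_norm M (\<lambda>x. f n x - f (r i) x) < e" using N n by blast
        then have "(L2_norm M (\<lambda>x. f n x - f (r i) x))\<^sup>2 \<le> e\<^sup>2" by (intro power_mono) auto
        moreover have "integrable M (\<lambda>x. (cmod (f n x - f (r i) x))\<^sup>2)" using L2_diff[OF f f] by (simp add: L2_def)
        ultimately show "(\<integral>\<^sup>+x. ennreal ((cmod (f n x - f (r i) x))\<^sup>2) \<partial>M) \<le> ennreal (e\<^sup>2)"
          by (subst nn_integral_eq_integral) (auto simp: L2_norm_square ennreal_leI)
      qed
    qed simp
    finally have bound: "(\<integral>\<^sup>+x. ennreal ((cmod (f n x - g x))\<^sup>2) \<partial>M) \<le> ennreal (e\<^sup>2)" .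
    show ?thesis using L2_norm_le_of_nn_integral[OF _ bound] e by simp
  qed
  obtain N1 where "\<And>m n. m \<ge> N1 \<Longrightarrow> n \<ge> N1 \<Longrightarrow> L2_norm M (\<lambda>x. f m x - f n x) < 1" using Cauchy[of 1] by auto
  then have "(\<lambda>x. f N1 x - g x) \<in> L2 M" using key[of 1 N1 N1] by simp
  from L2_diff[OF f[of N1] this] have g: "g \<in> L2 M" by simp
  moreover have "(\<lambda>n. L2_norm M (\<lambda>x. f n x - g x)) \<longlonglongrightarrow> 0"
  proof (rule LIMSEQ_I)
    fix e :: real assume "e > 0"
    then obtain N where "\<And>m n. m \<ge> N \<Longrightarrow> n \<ge> N \<Longrightarrow> L2_norm M (\<lambda>x. f m x - f n x) < e / 2" using Cauchy[of "e / 2"] by auto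
    then have "L2_norm M (\<lambda>x. f n x - g x) \<le> e / 2" if "n \<ge> N" for n using key[of "e / 2" N n] that \<open>e > 0\<close> by simp
    then have "norm (L2_norm M (\<lambda>x. f n x - g x) - 0) < e" if "n \<ge> N" for n
      using le_less_trans[of "L2_norm M (\<lambda>x. f n x - g x)" "e / 2" e] that \<open>e > 0\<close> by simp
    then show "\<exists>N. \<forall>n\<ge>N. norm (L2_norm M (\<lambda>x. f n x - g x) - 0) < e" by blast
  qed
  ultimately show ?thesis using that by blast
qed

text \<open>Projection onto the closure of a subspace: a minimising sequence is Cauchy by the
  parallelogram law, and minimality makes the difference of \<open>f\<close> and its limit
  \<open>G\<close> orthogonal to \<open>D\<close>, hence null.\<close>

theorem (in finite_measure) L2_dense_of_trivial_orthogonal: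
  assumes D: "D \<subseteq> L2 M" "D \<noteq> {}" "\<And>f g c. f \<in> D \<Longrightarrow> g \<in> D \<Longrightarrow> (\<lambda>x. f x + c * g x) \<in> D"
    and orth: "\<And>w. w \<in> L2 M \<Longrightarrow> (\<And>g. g \<in> D \<Longrightarrow> L2_inner M w g = 0) \<Longrightarrow> AE x in M. w x = 0"
    and f: "f \<in> L2 M" and e: "e > 0"
  shows "\<exists>g\<in>D. L2_norm M (\<lambda>x. f x - g x) < e"
proof -
  let ?d = "\<lambda>g. (L2_norm M (\<lambda>x. f x - g x))\<^sup>2"
  define \<delta> where "\<delta> = (INF g\<in>D. ?d g)"
  have \<delta>: "\<delta> \<le> ?d g" if "g \<in> D" for g
    unfolding \<delta>_def by (rule cINF_lower[OF _ that]) (auto intro: bdd_belowI[of _ 0])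
  have "\<exists>g\<in>D. ?d g < \<delta> + inverse (Suc n)" for n
  proof (rule ccontr)
    assume "\<not> ?thesis"
    then have "\<delta> + inverse (Suc n) \<le> \<delta>"
      unfolding \<delta>_def[symmetric] by (subst (2) \<delta>_def) (intro cINF_greatest D(2), auto simp: not_less)
    then show False by simp
  qed
  then have "\<exists>g. \<forall>n. g n \<in> D \<and> ?d (g n) < \<delta> + inverse (Suc n)" by (intro choice) blast
  then obtain g where g: "\<And>n. g n \<in> D" "\<And>n. ?d (g n) < \<delta> + inverse (Suc n)" by blast
  have gL: "g n \<in> L2 M" for n using g(1) D(1) by blast
  have gD: "(L2_norm M (\<lambda>x. g m x - g n x))\<^sup>2 \<le> 2 * inverse (Suc m) + 2 * inverse (Suc n)" for m n
  proof -
    let ?u = "\<lambda>x. f x - g m x" and ?v = "\<lambda>x. f x - g n x"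
    have u: "?u \<in> L2 M" "?v \<in> L2 M" using L2_diff f gL by auto
    \<comment> \<open>The midpoint of two members, in the shape that closure under
      \<open>f + c * g\<close> provides; its squared distance from \<open>f\<close> is at least
      \<delta>.\<close>
    have "(\<lambda>x. g m x + (1/2) * (g n x + (-1) * g m x)) \<in> D"
      using D(3)[OF g(1)[of m] D(3)[OF g(1)[of n] g(1)[of m], of "-1"], of "1/2"] .
    from \<delta>[OF this] have "\<delta> \<le> (L2_norm M (\<lambda>x. f x - (g m x + (1/2) * (g n x + (-1) * g m x))))\<^sup>2" .
    also have "(\<lambda>x. f x - (g m x + (1/2) * (g n x + (-1) * g m x))) = (\<lambda>x. (1/2) * (?u x + ?v x))"
      by (simp add: fun_eq_iff field_simps)
    finally have "\<delta> \<le> (L2_norm M (\<lambda>x. (1/2) * (?u x + ?v x)))\<^sup>2" .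
    also have "\<dots> = (L2_norm M (\<lambda>x. ?u x + ?v x))\<^sup>2 / 4" by (simp only: L2_norm_scale) (simp add: power_mult_distrib power2_eq_square)
    finally have 1: "4 * \<delta> \<le> (L2_norm M (\<lambda>x. ?u x + ?v x))\<^sup>2" by simp
    have "(L2_norm M (\<lambda>x. g m x - g n x))\<^sup>2 = (L2_norm M (\<lambda>x. ?v x - ?u x))\<^sup>2" by simp
    also have "\<dots> = (L2_norm M ?v)\<^sup>2 - 2 * Re (L2_inner M ?v ?u) + (L2_norm M ?u)\<^sup>2"
      by (rule L2_norm_square_diff[OF u(2,1)])
    finally have 2: "(L2_norm M (\<lambda>x. g m x - g n x))\<^sup>2 = (L2_norm M ?v)\<^sup>2 - 2 * Re (L2_inner M ?v ?u) + (L2_norm M ?u)\<^sup>2" .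
    have "Re (L2_inner M ?u ?v) = Re (L2_inner M ?v ?u)" by (subst L2_inner_cnj) simp
    then show ?thesis using 1 2 L2_norm_square_add[OF u] g(2)[of m] g(2)[of n] by linarith
  qed
  have "\<exists>N. \<forall>m\<ge>N. \<forall>n\<ge>N. L2_norm M (\<lambda>x. g m x - g n x) < e" if "e > 0" for e
  proof -
    note that0 = that
    have "e\<^sup>2 / 4 > 0" using that by simp
    from reals_Archimedean[OF this] obtain N where N: "inverse (real (Suc N)) < e\<^sup>2 / 4" ..
    have "L2_norm M (\<lambda>x. g m x - g n x) < e" if "m \<ge> N" "n \<ge> N" for m n
    proof -
      have "inverse (real (Suc m)) \<le> inverse (real (Suc N))" "inverse (real (Suc n)) \<le> inverse (real (Suc N))"
        using that by (auto intro!: le_imp_inverse_le)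
      then have "(L2_norm M (\<lambda>x. g m x - g n x))\<^sup>2 < e\<^sup>2" using gD[of m n] N by linarith
      then show ?thesis by (rule power2_less_imp_less) (use that0 in simp)
    qed
    then show ?thesis by blast
  qed
  then obtain G where G: "G \<in> L2 M" "(\<lambda>n. L2_norm M (\<lambda>x. g n x - G x)) \<longlonglongrightarrow> 0"
    by (rule L2_complete[of g, OF gL]) blast
  define w where "w = (\<lambda>x. f x - G x)"
  have w: "w \<in> L2 M" unfolding w_def by (rule L2_diff[OF f G(1)])
  have lim0: "(\<lambda>n. sqrt (\<delta> + inverse (Suc n)) + L2_norm M (\<lambda>x. g n x - G x)) \<longlonglongrightarrow> sqrt (\<delta> + 0) + 0"
    by (intro tendsto_intros G(2) LIMSEQ_inverse_real_of_nat)
  have dn: "L2_norm M (\<lambda>x. f x - g n x) \<le> sqrt (\<delta> + inverse (Suc n))" for n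
    using g(2)[of n] by (intro real_le_rsqrt) simp
  have "L2_norm M w \<le> sqrt (\<delta> + inverse (Suc n)) + L2_norm M (\<lambda>x. g n x - G x)" for n
    using L2_triangle_diff[OF f gL[of n] G(1)] dn[of n] by (simp add: w_def)
  then have wle: "L2_norm M w \<le> sqrt \<delta>" using LIMSEQ_le_const[OF lim0] by auto
  have \<delta>0: "0 \<le> \<delta>" unfolding \<delta>_def using D(2) by (intro cINF_greatest) auto
  have wd: "sqrt \<delta> \<le> L2_norm M (\<lambda>x. w x - c * d x)" if "d \<in> D" for c d
  proof -
    have d: "d \<in> L2 M" using that D(1) by blast
    have "sqrt \<delta> \<le> L2_norm M (\<lambda>x. w x - c * d x) + L2_norm M (\<lambda>x. g n x - G x)" for n
    proof -
      have "(\<lambda>x. g n x + c * d x) \<in> D" by (rule D(3)[OF g(1) that])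
      from \<delta>[OF this] have "sqrt \<delta> \<le> L2_norm M (\<lambda>x. f x - (g n x + c * d x))"
        by (intro real_le_lsqrt) simp
      also have "\<dots> = L2_norm M (\<lambda>x. (w x - c * d x) + (G x - g n x))" by (simp add: w_def algebra_simps)
      also have "\<dots> \<le> L2_norm M (\<lambda>x. w x - c * d x) + L2_norm M (\<lambda>x. G x - g n x)"
        by (intro L2_triangle L2_diff w L2_scale d G gL)
      finally show ?thesis by (simp add: L2_norm_minus_commute[of M G])
    qed
    then show ?thesis using LIMSEQ_le_const[of "\<lambda>n. L2_norm M (\<lambda>x. w x - c * d x) + L2_norm M (\<lambda>x. g n x - G x)" "L2_norm M (\<lambda>x. w x - c * d x) + 0"]
      tendsto_add[OF tendsto_const G(2)] by auto
  qed
  have "L2_inner M w d = 0" if "d \<in> D" for d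
  proof -
    have d: "d \<in> L2 M" using that D(1) by blast
    have Re0: "Re (c * L2_inner M w d) = 0" for c
    proof -
      let ?d = "\<lambda>x. c * d x"
      have dd: "?d \<in> L2 M" by (rule L2_scale[OF d])
      \<comment> \<open>Adding multiples of \<open>?d\<close> to \<open>w\<close> cannot decrease
        its norm, so a quadratic without constant term is nonnegative, and the discriminant forces
        its linear coefficient to vanish.\<close>
      have "(Re (L2_inner M w ?d))\<^sup>2 \<le> 0 * (L2_norm M ?d)\<^sup>2"
      proof (rule quadratic_nonneg_discriminant)
        fix s :: real
        have "(L2_norm M w)\<^sup>2 \<le> \<delta>" using power_mono[OF wle, of 2] \<delta>0 by simp
        also have "\<delta> = (sqrt \<delta>)\<^sup>2" using \<delta>0 by simp
        also have "\<dots> \<le> (L2_norm M (\<lambda>x. w x - (- (complex_of_real s * c)) * d x))\<^sup>2"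
          using wd[OF that, of "- (complex_of_real s * c)"] \<delta>0 by (intro power_mono) auto
        also have "\<dots> = (L2_norm M (\<lambda>x. w x + complex_of_real s * (c * d x)))\<^sup>2" by (simp add: mult.assoc)
        also have "\<dots> = (L2_norm M w)\<^sup>2 + 2 * s * Re (L2_inner M w ?d) + s\<^sup>2 * (L2_norm M ?d)\<^sup>2"
          by (subst L2_norm_square_add[OF w L2_scale[OF dd]]) (simp add: L2_inner_scale_right[where g="?d"] L2_norm_scale[where f="?d"] power_mult_distrib)
        finally show "0 \<le> 0 + 2 * s * Re (L2_inner M w ?d) + s\<^sup>2 * (L2_norm M ?d)\<^sup>2" by simp
      qed
      then show ?thesis by (simp add: L2_inner_scale_right)
    qed
    show ?thesis using Re0[of 1] Re0[of "- \<i>"] by (simp add: complex_eq_iff)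
  qed
  then have "AE x in M. w x = 0" using orth[OF w] by blast
  then have fG: "AE x in M. f x = G x" by (simp add: w_def)
  obtain n where n: "L2_norm M (\<lambda>x. g n x - G x) < e"
    using order_tendstoD(2)[OF G(2) e] by (auto simp: eventually_sequentially)
  have "L2_norm M (\<lambda>x. f x - g n x) = L2_norm M (\<lambda>x. G x - g n x)"
    using fG f G(1) gL[of n] by (intro L2_norm_cong_AE) (auto simp: L2_def)
  then show ?thesis using n g(1) by (metis L2_norm_minus_commute)
qed

section \<open>Forms of nonnegative self-adjoint operators\<close>

text \<open>What the theory of the form uses. Self-adjointness is left out so that the solution
  operator of the Dirichlet problem is an instance too; its graph consists of chosen representatives
  and is not closed under almost everywhere equality.\<close>

locale nonneg_symmetric_graph =
  fixes M :: "'a measure" and A :: "'a L2_graph"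
  assumes L2: "(f, h) \<in> A \<Longrightarrow> f \<in> L2 M" "(f, h) \<in> A \<Longrightarrow> h \<in> L2 M"
    and linear: "(f, h) \<in> A \<Longrightarrow> (f', h') \<in> A \<Longrightarrow> (\<lambda>x. f x + c * f' x, \<lambda>x. h x + c * h' x) \<in> A"
    and symmetric: "(f, h) \<in> A \<Longrightarrow> (f', h') \<in> A \<Longrightarrow> L2_inner M h f' = L2_inner M f h'"
    and nonneg: "(f, h) \<in> A \<Longrightarrow> 0 \<le> Re (L2_inner M h f)"

lemma op_adjoint_linear:
  assumes T: "T \<subseteq> L2 M \<times> L2 M" and "(f, h) \<in> op_adjoint M T" "(f', h') \<in> op_adjoint M T"
  shows "(\<lambda>x. f x + c * f' x, \<lambda>x. h x + c * h' x) \<in> op_adjoint M T"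
  using assms unfolding op_adjoint_def
  by (auto simp: L2_inner_linear L2_scale L2_add subset_iff split: prod.splits)

lemma self_adjoint_nonneg_imp_graph:
  assumes "self_adjoint M A" "nonneg_op M A"
  shows "nonneg_symmetric_graph M A"
proof
  have A: "op_adjoint M A = A" using assms(1) by (simp add: self_adjoint_def)
  have L: "f \<in> L2 M \<and> h \<in> L2 M \<and> (\<forall>(f', h')\<in>A. L2_inner M h' f = L2_inner M f' h)" if "(f, h) \<in> A" for f h
  proof -
    have "(f, h) \<in> op_adjoint M A" using that A by simp
    then show ?thesis by (simp add: op_adjoint_def)
  qed
  show "(f, h) \<in> A \<Longrightarrow> f \<in> L2 M" "(f, h) \<in> A \<Longrightarrow> h \<in> L2 M" for f h using L by blast+
  then have sub: "A \<subseteq> L2 M \<times> L2 M" by auto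
  show "(\<lambda>x. f x + c * f' x, \<lambda>x. h x + c * h' x) \<in> A" if "(f, h) \<in> A" "(f', h') \<in> A" for f h f' h' c
    using op_adjoint_linear[OF sub, of f h f' h' c] that unfolding A by blast
  show "L2_inner M h f' = L2_inner M f h'" if "(f, h) \<in> A" "(f', h') \<in> A" for f h f' h'
    using L[OF that(2)] that(1) by blast
  show "0 \<le> Re (L2_inner M h f)" if "(f, h) \<in> A" for f h
    using assms(2) that unfolding nonneg_op_def by blast
qed

context nonneg_symmetric_graph
begin

definition form :: "(('a \<Rightarrow> complex) \<times> ('a \<Rightarrow> complex)) \<Rightarrow> (('a \<Rightarrow> complex) \<times> ('a \<Rightarrow> complex)) \<Rightarrow> real" where
  "form w w' = Re (L2_inner M (snd w) (fst w'))"

text \<open>With \<open>s = - 1\<close> this is the difference on which form convergence is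
  tested.\<close>

definition comb :: "real \<Rightarrow> (('a \<Rightarrow> complex) \<times> ('a \<Rightarrow> complex)) \<Rightarrow> (('a \<Rightarrow> complex) \<times> ('a \<Rightarrow> complex)) \<Rightarrow>
    (('a \<Rightarrow> complex) \<times> ('a \<Rightarrow> complex))" where
  "comb s w w' = (\<lambda>x. fst w x + complex_of_real s * fst w' x, \<lambda>x. snd w x + complex_of_real s * snd w' x)"

lemma L2': "w \<in> A \<Longrightarrow> fst w \<in> L2 M" "w \<in> A \<Longrightarrow> snd w \<in> L2 M"
  using L2 by (metis prod.collapse)+

lemma comb_in: "w \<in> A \<Longrightarrow> w' \<in> A \<Longrightarrow> comb s w w' \<in> A"
  unfolding comb_def using linear by (metis prod.collapse)

lemma form_sym: "w \<in> A \<Longrightarrow> w' \<in> A \<Longrightarrow> form w w' = form w' w"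
proof -
  assume "w \<in> A" "w' \<in> A"
  then have "L2_inner M (snd w) (fst w') = L2_inner M (fst w) (snd w')" by (intro symmetric) simp_all
  then show "form w w' = form w' w" unfolding form_def by (subst (2) L2_inner_cnj) simp
qed

lemma form_comb:
  assumes "w \<in> A" "w' \<in> A"
  shows "form (comb s w w') (comb s w w') = form w w + 2 * s * form w w' + s\<^sup>2 * form w' w'"
proof -
  have "form (comb s w w') (comb s w w') = form w w + s * form w w' + s * form w' w + s * s * form w' w'"
    using assms unfolding form_def comb_def
    by (simp add: L2_inner_linear L2' L2_add L2_scale algebra_simps)
  then show ?thesis using form_sym[OF assms] by (simp add: power2_eq_square)
qed

lemma form_nonneg: "w \<in> A \<Longrightarrow> 0 \<le> form w w"
  unfolding form_def using nonneg by (metis prod.collapse)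

lemma form_Cauchy_Schwarz: "w \<in> A \<Longrightarrow> w' \<in> A \<Longrightarrow> (form w w')\<^sup>2 \<le> form w w * form w' w'"
  by (rule quadratic_nonneg_discriminant) (metis form_comb form_nonneg comb_in)

lemma form_triangle:
  assumes "w \<in> A" "w' \<in> A" "\<bar>s\<bar> = 1"
  shows "sqrt (form (comb s w w') (comb s w w')) \<le> sqrt (form w w) + sqrt (form w' w')"
proof -
  have "\<bar>form w w'\<bar> \<le> sqrt (form w w * form w' w')"
    using form_Cauchy_Schwarz[OF assms(1,2)] by (simp add: real_le_rsqrt)
  moreover have "s * form w w' \<le> \<bar>form w w'\<bar>" using assms(3) by (metis abs_ge_self abs_mult mult_1)
  moreover have "s\<^sup>2 = 1" using assms(3) by (metis one_power2 power2_abs)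
  ultimately have "form (comb s w w') (comb s w w') \<le> (sqrt (form w w) + sqrt (form w' w'))\<^sup>2"
    using form_nonneg assms by (simp add: form_comb power2_sum real_sqrt_mult)
  then show ?thesis using form_nonneg assms by (intro real_le_lsqrt) auto
qed

lemma form_sqrt_diff:
  assumes "w \<in> A" "w' \<in> A"
  shows "\<bar>sqrt (form w w) - sqrt (form w' w')\<bar> \<le> sqrt (form (comb (- 1) w w') (comb (- 1) w w'))"
proof -
  have 1: "comb 1 (comb (- 1) w w') w' = w" "comb (- 1) w (comb (- 1) w w') = w'"
    by (simp_all add: comb_def)
  have c: "comb (- 1) w w' \<in> A" using assms by (rule comb_in)
  show ?thesis
    using form_triangle[OF c assms(2), of 1] form_triangle[OF assms(1) c, of "- 1"] unfolding 1 by simp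
qed

lemma form_convergent_iff:
  "form_convergent M A w u \<longleftrightarrow> (\<forall>n. w n \<in> A) \<and> (\<lambda>n. L2_norm M (\<lambda>x. fst (w n) x - u x)) \<longlonglongrightarrow> 0 \<and>
     (\<forall>e>0. \<exists>N. \<forall>m\<ge>N. \<forall>n\<ge>N. form (comb (- 1) (w m) (w n)) (comb (- 1) (w m) (w n)) < e)"
  by (simp add: form_convergent_def form_def comb_def)

text \<open>Closability of the form. For fixed \<open>n\<close> the mixed terms
  \<open>form (w n) (w m)\<close> tend to 0 with growing \<open>m\<close>, because the first
  components tend to 0 in L2; what remains of the form of the difference is
  \<open>form (w n) (w n)\<close> plus a nonnegative term.\<close>

lemma form_null_sequence:
  assumes w: "form_convergent M A w (\<lambda>x. 0)"
  shows "(\<lambda>n. form (w n) (w n)) \<longlonglongrightarrow> 0"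
proof (rule LIMSEQ_I)
  fix e :: real assume "e > 0"
  note w' = w[unfolded form_convergent_iff]
  obtain N where N: "\<And>m n. m \<ge> N \<Longrightarrow> n \<ge> N \<Longrightarrow> form (comb (- 1) (w m) (w n)) (comb (- 1) (w m) (w n)) < e / 2"
    using w' \<open>e > 0\<close> by (meson half_gt_zero)
  have "form (w n) (w n) \<le> e / 2" if n: "n \<ge> N" for n
  proof -
    have "(\<lambda>m. L2_inner M (snd (w n)) (fst (w m))) \<longlonglongrightarrow> L2_inner M (snd (w n)) (\<lambda>x. 0)"
      using w' by (intro L2_inner_tendsto_right L2' L2_zero) auto
    then have "(\<lambda>m. Re (L2_inner M (snd (w n)) (fst (w m)))) \<longlonglongrightarrow> Re (L2_inner M (snd (w n)) (\<lambda>x. 0))"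
      by (rule tendsto_Re)
    then have "(\<lambda>m. form (w n) (w m)) \<longlonglongrightarrow> 0" by (simp add: form_def)
    then have lim: "(\<lambda>m. e / 2 + 2 * form (w n) (w m)) \<longlonglongrightarrow> e / 2 + 2 * 0" by (intro tendsto_intros)
    have "form (w n) (w n) \<le> e / 2 + 2 * form (w n) (w m)" if "m \<ge> N" for m
    proof -
      have "form (comb (- 1) (w n) (w m)) (comb (- 1) (w n) (w m)) = form (w n) (w n) - 2 * form (w n) (w m) + form (w m) (w m)"
        using w' by (subst form_comb) auto
      moreover have "0 \<le> form (w m) (w m)" using w' form_nonneg by blast
      ultimately show ?thesis using N[OF n that] by simp
    qed
    then show ?thesis using LIMSEQ_le_const[OF lim] by auto
  qed
  moreover have "0 \<le> form (w n) (w n)" for n using w' form_nonneg by blast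
  ultimately have "norm (form (w n) (w n) - 0) < e" if "n \<ge> N" for n using that \<open>e > 0\<close> by (smt (verit) field_sum_of_halves real_norm_def)
  then show "\<exists>N. \<forall>n\<ge>N. norm (form (w n) (w n) - 0) < e" by blast
qed

text \<open>Reduces the comparison of two approximating sequences to closability at 0.\<close>

lemma form_convergent_diff:
  assumes w: "form_convergent M A w u" and w': "form_convergent M A w' u" and u: "u \<in> L2 M"
  shows "form_convergent M A (\<lambda>n. comb (- 1) (w n) (w' n)) (\<lambda>x. 0)"
  unfolding form_convergent_iff
proof (intro conjI allI impI)
  note W = w[unfolded form_convergent_iff] and W' = w'[unfolded form_convergent_iff]
  have A: "w n \<in> A" "w' n \<in> A" for n using W W' by auto
  then show "comb (- 1) (w n) (w' n) \<in> A" for n by (intro comb_in)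
  have lim: "(\<lambda>n. L2_norm M (\<lambda>x. fst (w n) x - u x) + L2_norm M (\<lambda>x. fst (w' n) x - u x)) \<longlonglongrightarrow> 0 + 0"
    using W W' by (intro tendsto_add) auto
  have "norm (L2_norm M (\<lambda>x. fst (comb (- 1) (w n) (w' n)) x - 0)) \<le>
        L2_norm M (\<lambda>x. fst (w n) x - u x) + L2_norm M (\<lambda>x. fst (w' n) x - u x)" for n
    using L2_triangle_diff[OF L2'(1)[OF A(1)] u L2'(1)[OF A(2)], of n n] L2_norm_minus_commute[of M u "fst (w' n)"]
    by (simp add: comb_def)
  then show "(\<lambda>n. L2_norm M (\<lambda>x. fst (comb (- 1) (w n) (w' n)) x - 0)) \<longlonglongrightarrow> 0"
    by (intro Lim_null_comparison[OF always_eventually lim[simplified]] allI)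
  fix e :: real assume "e > 0"
  then have e: "(sqrt e / 2)\<^sup>2 > 0" by simp
  obtain N where N: "\<And>m n. m \<ge> N \<Longrightarrow> n \<ge> N \<Longrightarrow> form (comb (- 1) (w m) (w n)) (comb (- 1) (w m) (w n)) < (sqrt e / 2)\<^sup>2"
    using W e by blast
  obtain N' where N': "\<And>m n. m \<ge> N' \<Longrightarrow> n \<ge> N' \<Longrightarrow> form (comb (- 1) (w' m) (w' n)) (comb (- 1) (w' m) (w' n)) < (sqrt e / 2)\<^sup>2"
    using W' e by blast
  have "form (comb (- 1) (comb (- 1) (w m) (w' m)) (comb (- 1) (w n) (w' n))) (comb (- 1) (comb (- 1) (w m) (w' m)) (comb (- 1) (w n) (w' n))) < e"
    if "m \<ge> max N N'" "n \<ge> max N N'" for m n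
  proof -
    let ?x = "comb (- 1) (w m) (w n)" and ?y = "comb (- 1) (w' m) (w' n)"
    have eq: "comb (- 1) (comb (- 1) (w m) (w' m)) (comb (- 1) (w n) (w' n)) = comb (- 1) ?x ?y"
      by (simp add: comb_def algebra_simps)
    have "sqrt (form (comb (- 1) ?x ?y) (comb (- 1) ?x ?y)) \<le> sqrt (form ?x ?x) + sqrt (form ?y ?y)"
      by (intro form_triangle comb_in A) simp
    also have "\<dots> < sqrt e / 2 + sqrt e / 2"
      using N[of m n] N'[of m n] that \<open>e > 0\<close> by (intro add_strict_mono real_less_lsqrt) auto
    finally show ?thesis unfolding eq by simp
  qed
  then show "\<exists>N. \<forall>m\<ge>N. \<forall>n\<ge>N. form (comb (- 1) (comb (- 1) (w m) (w' m)) (comb (- 1) (w n) (w' n))) (comb (- 1) (comb (- 1) (w m) (w' m)) (comb (- 1) (w n) (w' n))) < e"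
    by blast
qed

text \<open>The description in \<open>form_value\<close> denotes: square roots of form values are
  Cauchy by the triangle inequality, and closability makes their limit independent of the
  sequence.\<close>

theorem form_value_tendsto:
  assumes w: "form_convergent M A w u" and u: "u \<in> L2 M"
  shows "(\<lambda>n. form (w n) (w n)) \<longlonglongrightarrow> form_value M A u"
proof -
  note W = w[unfolded form_convergent_iff]
  have A: "w n \<in> A" for n using W by blast
  have "Cauchy (\<lambda>n. sqrt (form (w n) (w n)))"
    unfolding Cauchy_def dist_real_def
  proof (intro allI impI)
    fix e :: real assume "e > 0"
    then obtain N where N: "\<And>m n. m \<ge> N \<Longrightarrow> n \<ge> N \<Longrightarrow> form (comb (- 1) (w m) (w n)) (comb (- 1) (w m) (w n)) < e\<^sup>2"
      using W by (meson zero_less_power)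
    have "\<bar>sqrt (form (w m) (w m)) - sqrt (form (w n) (w n))\<bar> < e" if "m \<ge> N" "n \<ge> N" for m n
      using form_sqrt_diff[OF A A, of m n] real_less_lsqrt[OF _ N[OF that]] \<open>e > 0\<close> by (smt (verit))
    then show "\<exists>N. \<forall>m\<ge>N. \<forall>n\<ge>N. \<bar>sqrt (form (w m) (w m)) - sqrt (form (w n) (w n))\<bar> < e" by blast
  qed
  then obtain c where c: "(\<lambda>n. sqrt (form (w n) (w n))) \<longlonglongrightarrow> c" by (auto simp: Cauchy_convergent_iff convergent_def)
  have lim: "(\<lambda>n. form (w' n) (w' n)) \<longlonglongrightarrow> c\<^sup>2" if w': "form_convergent M A w' u" for w'
  proof -
    have A': "w' n \<in> A" for n using w' by (simp add: form_convergent_iff)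
    let ?d = "\<lambda>n. comb (- 1) (w n) (w' n)"
    have "(\<lambda>n. sqrt (form (?d n) (?d n))) \<longlonglongrightarrow> sqrt 0"
      by (intro tendsto_real_sqrt form_null_sequence form_convergent_diff[OF w w' u])
    then have lim_d: "(\<lambda>n. sqrt (form (?d n) (?d n))) \<longlonglongrightarrow> 0" by simp
    have "norm (sqrt (form (w n) (w n)) - sqrt (form (w' n) (w' n))) \<le> sqrt (form (?d n) (?d n))" for n
      using form_sqrt_diff[OF A A'] by simp
    then have "(\<lambda>n. sqrt (form (w n) (w n)) - sqrt (form (w' n) (w' n))) \<longlonglongrightarrow> 0"
      by (intro Lim_null_comparison[OF always_eventually lim_d] allI)
    from tendsto_diff[OF c this] have "(\<lambda>n. sqrt (form (w' n) (w' n))) \<longlonglongrightarrow> c" by simp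
    then have "(\<lambda>n. (sqrt (form (w' n) (w' n)))\<^sup>2) \<longlonglongrightarrow> c\<^sup>2" by (rule tendsto_power)
    then show ?thesis using form_nonneg[OF A'] by simp
  qed
  have "form_value M A u = c\<^sup>2"
    unfolding form_value_def
  proof (rule the_equality)
    show "\<forall>w. form_convergent M A w u \<longrightarrow> (\<lambda>n. Re (L2_inner M (snd (w n)) (fst (w n)))) \<longlonglongrightarrow> c\<^sup>2"
      using lim by (simp add: form_def)
    fix c' assume "\<forall>w. form_convergent M A w u \<longrightarrow> (\<lambda>n. Re (L2_inner M (snd (w n)) (fst (w n)))) \<longlonglongrightarrow> c'"
    then have "(\<lambda>n. form (w n) (w n)) \<longlonglongrightarrow> c'" using w by (simp add: form_def)
    then show "c' = c\<^sup>2" using lim[OF w] LIMSEQ_unique by blast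
  qed
  then show ?thesis using lim[OF w] by simp
qed

lemma form_convergent_const: "(f, h) \<in> A \<Longrightarrow> form_convergent M A (\<lambda>n. (f, h)) f"
  by (simp add: form_convergent_def L2_norm_def)

lemma form_domain_graph: "(f, h) \<in> A \<Longrightarrow> f \<in> form_domain M A"
  unfolding form_domain_def using form_convergent_const L2 by blast

lemma form_value_graph: "(f, h) \<in> A \<Longrightarrow> form_value M A f = Re (L2_inner M h f)"
  using form_value_tendsto[OF form_convergent_const L2(1)] LIMSEQ_unique[OF tendsto_const]
  by (metis form_def fst_conv snd_conv)

text \<open>When one summand lies in the operator domain, the mixed term is an L2 inner product and
  needs convergence of the other sequence in norm only. From this polarised information the operator
  is recovered.\<close>

lemma form_value_add:
  assumes fh: "(f, h) \<in> A" and g: "g \<in> form_domain M A"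
  shows "form_value M A (\<lambda>x. f x + g x) = Re (L2_inner M h f) + 2 * Re (L2_inner M h g) + form_value M A g"
proof -
  obtain w where w: "form_convergent M A w g" and gL: "g \<in> L2 M" using g by (auto simp: form_domain_def)
  note W = w[unfolded form_convergent_iff]
  let ?w = "\<lambda>n. comb 1 (f, h) (w n)"
  have "form_convergent M A ?w (\<lambda>x. f x + g x)"
    unfolding form_convergent_iff
  proof (intro conjI)
    show "\<forall>n. ?w n \<in> A" using W fh comb_in by blast
    show "(\<lambda>n. L2_norm M (\<lambda>x. fst (?w n) x - (f x + g x))) \<longlonglongrightarrow> 0" using W by (simp add: comb_def)
    have "comb (- 1) (?w m) (?w n) = comb (- 1) (w m) (w n)" for m n by (simp add: comb_def)
    then show "\<forall>e>0. \<exists>N. \<forall>m\<ge>N. \<forall>n\<ge>N. form (comb (- 1) (?w m) (?w n)) (comb (- 1) (?w m) (?w n)) < e" using W by simp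
  qed
  from form_value_tendsto[OF this L2_add[OF L2(1)[OF fh] gL]]
  have 1: "(\<lambda>n. form (?w n) (?w n)) \<longlonglongrightarrow> form_value M A (\<lambda>x. f x + g x)" .
  have "form (?w n) (?w n) = Re (L2_inner M h f) + 2 * Re (L2_inner M h (fst (w n))) + form (w n) (w n)" for n
    using W fh by (subst form_comb) (auto simp: form_def)
  moreover have "(\<lambda>n. Re (L2_inner M h f) + 2 * Re (L2_inner M h (fst (w n))) + form (w n) (w n)) \<longlonglongrightarrow>
      Re (L2_inner M h f) + 2 * Re (L2_inner M h g) + form_value M A g"
    using W fh by (intro tendsto_intros form_value_tendsto[OF w gL] L2_inner_tendsto_right L2' gL L2(2)[OF fh]) auto
  ultimately show ?thesis using LIMSEQ_unique[OF 1] by simp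
qed

end

text \<open>Why a smallest extension is unique: equal forms, evaluated at \<open>f + g\<close> with
  \<open>f\<close> in one operator domain and \<open>g\<close> in the other, identify the real parts
  of the two mixed inner products. Multiplying \<open>g\<close> by the imaginary unit supplies the
  imaginary parts, and self-adjointness puts \<open>(f, h)\<close> into the other graph.\<close>

theorem form_le_antisym:
  assumes S: "self_adjoint M S" "nonneg_op M S" and T: "self_adjoint M T" "nonneg_op M T"
    and le: "form_le M S T" "form_le M T S"
  shows "S = T"
proof -
  have *: "S \<subseteq> T" if S: "self_adjoint M S" "nonneg_op M S" and T: "self_adjoint M T" "nonneg_op M T"
    and le: "form_le M S T" "form_le M T S" for S T
  proof (rule subrelI)
    fix f h assume fh: "(f, h) \<in> S"
    interpret S: nonneg_symmetric_graph M S using S by (rule self_adjoint_nonneg_imp_graph)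
    interpret T: nonneg_symmetric_graph M T using T by (rule self_adjoint_nonneg_imp_graph)
    have dom: "form_domain M S = form_domain M T" using le by (auto simp: form_le_def)
    have val: "form_value M S u = form_value M T u" if "u \<in> form_domain M T" for u
      using le that dom by (auto simp: form_le_def intro: antisym)
    have Re: "Re (L2_inner M h g) = Re (L2_inner M k f)" if gk: "(g, k) \<in> T" for g k
    proof -
      have fT: "f \<in> form_domain M T" using S.form_domain_graph[OF fh] dom by simp
      have gT: "g \<in> form_domain M T" by (rule T.form_domain_graph[OF gk])
      have 1: "form_value M S (\<lambda>x. f x + g x) = Re (L2_inner M h f) + 2 * Re (L2_inner M h g) + form_value M S g"
        by (rule S.form_value_add[OF fh]) (simp add: gT dom)
      have 2: "form_value M T (\<lambda>x. g x + f x) = Re (L2_inner M k g) + 2 * Re (L2_inner M k f) + form_value M T f"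
        by (rule T.form_value_add[OF gk fT])
      have "(\<lambda>x. f x + g x) \<in> form_domain M T"
      proof -
        obtain w where w: "form_convergent M T w f" and fL: "f \<in> L2 M" using fT by (auto simp: form_domain_def)
        note W = w[unfolded T.form_convergent_iff]
        let ?w = "\<lambda>n. T.comb 1 (g, k) (w n)"
        have "form_convergent M T ?w (\<lambda>x. f x + g x)"
          unfolding T.form_convergent_iff
        proof (intro conjI)
          show "\<forall>n. ?w n \<in> T" using W gk T.comb_in by blast
          show "(\<lambda>n. L2_norm M (\<lambda>x. fst (?w n) x - (f x + g x))) \<longlonglongrightarrow> 0" using W by (simp add: T.comb_def add.commute)
          have "T.comb (- 1) (?w m) (?w n) = T.comb (- 1) (w m) (w n)" for m n by (simp add: T.comb_def)
          then show "\<forall>e>0. \<exists>N. \<forall>m\<ge>N. \<forall>n\<ge>N. T.form (T.comb (- 1) (?w m) (?w n)) (T.comb (- 1) (?w m) (?w n)) < e" using W by simp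
        qed
        then show ?thesis using L2_add[OF fL T.L2(1)[OF gk]] by (auto simp: form_domain_def)
      qed
      from val[OF this] 1 2 val[OF gT] val[OF fT] S.form_value_graph[OF fh] T.form_value_graph[OF gk]
      show ?thesis by (simp add: add.commute)
    qed
    have "L2_inner M k f = L2_inner M g h" if gk: "(g, k) \<in> T" for g k
    proof -
      \<comment> \<open>Linearity is given in the shape \<open>f + c * f'\<close>, hence the factor
        \<i> is written as \<open>1 + (\<i> - 1)\<close>.\<close>
      have "(\<lambda>x. \<i> * g x, \<lambda>x. \<i> * k x) \<in> T"
        using T.linear[OF gk gk, of "\<i> - 1"] by (simp add: algebra_simps)
      from Re[OF this] have "Im (L2_inner M h g) = - Im (L2_inner M k f)"
        by (simp add: L2_inner_scale_right L2_inner_scale_left)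
      with Re[OF gk] have "L2_inner M h g = cnj (L2_inner M k f)" by (simp add: complex_eq_iff)
      then show ?thesis by (metis L2_inner_cnj complex_cnj_cnj)
    qed
    then have "(f, h) \<in> op_adjoint M T" using S.L2[OF fh] by (auto simp: op_adjoint_def)
    then show "(f, h) \<in> T" using T by (simp add: self_adjoint_def)
  qed
  show ?thesis using *[OF S T le] *[OF T S le(2,1)] by blast
qed

section \<open>Calculus of primitives\<close>

context nonempty_einterval
begin

lemma prim_add:
  fixes u v :: "real \<Rightarrow> 'a::{banach, second_countable_topology}"
  assumes "integrable leb u" "integrable leb v"
  shows "prim a b (\<lambda>t. u t + v t) x = prim a b u x + prim a b v x"
  unfolding prim_def scaleR_add_right
  by (rule Bochner_Integration.integral_add) (intro prim_integrable assms)+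

lemma prim_mult_left:
  fixes u :: "real \<Rightarrow> 'a::{real_normed_field, banach, second_countable_topology}"
  shows "prim a b (\<lambda>t. c * u t) x = c * prim a b u x"
  unfolding prim_def by (subst integral_mult_right_zero[symmetric]) (simp add: mult_scaleR_right)

lemma prim_cong:
  "(\<And>t. t \<in> I \<Longrightarrow> u t = v t) \<Longrightarrow> prim a b u x = prim a b v x"
  unfolding prim_def by (rule Bochner_Integration.integral_cong) auto

lemma prim_cong_AE:
  fixes u v :: "real \<Rightarrow> 'a::{banach, second_countable_topology}"
  assumes "integrable leb u" "integrable leb v" "AE t in leb. u t = v t"
  shows "prim a b u x = prim a b v x"
  unfolding prim_def
proof (rule integral_cong_AE)
  show "AE t in leb. indicator {..<x} t *\<^sub>R u t = indicator {..<x} t *\<^sub>R v t"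
    using assms(3) by eventually_elim simp
qed (use prim_integrable[OF assms(1)] prim_integrable[OF assms(2)] in auto)

lemma prim_mono:
  fixes u v :: "real \<Rightarrow> real"
  assumes "integrable leb u" "integrable leb v" "\<And>t. t \<in> I \<Longrightarrow> u t \<le> v t"
  shows "prim a b u x \<le> prim a b v x"
  unfolding prim_def
  by (rule integral_mono) (use prim_integrable[OF assms(1)] prim_integrable[OF assms(2)] assms(3) in \<open>auto simp: indicator_def\<close>)

lemma prim_norm_le:
  fixes u :: "real \<Rightarrow> 'a::{banach, second_countable_topology}"
  shows "norm (prim a b u x) \<le> prim a b (\<lambda>t. norm (u t)) x"
proof -
  have "norm (prim a b u x) \<le> (LINT t|leb. norm (indicator {..<x} t *\<^sub>R u t))"
    unfolding prim_def by (rule integral_norm_bound)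
  then show ?thesis by (simp add: prim_def)
qed

lemma prim_le_integral:
  fixes u :: "real \<Rightarrow> real"
  assumes "integrable leb u" "\<And>t. t \<in> I \<Longrightarrow> 0 \<le> u t"
  shows "prim a b u x \<le> (LINT t|leb. u t)"
  unfolding prim_def
  by (rule integral_mono) (use prim_integrable[OF assms(1)] assms in \<open>auto simp: indicator_def\<close>)

lemma prim_bounded:
  fixes u :: "real \<Rightarrow> 'a::{banach, second_countable_topology}"
  assumes "integrable leb u"
  shows "norm (prim a b u x) \<le> (LINT t|leb. norm (u t))"
  using prim_norm_le[of u x] prim_le_integral[of "\<lambda>t. norm (u t)" x] assms by simp

lemma prim_continuous_on:
  fixes u :: "real \<Rightarrow> 'a::{banach, second_countable_topology}"
  assumes u: "integrable leb u"
  shows "continuous_on I (prim a b u)"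
proof (rule continuous_at_imp_continuous_on, rule ballI)
  fix x assume "x \<in> I"
  have "continuous_on {x - 1..x + 1} (prim a b u)" by (rule AC_on_continuous_on[OF prim_AC_on[OF u]])
  then show "isCont (prim a b u) x" by (rule continuous_on_interior) simp
qed

lemma continuous_measurable_leb:
  fixes f :: "real \<Rightarrow> 'a::euclidean_space"
  shows "continuous_on I f \<Longrightarrow> f \<in> borel_measurable leb"
  by (rule continuous_imp_measurable_on_sets_lebesgue) auto

lemma prim_zero_left:
  fixes u :: "real \<Rightarrow> 'a::{banach, second_countable_topology}"
  assumes "\<And>t. t < x \<Longrightarrow> u t = 0"
  shows "prim a b u x = 0"
proof -
  have "(\<lambda>t. indicator {..<x} t *\<^sub>R u t) = (\<lambda>t. 0)" using assms by (auto simp: fun_eq_iff indicator_def)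
  then show ?thesis unfolding prim_def by (simp only: Bochner_Integration.integral_zero)
qed

lemma prim_full_right:
  fixes u :: "real \<Rightarrow> 'a::{banach, second_countable_topology}"
  assumes "\<And>t. x \<le> t \<Longrightarrow> u t = 0"
  shows "prim a b u x = (LINT t|leb. u t)"
proof -
  have "(\<lambda>t. indicator {..<x} t *\<^sub>R u t) = u" using assms by (auto simp: fun_eq_iff indicator_def not_less)
  then show ?thesis unfolding prim_def by (simp only:)
qed

lemma prim_measurable:
  fixes u :: "real \<Rightarrow> 'a::euclidean_space"
  shows "integrable leb u \<Longrightarrow> prim a b u \<in> borel_measurable leb"
  by (rule continuous_measurable_leb[OF prim_continuous_on])

lemma integrable_mult_bounded:
  fixes u f :: "real \<Rightarrow> 'a::{real_normed_field, banach, second_countable_topology}"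
  assumes u: "integrable leb u" and f: "f \<in> borel_measurable leb" "\<And>t. t \<in> I \<Longrightarrow> norm (f t) \<le> B"
  shows "integrable leb (\<lambda>t. u t * f t)"
proof (rule Bochner_Integration.integrable_bound)
  show "integrable leb (\<lambda>t. B * norm (u t))" using u by simp
  show "(\<lambda>t. u t * f t) \<in> borel_measurable leb" using u f(1) by simp
  show "AE t in leb. norm (u t * f t) \<le> norm (B * norm (u t))"
  proof (rule AE_I2)
    fix t assume "t \<in> space leb"
    then have "norm (u t) * norm (f t) \<le> norm (u t) * \<bar>B\<bar>"
      using f(2)[of t] by (intro mult_left_mono) auto
    then show "norm (u t * f t) \<le> norm (B * norm (u t))" by (simp add: norm_mult abs_mult mult.commute)
  qed
qed

lemma integrable_mult_prim:
  fixes u v :: "real \<Rightarrow> 'a::{real_normed_field, euclidean_space}"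
  assumes "integrable leb u" "integrable leb v"
  shows "integrable leb (\<lambda>t. u t * prim a b v t)"
  by (rule integrable_mult_bounded[OF assms(1) prim_measurable[OF assms(2)] prim_bounded[OF assms(2)]])

lemma AC_loc_mult: "f \<in> AC_loc a b \<Longrightarrow> g \<in> AC_loc a b \<Longrightarrow> (\<lambda>x. f x * g x) \<in> AC_loc a b"
  by (simp add: AC_loc_def abs_cont_on_iff_AC_on AC_on_mult)

lemma AC_loc_diff: "f \<in> AC_loc a b \<Longrightarrow> g \<in> AC_loc a b \<Longrightarrow> (\<lambda>x. f x - g x) \<in> AC_loc a b"
  by (simp add: AC_loc_def abs_cont_on_iff_AC_on AC_on_diff)

text \<open>Integration by parts; both primitives vanish at the left endpoint, so there is no
  boundary term.\<close>

theorem prim_mult: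
  fixes u v :: "real \<Rightarrow> complex"
  assumes u: "integrable leb u" and v: "integrable leb v" and x: "x \<in> I"
  shows "prim a b u x * prim a b v x = prim a b (\<lambda>t. u t * prim a b v t + v t * prim a b u t) x"
proof -
  have "prim a b u x * prim a b v x = 0 + prim a b (\<lambda>t. u t * prim a b v t + v t * prim a b u t) x"
  proof (rule AC_loc_eq_prim[OF _ _ _ _ x])
    show "(\<lambda>x. prim a b u x * prim a b v x) \<in> AC_loc a b"
      by (intro AC_loc_mult prim_AC_loc u v)
    show "AE x in leb. ((\<lambda>x. prim a b u x * prim a b v x) has_vector_derivative u x * prim a b v x + v x * prim a b u x) (at x)"
      using prim_has_vector_derivative[OF u] prim_has_vector_derivative[OF v]
    proof eventually_elim
      case (elim x)
      show ?case
        using has_vector_derivative_mult[OF elim] by (simp add: mult.commute add.commute)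
    qed
    show "integrable leb (\<lambda>t. u t * prim a b v t + v t * prim a b u t)"
      by (intro Bochner_Integration.integrable_add integrable_mult_prim u v)
    show "(((\<lambda>x. prim a b u x * prim a b v x) \<circ> real_of_ereal) \<longlongrightarrow> 0) (at_right a)"
      using tendsto_mult[OF prim_at_left_end[OF u] prim_at_left_end[OF v]] by (simp add: o_def)
  qed
  then show ?thesis by simp
qed

lemma prim_of_real:
  "prim a b (\<lambda>t. complex_of_real (u t)) x = complex_of_real (prim a b u x)"
  unfolding prim_def by (subst integral_complex_of_real[symmetric]) (simp add: scaleR_conv_of_real)

text \<open>Provides the factorials of the Picard bound. The induction is the product rule for
  \<open>prim a b \<kappa>\<close> and its preceding power; it passes through complex values because
  the product rule is stated for them.\<close>

lemma prim_power:
  fixes \<kappa> :: "real \<Rightarrow> real"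
  assumes \<kappa>: "integrable leb \<kappa>"
  shows "integrable leb (\<lambda>t. \<kappa> t * prim a b \<kappa> t ^ n)"
    and "x \<in> I \<Longrightarrow> prim a b (\<lambda>t. \<kappa> t * prim a b \<kappa> t ^ n) x = prim a b \<kappa> x ^ Suc n / real (Suc n)"
proof -
  have int: "integrable leb (\<lambda>t. \<kappa> t * prim a b \<kappa> t ^ n)" for n
  proof (rule integrable_mult_bounded[OF \<kappa>])
    show "(\<lambda>t. prim a b \<kappa> t ^ n) \<in> borel_measurable leb" using prim_measurable[OF \<kappa>] by simp
    show "norm (prim a b \<kappa> t ^ n) \<le> (LINT t|leb. norm (\<kappa> t)) ^ n" for t
      using power_mono[OF prim_bounded[OF \<kappa>, of t] norm_ge_zero, of n] by (simp add: power_abs)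
  qed
  then show "integrable leb (\<lambda>t. \<kappa> t * prim a b \<kappa> t ^ n)" .
  show "x \<in> I \<Longrightarrow> prim a b (\<lambda>t. \<kappa> t * prim a b \<kappa> t ^ n) x = prim a b \<kappa> x ^ Suc n / real (Suc n)"
  proof (induction n arbitrary: x)
    case (Suc n)
    let ?K = "prim a b \<kappa>"
    let ?u = "\<lambda>t. complex_of_real (\<kappa> t)" and ?v = "\<lambda>t. complex_of_real (real (Suc n) * (\<kappa> t * ?K t ^ n))"
    have K: "prim a b ?u t = of_real (?K t)" for t by (rule prim_of_real)
    have V: "prim a b ?v t = of_real (?K t ^ Suc n)" if "t \<in> I" for t
      unfolding prim_of_real prim_mult_left Suc.IH[OF that] by simp
    have "of_real (?K x * ?K x ^ Suc n) = prim a b ?u x * prim a b ?v x" using K V[OF Suc.prems] by simp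
    also have "\<dots> = prim a b (\<lambda>t. ?u t * prim a b ?v t + ?v t * prim a b ?u t) x"
      by (rule prim_mult[OF integrable_of_real[OF \<kappa>] integrable_of_real[OF integrable_mult_right[OF int]] Suc.prems])
    also have "\<dots> = prim a b (\<lambda>t. of_real (real (Suc (Suc n)) * (\<kappa> t * ?K t ^ Suc n))) x"
    proof (rule prim_cong)
      fix t assume t: "t \<in> I"
      have "\<kappa> t * ?K t ^ Suc n + real (Suc n) * (\<kappa> t * ?K t ^ n) * ?K t = real (Suc (Suc n)) * (\<kappa> t * ?K t ^ Suc n)"
        by (simp add: algebra_simps)
      then show "?u t * prim a b ?v t + ?v t * prim a b ?u t = of_real (real (Suc (Suc n)) * (\<kappa> t * ?K t ^ Suc n))"
        unfolding K V[OF t] of_real_mult[symmetric] of_real_add[symmetric] by (simp only:)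
    qed
    also have "\<dots> = of_real (real (Suc (Suc n)) * prim a b (\<lambda>t. \<kappa> t * ?K t ^ Suc n) x)"
      unfolding prim_of_real prim_mult_left ..
    finally have "?K x * ?K x ^ Suc n = real (Suc (Suc n)) * prim a b (\<lambda>t. \<kappa> t * ?K t ^ Suc n) x"
      by (rule of_real_eq_iff[THEN iffD1])
    then show ?case by (simp add: field_simps)
  qed simp
qed

subsection \<open>Linear systems with integrable coefficients\<close>

context
  fixes k11 k12 k21 k22 :: "real \<Rightarrow> real" and \<alpha> \<beta> :: real
  assumes k: "integrable leb k11" "integrable leb k12" "integrable leb k21" "integrable leb k22"
begin

text \<open>Increments of the Picard iteration rather than iterates: each is the integral operator
  applied to its predecessor, and the solution is their sum.\<close>

primrec picard :: "nat \<Rightarrow> (real \<Rightarrow> real) \<times> (real \<Rightarrow> real)" where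
  "picard 0 = ((\<lambda>_. \<alpha>), (\<lambda>_. \<beta>))"
| "picard (Suc n) =
    (prim a b (\<lambda>t. k11 t * fst (picard n) t + k12 t * snd (picard n) t),
     prim a b (\<lambda>t. k21 t * fst (picard n) t + k22 t * snd (picard n) t))"

text \<open>One integrable function dominating all entries of the matrix, so that the sum of the
  moduli of both components can be estimated at once.\<close>

definition "\<kappa> t = \<bar>k11 t\<bar> + \<bar>k12 t\<bar> + \<bar>k21 t\<bar> + \<bar>k22 t\<bar>"

lemma \<kappa>_integrable: "integrable leb \<kappa>"
  unfolding \<kappa>_def using k by auto

lemma \<kappa>_nonneg: "0 \<le> \<kappa> t"
  by (simp add: \<kappa>_def)

lemma prim_\<kappa>_nonneg: "0 \<le> prim a b \<kappa> t"
  using prim_mono[of "\<lambda>_. 0" \<kappa> t] \<kappa>_integrable \<kappa>_nonneg by (simp add: prim_def)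

text \<open>The three statements are proved together because each step needs the previous bound in
  order to integrate. Integrating \<open>\<kappa> t * prim a b \<kappa> t ^ n / fact n\<close> gives
  the next power over the next factorial.\<close>

lemma picard_bound:
  "fst (picard n) \<in> borel_measurable leb \<and> snd (picard n) \<in> borel_measurable leb \<and>
   (\<forall>t\<in>I. \<bar>fst (picard n) t\<bar> + \<bar>snd (picard n) t\<bar> \<le> (\<bar>\<alpha>\<bar> + \<bar>\<beta>\<bar>) * (prim a b \<kappa> t ^ n / fact n))"
  and picard_integrable:
  "integrable leb (\<lambda>t. k11 t * fst (picard n) t + k12 t * snd (picard n) t) \<and>
   integrable leb (\<lambda>t. k21 t * fst (picard n) t + k22 t * snd (picard n) t)"
  and picard_integrand_bound:
  "\<And>t. t \<in> I \<Longrightarrow> \<bar>k11 t * fst (picard n) t + k12 t * snd (picard n) t\<bar> + \<bar>k21 t * fst (picard n) t + k22 t * snd (picard n) t\<bar>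
     \<le> (\<bar>\<alpha>\<bar> + \<bar>\<beta>\<bar>) / fact n * (\<kappa> t * prim a b \<kappa> t ^ n)"
proof -
  let ?C = "\<bar>\<alpha>\<bar> + \<bar>\<beta>\<bar>" and ?K = "prim a b \<kappa>"
  let ?u = "\<lambda>n t. k11 t * fst (picard n) t + k12 t * snd (picard n) t"
  let ?v = "\<lambda>n t. k21 t * fst (picard n) t + k22 t * snd (picard n) t"
  have step: "(\<forall>t\<in>I. \<bar>?u n t\<bar> + \<bar>?v n t\<bar> \<le> ?C / fact n * (\<kappa> t * ?K t ^ n)) \<and> integrable leb (?u n) \<and> integrable leb (?v n)"
    if IH: "fst (picard n) \<in> borel_measurable leb" "snd (picard n) \<in> borel_measurable leb"
      "\<forall>t\<in>I. \<bar>fst (picard n) t\<bar> + \<bar>snd (picard n) t\<bar> \<le> ?C * (?K t ^ n / fact n)" for n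
  proof -
    have bound: "\<bar>?u n t\<bar> + \<bar>?v n t\<bar> \<le> ?C / fact n * (\<kappa> t * ?K t ^ n)" if "t \<in> I" for t
    proof -
      let ?x = "\<bar>fst (picard n) t\<bar>" and ?y = "\<bar>snd (picard n) t\<bar>"
      have "\<bar>?u n t\<bar> + \<bar>?v n t\<bar> \<le> (\<bar>k11 t\<bar> * ?x + \<bar>k12 t\<bar> * ?y) + (\<bar>k21 t\<bar> * ?x + \<bar>k22 t\<bar> * ?y)"
        by (intro add_mono order_trans[OF abs_triangle_ineq]) (simp_all add: abs_mult)
      also have "\<dots> \<le> \<kappa> t * (?x + ?y)"
      proof -
        have "0 \<le> \<bar>k12 t\<bar> * ?x" "0 \<le> \<bar>k22 t\<bar> * ?x" "0 \<le> \<bar>k11 t\<bar> * ?y" "0 \<le> \<bar>k21 t\<bar> * ?y" by simp_all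
        then show ?thesis unfolding \<kappa>_def ring_distribs by linarith
      qed
      also have "\<dots> \<le> \<kappa> t * (?C * (?K t ^ n / fact n))"
        using IH(3) that \<kappa>_nonneg by (intro mult_left_mono) auto
      finally show ?thesis by (simp add: algebra_simps)
    qed
    have dom: "integrable leb (\<lambda>t. ?C / fact n * (\<kappa> t * ?K t ^ n))"
      by (intro integrable_mult_right prim_power(1) \<kappa>_integrable)
    have kb: "k11 \<in> borel_measurable leb" "k12 \<in> borel_measurable leb" "k21 \<in> borel_measurable leb" "k22 \<in> borel_measurable leb"
      using k by auto
    have le: "\<bar>?u n t\<bar> \<le> \<bar>?C / fact n * (\<kappa> t * ?K t ^ n)\<bar>" "\<bar>?v n t\<bar> \<le> \<bar>?C / fact n * (\<kappa> t * ?K t ^ n)\<bar>" if "t \<in> I" for t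
      using bound[OF that] by linarith+
    have "integrable leb (?u n)"
      by (rule Bochner_Integration.integrable_bound[OF dom]) (use kb IH le in \<open>auto intro!: AE_I2\<close>)
    moreover have "integrable leb (?v n)"
      by (rule Bochner_Integration.integrable_bound[OF dom]) (use kb IH le in \<open>auto intro!: AE_I2\<close>)
    ultimately show ?thesis using bound by blast
  qed
  have main: "fst (picard n) \<in> borel_measurable leb \<and> snd (picard n) \<in> borel_measurable leb \<and>
    (\<forall>t\<in>I. \<bar>fst (picard n) t\<bar> + \<bar>snd (picard n) t\<bar> \<le> ?C * (?K t ^ n / fact n))" for n
  proof (induction n)
    case (Suc n)
    have uv: "integrable leb (?u n)" "integrable leb (?v n)"
      and bd: "\<And>t. t \<in> I \<Longrightarrow> \<bar>?u n t\<bar> + \<bar>?v n t\<bar> \<le> ?C / fact n * (\<kappa> t * ?K t ^ n)"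
      using step[of n] Suc.IH by auto
    have "\<bar>fst (picard (Suc n)) t\<bar> + \<bar>snd (picard (Suc n)) t\<bar> \<le> ?C * (?K t ^ Suc n / fact (Suc n))" if "t \<in> I" for t
    proof -
      have "\<bar>fst (picard (Suc n)) t\<bar> + \<bar>snd (picard (Suc n)) t\<bar> \<le> prim a b (\<lambda>t. \<bar>?u n t\<bar>) t + prim a b (\<lambda>t. \<bar>?v n t\<bar>) t"
        using prim_norm_le[of "?u n" t] prim_norm_le[of "?v n" t] by simp
      also have "\<dots> = prim a b (\<lambda>t. \<bar>?u n t\<bar> + \<bar>?v n t\<bar>) t" by (rule prim_add[symmetric]) (use uv in auto)
      also have "\<dots> \<le> prim a b (\<lambda>t. ?C / fact n * (\<kappa> t * ?K t ^ n)) t"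
        by (rule prim_mono) (use uv bd \<kappa>_integrable in \<open>auto intro!: integrable_mult_right prim_power(1)\<close>)
      also have "\<dots> = ?C / fact n * (?K t ^ Suc n / real (Suc n))"
        unfolding prim_mult_left prim_power(2)[OF \<kappa>_integrable that] ..
      finally show ?thesis by (simp add: field_simps)
    qed
    then show ?case using uv prim_measurable by auto
  qed simp
  show "fst (picard n) \<in> borel_measurable leb \<and> snd (picard n) \<in> borel_measurable leb \<and>
    (\<forall>t\<in>I. \<bar>fst (picard n) t\<bar> + \<bar>snd (picard n) t\<bar> \<le> ?C * (?K t ^ n / fact n))" by (rule main)
  show "integrable leb (?u n) \<and> integrable leb (?v n)" using step main by blast
  show "\<bar>?u n t\<bar> + \<bar>?v n t\<bar> \<le> ?C / fact n * (\<kappa> t * ?K t ^ n)" if "t \<in> I" for t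
    using step main that by blast
qed

lemma picard_summable:
  assumes "t \<in> I"
  shows "summable (\<lambda>n. \<bar>fst (picard n) t\<bar>)" "summable (\<lambda>n. \<bar>snd (picard n) t\<bar>)"
proof -
  have "summable (\<lambda>n. (\<bar>\<alpha>\<bar> + \<bar>\<beta>\<bar>) * (prim a b \<kappa> t ^ n / fact n))"
    using summable_exp[of "prim a b \<kappa> t"] by (intro summable_mult) (simp add: divide_inverse mult.commute)
  moreover have "\<bar>fst (picard n) t\<bar> \<le> (\<bar>\<alpha>\<bar> + \<bar>\<beta>\<bar>) * (prim a b \<kappa> t ^ n / fact n)"
    "\<bar>snd (picard n) t\<bar> \<le> (\<bar>\<alpha>\<bar> + \<bar>\<beta>\<bar>) * (prim a b \<kappa> t ^ n / fact n)" for n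
    using picard_bound[of n] assms by (meson abs_ge_zero add_increasing2 le_add_same_cancel1 order_trans add_increasing order_refl)+
  ultimately show "summable (\<lambda>n. \<bar>fst (picard n) t\<bar>)" "summable (\<lambda>n. \<bar>snd (picard n) t\<bar>)"
    by (auto intro: summable_comparison_test')
qed

text \<open>Sum and integral are exchanged under a summable majorant obtained by replacing the
  primitive of \<kappa> by its total mass \<open>Kb\<close>.\<close>

lemma picard_sum_prim:
  assumes g: "\<And>n. integrable leb (g n)" "\<And>n t. t \<in> I \<Longrightarrow> \<bar>g n t\<bar> \<le> (\<bar>\<alpha>\<bar> + \<bar>\<beta>\<bar>) / fact n * (\<kappa> t * prim a b \<kappa> t ^ n)"
  shows "integrable leb (\<lambda>t. \<Sum>n. g n t)" "prim a b (\<lambda>t. \<Sum>n. g n t) x = (\<Sum>n. prim a b (g n) x)"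
proof -
  let ?C = "\<bar>\<alpha>\<bar> + \<bar>\<beta>\<bar>"
  define Kb where "Kb = (LINT t|leb. \<kappa> t)"
  have K: "0 \<le> prim a b \<kappa> t" "prim a b \<kappa> t \<le> Kb" for t
    using prim_\<kappa>_nonneg prim_le_integral[OF \<kappa>_integrable] \<kappa>_nonneg by (auto simp: Kb_def)
  have Kb: "0 \<le> Kb" using K[of 0] by simp
  have ex: "summable (\<lambda>n. ?C * Kb ^ n / fact n)" 
    using summable_mult[OF summable_exp[of Kb], of ?C] by (simp add: divide_inverse mult.commute mult.left_commute)
  have le: "\<bar>g n t\<bar> \<le> (?C * Kb ^ n / fact n) * \<kappa> t" if "t \<in> I" for n t
  proof -
    have "\<bar>g n t\<bar> \<le> ?C / fact n * (\<kappa> t * prim a b \<kappa> t ^ n)" by (rule g(2)[OF that])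
    also have "\<dots> \<le> ?C / fact n * (\<kappa> t * Kb ^ n)"
      using K \<kappa>_nonneg by (intro mult_left_mono power_mono) auto
    finally show ?thesis by (simp add: algebra_simps)
  qed
  have sum: "summable (\<lambda>n. \<bar>g n t\<bar>)" if "t \<in> I" for t
    by (rule summable_comparison_test'[where N=0, OF summable_mult2[OF ex, of "\<kappa> t"]]) (use le that in auto)
  \<comment> \<open>The weight \<open>h\<close> is 1 for integrability of the sum and an indicator
    for its primitive.\<close>
  have sumint: "summable (\<lambda>n. LINT t|leb. \<bar>h t\<bar> * \<bar>g n t\<bar>)"
    if h: "h \<in> borel_measurable leb" "\<And>t. \<bar>h t\<bar> \<le> 1" for h
  proof (rule summable_comparison_test'[where N=0, OF summable_mult2[OF ex, of Kb]])
    fix n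
    have "(LINT t|leb. \<bar>h t\<bar> * \<bar>g n t\<bar>) \<le> (LINT t|leb. (?C * Kb ^ n / fact n) * \<kappa> t)"
    proof (rule integral_mono)
      show "integrable leb (\<lambda>t. \<bar>h t\<bar> * \<bar>g n t\<bar>)"
        by (rule Bochner_Integration.integrable_bound[OF g(1)[of n]]) (use g(1)[of n] h in \<open>auto intro!: AE_I2 mult_left_le_one_le\<close>)
      show "integrable leb (\<lambda>t. (?C * Kb ^ n / fact n) * \<kappa> t)" using \<kappa>_integrable by simp
      fix t assume "t \<in> space leb"
      then show "\<bar>h t\<bar> * \<bar>g n t\<bar> \<le> (?C * Kb ^ n / fact n) * \<kappa> t"
        using le[of t n] mult_right_mono[OF h(2)[of t], of "\<bar>g n t\<bar>"] by simp
    qed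
    then show "norm (LINT t|leb. \<bar>h t\<bar> * \<bar>g n t\<bar>) \<le> ?C * Kb ^ n / fact n * Kb" by (simp add: Kb_def)
  qed
  show "integrable leb (\<lambda>t. \<Sum>n. g n t)"
  proof (rule integrable_suminf[OF g(1)])
    show "AE t in leb. summable (\<lambda>n. norm (g n t))" using sum by (auto intro!: AE_I2)
    show "summable (\<lambda>n. LINT t|leb. norm (g n t))" using sumint[of "\<lambda>_. 1"] by simp
  qed
  have ind: "indicator {..<x} \<in> borel_measurable leb"
    by (rule measurable_restrict_space1) (simp add: borel_measurable_indicator)
  have "prim a b (\<lambda>t. \<Sum>n. g n t) x = (LINT t|leb. (\<Sum>n. indicator {..<x} t *\<^sub>R g n t))"
    unfolding prim_def using sum
    by (intro Bochner_Integration.integral_cong) (auto simp: suminf_mult summable_rabs_cancel)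
  also have "\<dots> = (\<Sum>n. LINT t|leb. indicator {..<x} t *\<^sub>R g n t)"
  proof (rule integral_suminf[OF prim_integrable[OF g(1)]])
    show "AE t in leb. summable (\<lambda>n. norm (indicator {..<x} t *\<^sub>R g n t))"
      using sum by (auto intro!: AE_I2 summable_mult simp: abs_mult)
    show "summable (\<lambda>n. LINT t|leb. norm (indicator {..<x} t *\<^sub>R g n t))"
      using sumint[OF ind] by (simp add: abs_mult)
  qed
  finally show "prim a b (\<lambda>t. \<Sum>n. g n t) x = (\<Sum>n. prim a b (g n) x)" by (simp add: prim_def)
qed

text \<open>The sum from index 1 on is the integral operator applied to the full sum, and the term
  of index 0 supplies the initial values.\<close>

theorem linear_system_solution:
  obtains Y Z :: "real \<Rightarrow> real" where
    "integrable leb (\<lambda>t. k11 t * Y t + k12 t * Z t)" "integrable leb (\<lambda>t. k21 t * Y t + k22 t * Z t)"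
    "\<And>x. x \<in> I \<Longrightarrow> Y x = \<alpha> + prim a b (\<lambda>t. k11 t * Y t + k12 t * Z t) x"
    "\<And>x. x \<in> I \<Longrightarrow> Z x = \<beta> + prim a b (\<lambda>t. k21 t * Y t + k22 t * Z t) x"
proof -
  define Y where "Y = (\<lambda>t. \<Sum>n. fst (picard n) t)"
  define Z where "Z = (\<lambda>t. \<Sum>n. snd (picard n) t)"
  let ?u = "\<lambda>n t. k11 t * fst (picard n) t + k12 t * snd (picard n) t"
  let ?v = "\<lambda>n t. k21 t * fst (picard n) t + k22 t * snd (picard n) t"
  have uv: "integrable leb (?u n)" "integrable leb (?v n)" for n using picard_integrable[of n] by auto
  have b: "\<bar>?u n t\<bar> \<le> (\<bar>\<alpha>\<bar> + \<bar>\<beta>\<bar>) / fact n * (\<kappa> t * prim a b \<kappa> t ^ n)" "\<bar>?v n t\<bar> \<le> (\<bar>\<alpha>\<bar> + \<bar>\<beta>\<bar>) / fact n * (\<kappa> t * prim a b \<kappa> t ^ n)"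
    if "t \<in> I" for n t using picard_integrand_bound[OF that, of n] by linarith+
  have sm: "summable (\<lambda>n. fst (picard n) t)" "summable (\<lambda>n. snd (picard n) t)" if "t \<in> I" for t
    by (rule summable_rabs_cancel[OF picard_summable(1)[OF that]], rule summable_rabs_cancel[OF picard_summable(2)[OF that]])
  have su: "k t * Y t + k' t * Z t = (\<Sum>n. k t * fst (picard n) t + k' t * snd (picard n) t)" if "t \<in> I" for t and k k' :: "real \<Rightarrow> real"
    unfolding Y_def Z_def using sm[OF that]
    by (simp add: suminf_mult[symmetric] suminf_add summable_mult)
  have U: "integrable leb (\<lambda>t. \<Sum>n. ?u n t)" "prim a b (\<lambda>t. \<Sum>n. ?u n t) x = (\<Sum>n. prim a b (?u n) x)" for x
    by (rule picard_sum_prim(1), rule uv(1), erule b(1)) (rule picard_sum_prim(2), rule uv(1), erule b(1))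
  have V: "integrable leb (\<lambda>t. \<Sum>n. ?v n t)" "prim a b (\<lambda>t. \<Sum>n. ?v n t) x = (\<Sum>n. prim a b (?v n) x)" for x
    by (rule picard_sum_prim(1), rule uv(2), erule b(2)) (rule picard_sum_prim(2), rule uv(2), erule b(2))
  have head: "(\<Sum>n. g n) = g 0 + (\<Sum>n. g (Suc n))" if "summable g" for g :: "nat \<Rightarrow> real"
    using suminf_split_head[OF that] by simp
  show ?thesis
  proof
    show "integrable leb (\<lambda>t. k11 t * Y t + k12 t * Z t)"
      by (rule Bochner_Integration.integrable_cong[THEN iffD2, OF refl _ U(1)]) (simp add: su)
    show "integrable leb (\<lambda>t. k21 t * Y t + k22 t * Z t)"
      by (rule Bochner_Integration.integrable_cong[THEN iffD2, OF refl _ V(1)]) (simp add: su)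
    fix x assume x: "x \<in> I"
    have "prim a b (\<lambda>t. k11 t * Y t + k12 t * Z t) x = prim a b (\<lambda>t. \<Sum>n. ?u n t) x" by (rule prim_cong) (rule su)
    also have "\<dots> = (\<Sum>n. fst (picard (Suc n)) x)" by (simp add: U(2))
    finally show "Y x = \<alpha> + prim a b (\<lambda>t. k11 t * Y t + k12 t * Z t) x"
      unfolding Y_def using head[OF sm(1)[OF x]] by simp
    have "prim a b (\<lambda>t. k21 t * Y t + k22 t * Z t) x = prim a b (\<lambda>t. \<Sum>n. ?v n t) x" by (rule prim_cong) (rule su)
    also have "\<dots> = (\<Sum>n. snd (picard (Suc n)) x)" by (simp add: V(2))
    finally show "Z x = \<beta> + prim a b (\<lambda>t. k21 t * Y t + k22 t * Z t) x"
      unfolding Z_def using head[OF sm(2)[OF x]] by simp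
  qed
qed

end

section \<open>Functions with integrable derivative on the whole interval\<close>

lemma leb_borel_measurable_AE:
  fixes f g :: "real \<Rightarrow> complex"
  assumes "f \<in> borel_measurable leb" "AE x in leb. f x = g x"
  shows "g \<in> borel_measurable leb"
proof -
  have 1: "(\<lambda>x. if x \<in> I then f x else 0) \<in> borel_measurable lebesgue"
    using assms(1) by (subst borel_measurable_if) auto
  have "AE x in lebesgue. x \<in> I \<longrightarrow> f x = g x"
    using assms(2) by (subst (asm) AE_restrict_space_iff) auto
  then have "AE x in lebesgue. (if x \<in> I then f x else 0) = (if x \<in> I then g x else 0)"
    by eventually_elim simp
  from borel_measurable_AE[OF 1 this] show ?thesis by (subst (asm) borel_measurable_if) auto
qed

text \<open>The set of disagreement is open and negligible, hence empty.\<close>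

lemma AE_eq_continuous_eq:
  fixes f g :: "real \<Rightarrow> complex"
  assumes S: "open S" "S \<subseteq> I" and c: "continuous_on S f" "continuous_on S g"
    and ae: "AE x in leb. x \<in> S \<longrightarrow> f x = g x" and x: "x \<in> S"
  shows "f x = g x"
proof (rule ccontr)
  assume ne: "f x \<noteq> g x"
  let ?U = "{t \<in> S. f t - g t \<in> - {0}}"
  have "open (- {0 :: complex})" by (simp add: open_Compl)
  from continuous_open_preimage[OF continuous_on_diff[OF c] S(1) this] have "open ?U"
    by (simp add: vimage_def Int_def)
  moreover have "?U \<noteq> {}" using ne x by auto
  ultimately have "\<not> negligible ?U" by (rule open_not_negligible)
  moreover obtain N where "negligible N" "\<forall>x\<in>I - N. x \<in> S \<longrightarrow> f x = g x"
    using ae unfolding AE_lebesgue_on_einterval by blast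
  then have "negligible ?U" using S(2) by (elim negligible_subset) auto
  ultimately show False by blast
qed

text \<open>In the regular case the derivatives that occur are integrable up to both endpoints. The
  predicate records absolute continuity, derivative, boundedness and the value at the left endpoint
  at once, and turns differentiation into algebra on \<open>u\<close>.\<close>

definition has_prim :: "(real \<Rightarrow> complex) \<Rightarrow> complex \<Rightarrow> (real \<Rightarrow> complex) \<Rightarrow> bool" where
  "has_prim F c u \<longleftrightarrow> integrable leb u \<and> (\<forall>x\<in>I. F x = c + prim a b u x)"

lemma has_prim_continuous_on:
  assumes "has_prim F c u"
  shows "continuous_on I F"
proof -
  have "continuous_on I (\<lambda>x. c + prim a b u x)"
    using assms by (intro continuous_intros prim_continuous_on) (simp add: has_prim_def)
  then show ?thesis using assms by (simp add: has_prim_def cong: continuous_on_cong)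
qed

lemma has_prim_AC_loc:
  assumes "has_prim F c u"
  shows "F \<in> AC_loc a b"
proof (rule AC_locI)
  fix x y assume xy: "x \<in> I" "y \<in> I" "x \<le> y"
  have u: "integrable leb u" using assms by (simp add: has_prim_def)
  show "AC_on x y F"
  proof (rule AC_on_dominated[OF prim_AC_on[OF u] prim_AC_on[OF u], where B=1])
    fix s t assume "x \<le> s" "s \<le> t" "t \<le> y"
    then have "s \<in> I" "t \<in> I" using Icc_subset_einterval[OF xy(1,2)] by auto
    then show "norm (F t - F s) \<le> 1 * (norm (prim a b u t - prim a b u s) + norm (prim a b u t - prim a b u s))"
      using assms by (simp add: has_prim_def)
  qed
qed

lemma has_prim_deriv:
  assumes "has_prim F c u"
  shows "AE x in leb. (F has_vector_derivative u x) (at x)"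
proof -
  have u: "integrable leb u" using assms by (simp add: has_prim_def)
  obtain N where N: "negligible N" "\<And>x. x \<in> I - N \<Longrightarrow> (prim a b u has_vector_derivative u x) (at x)"
    using prim_has_vector_derivative[OF u] unfolding AE_lebesgue_on_einterval by blast
  have "(F has_vector_derivative u x) (at x)" if "x \<in> I - N" for x
  proof (rule has_vector_derivative_transform_within_open)
    show "((\<lambda>x. c + prim a b u x) has_vector_derivative u x) (at x)"
      using has_vector_derivative_add[OF has_vector_derivative_const N(2)[OF that], of c] by simp
    show "open I" by simp
    show "x \<in> I" using that by simp
    show "c + prim a b u t = F t" if "t \<in> I" for t using assms that by (simp add: has_prim_def)
  qed
  then show ?thesis using N(1) unfolding AE_lebesgue_on_einterval by blast
qed

lemma has_prim_tendsto_left: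
  assumes "has_prim F c u"
  shows "((F \<circ> real_of_ereal) \<longlongrightarrow> c) (at_right a)"
proof -
  have u: "integrable leb u" using assms by (simp add: has_prim_def)
  have "((\<lambda>z. c + (prim a b u \<circ> real_of_ereal) z) \<longlongrightarrow> c + 0) (at_right a)"
    by (intro tendsto_add tendsto_const prim_at_left_end u)
  moreover have "eventually (\<lambda>z. c + (prim a b u \<circ> real_of_ereal) z = (F \<circ> real_of_ereal) z) (at_right a)"
    using eventually_in_einterval(1) by eventually_elim (use assms in \<open>simp add: has_prim_def\<close>)
  ultimately have "((F \<circ> real_of_ereal) \<longlongrightarrow> c + 0) (at_right a)" by (rule Lim_transform_eventually)
  then show ?thesis by simp
qed

lemma has_prim_tendsto_right:
  assumes "has_prim F c u"
  shows "((F \<circ> real_of_ereal) \<longlongrightarrow> c + (LINT t|leb. u t)) (at_left b)"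
proof -
  have u: "integrable leb u" using assms by (simp add: has_prim_def)
  have "((\<lambda>z. c + (prim a b u \<circ> real_of_ereal) z) \<longlongrightarrow> c + (LINT t|leb. u t)) (at_left b)"
    by (intro tendsto_add tendsto_const prim_at_right_end u)
  moreover have "eventually (\<lambda>z. c + (prim a b u \<circ> real_of_ereal) z = (F \<circ> real_of_ereal) z) (at_left b)"
    using eventually_in_einterval(2) by eventually_elim (use assms in \<open>simp add: has_prim_def\<close>)
  ultimately show ?thesis by (rule Lim_transform_eventually)
qed

lemma has_prim_left_value: "has_prim F c u \<Longrightarrow> left_value a F = c"
  unfolding left_value_def by (rule tendsto_Lim[OF at_ends_nontrivial(1) has_prim_tendsto_left])

lemma has_prim_right_value: "has_prim F c u \<Longrightarrow> right_value b F = c + (LINT t|leb. u t)"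
  unfolding right_value_def by (rule tendsto_Lim[OF at_ends_nontrivial(2) has_prim_tendsto_right])

lemma has_prim_measurable: "has_prim F c u \<Longrightarrow> F \<in> borel_measurable leb"
  by (rule continuous_measurable_leb[OF has_prim_continuous_on])

lemma has_prim_bounded:
  assumes "has_prim F c u" "x \<in> I"
  shows "norm (F x) \<le> norm c + (LINT t|leb. norm (u t))"
proof -
  have "F x = c + prim a b u x" using assms by (simp add: has_prim_def)
  then show ?thesis
    using norm_triangle_ineq[of c "prim a b u x"] prim_bounded[of u x] assms(1) by (simp add: has_prim_def)
qed

lemma has_primI:
  assumes "F \<in> AC_loc a b" "AE x in leb. (F has_vector_derivative u x) (at x)" "integrable leb u"
    "((F \<circ> real_of_ereal) \<longlongrightarrow> c) (at_right a)"
  shows "has_prim F c u"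
  using AC_loc_eq_prim[OF assms] assms(3) by (auto simp: has_prim_def)

lemma has_prim_const: "has_prim (\<lambda>x. c) c (\<lambda>x. 0)"
  by (simp add: has_prim_def prim_def)

lemma has_prim_prim: "integrable leb u \<Longrightarrow> has_prim (prim a b u) 0 u"
  by (simp add: has_prim_def)

lemma has_prim_add:
  "has_prim F c u \<Longrightarrow> has_prim G d v \<Longrightarrow> has_prim (\<lambda>x. F x + G x) (c + d) (\<lambda>x. u x + v x)"
  by (auto simp: has_prim_def prim_add)

lemma has_prim_mult:
  assumes F: "has_prim F c u" and G: "has_prim G d v"
  shows "has_prim (\<lambda>x. F x * G x) (c * d) (\<lambda>x. u x * G x + F x * v x)"
proof (rule has_primI)
  have u: "integrable leb u" "integrable leb v" using F G by (auto simp: has_prim_def)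
  show "(\<lambda>x. F x * G x) \<in> AC_loc a b" by (intro AC_loc_mult has_prim_AC_loc[OF F] has_prim_AC_loc[OF G])
  show "AE x in leb. ((\<lambda>x. F x * G x) has_vector_derivative u x * G x + F x * v x) (at x)"
    using has_prim_deriv[OF F] has_prim_deriv[OF G]
  proof eventually_elim
    case (elim x) then show ?case using has_vector_derivative_mult[OF elim] by (simp add: add.commute)
  qed
  have "(\<lambda>x. F x * v x) = (\<lambda>x. v x * F x)" by (simp add: fun_eq_iff)
  then have "integrable leb (\<lambda>x. F x * v x)"
    using integrable_mult_bounded[OF u(2) has_prim_measurable[OF F] has_prim_bounded[OF F]] by simp
  then show "integrable leb (\<lambda>x. u x * G x + F x * v x)"
    by (intro Bochner_Integration.integrable_add integrable_mult_bounded[OF u(1) has_prim_measurable[OF G] has_prim_bounded[OF G]])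
  show "(((\<lambda>x. F x * G x) \<circ> real_of_ereal) \<longlongrightarrow> c * d) (at_right a)"
    using tendsto_mult[OF has_prim_tendsto_left[OF F] has_prim_tendsto_left[OF G]] by (simp add: o_def)
qed

lemma has_prim_scale: "has_prim F c u \<Longrightarrow> has_prim (\<lambda>x. k * F x) (k * c) (\<lambda>x. k * u x)"
  using has_prim_mult[OF has_prim_const, of F c u k] by simp

lemma has_prim_diff:
  "has_prim F c u \<Longrightarrow> has_prim G d v \<Longrightarrow> has_prim (\<lambda>x. F x - G x) (c - d) (\<lambda>x. u x - v x)"
  using has_prim_add[of F c u "\<lambda>x. (-1) * G x" "(-1) * d" "\<lambda>x. (-1) * v x"] has_prim_scale[of G d v "-1"] by simp

lemma has_prim_cong:
  assumes "has_prim F c u" "\<And>x. x \<in> I \<Longrightarrow> F x = F' x" "\<And>x. x \<in> I \<Longrightarrow> u x = u' x" "c = c'"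
  shows "has_prim F' c' u'"
proof -
  have "integrable leb u \<longleftrightarrow> integrable leb u'"
    by (rule Bochner_Integration.integrable_cong) (use assms(3) in auto)
  then have "integrable leb u'" using assms(1) by (simp add: has_prim_def)
  moreover have "prim a b u x = prim a b u' x" for x by (rule prim_cong[OF assms(3)])
  ultimately show ?thesis using assms by (auto simp: has_prim_def)
qed

end

section \<open>Solutions of the Sturm--Liouville equation\<close>

locale sturm_liouville = nonempty_einterval +
  fixes p q r s :: "real \<Rightarrow> real"
  assumes p_measurable: "p \<in> borel_measurable (lebesgue_on (einterval a b))"
    and p_integrable: "integrable (lebesgue_on (einterval a b)) (\<lambda>x. 1 / p x)"
    and q_integrable: "integrable (lebesgue_on (einterval a b)) q"
    and r_integrable: "integrable (lebesgue_on (einterval a b)) r"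
    and s_integrable: "integrable (lebesgue_on (einterval a b)) s"
    and p_pos: "AE x in lebesgue_on (einterval a b). 0 < p x"
    and r_pos: "AE x in lebesgue_on (einterval a b). 0 < r x"
begin

abbreviation (input) "M \<equiv> weighted_measure a b r"

lemma r_measurable [measurable]: "r \<in> borel_measurable leb"
  using r_integrable by (rule borel_measurable_integrable)

lemma r_nonneg: "AE x in leb. 0 \<le> r x"
  using r_pos by eventually_elim simp

lemma sets_M [measurable_cong]: "sets M = sets leb"
  by (simp add: weighted_measure_def)

text \<open>Positivity of \<open>r\<close> gives the weighted measure the same null sets as Lebesgue
  measure.\<close>

lemma AE_M: "(AE x in M. P x) \<longleftrightarrow> (AE x in leb. P x)"
proof -
  have "(AE x in M. P x) \<longleftrightarrow> (AE x in leb. 0 < ennreal (r x) \<longrightarrow> P x)"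
    unfolding weighted_measure_def by (rule AE_density) simp
  also have "\<dots> \<longleftrightarrow> (AE x in leb. P x)"
  proof
    assume "AE x in leb. 0 < ennreal (r x) \<longrightarrow> P x"
    with r_pos show "AE x in leb. P x" by eventually_elim simp
  qed (auto elim: eventually_mono)
  finally show ?thesis .
qed

lemma measurable_M: "f \<in> borel_measurable M \<longleftrightarrow> f \<in> borel_measurable leb"
  by (simp add: measurable_cong_sets[OF sets_M refl])

lemma integrable_M:
  fixes f :: "real \<Rightarrow> 'b::{banach, second_countable_topology}"
  shows "f \<in> borel_measurable leb \<Longrightarrow> integrable M f \<longleftrightarrow> integrable leb (\<lambda>x. r x *\<^sub>R f x)"
  unfolding weighted_measure_def by (rule integrable_density[OF _ r_measurable r_nonneg])

lemma integral_M:
  fixes f :: "real \<Rightarrow> 'b::{banach, second_countable_topology}"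
  shows "f \<in> borel_measurable leb \<Longrightarrow> (LINT x|M. f x) = (LINT x|leb. r x *\<^sub>R f x)"
  unfolding weighted_measure_def by (rule integral_density[OF _ r_measurable r_nonneg])

sublocale M: finite_measure "weighted_measure a b r"
proof
  have "integrable M (\<lambda>x. 1 :: real)" using r_integrable by (subst integrable_M) auto
  then show "emeasure M (space M) \<noteq> \<infinity>"
    by (simp add: integrable_iff_bounded)
qed

lemma L2_M_measurable: "h \<in> L2 M \<Longrightarrow> h \<in> borel_measurable leb"
  using L2_measurable measurable_M by blast

lemma L2_M_bounded:
  assumes "f \<in> borel_measurable leb" "\<And>x. x \<in> I \<Longrightarrow> cmod (f x) \<le> B"
  shows "f \<in> L2 M"
  by (rule M.L2_bounded[where B=B]) (use assms in \<open>auto simp: measurable_M AE_M intro!: AE_I2\<close>)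

text \<open>Finite total weight makes the source \<open>r * h\<close> of the first-order system
  integrable, which is why variation of constants reaches all of L2.\<close>

lemma L2_M_integrable: "h \<in> L2 M \<Longrightarrow> integrable leb (\<lambda>x. complex_of_real (r x) * h x)"
  using M.L2_integrable[of h] by (simp add: integrable_M L2_M_measurable scaleR_conv_of_real)

lemma L2_AE_eq:
  assumes "f \<in> L2 M" "AE x in leb. f x = g x"
  shows "g \<in> L2 M"
  using assms leb_borel_measurable_AE[OF L2_M_measurable[OF assms(1)] assms(2)]
  by (intro L2_AE_cong[OF assms(1)]) (auto simp: measurable_M AE_M)

end

text \<open>The equation as a first-order system for a solution \<open>y\<close> and its
  quasi-derivative \<open>z\<close>: \<open>y' = - s * y + z / p\<close> and
  \<open>z' = q * y + s * z\<close>. Real values are required at every point, also outside the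
  interval, so that conjugation identities hold between functions.\<close>

locale sturm_liouville_system = sturm_liouville +
  fixes y1 z1 y2 z2 :: "real \<Rightarrow> complex"
  assumes y1: "has_prim y1 1 (\<lambda>x. of_real (- s x) * y1 x + of_real (1 / p x) * z1 x)"
    and z1: "has_prim z1 0 (\<lambda>x. of_real (q x) * y1 x + of_real (s x) * z1 x)"
    and y2: "has_prim y2 0 (\<lambda>x. of_real (- s x) * y2 x + of_real (1 / p x) * z2 x)"
    and z2: "has_prim z2 1 (\<lambda>x. of_real (q x) * y2 x + of_real (s x) * z2 x)"
    and real_solutions: "\<And>x. y1 x \<in> \<real>" "\<And>x. z1 x \<in> \<real>" "\<And>x. y2 x \<in> \<real>" "\<And>x. z2 x \<in> \<real>"

section \<open>Existence of the fundamental system, uniqueness of quasi-derivatives\<close>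

context sturm_liouville
begin

lemma system_exists: "\<exists>y1 z1 y2 z2. sturm_liouville_system a b p q r s y1 z1 y2 z2"
proof -
  have ex: "\<exists>Y Z :: real \<Rightarrow> complex. has_prim Y (complex_of_real \<alpha>) (\<lambda>x. of_real (- s x) * Y x + of_real (1 / p x) * Z x) \<and>
      has_prim Z (complex_of_real \<beta>) (\<lambda>x. of_real (q x) * Y x + of_real (s x) * Z x) \<and> (\<forall>x. Y x \<in> \<real>) \<and> (\<forall>x. Z x \<in> \<real>)" for \<alpha> \<beta>
  proof -
    obtain Y Z :: "real \<Rightarrow> real" where YZ:
      "integrable leb (\<lambda>t. - s t * Y t + 1 / p t * Z t)" "integrable leb (\<lambda>t. q t * Y t + s t * Z t)"
      "\<And>x. x \<in> I \<Longrightarrow> Y x = \<alpha> + prim a b (\<lambda>t. - s t * Y t + 1 / p t * Z t) x"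
      "\<And>x. x \<in> I \<Longrightarrow> Z x = \<beta> + prim a b (\<lambda>t. q t * Y t + s t * Z t) x"
      by (rule linear_system_solution[of "\<lambda>t. - s t" "\<lambda>t. 1 / p t" q s \<alpha> \<beta>])
        (use p_integrable q_integrable s_integrable in auto)
    have "has_prim (\<lambda>x. complex_of_real (Y x)) (complex_of_real \<alpha>) (\<lambda>x. complex_of_real (- s x * Y x + 1 / p x * Z x))"
      "has_prim (\<lambda>x. complex_of_real (Z x)) (complex_of_real \<beta>) (\<lambda>x. complex_of_real (q x * Y x + s x * Z x))"
    proof -
      have "complex_of_real (Y x) = \<alpha> + prim a b (\<lambda>x. complex_of_real (- s x * Y x + 1 / p x * Z x)) x"
        "complex_of_real (Z x) = \<beta> + prim a b (\<lambda>x. complex_of_real (q x * Y x + s x * Z x)) x" if "x \<in> I" for x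
        unfolding prim_of_real of_real_add[symmetric] of_real_eq_iff by (rule YZ(3)[OF that], rule YZ(4)[OF that])
      then show "has_prim (\<lambda>x. complex_of_real (Y x)) (complex_of_real \<alpha>) (\<lambda>x. complex_of_real (- s x * Y x + 1 / p x * Z x))"
        "has_prim (\<lambda>x. complex_of_real (Z x)) (complex_of_real \<beta>) (\<lambda>x. complex_of_real (q x * Y x + s x * Z x))"
        using integrable_of_real[OF YZ(1)] integrable_of_real[OF YZ(2)] by (simp_all only: has_prim_def, blast+)
    qed
    then have "has_prim (\<lambda>x. complex_of_real (Y x)) (complex_of_real \<alpha>) (\<lambda>x. of_real (- s x) * complex_of_real (Y x) + of_real (1 / p x) * complex_of_real (Z x)) \<and>
      has_prim (\<lambda>x. complex_of_real (Z x)) (complex_of_real \<beta>) (\<lambda>x. of_real (q x) * complex_of_real (Y x) + of_real (s x) * complex_of_real (Z x))"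
      by simp
    then show ?thesis by (intro exI[of _ "\<lambda>x. complex_of_real (Y x)"] exI[of _ "\<lambda>x. complex_of_real (Z x)"]) simp
  qed
  from ex[of 1 0] ex[of 0 1] obtain y1 z1 y2 z2 where
    "has_prim y1 1 (\<lambda>x. of_real (- s x) * y1 x + of_real (1 / p x) * z1 x)" "has_prim z1 0 (\<lambda>x. of_real (q x) * y1 x + of_real (s x) * z1 x)"
    "\<forall>x. y1 x \<in> \<real>" "\<forall>x. z1 x \<in> \<real>"
    "has_prim y2 0 (\<lambda>x. of_real (- s x) * y2 x + of_real (1 / p x) * z2 x)" "has_prim z2 1 (\<lambda>x. of_real (q x) * y2 x + of_real (s x) * z2 x)"
    "\<forall>x. y2 x \<in> \<real>" "\<forall>x. z2 x \<in> \<real>"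
    unfolding of_real_0 of_real_1 by blast
  then have "sturm_liouville_system a b p q r s y1 z1 y2 z2"
    by unfold_locales auto
  then show ?thesis by blast
qed

lemma is_quasi_deriv_unique:
  assumes "is_quasi_deriv a b p s f g" "is_quasi_deriv a b p s f g'" "x \<in> I"
  shows "g x = g' x"
proof (rule AE_eq_continuous_eq[OF open_einterval order_refl _ _ _ assms(3)])
  show "AE x in leb. x \<in> I \<longrightarrow> g x = g' x"
    using assms(1,2) unfolding is_quasi_deriv_def by auto
qed (use assms(1,2) in \<open>auto simp: is_quasi_deriv_def intro: AC_loc_continuous_on\<close>)

lemma quasi_deriv_eq: "is_quasi_deriv a b p s f g \<Longrightarrow> x \<in> I \<Longrightarrow> quasi_deriv a b p s f x = g x"
  unfolding quasi_deriv_def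
  using is_quasi_deriv_unique[OF someI[of "is_quasi_deriv a b p s f" g], of g x] by blast

end

section \<open>Variation of constants\<close>

context sturm_liouville_system
begin

abbreviation (input) "wint h \<equiv> integrable (lebesgue_on (einterval a b)) (\<lambda>t. complex_of_real (r t) * h t)"

definition "prim1 h = prim a b (\<lambda>t. y1 t * (complex_of_real (r t) * h t))"
definition "prim2 h = prim a b (\<lambda>t. y2 t * (complex_of_real (r t) * h t))"
definition "mom1 h = (LINT t|leb. y1 t * (complex_of_real (r t) * h t))"
definition "mom2 h = (LINT t|leb. y2 t * (complex_of_real (r t) * h t))"

text \<open>
  Variation of constants: \<open>sol \<alpha> \<beta> h\<close> solves $\tau f = h$ with $f(a) = \alpha$ and $f^{[1]}(a) = \beta$,
  and \<open>dsol \<alpha> \<beta> h\<close> is its quasi-derivative.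
\<close>

definition "sol \<alpha> \<beta> h x = y1 x * (\<alpha> + prim2 h x) + y2 x * (\<beta> - prim1 h x)"
definition "dsol \<alpha> \<beta> h x = z1 x * (\<alpha> + prim2 h x) + z2 x * (\<beta> - prim1 h x)"

definition "y1b = right_value b y1"
definition "y2b = right_value b y2"
definition "z1b = right_value b z1"
definition "z2b = right_value b z2"

text \<open>The derivative of the Wronskian cancels identically, so it keeps its value at
  \<open>a\<close>.\<close>

lemma wronskian: "x \<in> I \<Longrightarrow> y1 x * z2 x - y2 x * z1 x = 1"
proof -
  assume x: "x \<in> I"
  have "has_prim (\<lambda>x. y1 x * z2 x - y2 x * z1 x) (1 * 1 - 0 * 0)
    (\<lambda>x. ((of_real (- s x) * y1 x + of_real (1 / p x) * z1 x) * z2 x + y1 x * (of_real (q x) * y2 x + of_real (s x) * z2 x)) -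
      ((of_real (- s x) * y2 x + of_real (1 / p x) * z2 x) * z1 x + y2 x * (of_real (q x) * y1 x + of_real (s x) * z1 x)))"
    by (intro has_prim_diff has_prim_mult y1 y2 z1 z2)
  then have "has_prim (\<lambda>x. y1 x * z2 x - y2 x * z1 x) 1 (\<lambda>x. 0)"
    by (rule has_prim_cong) (simp_all add: algebra_simps)
  then show ?thesis using x by (simp add: has_prim_def prim_def)
qed

lemma y_tendsto_right:
  "((y1 \<circ> real_of_ereal) \<longlongrightarrow> y1b) (at_left b)" "((y2 \<circ> real_of_ereal) \<longlongrightarrow> y2b) (at_left b)"
  "((z1 \<circ> real_of_ereal) \<longlongrightarrow> z1b) (at_left b)" "((z2 \<circ> real_of_ereal) \<longlongrightarrow> z2b) (at_left b)"
  unfolding y1b_def y2b_def z1b_def z2b_def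
  using has_prim_tendsto_right[OF y1] has_prim_right_value[OF y1]
    has_prim_tendsto_right[OF y2] has_prim_right_value[OF y2]
    has_prim_tendsto_right[OF z1] has_prim_right_value[OF z1]
    has_prim_tendsto_right[OF z2] has_prim_right_value[OF z2] by auto

lemma wronskian_b: "y1b * z2b - y2b * z1b = 1"
proof (rule tendsto_unique[OF at_ends_nontrivial(2)])
  show "((\<lambda>z. (y1 \<circ> real_of_ereal) z * (z2 \<circ> real_of_ereal) z - (y2 \<circ> real_of_ereal) z * (z1 \<circ> real_of_ereal) z)
      \<longlongrightarrow> y1b * z2b - y2b * z1b) (at_left b)"
    by (intro tendsto_intros y_tendsto_right)
  show "((\<lambda>z. (y1 \<circ> real_of_ereal) z * (z2 \<circ> real_of_ereal) z - (y2 \<circ> real_of_ereal) z * (z1 \<circ> real_of_ereal) z)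
      \<longlongrightarrow> 1) (at_left b)"
    by (rule tendsto_eventually, rule eventually_mono[OF eventually_in_einterval(2)]) (simp add: wronskian)
qed

lemma real_b: "y1b \<in> \<real>" "y2b \<in> \<real>" "z1b \<in> \<real>" "z2b \<in> \<real>"
  using Lim_in_closed_set[OF closed_complex_Reals always_eventually at_ends_nontrivial(2) y_tendsto_right(1)]
    Lim_in_closed_set[OF closed_complex_Reals always_eventually at_ends_nontrivial(2) y_tendsto_right(2)]
    Lim_in_closed_set[OF closed_complex_Reals always_eventually at_ends_nontrivial(2) y_tendsto_right(3)]
    Lim_in_closed_set[OF closed_complex_Reals always_eventually at_ends_nontrivial(2) y_tendsto_right(4)]
    real_solutions by simp_all

lemma y_bounded: obtains B where "0 < B" "\<And>x. x \<in> I \<Longrightarrow> cmod (y1 x) \<le> B" "\<And>x. x \<in> I \<Longrightarrow> cmod (y2 x) \<le> B"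
proof -
  obtain B1 B2 where B: "\<And>x. x \<in> I \<Longrightarrow> cmod (y1 x) \<le> B1" "\<And>x. x \<in> I \<Longrightarrow> cmod (y2 x) \<le> B2"
    using has_prim_bounded[OF y1] has_prim_bounded[OF y2] by blast
  show ?thesis
    by (rule that[of "max 1 (max B1 B2)"]) (use B in \<open>auto intro: order_trans[OF _ max.cobounded1] simp: le_max_iff_disj\<close>)
qed

lemma y_measurable [measurable]:
  "y1 \<in> borel_measurable leb" "y2 \<in> borel_measurable leb" "z1 \<in> borel_measurable leb" "z2 \<in> borel_measurable leb"
  using has_prim_measurable y1 y2 z1 z2 by blast+

lemma y_wint: "wint h \<Longrightarrow> integrable leb (\<lambda>t. y1 t * (complex_of_real (r t) * h t))"
  "wint h \<Longrightarrow> integrable leb (\<lambda>t. y2 t * (complex_of_real (r t) * h t))"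
proof -
  have swap: "(\<lambda>t. y1 t * (complex_of_real (r t) * h t)) = (\<lambda>t. (complex_of_real (r t) * h t) * y1 t)"
    "(\<lambda>t. y2 t * (complex_of_real (r t) * h t)) = (\<lambda>t. (complex_of_real (r t) * h t) * y2 t)"
    by (simp_all only: mult.commute)
  show "wint h \<Longrightarrow> integrable leb (\<lambda>t. y1 t * (complex_of_real (r t) * h t))"
    "wint h \<Longrightarrow> integrable leb (\<lambda>t. y2 t * (complex_of_real (r t) * h t))"
    unfolding swap
    using integrable_mult_bounded[OF _ y_measurable(1) has_prim_bounded[OF y1]]
      integrable_mult_bounded[OF _ y_measurable(2) has_prim_bounded[OF y2]] by blast+
qed

lemma prim12:
  "wint h \<Longrightarrow> has_prim (prim1 h) 0 (\<lambda>t. y1 t * (complex_of_real (r t) * h t))"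
  "wint h \<Longrightarrow> has_prim (prim2 h) 0 (\<lambda>t. y2 t * (complex_of_real (r t) * h t))"
  unfolding prim1_def prim2_def by (intro has_prim_prim y_wint; assumption)+

text \<open>The two source terms \<open>y1 * y2 * r * h\<close> coming from the varying coefficients
  cancel, so the first equation of the system contains no source.\<close>

lemma sol_has_prim:
  assumes h: "wint h"
  shows "has_prim (sol \<alpha> \<beta> h) \<alpha> (\<lambda>x. of_real (- s x) * sol \<alpha> \<beta> h x + of_real (1 / p x) * dsol \<alpha> \<beta> h x)"
proof (rule has_prim_cong)
  show "has_prim (\<lambda>x. y1 x * (\<alpha> + prim2 h x) + y2 x * (\<beta> - prim1 h x)) (1 * (\<alpha> + 0) + 0 * (\<beta> - 0))
    (\<lambda>x. ((of_real (- s x) * y1 x + of_real (1 / p x) * z1 x) * (\<alpha> + prim2 h x) + y1 x * (0 + y2 x * (complex_of_real (r x) * h x))) +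
      ((of_real (- s x) * y2 x + of_real (1 / p x) * z2 x) * (\<beta> - prim1 h x) + y2 x * (0 - y1 x * (complex_of_real (r x) * h x))))"
    by (intro has_prim_add has_prim_diff has_prim_mult y1 y2 prim12 h has_prim_const)
qed (simp_all add: sol_def dsol_def algebra_simps)

text \<open>Here the varying coefficients leave minus the Wronskian times \<open>r * h\<close>, and
  the Wronskian is 1.\<close>

lemma dsol_has_prim:
  assumes h: "wint h"
  shows "has_prim (dsol \<alpha> \<beta> h) \<beta> (\<lambda>x. of_real (q x) * sol \<alpha> \<beta> h x + of_real (s x) * dsol \<alpha> \<beta> h x - complex_of_real (r x) * h x)"
proof (rule has_prim_cong)
  show "has_prim (\<lambda>x. z1 x * (\<alpha> + prim2 h x) + z2 x * (\<beta> - prim1 h x)) (0 * (\<alpha> + 0) + 1 * (\<beta> - 0))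
    (\<lambda>x. ((of_real (q x) * y1 x + of_real (s x) * z1 x) * (\<alpha> + prim2 h x) + z1 x * (0 + y2 x * (complex_of_real (r x) * h x))) +
      ((of_real (q x) * y2 x + of_real (s x) * z2 x) * (\<beta> - prim1 h x) + z2 x * (0 - y1 x * (complex_of_real (r x) * h x))))"
    by (intro has_prim_add has_prim_diff has_prim_mult z1 z2 prim12 h has_prim_const)
  fix x assume x: "x \<in> I"
  have "z1 x * (y2 x * (complex_of_real (r x) * h x)) - z2 x * (y1 x * (complex_of_real (r x) * h x))
      = - (y1 x * z2 x - y2 x * z1 x) * (complex_of_real (r x) * h x)" by (simp add: algebra_simps)
  also have "\<dots> = - (complex_of_real (r x) * h x)" using wronskian[OF x] by simp
  finally have w: "z1 x * (y2 x * (complex_of_real (r x) * h x)) - z2 x * (y1 x * (complex_of_real (r x) * h x)) = - (complex_of_real (r x) * h x)" .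
  have "((of_real (q x) * y1 x + of_real (s x) * z1 x) * (\<alpha> + prim2 h x) + z1 x * (0 + y2 x * (complex_of_real (r x) * h x))) +
      ((of_real (q x) * y2 x + of_real (s x) * z2 x) * (\<beta> - prim1 h x) + z2 x * (0 - y1 x * (complex_of_real (r x) * h x)))
    = of_real (q x) * sol \<alpha> \<beta> h x + of_real (s x) * dsol \<alpha> \<beta> h x
      + (z1 x * (y2 x * (complex_of_real (r x) * h x)) - z2 x * (y1 x * (complex_of_real (r x) * h x)))"
    by (simp add: sol_def dsol_def algebra_simps)
  then show "((of_real (q x) * y1 x + of_real (s x) * z1 x) * (\<alpha> + prim2 h x) + z1 x * (0 + y2 x * (complex_of_real (r x) * h x))) +
      ((of_real (q x) * y2 x + of_real (s x) * z2 x) * (\<beta> - prim1 h x) + z2 x * (0 - y1 x * (complex_of_real (r x) * h x)))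
    = of_real (q x) * sol \<alpha> \<beta> h x + of_real (s x) * dsol \<alpha> \<beta> h x - complex_of_real (r x) * h x"
    unfolding w by simp
qed (simp_all add: dsol_def)

text \<open>Agreement is asked on the interval only, since values outside carry no meaning. All
  boundary values used later are read off from here.\<close>

lemma sol_quasi_deriv:
  assumes h: "wint h" and f: "\<And>x. x \<in> I \<Longrightarrow> f x = sol \<alpha> \<beta> h x"
  shows "f \<in> D_tau a b p s" "\<And>x. x \<in> I \<Longrightarrow> quasi_deriv a b p s f x = dsol \<alpha> \<beta> h x"
    "AE x in leb. tau a b p q r s f x = h x"
    "left_value a f = \<alpha>" "left_value a (quasi_deriv a b p s f) = \<beta>"
    "right_value b f = y1b * (\<alpha> + mom2 h) + y2b * (\<beta> - mom1 h)"
    "right_value b (quasi_deriv a b p s f) = z1b * (\<alpha> + mom2 h) + z2b * (\<beta> - mom1 h)"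
proof -
  have sp: "has_prim f \<alpha> (\<lambda>x. of_real (- s x) * sol \<alpha> \<beta> h x + of_real (1 / p x) * dsol \<alpha> \<beta> h x)"
    by (rule has_prim_cong[OF sol_has_prim[OF h]]) (simp_all add: f)
  note dp = dsol_has_prim[OF h]
  have iq: "is_quasi_deriv a b p s f (dsol \<alpha> \<beta> h)"
    unfolding is_quasi_deriv_def
  proof (intro conjI has_prim_AC_loc[OF dp])
    show "AE x in leb. dsol \<alpha> \<beta> h x = complex_of_real (p x) * (vector_derivative f (at x) + complex_of_real (s x) * f x)"
      using has_prim_deriv[OF sp] p_pos AE_space
    proof eventually_elim
      case (elim x)
      then have "vector_derivative f (at x) = of_real (- s x) * sol \<alpha> \<beta> h x + of_real (1 / p x) * dsol \<alpha> \<beta> h x"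
        by (intro vector_derivative_at)
      then show ?case using elim f[of x] by (simp add: field_simps)
    qed
  qed
  then show "f \<in> D_tau a b p s" using has_prim_AC_loc[OF sp] by (auto simp: D_tau_def)
  show qd: "quasi_deriv a b p s f x = dsol \<alpha> \<beta> h x" if "x \<in> I" for x by (rule quasi_deriv_eq[OF iq that])
  have dp': "has_prim (quasi_deriv a b p s f) \<beta> (\<lambda>x. of_real (q x) * sol \<alpha> \<beta> h x + of_real (s x) * dsol \<alpha> \<beta> h x - complex_of_real (r x) * h x)"
    by (rule has_prim_cong[OF dp]) (simp_all add: qd)
  show "AE x in leb. tau a b p q r s f x = h x"
    using has_prim_deriv[OF dp'] r_pos AE_space
  proof eventually_elim
    case (elim x)
    then have "vector_derivative (quasi_deriv a b p s f) (at x) = of_real (q x) * sol \<alpha> \<beta> h x + of_real (s x) * dsol \<alpha> \<beta> h x - complex_of_real (r x) * h x"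
      by (intro vector_derivative_at)
    then show ?case using elim f[of x] qd[of x] by (simp add: tau_def)
  qed
  show "left_value a f = \<alpha>" by (rule has_prim_left_value[OF sp])
  show "left_value a (quasi_deriv a b p s f) = \<beta>" by (rule has_prim_left_value[OF dp'])
  have P: "((prim1 h \<circ> real_of_ereal) \<longlongrightarrow> mom1 h) (at_left b)" "((prim2 h \<circ> real_of_ereal) \<longlongrightarrow> mom2 h) (at_left b)"
    using has_prim_tendsto_right[OF prim12(1)[OF h]] has_prim_tendsto_right[OF prim12(2)[OF h]] by (simp_all add: mom1_def mom2_def)
  show "right_value b f = y1b * (\<alpha> + mom2 h) + y2b * (\<beta> - mom1 h)"
    unfolding right_value_def
  proof (rule tendsto_Lim[OF at_ends_nontrivial(2)], rule Lim_transform_eventually)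
    show "((\<lambda>z. (y1 \<circ> real_of_ereal) z * (\<alpha> + (prim2 h \<circ> real_of_ereal) z) + (y2 \<circ> real_of_ereal) z * (\<beta> - (prim1 h \<circ> real_of_ereal) z))
       \<longlongrightarrow> y1b * (\<alpha> + mom2 h) + y2b * (\<beta> - mom1 h)) (at_left b)"
      by (intro tendsto_intros y_tendsto_right P)
    show "eventually (\<lambda>z. (y1 \<circ> real_of_ereal) z * (\<alpha> + (prim2 h \<circ> real_of_ereal) z) + (y2 \<circ> real_of_ereal) z * (\<beta> - (prim1 h \<circ> real_of_ereal) z) = (f \<circ> real_of_ereal) z) (at_left b)"
      using eventually_in_einterval(2) by eventually_elim (simp add: f sol_def)
  qed
  show "right_value b (quasi_deriv a b p s f) = z1b * (\<alpha> + mom2 h) + z2b * (\<beta> - mom1 h)"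
    unfolding right_value_def
  proof (rule tendsto_Lim[OF at_ends_nontrivial(2)], rule Lim_transform_eventually)
    show "((\<lambda>z. (z1 \<circ> real_of_ereal) z * (\<alpha> + (prim2 h \<circ> real_of_ereal) z) + (z2 \<circ> real_of_ereal) z * (\<beta> - (prim1 h \<circ> real_of_ereal) z))
       \<longlongrightarrow> z1b * (\<alpha> + mom2 h) + z2b * (\<beta> - mom1 h)) (at_left b)"
      by (intro tendsto_intros y_tendsto_right P)
    show "eventually (\<lambda>z. (z1 \<circ> real_of_ereal) z * (\<alpha> + (prim2 h \<circ> real_of_ereal) z) + (z2 \<circ> real_of_ereal) z * (\<beta> - (prim1 h \<circ> real_of_ereal) z) = (quasi_deriv a b p s f \<circ> real_of_ereal) z) (at_left b)"
      using eventually_in_einterval(2) by eventually_elim (simp add: qd dsol_def)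
  qed
qed

text \<open>
  Conversely, the Wronskians of \<open>f\<close> with the fundamental system are primitives, so that no
  Gronwall-type argument is needed for uniqueness.
\<close>

theorem D_tau_eq_sol:
  assumes f: "f \<in> D_tau a b p s" and h: "wint (tau a b p q r s f)"
  obtains \<alpha> \<beta> where "\<And>x. x \<in> I \<Longrightarrow> f x = sol \<alpha> \<beta> (tau a b p q r s f) x"
proof -
  let ?h = "tau a b p q r s f" and ?g = "quasi_deriv a b p s f"
  have iq: "is_quasi_deriv a b p s f ?g"
  proof -
    have "\<exists>g. is_quasi_deriv a b p s f g" using f by (simp add: D_tau_def)
    then show ?thesis unfolding quasi_deriv_def by (rule someI_ex)
  qed
  have AC: "f \<in> AC_loc a b" "?g \<in> AC_loc a b" using f iq by (auto simp: D_tau_def is_quasi_deriv_def)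
  have g_eq: "AE x in leb. ?g x = of_real (p x) * (vector_derivative f (at x) + of_real (s x) * f x)"
    using iq by (simp add: is_quasi_deriv_def)
  have fd: "AE x in leb. (f has_vector_derivative (of_real (1 / p x) * ?g x - of_real (s x) * f x)) (at x)"
    using AC_loc_has_vector_derivative[OF AC(1) ab] g_eq p_pos
    by eventually_elim (simp add: field_simps)
  have gd: "AE x in leb. (?g has_vector_derivative (of_real (s x) * ?g x + of_real (q x) * f x - of_real (r x) * ?h x)) (at x)"
    using AC_loc_has_vector_derivative[OF AC(2) ab] r_pos
  proof eventually_elim
    case (elim x)
    have "of_real (s x) * ?g x + of_real (q x) * f x - of_real (r x) * ?h x = vector_derivative ?g (at x)"
      using elim(2) by (simp add: tau_def)
    then show ?case using elim(1) by simp
  qed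
  \<comment> \<open>For a homogeneous solution \<open>y\<close> with quasi-derivative
    \<open>z\<close>, the Wronskian \<open>y * ?g - z * f\<close> has derivative
    \<open>- y * r * ?h\<close>: all coefficient terms cancel. Only increments are used, because
    limits of \<open>f\<close> at the endpoints are not yet known to exist.\<close>
  have W: "y x * ?g x - z x * f x + prim a b (\<lambda>t. y t * (of_real (r t) * ?h t)) x = y c * ?g c - z c * f c + prim a b (\<lambda>t. y t * (of_real (r t) * ?h t)) c"
    if y: "has_prim y k1 (\<lambda>x. of_real (- s x) * y x + of_real (1 / p x) * z x)"
      and z: "has_prim z k2 (\<lambda>x. of_real (q x) * y x + of_real (s x) * z x)"
      and int: "integrable leb (\<lambda>t. y t * (of_real (r t) * ?h t))"
      and x: "x \<in> I" and c: "c \<in> I" for y z k1 k2 x c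
  proof -
    have "(y x * ?g x - z x * f x) - (y c * ?g c - z c * f c) = prim a b (\<lambda>t. (-1) * (y t * (of_real (r t) * ?h t))) x - prim a b (\<lambda>t. (-1) * (y t * (of_real (r t) * ?h t))) c"
    proof (rule AC_loc_increment[OF _ _ _ c x])
      show "(\<lambda>x. y x * ?g x - z x * f x) \<in> AC_loc a b"
        by (intro AC_loc_diff AC_loc_mult AC has_prim_AC_loc[OF y] has_prim_AC_loc[OF z])
      show "AE x in leb. ((\<lambda>x. y x * ?g x - z x * f x) has_vector_derivative (-1) * (y x * (of_real (r x) * ?h x))) (at x)"
        using has_prim_deriv[OF y] has_prim_deriv[OF z] fd gd
      proof eventually_elim
        case (elim x)
        note d = has_vector_derivative_diff[OF has_vector_derivative_mult[OF elim(1,4)] has_vector_derivative_mult[OF elim(2,3)]]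
        show ?case by (rule has_vector_derivative_eq_rhs[OF d]) (simp add: algebra_simps)
      qed
      show "integrable leb (\<lambda>t. (-1) * (y t * (of_real (r t) * ?h t)))" using int by simp
    qed
    then show ?thesis unfolding prim_mult_left by (simp add: algebra_simps)
  qed
  obtain c where c: "c \<in> I" using einterval_nonempty[OF ab] by blast
  \<comment> \<open>The data are extracted at an interior point \<open>c\<close>: up to sign they
    are the two Wronskians at \<open>c\<close>, carried back to \<open>a\<close> by the
    primitives.\<close>
  define \<beta> where "\<beta> = y1 c * ?g c - z1 c * f c + prim1 ?h c"
  define \<alpha> where "\<alpha> = - (y2 c * ?g c - z2 c * f c + prim2 ?h c)"
  have "f x = sol \<alpha> \<beta> ?h x" if x: "x \<in> I" for x
  proof -
    have 1: "y1 x * ?g x - z1 x * f x = \<beta> - prim1 ?h x"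
      using W[OF y1 z1 y_wint(1)[OF h] x c] unfolding \<beta>_def prim1_def by (simp add: algebra_simps)
    have 2: "- (y2 x * ?g x - z2 x * f x) = \<alpha> + prim2 ?h x"
      using W[OF y2 z2 y_wint(2)[OF h] x c] unfolding \<alpha>_def prim2_def by (simp add: algebra_simps)
    \<comment> \<open>Cramer's rule: inserting the Wronskian 1 recovers \<open>f\<close> from its
      Wronskians with both fundamental solutions.\<close>
    have "f x = (y1 x * z2 x - y2 x * z1 x) * f x" by (simp add: wronskian[OF x])
    also have "\<dots> = y1 x * (- (y2 x * ?g x - z2 x * f x)) + y2 x * (y1 x * ?g x - z1 x * f x)"
      by (simp add: algebra_simps)
    finally show ?thesis unfolding 1 2 sol_def .
  qed
  then show ?thesis using that by blast
qed

lemma sol_cong_AE: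
  assumes "wint h" "wint k" "AE x in leb. h x = k x"
  shows "prim1 h x = prim1 k x" "prim2 h x = prim2 k x" "sol \<alpha> \<beta> h x = sol \<alpha> \<beta> k x" "mom1 h = mom1 k" "mom2 h = mom2 k"
proof -
  have ae: "AE t in leb. y1 t * (complex_of_real (r t) * h t) = y1 t * (complex_of_real (r t) * k t)"
    "AE t in leb. y2 t * (complex_of_real (r t) * h t) = y2 t * (complex_of_real (r t) * k t)"
    using assms(3) by auto
  show p: "prim1 h x = prim1 k x" "prim2 h x = prim2 k x"
    unfolding prim1_def prim2_def by (intro prim_cong_AE y_wint assms ae)+
  show "sol \<alpha> \<beta> h x = sol \<alpha> \<beta> k x" unfolding sol_def p ..
  show "mom1 h = mom1 k" "mom2 h = mom2 k"
    unfolding mom1_def mom2_def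
    using y_wint[OF assms(1)] y_wint[OF assms(2)] ae by (auto intro!: integral_cong_AE)
qed

lemma sol_L2:
  assumes h: "wint h"
  shows "sol \<alpha> \<beta> h \<in> L2 M"
  by (rule L2_M_bounded[OF has_prim_measurable[OF sol_has_prim[OF h]] has_prim_bounded[OF sol_has_prim[OF h]]])

lemma sol_dom_max:
  assumes h: "h \<in> L2 M"
  shows "sol \<alpha> \<beta> h \<in> dom_max a b p q r s"
proof -
  note w = L2_M_integrable[OF h]
  have "AE x in leb. tau a b p q r s (sol \<alpha> \<beta> h) x = h x" by (rule sol_quasi_deriv(3)[OF w refl])
  then have "AE x in leb. h x = tau a b p q r s (sol \<alpha> \<beta> h) x" by eventually_elim simp
  then have "tau a b p q r s (sol \<alpha> \<beta> h) \<in> L2 M" by (rule L2_AE_eq[OF h])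
  then show ?thesis using sol_L2[OF w] sol_quasi_deriv(1)[OF w refl] by (simp add: dom_max_def)
qed

text \<open>Operators given by boundary conditions, expressed through the data of \<open>sol\<close>.\<close>

definition graph_of :: "(complex \<Rightarrow> complex \<Rightarrow> (real \<Rightarrow> complex) \<Rightarrow> bool) \<Rightarrow> real L2_graph" where
  "graph_of Q = {(f, h). f \<in> L2 M \<and> h \<in> L2 M \<and> (\<exists>\<alpha> \<beta>. (AE x in leb. f x = sol \<alpha> \<beta> h x) \<and> Q \<alpha> \<beta> h)}"

text \<open>Turns a condition on functions into a condition on the data of \<open>sol\<close>. The
  function in \<open>D\<close> equals \<open>sol\<close> everywhere on the interval, whereas the
  first component of the graph agrees with it almost everywhere only.\<close>

lemma tau_op_eq_graph_of:
  assumes D: "D \<subseteq> dom_max a b p q r s"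
    and Q1: "\<And>g \<alpha> \<beta> h. g \<in> D \<Longrightarrow> h \<in> L2 M \<Longrightarrow> (\<And>x. x \<in> I \<Longrightarrow> g x = sol \<alpha> \<beta> h x) \<Longrightarrow> Q \<alpha> \<beta> h"
    and Q2: "\<And>\<alpha> \<beta> h. h \<in> L2 M \<Longrightarrow> Q \<alpha> \<beta> h \<Longrightarrow> sol \<alpha> \<beta> h \<in> D"
  shows "tau_op a b p q r s D = graph_of Q"
proof (intro equalityI subrelI)
  fix f h assume "(f, h) \<in> tau_op a b p q r s D"
  then obtain g where g: "f \<in> L2 M" "h \<in> L2 M" "g \<in> D" "AE x in leb. f x = g x" "AE x in leb. h x = tau a b p q r s g x"
    by (auto simp: tau_op_def AE_M)
  have gd: "g \<in> D_tau a b p s" and t: "tau a b p q r s g \<in> L2 M" using g(3) D by (auto simp: dom_max_def)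
  obtain \<alpha> \<beta> where ab: "\<And>x. x \<in> I \<Longrightarrow> g x = sol \<alpha> \<beta> (tau a b p q r s g) x"
    by (rule D_tau_eq_sol[OF gd L2_M_integrable[OF t]]) blast
  have gs: "g x = sol \<alpha> \<beta> h x" if "x \<in> I" for x
    using ab[OF that] sol_cong_AE(3)[OF L2_M_integrable[OF g(2)] L2_M_integrable[OF t] g(5)] by simp
  have "AE x in leb. f x = sol \<alpha> \<beta> h x" using g(4) AE_space by eventually_elim (simp add: gs)
  then show "(f, h) \<in> graph_of Q" using g(1,2) Q1[OF g(3) g(2) gs] by (auto simp: graph_of_def)
next
  fix f h assume "(f, h) \<in> graph_of Q"
  then obtain \<alpha> \<beta> where fh: "f \<in> L2 M" "h \<in> L2 M" "AE x in leb. f x = sol \<alpha> \<beta> h x" "Q \<alpha> \<beta> h"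
    by (auto simp: graph_of_def)
  have "AE x in leb. tau a b p q r s (sol \<alpha> \<beta> h) x = h x"
    by (rule sol_quasi_deriv(3)[OF L2_M_integrable[OF fh(2)] refl])
  then have "AE x in leb. h x = tau a b p q r s (sol \<alpha> \<beta> h) x" by eventually_elim simp
  then show "(f, h) \<in> tau_op a b p q r s D"
    unfolding tau_op_def using fh(1-3) Q2[OF fh(2,4)] by (auto simp: AE_M)
qed

end

text \<open>One Gram-Schmidt step, normalised against \<open>k2\<close>; independence keeps both
  divisors nonzero.\<close>

lemma L2_dual_vector:
  assumes k: "k1 \<in> L2 M" "k2 \<in> L2 M"
    and indep: "\<And>A B. AE x in M. A * k1 x + B * k2 x = 0 \<Longrightarrow> A = 0 \<and> B = 0"
  shows "\<exists>A B. L2_inner M k1 (\<lambda>x. A * k1 x + B * k2 x) = 0 \<and> L2_inner M k2 (\<lambda>x. A * k1 x + B * k2 x) = 1"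
proof -
  have k1: "L2_inner M k1 k1 \<noteq> 0"
  proof
    assume "L2_inner M k1 k1 = 0"
    then have "AE x in M. k1 x = 0" by (intro L2_norm_eq_0_AE k) (simp add: L2_inner_self)
    then have "AE x in M. 1 * k1 x + 0 * k2 x = 0" by simp
    from indep[OF this] show False by simp
  qed
  define c where "c = L2_inner M k1 k2 / L2_inner M k1 k1"
  define w where "w = (\<lambda>x. - c * k1 x + k2 x)"
  have wL: "w \<in> L2 M" unfolding w_def by (intro L2_add L2_scale k)
  have "L2_inner M k1 w = - c * L2_inner M k1 k1 + L2_inner M k1 k2"
    unfolding w_def by (simp only: L2_inner_add_right[OF k(1) L2_scale[OF k(1)] k(2)] L2_inner_scale_right)
  then have w1: "L2_inner M k1 w = 0" using k1 by (simp add: c_def)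
  have "L2_inner M (\<lambda>x. - c * k1 x + k2 x) w = cnj (- c) * L2_inner M k1 w + L2_inner M k2 w"
    by (simp only: L2_inner_add_left[OF wL L2_scale[OF k(1)] k(2)] L2_inner_scale_left)
  then have "L2_inner M w w = L2_inner M k2 w" using w1 unfolding w_def[symmetric] by simp
  moreover have "L2_inner M w w \<noteq> 0"
  proof
    assume "L2_inner M w w = 0"
    then have "AE x in M. w x = 0" by (intro L2_norm_eq_0_AE wL) (simp add: L2_inner_self)
    then have "AE x in M. (- c) * k1 x + 1 * k2 x = 0" by (simp add: w_def)
    from indep[OF this] show False by simp
  qed
  moreover define n where "n = L2_inner M k2 w"
  ultimately have n: "n \<noteq> 0" by simp
  have eq: "(\<lambda>x. (- c / n) * k1 x + (1 / n) * k2 x) = (\<lambda>x. (1 / n) * w x)"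
    unfolding w_def using n by (simp add: fun_eq_iff field_simps)
  have "L2_inner M k1 (\<lambda>x. (1 / n) * w x) = 0" "L2_inner M k2 (\<lambda>x. (1 / n) * w x) = 1"
    unfolding L2_inner_scale_right using w1 n n_def by simp_all
  then show ?thesis unfolding eq[symmetric] by blast
qed

section \<open>Moments, local uniqueness and compactly supported sources\<close>

context sturm_liouville_system
begin

lemma y_L2: "y1 \<in> L2 M" "y2 \<in> L2 M"
  by (rule L2_M_bounded[OF y_measurable(1) has_prim_bounded[OF y1]], assumption)
    (rule L2_M_bounded[OF y_measurable(2) has_prim_bounded[OF y2]], assumption)

lemma mom_eq_inner:
  assumes h: "h \<in> L2 M"
  shows "mom1 h = L2_inner M y1 h" "mom2 h = L2_inner M y2 h"
proof -
  have [measurable]: "h \<in> borel_measurable leb" using h by (rule L2_M_measurable)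
  have c: "cnj (y1 x) = y1 x" "cnj (y2 x) = y2 x" for x
    using real_solutions by (simp_all add: complex_is_Real_iff complex_eq_iff)
  show "mom1 h = L2_inner M y1 h" "mom2 h = L2_inner M y2 h"
    unfolding mom1_def mom2_def L2_inner_def c
    by (subst integral_M; simp add: scaleR_conv_of_real mult.left_commute)+
qed

lemma prim12_linear:
  assumes "wint h" "wint k"
  shows "prim1 (\<lambda>x. h x + c * k x) x = prim1 h x + c * prim1 k x" "prim2 (\<lambda>x. h x + c * k x) x = prim2 h x + c * prim2 k x"
proof -
  have "(\<lambda>t. y t * (complex_of_real (r t) * (h t + c * k t))) = (\<lambda>t. y t * (complex_of_real (r t) * h t) + c * (y t * (complex_of_real (r t) * k t)))" for y
    by (simp add: fun_eq_iff algebra_simps)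
  then show "prim1 (\<lambda>x. h x + c * k x) x = prim1 h x + c * prim1 k x" "prim2 (\<lambda>x. h x + c * k x) x = prim2 h x + c * prim2 k x"
    unfolding prim1_def prim2_def
    using y_wint[OF assms(1)] y_wint[OF assms(2)] by (simp_all add: prim_add prim_mult_left)
qed

lemma sol_linear:
  assumes "wint h" "wint k"
  shows "sol (\<alpha> + c * \<alpha>') (\<beta> + c * \<beta>') (\<lambda>x. h x + c * k x) x = sol \<alpha> \<beta> h x + c * sol \<alpha>' \<beta>' k x"
  unfolding sol_def prim12_linear[OF assms] by (simp add: algebra_simps)

lemma prim_zero [simp]: "prim1 (\<lambda>x. 0) x = 0" "prim2 (\<lambda>x. 0) x = 0"
  by (simp_all add: prim1_def prim2_def prim_def)

lemma sol_homogeneous: "sol \<alpha> \<beta> (\<lambda>x. 0) x = \<alpha> * y1 x + \<beta> * y2 x"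
  by (simp add: sol_def mult.commute)

lemma mom_linear:
  assumes "h \<in> L2 M" "k \<in> L2 M"
  shows "mom1 (\<lambda>x. h x + c * k x) = mom1 h + c * mom1 k" "mom2 (\<lambda>x. h x + c * k x) = mom2 h + c * mom2 k"
  using assms y_L2 by (simp_all add: mom_eq_inner L2_add L2_scale L2_inner_linear)

lemma mom_diff:
  assumes "h \<in> L2 M" "k \<in> L2 M"
  shows "mom1 (\<lambda>x. h x - k x) = mom1 h - mom1 k" "mom2 (\<lambda>x. h x - k x) = mom2 h - mom2 k"
  using mom_linear[OF assms, of "-1"] by simp_all

lemma mom_zero [simp]: "mom1 (\<lambda>x. 0) = 0" "mom2 (\<lambda>x. 0) = 0"
  by (simp_all add: mom1_def mom2_def)

lemma wint_zero: "wint (\<lambda>x. 0)"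
  by simp

lemma prim12_bound:
  obtains C where "0 < C" "\<And>h x. h \<in> L2 M \<Longrightarrow> cmod (prim1 h x) \<le> C * L2_norm M h" "\<And>h x. h \<in> L2 M \<Longrightarrow> cmod (prim2 h x) \<le> C * L2_norm M h"
proof -
  obtain B where B: "0 < B" "\<And>x. x \<in> I \<Longrightarrow> cmod (y1 x) \<le> B" "\<And>x. x \<in> I \<Longrightarrow> cmod (y2 x) \<le> B" by (rule y_bounded) blast
  define C where "C = B * (L2_norm M (\<lambda>_. 1) + 1)"
  have C: "0 < C" using B(1) by (simp add: C_def add_nonneg_pos)
  have bound: "cmod (prim a b (\<lambda>t. y t * (complex_of_real (r t) * h t)) x) \<le> C * L2_norm M h"
    if y: "\<And>x. x \<in> I \<Longrightarrow> cmod (y x) \<le> B" and int: "integrable leb (\<lambda>t. y t * (complex_of_real (r t) * h t))" and h: "h \<in> L2 M" for y h x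
  proof -
    have [measurable]: "h \<in> borel_measurable leb" using h by (rule L2_M_measurable)
    have "cmod (prim a b (\<lambda>t. y t * (complex_of_real (r t) * h t)) x) \<le> (LINT t|leb. cmod (y t * (complex_of_real (r t) * h t)))"
      by (rule prim_bounded[OF int])
    also have "\<dots> \<le> (LINT t|leb. B * cmod (complex_of_real (r t) * h t))"
    proof (rule integral_mono)
      show "integrable leb (\<lambda>t. cmod (y t * (complex_of_real (r t) * h t)))" using int by simp
      show "integrable leb (\<lambda>t. B * cmod (complex_of_real (r t) * h t))" using L2_M_integrable[OF h] by (intro integrable_mult_right integrable_norm)
      show "cmod (y t * (complex_of_real (r t) * h t)) \<le> B * cmod (complex_of_real (r t) * h t)" if "t \<in> space leb" for t
        unfolding norm_mult[of "y t"] using y[of t] that by (intro mult_right_mono) auto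
    qed
    also have "\<dots> = B * (LINT t|leb. r t *\<^sub>R cmod (h t))"
    proof -
      have "(LINT t|leb. cmod (complex_of_real (r t) * h t)) = (LINT t|leb. r t *\<^sub>R cmod (h t))"
        by (rule integral_cong_AE) (use r_nonneg in \<open>auto simp: norm_mult elim: eventually_mono\<close>)
      then show ?thesis by simp
    qed
    also have "(LINT t|leb. r t *\<^sub>R cmod (h t)) = (LINT t|M. cmod (h t))" by (rule integral_M[symmetric]) simp
    also have "\<dots> \<le> L2_norm M (\<lambda>_. 1) * L2_norm M h" by (rule M.L2_L1_bound[OF h])
    also have "B * (L2_norm M (\<lambda>_. 1) * L2_norm M h) \<le> C * L2_norm M h"
      using B(1) unfolding C_def mult.assoc by (intro mult_left_mono mult_right_mono) auto
    finally show ?thesis using B(1) by (simp add: mult_left_mono)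
  qed
  show ?thesis
    using that[OF C] bound[OF B(2) y_wint(1)[OF L2_M_integrable]] bound[OF B(3) y_wint(2)[OF L2_M_integrable]]
    unfolding prim1_def prim2_def by blast
qed

text \<open>Boundedness of the fundamental system and finiteness of the weight make the solution
  operator with zero data at \<open>a\<close> bounded, which is what passing to graph closures
  requires.\<close>

lemma sol_norm_bound:
  obtains C where "0 < C" "\<And>h x. h \<in> L2 M \<Longrightarrow> x \<in> I \<Longrightarrow> cmod (sol 0 0 h x) \<le> C * L2_norm M h"
    "\<And>h. h \<in> L2 M \<Longrightarrow> L2_norm M (sol 0 0 h) \<le> C * L2_norm M h"
proof -
  obtain B where B: "0 < B" "\<And>x. x \<in> I \<Longrightarrow> cmod (y1 x) \<le> B" "\<And>x. x \<in> I \<Longrightarrow> cmod (y2 x) \<le> B" by (rule y_bounded) blast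
  obtain C where C: "0 < C" "\<And>h x. h \<in> L2 M \<Longrightarrow> cmod (prim1 h x) \<le> C * L2_norm M h" "\<And>h x. h \<in> L2 M \<Longrightarrow> cmod (prim2 h x) \<le> C * L2_norm M h"
    by (rule prim12_bound) blast
  define K where "K = 2 * B * C"
  have K: "0 < K" using B(1) C(1) by (simp add: K_def)
  have pt: "cmod (sol 0 0 h x) \<le> K * L2_norm M h" if "h \<in> L2 M" "x \<in> I" for h x
  proof -
    have "cmod (sol 0 0 h x) \<le> cmod (y1 x) * cmod (prim2 h x) + cmod (y2 x) * cmod (prim1 h x)"
      unfolding sol_def using norm_triangle_ineq4[of "y1 x * prim2 h x" "y2 x * prim1 h x"] by (simp add: norm_mult)
    also have "\<dots> \<le> B * (C * L2_norm M h) + B * (C * L2_norm M h)"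
      using B C that by (intro add_mono mult_mono) (auto intro: less_imp_le)
    finally show ?thesis by (simp add: K_def)
  qed
  define L where "L = K * (L2_norm M (\<lambda>_. 1) + 1)"
  have "K \<le> L" using K by (simp add: L_def)
  have nm: "L2_norm M (sol 0 0 h) \<le> L * L2_norm M h" if h: "h \<in> L2 M" for h
  proof -
    have s2: "sol 0 0 h \<in> L2 M" by (rule sol_L2[OF L2_M_integrable[OF h]])
    have "(L2_norm M (sol 0 0 h))\<^sup>2 \<le> (L2_norm M (\<lambda>x. complex_of_real (K * L2_norm M h) * 1))\<^sup>2"
      unfolding L2_norm_square
    proof (rule integral_mono_AE)
      show "integrable M (\<lambda>x. (cmod (sol 0 0 h x))\<^sup>2)" using s2 by (rule L2_integrable_square)
      show "AE x in M. (cmod (sol 0 0 h x))\<^sup>2 \<le> (cmod (complex_of_real (K * L2_norm M h) * 1))\<^sup>2"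
        unfolding AE_M using pt[OF h] K by (intro AE_I2 power_mono) (auto simp: norm_mult)
    qed simp
    then have "L2_norm M (sol 0 0 h) \<le> L2_norm M (\<lambda>x. complex_of_real (K * L2_norm M h) * 1)"
      by (rule power2_le_imp_le) simp
    also have "\<dots> = K * L2_norm M h * L2_norm M (\<lambda>_. 1)"
      unfolding L2_norm_scale using K by (simp add: norm_mult)
    also have "\<dots> \<le> L * L2_norm M h" using K unfolding L_def by (simp add: algebra_simps)
    finally show ?thesis .
  qed
  have "cmod (sol 0 0 h x) \<le> L * L2_norm M h" if "h \<in> L2 M" "x \<in> I" for h x
    using pt[OF that] mult_right_mono[OF \<open>K \<le> L\<close>, of "L2_norm M h"] by simp
  moreover have "0 < L" using K \<open>K \<le> L\<close> by simp
  ultimately show ?thesis using that[of L] nm by blast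
qed

text \<open>A solution vanishing on an open set has zero derivative there, hence zero
  quasi-derivative, hence zero source; the varying coefficients vanish as well because the Wronskian
  matrix is invertible. The open set may be disconnected, as is the complement of a compact
  support.\<close>

lemma sol_local_uniqueness:
  assumes h: "wint h" and S: "open S" "S \<subseteq> I" and zero: "AE x in leb. x \<in> S \<longrightarrow> sol \<alpha> \<beta> h x = 0"
  shows "AE x in leb. x \<in> S \<longrightarrow> h x = 0"
    and "x \<in> S \<Longrightarrow> \<alpha> + prim2 h x = 0" "x \<in> S \<Longrightarrow> \<beta> - prim1 h x = 0"
proof -
  note sp = sol_has_prim[OF h, of \<alpha> \<beta>] and dp = dsol_has_prim[OF h, of \<alpha> \<beta>]
  have sol0: "sol \<alpha> \<beta> h x = 0" if "x \<in> S" for x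
    by (rule AE_eq_continuous_eq[OF S continuous_on_subset[OF has_prim_continuous_on[OF sp] S(2)] continuous_on_const zero that])
  have deriv0: "c = 0" if "(f has_vector_derivative c) (at x)" "\<And>t. t \<in> S \<Longrightarrow> f t = 0" "x \<in> S" for f c x
  proof -
    have "((\<lambda>t. 0) has_vector_derivative c) (at x)"
      by (rule has_vector_derivative_transform_within_open[OF that(1) S(1) that(3)]) (rule that(2))
    then show ?thesis using has_vector_derivative_const vector_derivative_unique_at by blast
  qed
  have "AE x in leb. x \<in> S \<longrightarrow> dsol \<alpha> \<beta> h x = 0"
    using has_prim_deriv[OF sp] p_pos
  proof eventually_elim
    case (elim x)
    show ?case
    proof
      assume x: "x \<in> S"
      have "of_real (- s x) * sol \<alpha> \<beta> h x + of_real (1 / p x) * dsol \<alpha> \<beta> h x = 0"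
        by (rule deriv0[OF elim(1) sol0 x])
      then show "dsol \<alpha> \<beta> h x = 0" using sol0[OF x] elim(2) by simp
    qed
  qed
  from AE_eq_continuous_eq[OF S continuous_on_subset[OF has_prim_continuous_on[OF dp] S(2)] continuous_on_const this]
  have dsol0: "dsol \<alpha> \<beta> h x = 0" if "x \<in> S" for x using that .
  show "AE x in leb. x \<in> S \<longrightarrow> h x = 0"
    using has_prim_deriv[OF dp] r_pos
  proof eventually_elim
    case (elim x)
    show ?case
    proof
      assume x: "x \<in> S"
      have "of_real (q x) * sol \<alpha> \<beta> h x + of_real (s x) * dsol \<alpha> \<beta> h x - complex_of_real (r x) * h x = 0"
        by (rule deriv0[OF elim(1) dsol0 x])
      then show "h x = 0" using sol0[OF x] dsol0[OF x] elim(2) by simp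
    qed
  qed
  have AB: "\<alpha> + prim2 h x = 0 \<and> \<beta> - prim1 h x = 0" if x: "x \<in> S" for x
  proof -
    let ?A = "\<alpha> + prim2 h x" and ?B = "\<beta> - prim1 h x"
    have w: "y1 x * z2 x - y2 x * z1 x = 1" using wronskian x S(2) by blast
    have "?A = (y1 x * z2 x - y2 x * z1 x) * ?A" "?B = (y1 x * z2 x - y2 x * z1 x) * ?B" by (simp_all only: w mult_1)
    moreover have "(y1 x * z2 x - y2 x * z1 x) * ?A = z2 x * sol \<alpha> \<beta> h x - y2 x * dsol \<alpha> \<beta> h x"
      "(y1 x * z2 x - y2 x * z1 x) * ?B = y1 x * dsol \<alpha> \<beta> h x - z1 x * sol \<alpha> \<beta> h x"
      by (simp_all add: sol_def dsol_def algebra_simps)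
    ultimately show ?thesis using sol0[OF x] dsol0[OF x] by simp
  qed
  show "x \<in> S \<Longrightarrow> \<alpha> + prim2 h x = 0" "x \<in> S \<Longrightarrow> \<beta> - prim1 h x = 0" using AB by blast+
qed

lemma homogeneous_independent:
  assumes "open S" "S \<subseteq> I" "S \<noteq> {}" "AE x in leb. x \<in> S \<longrightarrow> A * y1 x + B * y2 x = 0"
  shows "A = 0 \<and> B = 0"
proof -
  obtain x where "x \<in> S" using assms(3) by blast
  have "AE x in leb. x \<in> S \<longrightarrow> sol A B (\<lambda>x. 0) x = 0" using assms(4) by (simp add: sol_homogeneous)
  from sol_local_uniqueness(2,3)[OF wint_zero assms(1,2) this \<open>x \<in> S\<close>] show ?thesis by simp
qed

lemma indicator_measurable_leb: "(\<lambda>x. indicator {c..d} x :: complex) \<in> borel_measurable leb"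
proof -
  have "indicat_real {c..d} \<in> borel_measurable leb"
    by (rule measurable_restrict_space1) (simp add: borel_measurable_indicator)
  then have "(\<lambda>x. complex_of_real (indicat_real {c..d} x)) \<in> borel_measurable leb" by simp
  moreover have "(\<lambda>x. indicator {c..d} x :: complex) = (\<lambda>x. complex_of_real (indicat_real {c..d} x))"
    by (auto simp: indicator_def)
  ultimately show ?thesis by simp
qed

text \<open>Compactly supported sources dual to the two moments, used to repair moments at small
  cost. They exist because the fundamental solutions remain independent on every open
  subinterval.\<close>

lemma biorthogonal_exists:
  obtains c d e1 e2 where "c \<in> I" "d \<in> I" "e1 \<in> L2 M" "e2 \<in> L2 M"
    "\<And>x. x \<notin> {c..d} \<Longrightarrow> e1 x = 0" "\<And>x. x \<notin> {c..d} \<Longrightarrow> e2 x = 0"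
    "mom1 e1 = 1" "mom2 e1 = 0" "mom1 e2 = 0" "mom2 e2 = 1"
proof -
  obtain c0 where "c0 \<in> I" using einterval_nonempty[OF ab] by blast
  then obtain c d where cd: "c \<in> I" "d \<in> I" "c < c0" "c0 < d" by (rule einterval_neighbourhood)
  define k1 where "k1 = (\<lambda>x. indicator {c..d} x * y1 x)"
  define k2 where "k2 = (\<lambda>x. indicator {c..d} x * y2 x)"
  note ind = indicator_measurable_leb[of c d]
  have k: "k1 \<in> L2 M" "k2 \<in> L2 M"
  proof -
    obtain B where B: "0 < B" "\<And>x. x \<in> I \<Longrightarrow> cmod (y1 x) \<le> B" "\<And>x. x \<in> I \<Longrightarrow> cmod (y2 x) \<le> B" by (rule y_bounded) blast
    show "k1 \<in> L2 M" "k2 \<in> L2 M"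
      unfolding k1_def k2_def using ind B by (auto intro!: L2_M_bounded[where B=B] simp: indicator_def)
  qed
  have S: "open {c<..<d}" "{c<..<d} \<subseteq> I" "{c<..<d} \<noteq> {}"
    using Icc_subset_einterval[OF cd(1,2)] cd by (auto simp: subset_iff)
  have ind1: "A = 0 \<and> B = 0" if "AE x in M. A * k1 x + B * k2 x = 0" for A B
  proof (rule homogeneous_independent[OF S])
    show "AE x in leb. x \<in> {c<..<d} \<longrightarrow> A * y1 x + B * y2 x = 0"
      using that unfolding AE_M by eventually_elim (auto simp: k1_def k2_def indicator_def)
  qed
  have ind2: "A = 0 \<and> B = 0" if "AE x in M. A * k2 x + B * k1 x = 0" for A B
    using ind1[of B A] that by (simp add: add.commute)
  obtain A B where AB: "L2_inner M k1 (\<lambda>x. A * k1 x + B * k2 x) = 0" "L2_inner M k2 (\<lambda>x. A * k1 x + B * k2 x) = 1"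
    using L2_dual_vector[OF k ind1] by blast
  obtain C D where CD: "L2_inner M k2 (\<lambda>x. C * k2 x + D * k1 x) = 0" "L2_inner M k1 (\<lambda>x. C * k2 x + D * k1 x) = 1"
    using L2_dual_vector[OF k(2,1) ind2] by blast
  \<comment> \<open>Combinations of the truncated solutions vanish off \<open>{c..d}\<close>, so
    pairing them with \<open>y1\<close> or with its truncation is the same.\<close>
  have inner_k: "L2_inner M y1 (\<lambda>x. U * k1 x + V * k2 x) = L2_inner M k1 (\<lambda>x. U * k1 x + V * k2 x)"
    "L2_inner M y2 (\<lambda>x. U * k1 x + V * k2 x) = L2_inner M k2 (\<lambda>x. U * k1 x + V * k2 x)" for U V
    unfolding L2_inner_def by (rule Bochner_Integration.integral_cong, simp, simp add: k1_def k2_def indicator_def)+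
  show ?thesis
  proof (rule that[OF cd(1,2)])
    have L: "(\<lambda>x. U * k1 x + V * k2 x) \<in> L2 M" for U V by (intro L2_add L2_scale k)
    have sw: "(\<lambda>x. C * k2 x + D * k1 x) = (\<lambda>x. D * k1 x + C * k2 x)" by (simp add: fun_eq_iff)
    show "(\<lambda>x. D * k1 x + C * k2 x) \<in> L2 M" "(\<lambda>x. A * k1 x + B * k2 x) \<in> L2 M" by (rule L)+
    show "x \<notin> {c..d} \<Longrightarrow> D * k1 x + C * k2 x = 0" "x \<notin> {c..d} \<Longrightarrow> A * k1 x + B * k2 x = 0" for x
      by (simp_all add: k1_def k2_def)
    show "mom1 (\<lambda>x. D * k1 x + C * k2 x) = 1" "mom2 (\<lambda>x. D * k1 x + C * k2 x) = 0"
      "mom1 (\<lambda>x. A * k1 x + B * k2 x) = 0" "mom2 (\<lambda>x. A * k1 x + B * k2 x) = 1"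
      unfolding mom_eq_inner[OF L] inner_k using AB CD unfolding sw by simp_all
  qed
qed

lemma compactly_supported_bounds:
  assumes "compactly_supported_in a b g"
  obtains c d where "c \<in> I" "d \<in> I" "\<And>x. x \<in> I \<Longrightarrow> x \<notin> {c..d} \<Longrightarrow> g x = 0"
proof -
  obtain K where K: "compact K" "K \<subseteq> I" "\<forall>x\<in>I - K. g x = 0" using assms by (auto simp: compactly_supported_in_def)
  show ?thesis
  proof (cases "K = {}")
    case True
    obtain c where "c \<in> I" using einterval_nonempty[OF ab] by blast
    then show ?thesis using that[of c c] K True by blast
  next
    case False
    have bdd: "bdd_below K" "bdd_above K"
      using K(1) by (auto intro: bounded_imp_bdd_below bounded_imp_bdd_above compact_imp_bounded)
    have "Inf K \<in> K" "Sup K \<in> K"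
      using closed_contains_Inf[OF False bdd(1)] closed_contains_Sup[OF False bdd(2)] compact_imp_closed[OF K(1)] by auto
    moreover have "K \<subseteq> {Inf K..Sup K}" using bdd by (auto intro: cInf_lower cSup_upper)
    ultimately show ?thesis using that[of "Inf K" "Sup K"] K by blast
  qed
qed

lemma eventually_near_ends:
  assumes "c \<in> I"
  shows "eventually (\<lambda>z. real_of_ereal z \<in> I \<and> real_of_ereal z < c) (at_right a)"
    "eventually (\<lambda>z. real_of_ereal z \<in> I \<and> c < real_of_ereal z) (at_left b)"
proof -
  have c: "a < ereal c" "ereal c < b" using assms by (auto simp: einterval_iff)
  have "eventually (\<lambda>z. z < ereal c) (at_right a)" unfolding eventually_at_right[OF ab] using c by blast
  moreover have "eventually (\<lambda>z. a < z) (at_right a)" unfolding eventually_at_right[OF ab] using ab by blast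
  ultimately show "eventually (\<lambda>z. real_of_ereal z \<in> I \<and> real_of_ereal z < c) (at_right a)"
    using eventually_in_einterval(1)
  proof eventually_elim
    case (elim z)
    then have "ereal (real_of_ereal z) = z" by (intro ereal_real') auto
    then show ?case using elim by (metis ereal_less(1) less_ereal.simps(1))
  qed
  have "eventually (\<lambda>z. ereal c < z) (at_left b)" unfolding eventually_at_left[OF ab] using c by blast
  moreover have "eventually (\<lambda>z. z < b) (at_left b)" unfolding eventually_at_left[OF ab] using ab by blast
  ultimately show "eventually (\<lambda>z. real_of_ereal z \<in> I \<and> c < real_of_ereal z) (at_left b)"
    using eventually_in_einterval(2)
  proof eventually_elim
    case (elim z)
    then have "ereal (real_of_ereal z) = z" by (intro ereal_real') auto
    then show ?case using elim by (metis less_ereal.simps(1))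
  qed
qed

text \<open>Off the support both varying coefficients vanish. Their limits at \<open>a\<close> are
  \<alpha> and \<beta>, those at \<open>b\<close> are \<open>\<alpha> + mom2 h\<close> and
  \<open>\<beta> - mom1 h\<close>.\<close>

lemma compact_support_imp_trivial_data:
  assumes h: "wint h" and g: "compactly_supported_in a b (sol \<alpha> \<beta> h)"
  shows "\<alpha> = 0" "\<beta> = 0" "mom1 h = 0" "mom2 h = 0"
proof -
  obtain c d where cd: "c \<in> I" "d \<in> I" "\<And>x. x \<in> I \<Longrightarrow> x \<notin> {c..d} \<Longrightarrow> sol \<alpha> \<beta> h x = 0"
    by (rule compactly_supported_bounds[OF g]) blast
  let ?S = "I \<inter> (- {c..d})"
  have S: "open ?S" "?S \<subseteq> I" by (intro open_Int open_Compl open_einterval closed_atLeastAtMost) simp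
  have "AE x in leb. x \<in> ?S \<longrightarrow> sol \<alpha> \<beta> h x = 0" using cd(3) by (intro AE_I2) auto
  note z = sol_local_uniqueness(2,3)[OF h S this]
  have l: "((\<lambda>z. \<alpha> + (prim2 h \<circ> real_of_ereal) z) \<longlongrightarrow> \<alpha> + 0) (at_right a)" "((\<lambda>z. \<beta> - (prim1 h \<circ> real_of_ereal) z) \<longlongrightarrow> \<beta> - 0) (at_right a)"
    by (rule tendsto_add[OF tendsto_const has_prim_tendsto_left[OF prim12(2)[OF h]]],
        rule tendsto_diff[OF tendsto_const has_prim_tendsto_left[OF prim12(1)[OF h]]])
  have r: "((\<lambda>z. \<alpha> + (prim2 h \<circ> real_of_ereal) z) \<longlongrightarrow> \<alpha> + mom2 h) (at_left b)" "((\<lambda>z. \<beta> - (prim1 h \<circ> real_of_ereal) z) \<longlongrightarrow> \<beta> - mom1 h) (at_left b)"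
  proof -
    have P: "((prim2 h \<circ> real_of_ereal) \<longlongrightarrow> mom2 h) (at_left b)" "((prim1 h \<circ> real_of_ereal) \<longlongrightarrow> mom1 h) (at_left b)"
      using has_prim_tendsto_right[OF prim12(1)[OF h]] has_prim_tendsto_right[OF prim12(2)[OF h]]
      by (simp_all add: mom1_def mom2_def)
    show "((\<lambda>z. \<alpha> + (prim2 h \<circ> real_of_ereal) z) \<longlongrightarrow> \<alpha> + mom2 h) (at_left b)" "((\<lambda>z. \<beta> - (prim1 h \<circ> real_of_ereal) z) \<longlongrightarrow> \<beta> - mom1 h) (at_left b)"
      by (rule tendsto_add[OF tendsto_const P(1)], rule tendsto_diff[OF tendsto_const P(2)])
  qed
  have el: "eventually (\<lambda>z. \<alpha> + (prim2 h \<circ> real_of_ereal) z = 0) (at_right a)" "eventually (\<lambda>z. \<beta> - (prim1 h \<circ> real_of_ereal) z = 0) (at_right a)"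
    using eventually_near_ends(1)[OF cd(1)] by (eventually_elim, simp add: z)+
  have er: "eventually (\<lambda>z. \<alpha> + (prim2 h \<circ> real_of_ereal) z = 0) (at_left b)" "eventually (\<lambda>z. \<beta> - (prim1 h \<circ> real_of_ereal) z = 0) (at_left b)"
    using eventually_near_ends(2)[OF cd(2)] by (eventually_elim, simp add: z)+
  show \<alpha>: "\<alpha> = 0" using tendsto_unique[OF at_ends_nontrivial(1) l(1) tendsto_eventually[OF el(1)]] by simp
  show \<beta>: "\<beta> = 0" using tendsto_unique[OF at_ends_nontrivial(1) l(2) tendsto_eventually[OF el(2)]] by simp
  show "mom2 h = 0" using tendsto_unique[OF at_ends_nontrivial(2) r(1) tendsto_eventually[OF er(1)]] \<alpha> by simp
  show "mom1 h = 0" using tendsto_unique[OF at_ends_nontrivial(2) r(2) tendsto_eventually[OF er(2)]] \<beta> by simp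
qed

lemma prim12_zero_left:
  assumes "\<And>t. t < x \<Longrightarrow> h t = 0"
  shows "prim1 h x = 0" "prim2 h x = 0"
  unfolding prim1_def prim2_def by (rule prim_zero_left, use assms in simp)+

lemma prim12_full_right:
  assumes "\<And>t. x \<le> t \<Longrightarrow> h t = 0"
  shows "prim1 h x = mom1 h" "prim2 h x = mom2 h"
  unfolding prim1_def prim2_def mom1_def mom2_def by (rule prim_full_right, use assms in simp)+

text \<open>Before the support nothing has been accumulated; behind it the accumulated integrals are
  the full moments, which vanish.\<close>

lemma compact_support_of_source:
  assumes cd: "c \<in> I" "d \<in> I" "\<And>x. x \<notin> {c..d} \<Longrightarrow> h x = 0"
    and mom: "mom1 h = 0" "mom2 h = 0"
  shows "compactly_supported_in a b (sol 0 0 h)"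
  unfolding compactly_supported_in_def
proof (intro exI conjI ballI)
  show "compact {c..d}" "{c..d} \<subseteq> I" using Icc_subset_einterval[OF cd(1,2)] by auto
  fix x assume "x \<in> I - {c..d}"
  then consider "x < c" | "d < x" by fastforce
  then have "prim1 h x = 0 \<and> prim2 h x = 0"
  proof cases
    case 1
    then show ?thesis using prim12_zero_left[of x h] cd(3) by auto
  next
    case 2
    then show ?thesis using prim12_full_right[of x h] cd(3) mom by auto
  qed
  then show "sol 0 0 h x = 0" by (simp add: sol_def)
qed

abbreviation (input) "T_min_data \<equiv> (\<lambda>\<alpha> \<beta> h. \<alpha> = 0 \<and> \<beta> = 0 \<and> mom1 h = 0 \<and> mom2 h = 0)"

lemma truncation_tendsto:
  assumes h: "h \<in> L2 M" and e: "e > 0"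
  obtains c d where "c \<in> I" "d \<in> I" "L2_norm M (\<lambda>x. h x - indicator {c..d} x * h x) < e"
    "(\<lambda>x. indicator {c..d} x * h x) \<in> L2 M"
proof -
  obtain u l :: "nat \<Rightarrow> real" where ul: "I = (\<Union>i. {l i..u i})" "incseq u" "decseq l" "\<And>i. l i < u i"
    by (rule einterval_Icc_approximation[OF ab]) blast
  have in_I: "l i \<in> I" "u i \<in> I" for i unfolding ul(1) using ul(4)[of i] by (auto intro!: exI[of _ i])
  have [measurable]: "h \<in> borel_measurable leb" by (rule L2_M_measurable[OF h])
  note indicator_measurable_leb [measurable]
  have L: "(\<lambda>x. indicator {c..d} x * h x) \<in> L2 M" for c d :: real
    unfolding L2_def
  proof (intro CollectI conjI)
    show "(\<lambda>x. indicator {c..d} x * h x) \<in> borel_measurable M" unfolding measurable_M by simp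
    then show "integrable M (\<lambda>x. (cmod (indicator {c..d} x * h x))\<^sup>2)"
      by (intro Bochner_Integration.integrable_bound[OF L2_integrable_square[OF h]]) (auto simp: indicator_def)
  qed
  have "(\<lambda>n. LINT x|M. (cmod (h x - indicator {l n..u n} x * h x))\<^sup>2) \<longlonglongrightarrow> (LINT x|M. 0)"
  proof (rule Bochner_Integration.integral_dominated_convergence[where w="\<lambda>x. (cmod (h x))\<^sup>2"])
    show "integrable M (\<lambda>x. (cmod (h x))\<^sup>2)" by (rule L2_integrable_square[OF h])
    show "(\<lambda>x. (cmod (h x - indicator {l n..u n} x * h x))\<^sup>2) \<in> borel_measurable M" for n unfolding measurable_M by simp
    show "AE x in M. norm ((cmod (h x - indicator {l n..u n} x * h x))\<^sup>2) \<le> (cmod (h x))\<^sup>2" for n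
      by (auto simp: indicator_def)
    show "AE x in M. (\<lambda>n. (cmod (h x - indicator {l n..u n} x * h x))\<^sup>2) \<longlonglongrightarrow> 0"
      unfolding AE_M
    proof (rule AE_I2)
      fix x assume "x \<in> space leb"
      then have "x \<in> (\<Union>i. {l i..u i})" unfolding ul(1)[symmetric] by simp
      then obtain i where i: "l i \<le> x" "x \<le> u i" by auto
      have "(cmod (h x - indicator {l n..u n} x * h x))\<^sup>2 = 0" if "n \<ge> i" for n
        using i incseqD[OF ul(2) that] decseqD[OF ul(3) that] by (simp add: indicator_def)
      then show "(\<lambda>n. (cmod (h x - indicator {l n..u n} x * h x))\<^sup>2) \<longlonglongrightarrow> 0"
        by (intro tendsto_eventually) (auto simp: eventually_sequentially)
    qed
  qed simp
  then have "(\<lambda>n. (L2_norm M (\<lambda>x. h x - indicator {l n..u n} x * h x))\<^sup>2) \<longlonglongrightarrow> 0" by (simp add: L2_norm_square)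
  from order_tendstoD(2)[OF this, of "e\<^sup>2"] obtain n where "(L2_norm M (\<lambda>x. h x - indicator {l n..u n} x * h x))\<^sup>2 < e\<^sup>2"
    using e by (auto simp: eventually_sequentially)
  then have "L2_norm M (\<lambda>x. h x - indicator {l n..u n} x * h x) < e" by (rule power2_less_imp_less) (use e in simp)
  then show ?thesis using that in_I L by blast
qed

section \<open>The solution operator with zero data at the left endpoint and the Lagrange
  identity\<close>

abbreviation (input) "G h \<equiv> sol 0 0 h"

lemma G_L2: "h \<in> L2 M \<Longrightarrow> G h \<in> L2 M"
  by (rule sol_L2[OF L2_M_integrable])

lemma sol_decomp: "sol \<alpha> \<beta> h = (\<lambda>x. (\<alpha> * y1 x + \<beta> * y2 x) + G h x)"
  by (simp add: sol_def fun_eq_iff algebra_simps)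

lemma G_linear:
  "h \<in> L2 M \<Longrightarrow> k \<in> L2 M \<Longrightarrow> G (\<lambda>x. h x + c * k x) x = G h x + c * G k x"
  using sol_linear[OF L2_M_integrable L2_M_integrable, of h k 0 c 0 0 0] by simp

lemma G_diff: "h \<in> L2 M \<Longrightarrow> k \<in> L2 M \<Longrightarrow> G (\<lambda>x. h x - k x) x = G h x - G k x"
  using G_linear[of h k "-1"] by simp

text \<open>The homogeneous part of a solution is seen by \<open>k\<close> only through its moments;
  when these vanish, the data at \<open>a\<close> drop out of the pairing.\<close>

lemma inner_sol:
  assumes "k \<in> L2 M" "h \<in> L2 M"
  shows "L2_inner M k (sol \<alpha> \<beta> h) = \<alpha> * cnj (mom1 k) + \<beta> * cnj (mom2 k) + L2_inner M k (G h)"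
proof -
  have "L2_inner M k y1 = cnj (mom1 k)" "L2_inner M k y2 = cnj (mom2 k)"
    using L2_inner_cnj[of M k y1] L2_inner_cnj[of M k y2] mom_eq_inner[OF assms(1)] by simp_all
  then show ?thesis
    unfolding sol_decomp[of \<alpha> \<beta> h]
    unfolding L2_inner_add_right[OF assms(1) L2_add[OF L2_scale[OF y_L2(1)] L2_scale[OF y_L2(2)]] G_L2[OF assms(2)]]
      L2_inner_add_right[OF assms(1) L2_scale[OF y_L2(1)] L2_scale[OF y_L2(2)]] L2_inner_scale_right by simp
qed

text \<open>The difference of the integrands is the derivative of
  \<open>prim2 h x * prim1 k x - prim1 h x * prim2 k x\<close>, which vanishes at \<open>a\<close>
  and is the expression in the moments at \<open>b\<close>.\<close>

lemma Lagrange_bilinear: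
  assumes h: "wint h" and k: "wint k"
  shows "(LINT t|leb. G h t * (complex_of_real (r t) * k t)) - (LINT t|leb. (complex_of_real (r t) * h t) * G k t)
    = mom2 h * mom1 k - mom1 h * mom2 k"
proof -
  let ?F = "\<lambda>x. prim2 h x * prim1 k x - prim1 h x * prim2 k x"
  let ?hh = "\<lambda>t. complex_of_real (r t) * h t" and ?kk = "\<lambda>t. complex_of_real (r t) * k t"
  have hp: "has_prim ?F (0 * 0 - 0 * 0) (\<lambda>x. ((y2 x * ?hh x) * prim1 k x + prim2 h x * (y1 x * ?kk x)) - ((y1 x * ?hh x) * prim2 k x + prim1 h x * (y2 x * ?kk x)))"
    by (intro has_prim_diff has_prim_mult prim12 h k)
  have P: "((prim1 g \<circ> real_of_ereal) \<longlongrightarrow> mom1 g) (at_left b)" "((prim2 g \<circ> real_of_ereal) \<longlongrightarrow> mom2 g) (at_left b)"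
    if "wint g" for g
    using has_prim_tendsto_right[OF prim12(1)[OF that]] has_prim_tendsto_right[OF prim12(2)[OF that]] by (simp_all add: mom1_def mom2_def)
  have "((\<lambda>z. (prim2 h \<circ> real_of_ereal) z * (prim1 k \<circ> real_of_ereal) z - (prim1 h \<circ> real_of_ereal) z * (prim2 k \<circ> real_of_ereal) z) \<longlongrightarrow> mom2 h * mom1 k - mom1 h * mom2 k) (at_left b)"
    by (intro tendsto_diff tendsto_mult P h k)
  then have "((?F \<circ> real_of_ereal) \<longlongrightarrow> mom2 h * mom1 k - mom1 h * mom2 k) (at_left b)" by (simp add: o_def)
  from tendsto_unique[OF at_ends_nontrivial(2) this has_prim_tendsto_right[OF hp]]
  have "mom2 h * mom1 k - mom1 h * mom2 k = (LINT x|leb. ((y2 x * ?hh x) * prim1 k x + prim2 h x * (y1 x * ?kk x)) - ((y1 x * ?hh x) * prim2 k x + prim1 h x * (y2 x * ?kk x)))"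
    by simp
  also have "\<dots> = (LINT t|leb. G h t * ?kk t - ?hh t * G k t)"
    by (rule Bochner_Integration.integral_cong) (simp_all add: sol_def algebra_simps)
  also have "\<dots> = (LINT t|leb. G h t * ?kk t) - (LINT t|leb. ?hh t * G k t)"
  proof (rule Bochner_Integration.integral_diff)
    show "integrable leb (\<lambda>t. ?hh t * G k t)"
      by (rule integrable_mult_bounded[OF h has_prim_measurable[OF sol_has_prim[OF k]] has_prim_bounded[OF sol_has_prim[OF k]]])
    have "integrable leb (\<lambda>t. ?kk t * G h t)"
      by (rule integrable_mult_bounded[OF k has_prim_measurable[OF sol_has_prim[OF h]] has_prim_bounded[OF sol_has_prim[OF h]]])
    moreover have "(\<lambda>t. G h t * ?kk t) = (\<lambda>t. ?kk t * G h t)" by (simp only: mult.commute)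
    ultimately show "integrable leb (\<lambda>t. G h t * ?kk t)" by simp
  qed
  finally show ?thesis by simp
qed

lemma prim_cnj: "prim a b (\<lambda>t. cnj (u t)) x = cnj (prim a b u x)"
  unfolding prim_def by (subst Bochner_Integration.integral_cnj[symmetric]) simp

lemma cnj_y: "cnj (y1 x) = y1 x" "cnj (y2 x) = y2 x"
  using real_solutions by (simp_all add: complex_is_Real_iff complex_eq_iff)

lemma cnj_source:
  "prim1 (\<lambda>t. cnj (h t)) x = cnj (prim1 h x)" "prim2 (\<lambda>t. cnj (h t)) x = cnj (prim2 h x)"
  "mom1 (\<lambda>t. cnj (h t)) = cnj (mom1 h)" "mom2 (\<lambda>t. cnj (h t)) = cnj (mom2 h)"
  "G (\<lambda>t. cnj (h t)) x = cnj (G h x)"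
proof -
  have eq: "(\<lambda>t. y1 t * (complex_of_real (r t) * cnj (h t))) = (\<lambda>t. cnj (y1 t * (complex_of_real (r t) * h t)))"
    "(\<lambda>t. y2 t * (complex_of_real (r t) * cnj (h t))) = (\<lambda>t. cnj (y2 t * (complex_of_real (r t) * h t)))"
    by (simp_all add: cnj_y)
  show p: "prim1 (\<lambda>t. cnj (h t)) x = cnj (prim1 h x)" "prim2 (\<lambda>t. cnj (h t)) x = cnj (prim2 h x)"
    unfolding prim1_def prim2_def eq by (rule prim_cnj)+
  show "mom1 (\<lambda>t. cnj (h t)) = cnj (mom1 h)" "mom2 (\<lambda>t. cnj (h t)) = cnj (mom2 h)"
    unfolding mom1_def mom2_def eq by (rule Bochner_Integration.integral_cnj)+
  show "G (\<lambda>t. cnj (h t)) x = cnj (G h x)" unfolding sol_def p by (simp add: cnj_y)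
qed

text \<open>The fundamental system is real, so conjugating a source conjugates its solution and its
  moments; the bilinear identity is applied to the conjugate of \<open>h\<close>.\<close>

lemma Lagrange_identity:
  assumes h: "h \<in> L2 M" and k: "k \<in> L2 M"
  shows "L2_inner M (G h) k - L2_inner M h (G k) = cnj (mom2 h) * mom1 k - cnj (mom1 h) * mom2 k"
proof -
  have [measurable]: "h \<in> borel_measurable leb" "k \<in> borel_measurable leb" using h k L2_M_measurable by auto
  have [measurable]: "G h \<in> borel_measurable leb" "G k \<in> borel_measurable leb" using G_L2 h k L2_M_measurable by auto
  have wc: "wint (\<lambda>t. cnj (h t))"
    using L2_M_integrable[OF h] by (subst complex_integrable_cnj[symmetric]) simp
  have "L2_inner M (G h) k = (LINT t|leb. G (\<lambda>t. cnj (h t)) t * (complex_of_real (r t) * k t))"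
    unfolding L2_inner_def cnj_source by (subst integral_M) (simp_all add: scaleR_conv_of_real mult.left_commute)
  moreover have "L2_inner M h (G k) = (LINT t|leb. (complex_of_real (r t) * cnj (h t)) * G k t)"
    unfolding L2_inner_def by (subst integral_M) (simp_all add: scaleR_conv_of_real mult.assoc)
  ultimately show ?thesis
    using Lagrange_bilinear[OF wc L2_M_integrable[OF k]] unfolding cnj_source by simp
qed

lemma G_symmetric:
  assumes "h \<in> L2 M" "k \<in> L2 M" "mom1 h = 0" "mom2 h = 0"
  shows "L2_inner M (G h) k = L2_inner M h (G k)"
  using Lagrange_identity[OF assms(1,2)] assms(3,4) by simp

section \<open>The minimal operator and its adjoint\<close>

lemma graph_ofI: "f \<in> L2 M \<Longrightarrow> h \<in> L2 M \<Longrightarrow> AE x in leb. f x = sol \<alpha> \<beta> h x \<Longrightarrow> Q \<alpha> \<beta> h \<Longrightarrow> (f, h) \<in> graph_of Q"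
  by (auto simp: graph_of_def)

lemma graph_of_sol: "h \<in> L2 M \<Longrightarrow> Q \<alpha> \<beta> h \<Longrightarrow> (sol \<alpha> \<beta> h, h) \<in> graph_of Q"
  by (rule graph_ofI[OF sol_L2[OF L2_M_integrable]]) auto

lemma correct_moments:
  assumes e: "e1 \<in> L2 M" "e2 \<in> L2 M" "mom1 e1 = 1" "mom2 e1 = 0" "mom1 e2 = 0" "mom2 e2 = 1" and h: "h \<in> L2 M"
  defines "h' \<equiv> \<lambda>x. (h x + (- mom1 h) * e1 x) + (- mom2 h) * e2 x"
  shows "h' \<in> L2 M" "mom1 h' = 0" "mom2 h' = 0"
proof -
  have 1: "(\<lambda>x. h x + (- mom1 h) * e1 x) \<in> L2 M" by (intro L2_add L2_scale h e)
  show "h' \<in> L2 M" unfolding h'_def by (intro L2_add[OF 1] L2_scale e)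
  show "mom1 h' = 0" "mom2 h' = 0"
    unfolding h'_def mom_linear[OF 1 e(2)] mom_linear[OF h e(1)] by (simp_all add: e)
qed

text \<open>The operator with trivial data is closed: the moments are continuous functionals and
  \<open>G\<close> is bounded, so both conditions survive limits in the graph.\<close>

lemma T_min_closure_subset: "op_closure M (graph_of (\<lambda>\<alpha> \<beta> h. compactly_supported_in a b (sol \<alpha> \<beta> h))) \<subseteq> graph_of T_min_data"
proof (rule subrelI)
  let ?Q0 = "\<lambda>\<alpha> \<beta> h. compactly_supported_in a b (sol \<alpha> \<beta> h)"
  obtain C where C: "0 < C" "\<And>h x. h \<in> L2 M \<Longrightarrow> x \<in> I \<Longrightarrow> cmod (G h x) \<le> C * L2_norm M h"
    "\<And>h. h \<in> L2 M \<Longrightarrow> L2_norm M (G h) \<le> C * L2_norm M h"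
    by (rule sol_norm_bound) blast
  fix f h assume fh: "(f, h) \<in> op_closure M (graph_of ?Q0)"
  then have L: "f \<in> L2 M" "h \<in> L2 M" by (auto simp: op_closure_def)
  have approx: "\<exists>h'. h' \<in> L2 M \<and> mom1 h' = 0 \<and> mom2 h' = 0 \<and> L2_norm M (\<lambda>x. f x - G h' x) < e \<and> L2_norm M (\<lambda>x. h x - h' x) < e"
    if e: "e > 0" for e
  proof -
    obtain f' h' where f': "(f', h') \<in> graph_of ?Q0" "L2_norm M (\<lambda>x. f x - f' x) < e" "L2_norm M (\<lambda>x. h x - h' x) < e"
      using fh e unfolding op_closure_def by blast
    then obtain \<alpha> \<beta> where ab: "f' \<in> L2 M" "h' \<in> L2 M" "AE x in leb. f' x = sol \<alpha> \<beta> h' x" "?Q0 \<alpha> \<beta> h'"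
      by (auto simp: graph_of_def)
    note t = compact_support_imp_trivial_data[OF L2_M_integrable[OF ab(2)] ab(4)]
    have "L2_norm M (\<lambda>x. f x - G h' x) = L2_norm M (\<lambda>x. f x - f' x)"
      using ab(3) L(1) ab(1,2) G_L2[OF ab(2)] unfolding t
      by (intro L2_norm_cong_AE) (auto simp: L2_def AE_M elim: eventually_mono)
    then show ?thesis using t f' ab(2) by auto
  qed
  have small: "c = 0" if "\<And>e. e > 0 \<Longrightarrow> cmod c \<le> K * e" for c K
  proof (rule ccontr)
    assume c: "c \<noteq> 0"
    define k where "k = \<bar>K\<bar> + 1"
    have k: "k > 0" "K \<le> k" by (auto simp: k_def)
    define e where "e = cmod c / (2 * k)"
    have e: "e > 0" using c k by (simp add: e_def)
    have "cmod c \<le> K * e" by (rule that[OF e])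
    also have "\<dots> \<le> k * e" using e k by (intro mult_right_mono) auto
    also have "\<dots> = cmod c / 2" unfolding e_def using k by simp
    finally show False using c by simp
  qed
  have mom0: "L2_inner M y h = 0" if y: "y \<in> L2 M" and "\<And>h'. h' \<in> L2 M \<Longrightarrow> mom1 h' = 0 \<Longrightarrow> mom2 h' = 0 \<Longrightarrow> L2_inner M y h' = 0" for y
  proof (rule small)
    fix e :: real assume "e > 0"
    from approx[OF this] obtain h' where h': "h' \<in> L2 M" "mom1 h' = 0" "mom2 h' = 0" "L2_norm M (\<lambda>x. h x - h' x) < e" by blast
    have "L2_inner M y h = L2_inner M y (\<lambda>x. h x - h' x)" using that(2)[OF h'(1-3)] by (simp add: L2_inner_diff_right y L h')
    then have "cmod (L2_inner M y h) \<le> L2_norm M y * L2_norm M (\<lambda>x. h x - h' x)"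
      using L2_Cauchy_Schwarz[OF y L2_diff[OF L(2) h'(1)]] by simp
    also have "\<dots> \<le> L2_norm M y * e" using h'(4) by (intro mult_left_mono) auto
    finally show "cmod (L2_inner M y h) \<le> L2_norm M y * e" .
  qed
  have "mom1 h = 0" "mom2 h = 0"
    unfolding mom_eq_inner[OF L(2)] by (rule mom0[OF y_L2(1)], simp add: mom_eq_inner, rule mom0[OF y_L2(2)], simp add: mom_eq_inner)
  moreover have "complex_of_real (L2_norm M (\<lambda>x. f x - G h x)) = 0"
  proof (rule small)
    fix e :: real assume "e > 0"
    from approx[OF this] obtain h' where h': "h' \<in> L2 M" "L2_norm M (\<lambda>x. f x - G h' x) < e" "L2_norm M (\<lambda>x. h x - h' x) < e" by blast
    have "L2_norm M (\<lambda>x. G h' x - G h x) = L2_norm M (G (\<lambda>x. h' x - h x))"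
      by (rule arg_cong[where f="L2_norm M"]) (simp add: fun_eq_iff G_diff[OF h'(1) L(2)])
    also have "\<dots> \<le> C * L2_norm M (\<lambda>x. h' x - h x)" by (rule C(3)[OF L2_diff[OF h'(1) L(2)]])
    also have "\<dots> \<le> C * e" using h'(3) C(1) by (intro mult_left_mono) (auto simp: L2_norm_minus_commute[of M h'])
    finally have "L2_norm M (\<lambda>x. G h' x - G h x) \<le> C * e" .
    then show "cmod (complex_of_real (L2_norm M (\<lambda>x. f x - G h x))) \<le> (1 + C) * e"
      using L2_triangle_diff[OF L(1) G_L2[OF h'(1)] G_L2[OF L(2)]] h'(2) by (simp add: algebra_simps)
  qed
  then have "AE x in leb. f x = G h x"
    using L2_norm_eq_0_AE[OF L2_diff[OF L(1) G_L2[OF L(2)]]] by (simp add: AE_M)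
  ultimately show "(f, h) \<in> graph_of T_min_data" using L by (intro graph_ofI) auto
qed

text \<open>Truncating the source to a compact interval spoils its vanishing moments only slightly,
  and the biorthogonal sources restore them without leaving compact support.\<close>

lemma T_min_closure_supset: "graph_of T_min_data \<subseteq> op_closure M (graph_of (\<lambda>\<alpha> \<beta> h. compactly_supported_in a b (sol \<alpha> \<beta> h)))"
proof (rule subrelI)
  let ?Q0 = "\<lambda>\<alpha> \<beta> h. compactly_supported_in a b (sol \<alpha> \<beta> h)"
  obtain C where C: "0 < C" "\<And>h x. h \<in> L2 M \<Longrightarrow> x \<in> I \<Longrightarrow> cmod (G h x) \<le> C * L2_norm M h"
    "\<And>h. h \<in> L2 M \<Longrightarrow> L2_norm M (G h) \<le> C * L2_norm M h"
    by (rule sol_norm_bound) blast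
  fix f h assume "(f, h) \<in> graph_of T_min_data"
  then have fh: "f \<in> L2 M" "h \<in> L2 M" "AE x in leb. f x = G h x" "mom1 h = 0" "mom2 h = 0" by (auto simp: graph_of_def)
  obtain c0 d0 e1 e2 where e: "c0 \<in> I" "d0 \<in> I" "e1 \<in> L2 M" "e2 \<in> L2 M"
    "\<And>x. x \<notin> {c0..d0} \<Longrightarrow> e1 x = 0" "\<And>x. x \<notin> {c0..d0} \<Longrightarrow> e2 x = 0"
    "mom1 e1 = 1" "mom2 e1 = 0" "mom1 e2 = 0" "mom2 e2 = 1" by (rule biorthogonal_exists, rule that) assumption+
  \<comment> \<open>The ratio of the total change of the source to the truncation error: the
    truncation itself plus the two moment corrections, estimated by Cauchy-Schwarz.\<close>
  define K where "K = 1 + L2_norm M y1 * L2_norm M e1 + L2_norm M y2 * L2_norm M e2"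
  have K: "K \<ge> 1" by (simp add: K_def)
  show "(f, h) \<in> op_closure M (graph_of ?Q0)"
    unfolding op_closure_def
  proof (intro CollectI, simp only: prod.case, intro conjI allI impI fh(1,2))
    fix \<epsilon> :: real assume \<epsilon>: "\<epsilon> > 0"
    \<comment> \<open>The factor \<open>C + 1\<close> makes both \<open>K * \<delta>\<close> and
      \<open>C * (K * \<delta>)\<close>, the errors in source and in solution, smaller than
      \<epsilon>.\<close>
    define X where "X = K * (C + 1)"
    define \<delta> where "\<delta> = \<epsilon> / X"
    have KC: "X > 0" using K C(1) by (simp add: X_def)
    then have \<delta>: "\<delta> > 0" using \<epsilon> by (simp add: \<delta>_def)
    obtain c d where cd: "c \<in> I" "d \<in> I" "L2_norm M (\<lambda>x. h x - indicator {c..d} x * h x) < \<delta>"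
      "(\<lambda>x. indicator {c..d} x * h x) \<in> L2 M" by (rule truncation_tendsto[OF fh(2) \<delta>])
    define t where "t = (\<lambda>x. indicator {c..d} x * h x)"
    define h' where "h' = (\<lambda>x. (t x + (- mom1 t) * e1 x) + (- mom2 t) * e2 x)"
    have tL: "t \<in> L2 M" using cd(4) by (simp add: t_def)
    note h' = correct_moments[OF e(3,4,7-10) tL, folded h'_def]
    have supp: "h' x = 0" if "x \<notin> {min c c0..max d d0}" for x
    proof -
      have "x \<notin> {c..d}" "x \<notin> {c0..d0}" using that by auto
      then show ?thesis using e(5,6) by (simp add: h'_def t_def)
    qed
    have ends: "min c c0 \<in> I" "max d d0 \<in> I" using cd e by (auto simp: min_def max_def)
    have Q0: "?Q0 0 0 h'" by (rule compact_support_of_source[OF ends supp h'(2,3)])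
    have ht: "L2_norm M (\<lambda>x. h x - t x) < \<delta>" using cd(3) by (simp add: t_def)
    have m1: "cmod (mom1 t) \<le> L2_norm M y1 * \<delta>"
    proof -
      have "mom1 t = - L2_inner M y1 (\<lambda>x. h x - t x)"
        using fh(4) by (simp add: mom_eq_inner tL fh(2) L2_inner_diff_right y_L2)
      then have "cmod (mom1 t) \<le> L2_norm M y1 * L2_norm M (\<lambda>x. h x - t x)"
        using L2_Cauchy_Schwarz[OF y_L2(1) L2_diff[OF fh(2) tL]] by simp
      also have "\<dots> \<le> L2_norm M y1 * \<delta>" using ht by (intro mult_left_mono) auto
      finally show ?thesis .
    qed
    have m2: "cmod (mom2 t) \<le> L2_norm M y2 * \<delta>"
    proof -
      have "mom2 t = - L2_inner M y2 (\<lambda>x. h x - t x)"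
        using fh(5) by (simp add: mom_eq_inner tL fh(2) L2_inner_diff_right y_L2)
      then have "cmod (mom2 t) \<le> L2_norm M y2 * L2_norm M (\<lambda>x. h x - t x)"
        using L2_Cauchy_Schwarz[OF y_L2(2) L2_diff[OF fh(2) tL]] by simp
      also have "\<dots> \<le> L2_norm M y2 * \<delta>" using ht by (intro mult_left_mono) auto
      finally show ?thesis .
    qed
    have hh: "L2_norm M (\<lambda>x. h x - h' x) \<le> K * \<delta>"
    proof -
      have eq: "(\<lambda>x. h x - h' x) = (\<lambda>x. (h x - t x) + (mom1 t * e1 x + mom2 t * e2 x))"
        by (simp add: h'_def fun_eq_iff algebra_simps)
      have "L2_norm M (\<lambda>x. h x - h' x) \<le> L2_norm M (\<lambda>x. h x - t x) + L2_norm M (\<lambda>x. mom1 t * e1 x + mom2 t * e2 x)"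
        unfolding eq by (intro L2_triangle L2_diff L2_add L2_scale fh(2) tL e)
      also have "L2_norm M (\<lambda>x. mom1 t * e1 x + mom2 t * e2 x) \<le> L2_norm M (\<lambda>x. mom1 t * e1 x) + L2_norm M (\<lambda>x. mom2 t * e2 x)"
        by (intro L2_triangle L2_scale e)
      also have "\<dots> = cmod (mom1 t) * L2_norm M e1 + cmod (mom2 t) * L2_norm M e2" by (simp only: L2_norm_scale)
      also have "\<dots> \<le> (L2_norm M y1 * \<delta>) * L2_norm M e1 + (L2_norm M y2 * \<delta>) * L2_norm M e2"
        using m1 m2 by (intro add_mono mult_right_mono) auto
      finally show ?thesis using ht by (simp add: K_def algebra_simps)
    qed
    have "\<delta> * X = \<epsilon>" using KC by (simp add: \<delta>_def)
    then have K\<delta>: "K * \<delta> * (C + 1) = \<epsilon>" by (simp add: X_def mult.commute mult.left_commute)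
    have K\<delta>0: "K * \<delta> > 0" using K \<delta> by simp
    have "K * \<delta> * C + K * \<delta> = \<epsilon>" using K\<delta> by (simp add: distrib_left)
    moreover have "K * \<delta> * C > 0" using K\<delta>0 C(1) by simp
    ultimately have 1: "K * \<delta> < \<epsilon>" and 2: "C * (K * \<delta>) < \<epsilon>"
    using K\<delta>0 by (simp_all add: mult.commute[of C])
    have "L2_norm M (\<lambda>x. f x - G h' x) = L2_norm M (G (\<lambda>x. h x - h' x))"
    proof (rule L2_norm_cong_AE)
      show "AE x in M. f x - G h' x = G (\<lambda>x. h x - h' x) x"
        unfolding AE_M using fh(3) by eventually_elim (simp add: G_diff[OF fh(2) h'(1)])
    qed (use fh(1) G_L2[OF h'(1)] G_L2[OF L2_diff[OF fh(2) h'(1)]] in \<open>auto simp: L2_def\<close>)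
    also have "\<dots> \<le> C * L2_norm M (\<lambda>x. h x - h' x)" by (rule C(3)[OF L2_diff[OF fh(2) h'(1)]])
    also have "\<dots> \<le> C * (K * \<delta>)" using hh C(1) by (intro mult_left_mono) auto
    finally have 3: "L2_norm M (\<lambda>x. f x - G h' x) < \<epsilon>" using 2 by simp
    have "(G h', h') \<in> graph_of ?Q0" by (rule graph_of_sol) (use h'(1) Q0 in auto)
    then show "\<exists>(f', h')\<in>graph_of ?Q0. L2_norm M (\<lambda>x. f x - f' x) < \<epsilon> \<and> L2_norm M (\<lambda>x. h x - h' x) < \<epsilon>"
      using 3 hh 1 by (intro bexI[of _ "(G h', h')"]) auto
  qed
qed

theorem T_min_eq: "T_min a b p q r s = graph_of T_min_data"
proof -
  define D where "D = {g \<in> dom_max a b p q r s. compactly_supported_in a b g}"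
  let ?Q0 = "\<lambda>\<alpha> \<beta> h. compactly_supported_in a b (sol \<alpha> \<beta> h)"
  have cs_cong: "compactly_supported_in a b g \<longleftrightarrow> compactly_supported_in a b g'" if "\<And>x. x \<in> I \<Longrightarrow> g x = g' x" for g g'
    unfolding compactly_supported_in_def using that by auto
  have T0: "tau_op a b p q r s D = graph_of ?Q0"
  proof (rule tau_op_eq_graph_of)
    show "D \<subseteq> dom_max a b p q r s" by (auto simp: D_def)
    show "?Q0 \<alpha> \<beta> h" if "g \<in> D" "h \<in> L2 M" "\<And>x. x \<in> I \<Longrightarrow> g x = sol \<alpha> \<beta> h x" for g \<alpha> \<beta> h
      using that(1) cs_cong[OF that(3)] by (simp add: D_def)
    show "sol \<alpha> \<beta> h \<in> D" if "h \<in> L2 M" "?Q0 \<alpha> \<beta> h" for \<alpha> \<beta> h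
      using that sol_dom_max by (simp add: D_def)
  qed
  show ?thesis
    unfolding T_min_def D_def[symmetric] T0 using T_min_closure_subset T_min_closure_supset by (rule equalityI)
qed

text \<open>\<open>g - G k\<close> is orthogonal to every source with vanishing moments. Such
  sources have codimension two, so the difference is a combination of \<open>y1\<close> and
  \<open>y2\<close>, and pairing with the biorthogonal sources yields its coefficients.\<close>

theorem T_min_adjoint:
  assumes gk: "(g, k) \<in> op_adjoint M (graph_of T_min_data)"
  shows "(g, k) \<in> graph_of (\<lambda>_ _ _. True)"
proof -
  have L: "g \<in> L2 M" "k \<in> L2 M" using gk by (auto simp: op_adjoint_def)
  obtain c0 d0 e1 e2 where e: "e1 \<in> L2 M" "e2 \<in> L2 M"
      "mom1 e1 = 1" "mom2 e1 = 0" "mom1 e2 = 0" "mom2 e2 = 1" by (rule biorthogonal_exists, rule that) assumption+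
  define w where "w = (\<lambda>x. g x - G k x)"
  have w: "w \<in> L2 M" unfolding w_def by (intro L2_diff L G_L2)
  have orth: "L2_inner M h w = 0" if h: "h \<in> L2 M" "mom1 h = 0" "mom2 h = 0" for h
  proof -
    have "(G h, h) \<in> graph_of T_min_data" by (rule graph_of_sol) (use h in auto)
    then have "L2_inner M h g = L2_inner M (G h) k" using gk by (auto simp: op_adjoint_def)
    then show ?thesis unfolding w_def using h L G_L2 by (simp add: L2_inner_diff_right G_symmetric)
  qed
  define c1 where "c1 = L2_inner M e1 w"
  define c2 where "c2 = L2_inner M e2 w"
  define v where "v = (\<lambda>x. w x - (c1 * y1 x + c2 * y2 x))"
  have v: "v \<in> L2 M" unfolding v_def by (intro L2_diff w L2_add L2_scale y_L2)
  have "L2_inner M h v = 0" if h: "h \<in> L2 M" for h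
  proof -
    let ?h = "\<lambda>x. (h x + (- mom1 h) * e1 x) + (- mom2 h) * e2 x"
    note h' = correct_moments[OF e h]
    have 1: "(\<lambda>x. h x + (- mom1 h) * e1 x) \<in> L2 M" by (intro L2_add L2_scale h e)
    have "0 = L2_inner M ?h w" by (rule orth[OF h', symmetric])
    also have "\<dots> = L2_inner M h w + cnj (- mom1 h) * c1 + cnj (- mom2 h) * c2"
      unfolding L2_inner_add_left[OF w 1 L2_scale[OF e(2)]] L2_inner_add_left[OF w h L2_scale[OF e(1)]] L2_inner_scale_left c1_def c2_def ..
    finally have hw: "L2_inner M h w = cnj (mom1 h) * c1 + cnj (mom2 h) * c2" by (simp add: algebra_simps)
    have "L2_inner M h y1 = cnj (mom1 h)" "L2_inner M h y2 = cnj (mom2 h)"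
      using L2_inner_cnj[of M h y1] L2_inner_cnj[of M h y2] mom_eq_inner[OF h] by simp_all
    then show ?thesis
      unfolding v_def using hw h w y_L2 by (simp add: L2_inner_diff_right L2_inner_add_right L2_add L2_scale L2_inner_scale_right)
  qed
  from this[OF v] have "AE x in M. v x = 0" by (intro L2_norm_eq_0_AE v) (simp add: L2_inner_self)
  then have "AE x in leb. g x = sol c1 c2 k x" unfolding AE_M sol_decomp[of c1 c2 k] by (simp add: v_def w_def algebra_simps)
  then show ?thesis by (intro graph_ofI L) auto
qed

section \<open>The candidate operator\<close>

text \<open>Leaving \<alpha> and \<beta> free adds the kernel of the adjoint to the domain of
  \<open>T_min\<close>.\<close>

abbreviation (input) "Krein_data \<equiv> (\<lambda>\<alpha> \<beta> h. mom1 h = 0 \<and> mom2 h = 0)"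

lemma graph_of_mono: "(\<And>\<alpha> \<beta> h. Q \<alpha> \<beta> h \<Longrightarrow> Q' \<alpha> \<beta> h) \<Longrightarrow> graph_of Q \<subseteq> graph_of Q'"
  unfolding graph_of_def by blast

lemma op_adjoint_antimono: "T \<subseteq> S \<Longrightarrow> op_adjoint M' S \<subseteq> op_adjoint M' T"
  by (auto simp: op_adjoint_def)

lemma inner_Krein:
  assumes "(f, h) \<in> graph_of (\<lambda>_ _ _. True)" "k \<in> L2 M" "mom1 k = 0" "mom2 k = 0"
  shows "L2_inner M k f = L2_inner M k (G h)"
proof -
  obtain \<alpha> \<beta> where fh: "f \<in> L2 M" "h \<in> L2 M" "AE x in leb. f x = sol \<alpha> \<beta> h x" using assms(1) by (auto simp: graph_of_def)
  have "L2_inner M k f = L2_inner M k (sol \<alpha> \<beta> h)"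
    by (rule L2_inner_cong_AE) (use fh assms(2) sol_L2[OF L2_M_integrable[OF fh(2)]] in \<open>auto simp: AE_M\<close>)
  also have "\<dots> = \<alpha> * cnj (mom1 k) + \<beta> * cnj (mom2 k) + L2_inner M k (G h)" by (rule inner_sol[OF assms(2) fh(2)])
  finally show ?thesis using assms(3,4) by simp
qed

text \<open>The homogeneous solutions belong to the graph with source 0; testing against them forces
  the moments of \<open>k\<close> to vanish. Conversely, homogeneous parts are invisible to sources
  without moments, so symmetry reduces to that of \<open>G\<close>.\<close>

lemma Krein_adjoint: "op_adjoint M (graph_of Krein_data) = graph_of Krein_data"
proof (intro equalityI subrelI)
  fix g k assume gk: "(g, k) \<in> op_adjoint M (graph_of Krein_data)"
  have "graph_of T_min_data \<subseteq> graph_of Krein_data" by (rule graph_of_mono) simp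
  with gk have "(g, k) \<in> op_adjoint M (graph_of T_min_data)" using op_adjoint_antimono by blast
  then have g: "(g, k) \<in> graph_of (\<lambda>_ _ _. True)" by (rule T_min_adjoint)
  then obtain \<alpha> \<beta> where k: "g \<in> L2 M" "k \<in> L2 M" "AE x in leb. g x = sol \<alpha> \<beta> k x" by (auto simp: graph_of_def)
  have "(sol 1 0 (\<lambda>x. 0), \<lambda>x. 0) \<in> graph_of Krein_data" "(sol 0 1 (\<lambda>x. 0), \<lambda>x. 0) \<in> graph_of Krein_data"
    by (rule graph_of_sol[OF L2_zero]; simp)+
  then have "L2_inner M (sol 1 0 (\<lambda>x. 0)) k = 0" "L2_inner M (sol 0 1 (\<lambda>x. 0)) k = 0"
    using gk by (fastforce simp: op_adjoint_def)+
  moreover have "sol 1 0 (\<lambda>x. 0) = y1" "sol 0 1 (\<lambda>x. 0) = y2" by (simp_all add: sol_homogeneous fun_eq_iff)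
  ultimately have "mom1 k = 0" "mom2 k = 0" using mom_eq_inner[OF k(2)] by simp_all
  then show "(g, k) \<in> graph_of Krein_data" using k by (intro graph_ofI) auto
next
  fix g k assume "(g, k) \<in> graph_of Krein_data"
  then have gk: "g \<in> L2 M" "k \<in> L2 M" "(g, k) \<in> graph_of (\<lambda>_ _ _. True)" "mom1 k = 0" "mom2 k = 0" by (auto simp: graph_of_def)
  have "L2_inner M h g = L2_inner M f k" if "(f, h) \<in> graph_of Krein_data" for f h
  proof -
    have fh: "f \<in> L2 M" "h \<in> L2 M" "(f, h) \<in> graph_of (\<lambda>_ _ _. True)" "mom1 h = 0" "mom2 h = 0" using that by (auto simp: graph_of_def)
    have "L2_inner M f k = cnj (L2_inner M k f)" by (rule L2_inner_cnj)
    also have "\<dots> = cnj (L2_inner M k (G h))" using inner_Krein[OF fh(3) gk(2,4,5)] by simp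
    also have "\<dots> = L2_inner M (G h) k" by (rule L2_inner_cnj[symmetric])
    also have "\<dots> = L2_inner M h (G k)" by (rule G_symmetric[OF fh(2) gk(2) fh(4,5)])
    also have "\<dots> = L2_inner M h g" using inner_Krein[OF gk(3) fh(2,4,5)] by simp
    finally show ?thesis by simp
  qed
  then show "(g, k) \<in> op_adjoint M (graph_of Krein_data)" using gk(1,2) by (auto simp: op_adjoint_def)
qed

text \<open>A function \<open>w\<close> orthogonal to the domain has no moments, since the domain
  contains \<open>y1\<close> and \<open>y2\<close>. Orthogonality to the functions
  \<open>G h\<close> then puts \<open>G w\<close>, with source 0, into the adjoint of
  \<open>T_min\<close>; so \<open>G w\<close> is homogeneous, and \<open>w\<close> vanishes.\<close>

lemma Krein_dense: "densely_defined M (graph_of Krein_data)"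
  unfolding densely_defined_def
proof (intro ballI allI impI)
  fix f and e :: real assume f: "f \<in> L2 M" and e: "e > 0"
  define D where "D = fst ` graph_of Krein_data"
  have "\<exists>g\<in>D. L2_norm M (\<lambda>x. f x - g x) < e"
  proof (rule M.L2_dense_of_trivial_orthogonal[OF _ _ _ _ f e])
    show "D \<subseteq> L2 M" by (auto simp: D_def graph_of_def)
    have y: "y1 \<in> D" "y2 \<in> D"
      unfolding D_def
      using graph_of_sol[OF L2_zero, of Krein_data 1 0] graph_of_sol[OF L2_zero, of Krein_data 0 1]
      by (force simp: sol_homogeneous image_iff)+
    then show "D \<noteq> {}" by blast
    show "(\<lambda>x. f x + c * g x) \<in> D" if fg: "f \<in> D" "g \<in> D" for f g c
    proof -
      obtain h k where hk: "(f, h) \<in> graph_of Krein_data" "(g, k) \<in> graph_of Krein_data" using fg unfolding D_def by fastforce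
      have adj: "(f, h) \<in> op_adjoint M (graph_of Krein_data)" if "(f, h) \<in> graph_of Krein_data" for f h
        using that unfolding Krein_adjoint .
      have "graph_of Krein_data \<subseteq> L2 M \<times> L2 M" unfolding graph_of_def by blast
      from op_adjoint_linear[OF this adj[OF hk(1)] adj[OF hk(2)]]
      have "(\<lambda>x. f x + c * g x, \<lambda>x. h x + c * k x) \<in> graph_of Krein_data" unfolding Krein_adjoint .
      then show ?thesis unfolding D_def by (rule image_eqI[rotated]) simp
    qed
    fix w assume w: "w \<in> L2 M" and orth: "\<And>g. g \<in> D \<Longrightarrow> L2_inner M w g = 0"
    have mw: "mom1 w = 0" "mom2 w = 0"
      unfolding mom_eq_inner[OF w] by (subst L2_inner_cnj, simp add: orth y)+
    have "(G w, \<lambda>x. 0) \<in> op_adjoint M (graph_of T_min_data)"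
      unfolding op_adjoint_def
    proof (clarsimp simp: G_L2[OF w] L2_zero)
      fix f h assume fh: "(f, h) \<in> graph_of T_min_data"
      then have h: "h \<in> L2 M" "mom1 h = 0" "mom2 h = 0" by (auto simp: graph_of_def)
      have "(G h, h) \<in> graph_of Krein_data" by (rule graph_of_sol) (use h in auto)
      then have "G h \<in> D" unfolding D_def by (rule image_eqI[rotated]) simp
      then have "L2_inner M w (G h) = 0" by (rule orth)
      then have "L2_inner M (G w) h = 0" using G_symmetric[OF w h(1) mw] by simp
      then show "L2_inner M h (G w) = 0" by (subst L2_inner_cnj) simp
    qed
    from T_min_adjoint[OF this] obtain \<alpha> \<beta> where ab: "AE x in leb. G w x = sol \<alpha> \<beta> (\<lambda>x. 0) x" by (auto simp: graph_of_def)
    have "AE x in leb. x \<in> I \<longrightarrow> sol (- \<alpha>) (- \<beta>) w x = 0"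
      using ab
    proof eventually_elim
      case (elim x) then show ?case unfolding sol_decomp[of "- \<alpha>" "- \<beta>" w] by (simp add: sol_homogeneous)
    qed
    from sol_local_uniqueness(1)[OF L2_M_integrable[OF w] open_einterval order_refl this]
    show "AE x in M. w x = 0" unfolding AE_M using AE_space by eventually_elim simp
  qed
  then show "\<exists>(g, h)\<in>graph_of Krein_data. L2_norm M (\<lambda>x. f x - g x) < e" by (auto simp: D_def)
qed

theorem Krein_self_adjoint: "self_adjoint M (graph_of Krein_data)"
  by (simp add: self_adjoint_def Krein_dense Krein_adjoint)

end

section \<open>Approximate point sources\<close>

lemma (in finite_measure) L2_dominated_convergence:
  assumes f: "\<And>n. f n \<in> L2 M" and g: "g \<in> L2 M"
    and bd: "\<And>n. AE x in M. cmod (f n x - g x) \<le> B"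
    and lim: "AE x in M. (\<lambda>n. f n x) \<longlonglongrightarrow> g x"
  shows "(\<lambda>n. L2_norm M (\<lambda>x. f n x - g x)) \<longlonglongrightarrow> 0"
proof -
  have [measurable]: "f n \<in> borel_measurable M" "g \<in> borel_measurable M" for n using f g by (auto simp: L2_def)
  have "(\<lambda>n. LINT x|M. (cmod (f n x - g x))\<^sup>2) \<longlonglongrightarrow> (LINT x|M. 0)"
  proof (rule Bochner_Integration.integral_dominated_convergence[where w="\<lambda>x. B\<^sup>2"])
    show "AE x in M. (\<lambda>n. (cmod (f n x - g x))\<^sup>2) \<longlonglongrightarrow> 0"
      using lim by eventually_elim (auto intro!: tendsto_eq_intros simp: LIM_zero_iff tendsto_norm_zero_iff)
    show "AE x in M. norm ((cmod (f n x - g x))\<^sup>2) \<le> B\<^sup>2" for n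
      using bd[of n] by eventually_elim (simp add: power_mono)
  qed simp_all
  then have "(\<lambda>n. sqrt (LINT x|M. (cmod (f n x - g x))\<^sup>2)) \<longlonglongrightarrow> sqrt 0"
    by (intro tendsto_real_sqrt) simp
  then show ?thesis by (simp add: L2_norm_def)
qed

context sturm_liouville_system
begin

text \<open>The bump is normalised so that \<open>r * \<delta>\<close> is a probability density
  \<rho>; all estimates are averages over \<open>{l..u}\<close>, where \<open>y1\<close> and
  \<open>y2\<close> are nearly constant. The self-energy is small because the kernel
  \<open>y1 x * y2 t - y2 x * y1 t\<close> of \<open>G\<close> vanishes on the diagonal.\<close>

lemma bump_exists:
  assumes lu: "l < u" "l \<in> I" "u \<in> I" and e: "0 \<le> e"
    and close: "\<And>t. t \<in> {l..u} \<Longrightarrow> cmod (y1 t - Y1) \<le> e" "\<And>t. t \<in> {l..u} \<Longrightarrow> cmod (y2 t - Y2) \<le> e"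
  obtains \<delta> where "\<delta> \<in> L2 M" "\<And>x. x \<notin> {l..u} \<Longrightarrow> \<delta> x = 0"
    "cmod (mom1 \<delta> - Y1) \<le> e" "cmod (mom2 \<delta> - Y2) \<le> e"
    "\<And>x. cmod (prim1 \<delta> x) \<le> cmod Y1 + cmod Y2 + e" "\<And>x. cmod (prim2 \<delta> x) \<le> cmod Y1 + cmod Y2 + e"
    "cmod (L2_inner M \<delta> (G \<delta>)) \<le> 3 * (e * (cmod Y1 + cmod Y2 + e))"
proof -
  have sub: "{l..u} \<subseteq> I" by (rule Icc_subset_einterval[OF lu(2,3)])
  have indr [measurable]: "indicat_real {l..u} \<in> borel_measurable leb"
    by (rule measurable_restrict_space1) (simp add: borel_measurable_indicator)
  define w where "w t = r t * indicat_real {l..u} t" for t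
  have w: "integrable leb w"
    unfolding w_def by (rule Bochner_Integration.integrable_bound[OF r_integrable], measurable) (auto simp: indicator_def)
  have w0: "AE t in leb. 0 \<le> w t" using r_nonneg by eventually_elim (simp add: w_def)
  define m where "m = (LINT t|leb. w t)"
  \<comment> \<open>\<open>r\<close> is positive almost everywhere, so a zero integral would make a
    nonempty open interval negligible.\<close>
  have "m \<noteq> 0"
  proof
    assume "m = 0"
    then have "AE t in leb. w t = 0"
      using integral_nonneg_eq_0_iff_AE[OF w w0] by (simp add: m_def)
    then have "AE t in leb. t \<in> {l<..<u} \<longrightarrow> (1::complex) = 0"
      using r_pos by eventually_elim (auto simp: w_def)
    then have "(1::complex) = 0"
      by (rule AE_eq_continuous_eq[where S="{l<..<u}" and x="(l+u)/2" and f="\<lambda>_. 1" and g="\<lambda>_. 0", rotated 4])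
        (use sub lu(1) in \<open>auto simp: subset_iff\<close>)
    then show False by simp
  qed
  moreover have "0 \<le> m" unfolding m_def by (rule integral_nonneg_AE[OF w0])
  ultimately have m: "0 < m" by simp
  define \<rho> where "\<rho> t = w t / m" for t
  have \<rho>: "integrable leb \<rho>" "(LINT t|leb. \<rho> t) = 1" "AE t in leb. 0 \<le> \<rho> t" "\<And>t. t \<notin> {l..u} \<Longrightarrow> \<rho> t = 0"
  proof -
    show "integrable leb \<rho>" "(LINT t|leb. \<rho> t) = 1" unfolding \<rho>_def using w m by (simp_all add: m_def)
    show "AE t in leb. 0 \<le> \<rho> t" using w0 by eventually_elim (use m in \<open>simp add: \<rho>_def\<close>)
    show "\<rho> t = 0" if "t \<notin> {l..u}" for t using that by (simp add: \<rho>_def w_def)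
  qed
  define \<delta> where "\<delta> t = complex_of_real (indicat_real {l..u} t / m)" for t
  have \<delta>\<rho>: "complex_of_real (r t) * \<delta> t = complex_of_real (\<rho> t)" for t by (simp add: \<delta>_def \<rho>_def w_def)
  have L: "\<delta> \<in> L2 M"
    unfolding \<delta>_def by (rule L2_M_bounded[where B="1/m"], measurable) (use m in \<open>auto simp: indicator_def norm_divide\<close>)
  have supp: "\<delta> x = 0" if "x \<notin> {l..u}" for x using that by (simp add: \<delta>_def)
  have avg: "cmod (LINT t|leb. F t * complex_of_real (\<rho> t)) \<le> \<eta>"
    if F: "\<And>t. t \<in> {l..u} \<Longrightarrow> cmod (F t) \<le> \<eta>" and int: "integrable leb (\<lambda>t. F t * complex_of_real (\<rho> t))" for F \<eta>
  proof -
    have "cmod (LINT t|leb. F t * complex_of_real (\<rho> t)) \<le> (LINT t|leb. cmod (F t * complex_of_real (\<rho> t)))"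
      by (rule integral_norm_bound)
    also have "\<dots> \<le> (LINT t|leb. \<eta> * \<rho> t)"
    proof (rule integral_mono_AE)
      show "AE t in leb. cmod (F t * complex_of_real (\<rho> t)) \<le> \<eta> * \<rho> t"
        using \<rho>(3)
      proof eventually_elim
        case (elim t)
        show ?case
        proof (cases "t \<in> {l..u}")
          case True
          have "cmod (F t) * \<rho> t \<le> \<eta> * \<rho> t" by (rule mult_right_mono[OF F[OF True] elim])
          then show ?thesis using elim by (simp add: norm_mult)
        next
          case False
          then show ?thesis using \<rho>(4) by simp
        qed
      qed
    qed (use int \<rho>(1) in auto)
    also have "\<dots> = \<eta>" using \<rho>(2) by simp
    finally show ?thesis .
  qed
  have int: "integrable leb (\<lambda>t. complex_of_real (\<rho> t))" using \<rho>(1) by simp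
  have inty: "integrable leb (\<lambda>t. y1 t * complex_of_real (\<rho> t))" "integrable leb (\<lambda>t. y2 t * complex_of_real (\<rho> t))"
    using y_wint[OF L2_M_integrable[OF L]] unfolding \<delta>\<rho> by auto
  have one: "(LINT t|leb. complex_of_real (\<rho> t)) = 1" using \<rho>(2) by simp
  have moms: "cmod (mom1 \<delta> - Y1) \<le> e" "cmod (mom2 \<delta> - Y2) \<le> e"
  proof -
    have eq: "(LINT t|leb. y t * complex_of_real (\<rho> t)) - Y = (LINT t|leb. (y t - Y) * complex_of_real (\<rho> t))"
      if "integrable leb (\<lambda>t. y t * complex_of_real (\<rho> t))" for y Y
      using that int one by (simp add: left_diff_distrib)
    have i: "integrable leb (\<lambda>t. (y t - Y) * complex_of_real (\<rho> t))"
      if "integrable leb (\<lambda>t. y t * complex_of_real (\<rho> t))" for y Y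
      unfolding left_diff_distrib by (intro Bochner_Integration.integrable_diff integrable_mult_right that int)
    show "cmod (mom1 \<delta> - Y1) \<le> e" "cmod (mom2 \<delta> - Y2) \<le> e"
      unfolding mom1_def mom2_def \<delta>\<rho> eq[OF inty(1)] eq[OF inty(2)]
      by (rule avg[OF close(1) i[OF inty(1)]] avg[OF close(2) i[OF inty(2)]], assumption)+
  qed
  let ?N = "cmod Y1 + cmod Y2 + e"
  have N: "cmod (y1 t) \<le> ?N" "cmod (y2 t) \<le> ?N" if "t \<in> {l..u}" for t
    using close[OF that] norm_triangle_ineq2[of "y1 t" Y1] norm_triangle_ineq2[of "y2 t" Y2] norm_ge_zero[of Y1] norm_ge_zero[of Y2] by linarith+
  have N0: "0 \<le> ?N" using e by simp
  have pavg: "cmod (prim a b (\<lambda>t. F t * complex_of_real (\<rho> t)) x) \<le> \<eta>"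
    if F: "\<And>t. t \<in> {l..u} \<Longrightarrow> cmod (F t) \<le> \<eta>" and "0 \<le> \<eta>" and int: "integrable leb (\<lambda>t. F t * complex_of_real (\<rho> t))" for F \<eta> x
  proof -
    have eq: "(\<lambda>t. indicator {..<x} t *\<^sub>R (F t * complex_of_real (\<rho> t))) = (\<lambda>t. (indicator {..<x} t *\<^sub>R F t) * complex_of_real (\<rho> t))"
      by simp
    show ?thesis
      using prim_integrable[OF int, of x] unfolding prim_def eq
      by (intro avg) (use F \<open>0 \<le> \<eta>\<close> in \<open>auto simp: indicator_def\<close>)
  qed
  have prims: "cmod (prim1 \<delta> x) \<le> ?N" "cmod (prim2 \<delta> x) \<le> ?N" for x
    unfolding prim1_def prim2_def \<delta>\<rho> using N N0 inty by (auto intro!: pavg)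
  have Gb: "cmod (G \<delta> x) \<le> 3 * (e * ?N)" if x: "x \<in> {l..u}" for x
  proof -
    have "prim a b (\<lambda>t. (Y1 * y2 t - Y2 * y1 t) * complex_of_real (\<rho> t)) x = Y1 * prim2 \<delta> x - Y2 * prim1 \<delta> x"
    proof -
      have "prim a b (\<lambda>t. Y1 * (y2 t * complex_of_real (\<rho> t)) + (- Y2) * (y1 t * complex_of_real (\<rho> t))) x = Y1 * prim2 \<delta> x + (- Y2) * prim1 \<delta> x"
        unfolding prim1_def prim2_def \<delta>\<rho>
        by (subst prim_add) (use inty in \<open>simp_all add: prim_mult_left[of "- Y2", simplified] prim_mult_left\<close>)
      then show ?thesis by (simp add: left_diff_distrib mult.assoc)
    qed
    \<comment> \<open>Replacing \<open>y1 x\<close> and \<open>y2 x\<close> by \<open>Y1\<close> and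
      \<open>Y2\<close> leaves an antisymmetric main term that is small by itself; the three pieces
      account for the factor 3.\<close>
    then have G: "G \<delta> x = (y1 x - Y1) * prim2 \<delta> x - (y2 x - Y2) * prim1 \<delta> x
        + prim a b (\<lambda>t. (Y1 * y2 t - Y2 * y1 t) * complex_of_real (\<rho> t)) x"
      by (simp add: sol_def algebra_simps)
    have "cmod (prim a b (\<lambda>t. (Y1 * y2 t - Y2 * y1 t) * complex_of_real (\<rho> t)) x) \<le> e * ?N"
    proof (rule pavg)
      fix t assume t: "t \<in> {l..u}"
      have "Y1 * y2 t - Y2 * y1 t = Y1 * (y2 t - Y2) - Y2 * (y1 t - Y1)" by (simp add: algebra_simps)
      then have "cmod (Y1 * y2 t - Y2 * y1 t) \<le> cmod Y1 * cmod (y2 t - Y2) + cmod Y2 * cmod (y1 t - Y1)"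
        using norm_triangle_ineq4[of "Y1 * (y2 t - Y2)" "Y2 * (y1 t - Y1)"] by (simp add: norm_mult)
      also have "\<dots> \<le> cmod Y1 * e + cmod Y2 * e" using close[OF t] by (intro add_mono mult_left_mono) auto
      also have "\<dots> \<le> e * ?N" using e by (simp add: algebra_simps)
      finally show "cmod (Y1 * y2 t - Y2 * y1 t) \<le> e * ?N" .
    next
      have "integrable leb (\<lambda>t. Y1 * (y2 t * complex_of_real (\<rho> t)) - Y2 * (y1 t * complex_of_real (\<rho> t)))"
        using inty by (intro Bochner_Integration.integrable_diff integrable_mult_right)
      then show "integrable leb (\<lambda>t. (Y1 * y2 t - Y2 * y1 t) * complex_of_real (\<rho> t))"
        by (simp add: left_diff_distrib mult.assoc)
    qed (use e N0 in auto)
    moreover have "cmod ((y1 x - Y1) * prim2 \<delta> x) \<le> e * ?N" "cmod ((y2 x - Y2) * prim1 \<delta> x) \<le> e * ?N"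
      unfolding norm_mult by (intro mult_mono close x prims e norm_ge_zero)+
    ultimately show ?thesis
      unfolding G using norm_triangle_ineq[of "(y1 x - Y1) * prim2 \<delta> x - (y2 x - Y2) * prim1 \<delta> x" "prim a b (\<lambda>t. (Y1 * y2 t - Y2 * y1 t) * complex_of_real (\<rho> t)) x"]
        norm_triangle_ineq4[of "(y1 x - Y1) * prim2 \<delta> x" "(y2 x - Y2) * prim1 \<delta> x"] by linarith
  qed
  have GL: "G \<delta> \<in> L2 M" by (rule G_L2[OF L])
  have [measurable]: "\<delta> \<in> borel_measurable leb" "G \<delta> \<in> borel_measurable leb" using L GL L2_M_measurable by auto
  have eqr: "r x *\<^sub>R (cnj (\<delta> x) * G \<delta> x) = G \<delta> x * complex_of_real (\<rho> x)" for x
  proof -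
    have "cnj (\<delta> x) = \<delta> x" by (simp add: \<delta>_def)
    then show ?thesis unfolding \<delta>\<rho>[symmetric] by (simp add: scaleR_conv_of_real)
  qed
  have inner: "L2_inner M \<delta> (G \<delta>) = (LINT t|leb. G \<delta> t * complex_of_real (\<rho> t))"
    unfolding L2_inner_def by (subst integral_M) (simp_all only: eqr, measurable)
  have "integrable leb (\<lambda>t. G \<delta> t * complex_of_real (\<rho> t))"
    using L2_mult_integrable[OF L GL] integrable_M[of "\<lambda>x. cnj (\<delta> x) * G \<delta> x"] unfolding eqr by simp
  then have "cmod (L2_inner M \<delta> (G \<delta>)) \<le> 3 * (e * ?N)" unfolding inner by (intro avg Gb)
  then show ?thesis using that L supp moms prims by blast
qed

text \<open>\<open>Y1\<close> and \<open>Y2\<close> are the values of the fundamental solutions at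
  the point carrying the source, and \<theta> is the set of points to its right: \<open>UNIV\<close>
  for the endpoint \<open>a\<close>, \<open>{}\<close> for \<open>b\<close>, a ray for an interior
  point. Convergence is demanded of solutions, moments and self-energies, not of the sources, whose
  norms blow up as they concentrate.\<close>

definition "delta_at \<theta> Y1 Y2 \<delta> \<longleftrightarrow> (\<forall>n. \<delta> n \<in> L2 M) \<and> (\<lambda>n. mom1 (\<delta> n)) \<longlonglongrightarrow> Y1 \<and> (\<lambda>n. mom2 (\<delta> n)) \<longlonglongrightarrow> Y2 \<and>
  (\<lambda>n. L2_norm M (\<lambda>x. G (\<delta> n) x - (if x \<in> \<theta> then y1 x * Y2 - y2 x * Y1 else 0))) \<longlonglongrightarrow> 0 \<and>
  (\<lambda>x. if x \<in> \<theta> then y1 x * Y2 - y2 x * Y1 else 0) \<in> L2 M \<and>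
  (\<lambda>n. L2_inner M (\<delta> n) (G (\<delta> n))) \<longlonglongrightarrow> 0"

text \<open>By \<open>pos\<close> almost every point is eventually behind or before the support,
  which fixes the pointwise limit; uniform bounds on the running integrals make the convergence
  dominated.\<close>

lemma delta_sequence:
  fixes l u e :: "nat \<Rightarrow> real"
  assumes lu: "\<And>n. l n < u n" "\<And>n. l n \<in> I" "\<And>n. u n \<in> I"
    and e: "\<And>n. 0 \<le> e n" "e \<longlonglongrightarrow> 0"
    and close: "\<And>n t. t \<in> {l n..u n} \<Longrightarrow> cmod (y1 t - Y1) \<le> e n" "\<And>n t. t \<in> {l n..u n} \<Longrightarrow> cmod (y2 t - Y2) \<le> e n"
    and pos: "AE x in leb. \<forall>\<^sub>F n in sequentially. if x \<in> \<theta> then u n < x else x \<le> l n"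
    and \<theta>: "\<theta> \<in> sets borel"
  obtains \<delta> where "delta_at \<theta> Y1 Y2 \<delta>" "\<And>n x. \<delta> n x \<noteq> 0 \<Longrightarrow> x \<in> {l n..u n}"
proof -
  have "\<exists>\<delta>. \<delta> \<in> L2 M \<and> (\<forall>x. x \<notin> {l n..u n} \<longrightarrow> \<delta> x = 0) \<and>
    cmod (mom1 \<delta> - Y1) \<le> e n \<and> cmod (mom2 \<delta> - Y2) \<le> e n \<and>
    (\<forall>x. cmod (prim1 \<delta> x) \<le> cmod Y1 + cmod Y2 + e n) \<and> (\<forall>x. cmod (prim2 \<delta> x) \<le> cmod Y1 + cmod Y2 + e n) \<and>
    cmod (L2_inner M \<delta> (G \<delta>)) \<le> 3 * (e n * (cmod Y1 + cmod Y2 + e n))" for n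
    by (rule bump_exists[OF lu(1)[of n] lu(2)[of n] lu(3)[of n] e(1)[of n] close(1)[of _ n] close(2)[of _ n]]) blast+
  then obtain \<delta> where \<delta>: "\<And>n. \<delta> n \<in> L2 M" "\<And>n x. x \<notin> {l n..u n} \<Longrightarrow> \<delta> n x = 0"
    "\<And>n. cmod (mom1 (\<delta> n) - Y1) \<le> e n" "\<And>n. cmod (mom2 (\<delta> n) - Y2) \<le> e n"
    "\<And>n x. cmod (prim1 (\<delta> n) x) \<le> cmod Y1 + cmod Y2 + e n" "\<And>n x. cmod (prim2 (\<delta> n) x) \<le> cmod Y1 + cmod Y2 + e n"
    "\<And>n. cmod (L2_inner M (\<delta> n) (G (\<delta> n))) \<le> 3 * (e n * (cmod Y1 + cmod Y2 + e n))"
    by metis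
  let ?g = "\<lambda>x. if x \<in> \<theta> then y1 x * Y2 - y2 x * Y1 else 0"
  obtain B where B: "0 < B" "\<And>x. x \<in> I \<Longrightarrow> cmod (y1 x) \<le> B" "\<And>x. x \<in> I \<Longrightarrow> cmod (y2 x) \<le> B" by (rule y_bounded) blast
  obtain E where E: "\<And>n. e n \<le> E" using convergent_imp_Bseq[of e] e(2) unfolding Bseq_def convergent_def
    by (metis abs_le_D1 real_norm_def)
  have m1: "(\<lambda>n. mom1 (\<delta> n)) \<longlonglongrightarrow> Y1" and m2: "(\<lambda>n. mom2 (\<delta> n)) \<longlonglongrightarrow> Y2"
    by (rule LIM_zero_cancel, rule Lim_null_comparison[OF always_eventually e(2)], use \<delta>(3,4) in blast)+
  have inner: "(\<lambda>n. L2_inner M (\<delta> n) (G (\<delta> n))) \<longlonglongrightarrow> 0"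
  proof (rule Lim_null_comparison[OF always_eventually])
    show "(\<lambda>n. 3 * (e n * (cmod Y1 + cmod Y2 + e n))) \<longlonglongrightarrow> 0" by (rule tendsto_eq_intros e(2) refl | simp)+
  qed (use \<delta>(7) in blast)
  have gm: "?g \<in> borel_measurable leb"
  proof -
    have [measurable]: "\<theta> \<inter> I \<in> sets leb" using \<theta> by (auto simp: sets_restrict_space)
    have "(\<lambda>x. if x \<in> \<theta> \<inter> I then y1 x * Y2 - y2 x * Y1 else 0) \<in> borel_measurable leb" by measurable
    then show ?thesis by (rule measurable_cong[THEN iffD1, rotated]) auto
  qed
  have gb: "cmod (?g x) \<le> B * cmod Y2 + B * cmod Y1" if "x \<in> I" for x
  proof -
    have "cmod (y1 x * Y2 - y2 x * Y1) \<le> B * cmod Y2 + B * cmod Y1"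
      by (rule order_trans[OF norm_triangle_ineq4]) (use B that in \<open>auto simp: norm_mult intro!: add_mono mult_right_mono\<close>)
    then show ?thesis using B(1) by (auto intro!: add_nonneg_nonneg)
  qed
  have gL: "?g \<in> L2 M" by (rule L2_M_bounded[OF gm gb])
  have GL: "G (\<delta> n) \<in> L2 M" for n by (rule G_L2[OF \<delta>(1)])
  have Gb: "cmod (G (\<delta> n) x) \<le> 2 * (B * (cmod Y1 + cmod Y2 + E))" if "x \<in> I" for n x
  proof -
    have "cmod (prim1 (\<delta> n) x) \<le> cmod Y1 + cmod Y2 + E" "cmod (prim2 (\<delta> n) x) \<le> cmod Y1 + cmod Y2 + E"
      using \<delta>(5,6)[of n x] E[of n] by auto
    then have "cmod (y1 x * prim2 (\<delta> n) x) \<le> B * (cmod Y1 + cmod Y2 + E)" "cmod (y2 x * prim1 (\<delta> n) x) \<le> B * (cmod Y1 + cmod Y2 + E)"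
      unfolding norm_mult using B that by (auto intro!: mult_mono)
    then show ?thesis unfolding sol_def using norm_triangle_ineq4[of "y1 x * prim2 (\<delta> n) x" "y2 x * prim1 (\<delta> n) x"] by simp
  qed
  have "(\<lambda>n. L2_norm M (\<lambda>x. G (\<delta> n) x - ?g x)) \<longlonglongrightarrow> 0"
  proof (rule M.L2_dominated_convergence[OF GL gL])
    show "AE x in M. cmod (G (\<delta> n) x - ?g x) \<le> 2 * (B * (cmod Y1 + cmod Y2 + E)) + (B * cmod Y2 + B * cmod Y1)" for n
      unfolding AE_M by (rule AE_I2) (rule order_trans[OF norm_triangle_ineq4 add_mono[OF Gb gb]], auto)
    show "AE x in M. (\<lambda>n. G (\<delta> n) x) \<longlonglongrightarrow> ?g x"
      unfolding AE_M using pos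
    proof eventually_elim
      case (elim x)
      show ?case
      proof (cases "x \<in> \<theta>")
        case True
        \<comment> \<open>Behind the support the running integrals have reached the full
          moments.\<close>
        have "(\<lambda>n. y1 x * mom2 (\<delta> n) - y2 x * mom1 (\<delta> n)) \<longlonglongrightarrow> y1 x * Y2 - y2 x * Y1"
          by (intro tendsto_intros m1 m2)
        moreover have "\<forall>\<^sub>F n in sequentially. y1 x * mom2 (\<delta> n) - y2 x * mom1 (\<delta> n) = G (\<delta> n) x"
          using elim
        proof eventually_elim
          case (elim n)
          then have "u n < x" using True by simp
          then show ?case using prim12_full_right[of x "\<delta> n"] \<delta>(2)[of _ n] by (simp add: sol_def)
        qed
        ultimately show ?thesis using True by (simp add: tendsto_cong)
      next
        case False
        have "\<forall>\<^sub>F n in sequentially. G (\<delta> n) x = 0"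
          using elim
        proof eventually_elim
          case (elim n)
          then have "x \<le> l n" using False by simp
          then show ?case using prim12_zero_left[of x "\<delta> n"] \<delta>(2)[of _ n] by (simp add: sol_def)
        qed
        then show ?thesis using False by (simp add: tendsto_eventually)
      qed
    qed
  qed
  then have "delta_at \<theta> Y1 Y2 \<delta>" unfolding delta_at_def using \<delta>(1) m1 m2 gL inner by blast
  then show ?thesis using that \<delta>(2) by blast
qed

end

section \<open>Intervals shrinking to the endpoints\<close>

context nonempty_einterval
begin

lemma Icc_near_left_end:
  assumes "\<forall>\<^sub>F z in at_right a. P (real_of_ereal z)"
  obtains l u where "l < u" "l \<in> I" "u \<in> I" "\<And>t. t \<in> {l..u} \<Longrightarrow> P t"
proof -
  have "\<forall>\<^sub>F z in at_right a. P (real_of_ereal z) \<and> real_of_ereal z \<in> I"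
    using assms eventually_in_einterval(1) by eventually_elim simp
  then obtain d where d: "d > a" "\<And>z. a < z \<Longrightarrow> z < d \<Longrightarrow> P (real_of_ereal z) \<and> real_of_ereal z \<in> I"
    unfolding eventually_at_right[OF ab] by blast
  obtain v where v: "a < v" "v < d" using dense[OF d(1)] by blast
  obtain w where w: "a < w" "w < v" using dense[OF v(1)] by blast
  have e: "ereal (real_of_ereal v) = v" "ereal (real_of_ereal w) = w" using v w by (intro ereal_real'; auto)+
  show ?thesis
  proof (rule that[of "real_of_ereal w" "real_of_ereal v"])
    show "real_of_ereal w < real_of_ereal v" using w(2) e by (metis less_ereal.simps(1))
    show "real_of_ereal w \<in> I" "real_of_ereal v \<in> I" using d(2) v w less_trans by blast+
    fix t assume "t \<in> {real_of_ereal w..real_of_ereal v}"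
    then have "w \<le> ereal t" "ereal t \<le> v" using e by (metis atLeastAtMost_iff ereal_less_eq(3))+
    then have "a < ereal t" "ereal t < d" using v w by (auto intro: less_le_trans le_less_trans)
    then show "P t" using d(2)[of "ereal t"] by simp
  qed
qed

lemma Icc_near_right_end:
  assumes "\<forall>\<^sub>F z in at_left b. P (real_of_ereal z)"
  obtains l u where "l < u" "l \<in> I" "u \<in> I" "\<And>t. t \<in> {l..u} \<Longrightarrow> P t"
proof -
  have "\<forall>\<^sub>F z in at_left b. P (real_of_ereal z) \<and> real_of_ereal z \<in> I"
    using assms eventually_in_einterval(2) by eventually_elim simp
  then obtain d where d: "d < b" "\<And>z. d < z \<Longrightarrow> z < b \<Longrightarrow> P (real_of_ereal z) \<and> real_of_ereal z \<in> I"
    unfolding eventually_at_left[OF ab] by blast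
  obtain w where w: "d < w" "w < b" using dense[OF d(1)] by blast
  obtain v where v: "w < v" "v < b" using dense[OF w(2)] by blast
  have e: "ereal (real_of_ereal v) = v" "ereal (real_of_ereal w) = w" using v w by (intro ereal_real'; auto)+
  show ?thesis
  proof (rule that[of "real_of_ereal w" "real_of_ereal v"])
    show "real_of_ereal w < real_of_ereal v" using v(1) e by (metis less_ereal.simps(1))
    show "real_of_ereal w \<in> I" "real_of_ereal v \<in> I" using d(2) v w less_trans by blast+
    fix t assume "t \<in> {real_of_ereal w..real_of_ereal v}"
    then have "w \<le> ereal t" "ereal t \<le> v" using e by (metis atLeastAtMost_iff ereal_less_eq(3))+
    then have "d < ereal t" "ereal t < b" using v w by (auto intro: less_le_trans le_less_trans)
    then show "P t" using d(2)[of "ereal t"] by simp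
  qed
qed

lemma exhausting_sequences:
  obtains L U :: "nat \<Rightarrow> real" where "\<And>n. L n \<in> I" "\<And>n. U n \<in> I"
    "\<And>x. x \<in> I \<Longrightarrow> \<forall>\<^sub>F n in sequentially. L n \<le> x" "\<And>x. x \<in> I \<Longrightarrow> \<forall>\<^sub>F n in sequentially. x \<le> U n"
proof -
  obtain u l :: "nat \<Rightarrow> real" where ul: "I = (\<Union>i. {l i..u i})" "incseq u" "decseq l" "\<And>i. l i < u i"
    by (rule einterval_Icc_approximation[OF ab]) blast
  have in_I: "l i \<in> I" "u i \<in> I" for i unfolding ul(1) using ul(4)[of i] by (auto intro!: exI[of _ i])
  have ev: "\<forall>\<^sub>F n in sequentially. l n \<le> x \<and> x \<le> u n" if x: "x \<in> I" for x
  proof -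
    obtain i where i: "l i \<le> x" "x \<le> u i" using x unfolding ul(1) by auto
    show ?thesis
      using eventually_ge_at_top[of i]
    proof eventually_elim
      case (elim n)
      then show ?case using i decseqD[OF ul(3) elim] incseqD[OF ul(2) elim] by linarith
    qed
  qed
  show ?thesis
    by (rule that[of l u]) (use in_I ev in \<open>auto simp: eventually_conj_iff\<close>)
qed

end

section \<open>Point sources at the endpoints and in the interior\<close>

context sturm_liouville_system
begin

lemma inverse_Suc_null: "(\<lambda>n. 1 / real (Suc n)) \<longlonglongrightarrow> 0"
  using LIMSEQ_inverse_real_of_nat by (simp add: inverse_eq_divide)

lemma delta_at_left_end:
  obtains \<delta> where "delta_at UNIV 1 0 \<delta>" "\<And>m. m \<in> I \<Longrightarrow> \<forall>\<^sub>F n in sequentially. \<forall>x. \<delta> n x \<noteq> 0 \<longrightarrow> x < m"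
proof -
  obtain L U :: "nat \<Rightarrow> real" where LU: "\<And>n. L n \<in> I" "\<And>n. U n \<in> I"
    "\<And>x. x \<in> I \<Longrightarrow> \<forall>\<^sub>F n in sequentially. L n \<le> x" "\<And>x. x \<in> I \<Longrightarrow> \<forall>\<^sub>F n in sequentially. x \<le> U n"
    by (rule exhausting_sequences) blast
  \<comment> \<open>The \<open>n\<close>-th interval lies to the left of \<open>L n\<close>, hence
    eventually to the left of any given point, and on it both solutions are within
    \<open>1 / real (Suc n)\<close> of their values at \<open>a\<close>.\<close>
  have "\<exists>l u. l < u \<and> l \<in> I \<and> u \<in> I \<and> (\<forall>t\<in>{l..u}. t < L n \<and> cmod (y1 t - 1) \<le> 1 / real (Suc n) \<and> cmod (y2 t - 0) \<le> 1 / real (Suc n))" for n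
  proof -
    have "\<forall>\<^sub>F z in at_right a. real_of_ereal z < L n \<and> cmod (y1 (real_of_ereal z) - 1) \<le> 1 / real (Suc n)
        \<and> cmod (y2 (real_of_ereal z) - 0) \<le> 1 / real (Suc n)"
      using eventually_near_ends(1)[OF LU(1)[of n]]
        tendstoD[OF has_prim_tendsto_left[OF y1], of "1 / real (Suc n)", simplified]
        tendstoD[OF has_prim_tendsto_left[OF y2], of "1 / real (Suc n)", simplified]
      by eventually_elim (auto simp: dist_norm)
    then show ?thesis by (rule Icc_near_left_end) blast
  qed
  then obtain l u where lu: "\<And>n. l n < u n" "\<And>n. l n \<in> I" "\<And>n. u n \<in> I"
    "\<And>n t. t \<in> {l n..u n} \<Longrightarrow> t < L n"
    "\<And>n t. t \<in> {l n..u n} \<Longrightarrow> cmod (y1 t - 1) \<le> 1 / real (Suc n)" "\<And>n t. t \<in> {l n..u n} \<Longrightarrow> cmod (y2 t - 0) \<le> 1 / real (Suc n)"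
    by metis
  have ev: "\<forall>\<^sub>F n in sequentially. u n < x" if "x \<in> I" for x
    using LU(3)[OF that]
  proof eventually_elim
    case (elim n)
    then show ?case using lu(4)[of "u n" n] lu(1)[of n] by simp
  qed
  have pos: "AE x in leb. \<forall>\<^sub>F n in sequentially. if x \<in> UNIV then u n < x else x \<le> l n"
    by (rule AE_I2) (use ev in simp)
  obtain \<delta> where \<delta>: "delta_at UNIV 1 0 \<delta>" "\<And>n x. \<delta> n x \<noteq> 0 \<Longrightarrow> x \<in> {l n..u n}"
    by (rule delta_sequence[OF lu(1,2,3) _ inverse_Suc_null lu(5,6) pos]) auto
  have "\<forall>\<^sub>F n in sequentially. \<forall>x. \<delta> n x \<noteq> 0 \<longrightarrow> x < m" if "m \<in> I" for m
    using ev[OF that] by eventually_elim (use \<delta>(2) in fastforce)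
  then show ?thesis using that \<delta>(1) by blast
qed

lemma delta_at_right_end:
  obtains \<delta> where "delta_at {} y1b y2b \<delta>" "\<And>m. m \<in> I \<Longrightarrow> \<forall>\<^sub>F n in sequentially. \<forall>x. \<delta> n x \<noteq> 0 \<longrightarrow> m \<le> x"
proof -
  obtain L U :: "nat \<Rightarrow> real" where LU: "\<And>n. L n \<in> I" "\<And>n. U n \<in> I"
    "\<And>x. x \<in> I \<Longrightarrow> \<forall>\<^sub>F n in sequentially. L n \<le> x" "\<And>x. x \<in> I \<Longrightarrow> \<forall>\<^sub>F n in sequentially. x \<le> U n"
    by (rule exhausting_sequences) blast
  have "\<exists>l u. l < u \<and> l \<in> I \<and> u \<in> I \<and> (\<forall>t\<in>{l..u}. U n < t \<and> cmod (y1 t - y1b) \<le> 1 / real (Suc n) \<and> cmod (y2 t - y2b) \<le> 1 / real (Suc n))" for n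
  proof -
    have "\<forall>\<^sub>F z in at_left b. U n < real_of_ereal z \<and> cmod (y1 (real_of_ereal z) - y1b) \<le> 1 / real (Suc n)
        \<and> cmod (y2 (real_of_ereal z) - y2b) \<le> 1 / real (Suc n)"
      using eventually_near_ends(2)[OF LU(2)[of n]]
        tendstoD[OF y_tendsto_right(1), of "1 / real (Suc n)", simplified]
        tendstoD[OF y_tendsto_right(2), of "1 / real (Suc n)", simplified]
      by eventually_elim (auto simp: dist_norm)
    then show ?thesis by (rule Icc_near_right_end) blast
  qed
  then obtain l u where lu: "\<And>n. l n < u n" "\<And>n. l n \<in> I" "\<And>n. u n \<in> I"
    "\<And>n t. t \<in> {l n..u n} \<Longrightarrow> U n < t"
    "\<And>n t. t \<in> {l n..u n} \<Longrightarrow> cmod (y1 t - y1b) \<le> 1 / real (Suc n)" "\<And>n t. t \<in> {l n..u n} \<Longrightarrow> cmod (y2 t - y2b) \<le> 1 / real (Suc n)"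
    by metis
  have ev: "\<forall>\<^sub>F n in sequentially. x \<le> l n" if "x \<in> I" for x
    using LU(4)[OF that]
  proof eventually_elim
    case (elim n)
    then show ?case using lu(4)[of "l n" n] lu(1)[of n] by simp
  qed
  have pos: "AE x in leb. \<forall>\<^sub>F n in sequentially. if x \<in> {} then u n < x else x \<le> l n"
    by (rule AE_I2) (use ev in simp)
  obtain \<delta> where \<delta>: "delta_at {} y1b y2b \<delta>" "\<And>n x. \<delta> n x \<noteq> 0 \<Longrightarrow> x \<in> {l n..u n}"
    by (rule delta_sequence[OF lu(1,2,3) _ inverse_Suc_null lu(5,6) pos]) auto
  have "\<forall>\<^sub>F n in sequentially. \<forall>x. \<delta> n x \<noteq> 0 \<longrightarrow> m \<le> x" if "m \<in> I" for m
    using ev[OF that] by eventually_elim (use \<delta>(2) in fastforce)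
  then show ?thesis using that \<delta>(1) by blast
qed

text \<open>The source is placed in \<open>{c..u n}\<close>, to the right of \<open>c\<close>, so
  that \<open>c\<close> itself separates it from a source at the left endpoint.\<close>

lemma delta_at_interior:
  assumes c: "c \<in> I"
  obtains \<delta> where "delta_at {c<..} (y1 c) (y2 c) \<delta>" "\<And>n x. \<delta> n x \<noteq> 0 \<Longrightarrow> c \<le> x"
    "\<And>m. c < m \<Longrightarrow> \<forall>\<^sub>F n in sequentially. \<forall>x. \<delta> n x \<noteq> 0 \<longrightarrow> x < m"
proof -
  have cont: "continuous (at c) y1" "continuous (at c) y2"
    using has_prim_continuous_on[OF y1] has_prim_continuous_on[OF y2] c continuous_on_eq_continuous_at[OF open_einterval] by blast+
  have "\<exists>u>c. u \<in> I \<and> (\<forall>t\<in>{c..u}. t < c + 1 / real (Suc n) \<and> cmod (y1 t - y1 c) \<le> 1 / real (Suc n) \<and> cmod (y2 t - y2 c) \<le> 1 / real (Suc n))" for n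
  proof -
    have "\<forall>\<^sub>F t in at c. cmod (y1 t - y1 c) \<le> 1 / real (Suc n)" "\<forall>\<^sub>F t in at c. cmod (y2 t - y2 c) \<le> 1 / real (Suc n)"
      using tendstoD[OF cont(1)[unfolded continuous_at], of "1 / real (Suc n)"] tendstoD[OF cont(2)[unfolded continuous_at], of "1 / real (Suc n)"]
      by (auto simp: dist_norm elim: eventually_mono)
    then have "\<forall>\<^sub>F t in at_right c. cmod (y1 t - y1 c) \<le> 1 / real (Suc n) \<and> cmod (y2 t - y2 c) \<le> 1 / real (Suc n)"
      by (simp add: eventually_at_split eventually_conj)
    moreover have "\<forall>\<^sub>F t in at_right c. t \<in> I"
      using eventually_at_in_open'[OF open_einterval c] by (simp add: eventually_at_split)
    moreover have "\<forall>\<^sub>F t in at_right c. t < c + 1 / real (Suc n)"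
      by (rule eventually_at_rightI[of c "c + 1 / real (Suc n)"]) auto
    ultimately have "\<forall>\<^sub>F t in at_right c. t \<in> I \<and> t < c + 1 / real (Suc n) \<and> cmod (y1 t - y1 c) \<le> 1 / real (Suc n) \<and> cmod (y2 t - y2 c) \<le> 1 / real (Suc n)"
      by eventually_elim simp
    then obtain d where d: "d > c" "\<And>t. c < t \<Longrightarrow> t < d \<Longrightarrow> t \<in> I \<and> t < c + 1 / real (Suc n) \<and> cmod (y1 t - y1 c) \<le> 1 / real (Suc n) \<and> cmod (y2 t - y2 c) \<le> 1 / real (Suc n)"
      unfolding eventually_at_right_field by blast
    obtain u where u: "c < u" "u < d" using dense[OF d(1)] by blast
    show ?thesis
    proof (intro exI[of _ u] conjI ballI)
      fix t assume "t \<in> {c..u}"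
      then have "t = c \<or> c < t \<and> t < d" using u by auto
      then show "t < c + 1 / real (Suc n)" "cmod (y1 t - y1 c) \<le> 1 / real (Suc n)" "cmod (y2 t - y2 c) \<le> 1 / real (Suc n)"
        using d(2)[of t] by auto
    qed (use d(2) u in blast)+
  qed
  then obtain u where u: "\<And>n. c < u n" "\<And>n. u n \<in> I"
    "\<And>n t. t \<in> {c..u n} \<Longrightarrow> t < c + 1 / real (Suc n)"
    "\<And>n t. t \<in> {c..u n} \<Longrightarrow> cmod (y1 t - y1 c) \<le> 1 / real (Suc n)" "\<And>n t. t \<in> {c..u n} \<Longrightarrow> cmod (y2 t - y2 c) \<le> 1 / real (Suc n)"
    by metis
  have ev: "\<forall>\<^sub>F n in sequentially. u n < x" if "c < x" for x
  proof -
    have "\<forall>\<^sub>F n in sequentially. 1 / real (Suc n) < x - c"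
      using order_tendstoD(2)[OF inverse_Suc_null, of "x - c"] that by simp
    then show ?thesis
    proof eventually_elim
      case (elim n)
      then show ?case using u(3)[of "u n" n] u(1)[of n] by simp
    qed
  qed
  have pos: "AE x in leb. \<forall>\<^sub>F n in sequentially. if x \<in> {c<..} then u n < x else x \<le> c"
    by (rule AE_I2) (use ev in simp)
  obtain \<delta> where \<delta>: "delta_at {c<..} (y1 c) (y2 c) \<delta>" "\<And>n x. \<delta> n x \<noteq> 0 \<Longrightarrow> x \<in> {c..u n}"
    by (rule delta_sequence[OF u(1) c u(2) _ inverse_Suc_null u(4,5) pos]) auto
  have "\<forall>\<^sub>F n in sequentially. \<forall>x. \<delta> n x \<noteq> 0 \<longrightarrow> x < m" if "c < m" for m
    using ev[OF that] by eventually_elim (use \<delta>(2) in fastforce)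
  then show ?thesis using that \<delta> by fastforce
qed

text \<open>Upgrades limits of moments to equalities, so that suitable sources or their differences
  fall into the range of \<open>T_min\<close>. The correction is a combination of two fixed sources
  with coefficients tending to 0 and leaves the limits of solution and energy unchanged.\<close>

lemma moment_correction:
  assumes d: "\<And>n. d n \<in> L2 M" and m: "(\<lambda>n. mom1 (d n)) \<longlonglongrightarrow> m1" "(\<lambda>n. mom2 (d n)) \<longlonglongrightarrow> m2"
    and g: "g \<in> L2 M" "(\<lambda>n. L2_norm M (\<lambda>x. G (d n) x - g x)) \<longlonglongrightarrow> 0"
    and k0: "(\<lambda>n. L2_inner M (d n) (G (d n))) \<longlonglongrightarrow> k0"
  obtains k where "\<And>n. k n \<in> L2 M" "\<And>n. mom1 (k n) = m1" "\<And>n. mom2 (k n) = m2"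
    "(\<lambda>n. L2_norm M (\<lambda>x. G (k n) x - g x)) \<longlonglongrightarrow> 0" "(\<lambda>n. L2_inner M (k n) (G (k n))) \<longlonglongrightarrow> k0"
proof -
  obtain c d' e1 e2 where e: "e1 \<in> L2 M" "e2 \<in> L2 M" "mom1 e1 = 1" "mom2 e1 = 0" "mom1 e2 = 0" "mom2 e2 = 1"
    by (rule biorthogonal_exists) blast
  obtain C where C: "0 < C" "\<And>h. h \<in> L2 M \<Longrightarrow> L2_norm M (G h) \<le> C * L2_norm M h"
    by (rule sol_norm_bound) blast
  define c1 where "c1 n = m1 - mom1 (d n)" for n
  define c2 where "c2 n = m2 - mom2 (d n)" for n
  have c: "c1 \<longlonglongrightarrow> 0" "c2 \<longlonglongrightarrow> 0" unfolding c1_def c2_def using tendsto_diff[OF tendsto_const m(1), of m1] tendsto_diff[OF tendsto_const m(2), of m2] by simp_all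
  define w where "w n = (\<lambda>x. c1 n * e1 x + c2 n * e2 x)" for n
  define k where "k n = (\<lambda>x. d n x + 1 * w n x)" for n
  have w: "w n \<in> L2 M" for n unfolding w_def by (intro L2_add L2_scale e)
  have k: "k n \<in> L2 M" for n unfolding k_def by (intro L2_add L2_scale w d)
  have mw: "mom1 (w n) = c1 n" "mom2 (w n) = c2 n" for n
    unfolding w_def using mom_linear[OF L2_scale[OF e(1)] e(2)] mom_linear[OF L2_zero e(1)] e by simp_all
  have mk: "mom1 (k n) = m1" "mom2 (k n) = m2" for n
    unfolding k_def mom_linear[OF d w] mw by (simp_all add: c1_def c2_def)
  have w0: "(\<lambda>n. L2_norm M (w n)) \<longlonglongrightarrow> 0"
  proof (rule Lim_null_comparison[OF always_eventually])
    show "\<forall>n. norm (L2_norm M (w n)) \<le> cmod (c1 n) * L2_norm M e1 + cmod (c2 n) * L2_norm M e2"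
      unfolding w_def using L2_triangle[OF L2_scale[OF e(1)] L2_scale[OF e(2)]] by (simp add: L2_norm_scale)
    show "(\<lambda>n. cmod (c1 n) * L2_norm M e1 + cmod (c2 n) * L2_norm M e2) \<longlonglongrightarrow> 0"
      using c by (auto intro!: tendsto_eq_intros)
  qed
  have Gw0: "(\<lambda>n. L2_norm M (G (w n))) \<longlonglongrightarrow> 0"
  proof (rule Lim_null_comparison[OF always_eventually])
    show "\<forall>n. norm (L2_norm M (G (w n))) \<le> C * L2_norm M (w n)" using C(2)[OF w] by simp
    show "(\<lambda>n. C * L2_norm M (w n)) \<longlonglongrightarrow> 0" using w0 by (auto intro!: tendsto_eq_intros)
  qed
  have Gk: "G (k n) = (\<lambda>x. G (d n) x + G (w n) x)" for n
    unfolding k_def using G_linear[OF d w, of _ 1] by (simp add: fun_eq_iff)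
  have conv: "(\<lambda>n. L2_norm M (\<lambda>x. G (k n) x - g x)) \<longlonglongrightarrow> 0"
  proof (rule Lim_null_comparison[OF always_eventually])
    show "\<forall>n. norm (L2_norm M (\<lambda>x. G (k n) x - g x)) \<le> L2_norm M (\<lambda>x. G (d n) x - g x) + L2_norm M (G (w n))"
    proof
      fix n
      have "(\<lambda>x. G (k n) x - g x) = (\<lambda>x. (G (d n) x - g x) + G (w n) x)" by (simp add: Gk algebra_simps)
      then show "norm (L2_norm M (\<lambda>x. G (k n) x - g x)) \<le> L2_norm M (\<lambda>x. G (d n) x - g x) + L2_norm M (G (w n))"
        using L2_triangle[OF L2_diff[OF G_L2[OF d] g(1)] G_L2[OF w], of n n] by simp
    qed
    show "(\<lambda>n. L2_norm M (\<lambda>x. G (d n) x - g x) + L2_norm M (G (w n))) \<longlonglongrightarrow> 0"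
      using tendsto_add[OF g(2) Gw0] by simp
  qed
  have bd: "L2_norm M (G (d n)) \<le> L2_norm M (\<lambda>x. G (d n) x - g x) + L2_norm M g" for n
    using L2_triangle[OF L2_diff[OF G_L2[OF d] g(1)] g(1), of n] by simp
  have z: "(\<lambda>n. (L2_norm M (\<lambda>x. G (d n) x - g x) + L2_norm M g) * L2_norm M (w n)) \<longlonglongrightarrow> 0"
    by (rule tendsto_eq_intros g(2) w0 refl | simp)+
  have 1: "(\<lambda>n. L2_inner M (G (d n)) (w n)) \<longlonglongrightarrow> 0"
  proof (rule Lim_null_comparison[OF always_eventually z], rule allI)
    show "norm (L2_inner M (G (d n)) (w n)) \<le> (L2_norm M (\<lambda>x. G (d n) x - g x) + L2_norm M g) * L2_norm M (w n)" for n
      by (rule order_trans[OF L2_Cauchy_Schwarz[OF G_L2[OF d] w]]) (intro mult_right_mono bd L2_norm_nonneg)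
  qed
  have 2: "(\<lambda>n. L2_inner M (w n) (G (d n))) \<longlonglongrightarrow> 0"
  proof (rule Lim_null_comparison[OF always_eventually z], rule allI)
    show "norm (L2_inner M (w n) (G (d n))) \<le> (L2_norm M (\<lambda>x. G (d n) x - g x) + L2_norm M g) * L2_norm M (w n)" for n
      using L2_Cauchy_Schwarz[OF w G_L2[OF d], of n n] mult_right_mono[OF bd[of n] L2_norm_nonneg[of M "w n"]] by (simp add: mult.commute)
  qed
  have 3: "(\<lambda>n. L2_inner M (w n) (G (w n))) \<longlonglongrightarrow> 0"
  proof (rule Lim_null_comparison[OF always_eventually])
    show "\<forall>n. norm (L2_inner M (w n) (G (w n))) \<le> L2_norm M (w n) * L2_norm M (G (w n))" using L2_Cauchy_Schwarz[OF w G_L2[OF w]] by blast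
    show "(\<lambda>n. L2_norm M (w n) * L2_norm M (G (w n))) \<longlonglongrightarrow> 0" using tendsto_mult[OF w0 Gw0] by simp
  qed
  \<comment> \<open>The sources \<open>d n\<close> may be unbounded in norm although
    \<open>G (d n)\<close> is bounded. The Lagrange identity therefore moves the operator onto
    \<open>d n\<close>, at the price of products of moments.\<close>
  have 4: "L2_inner M (d n) (G (w n)) = L2_inner M (G (d n)) (w n) - (cnj (mom2 (d n)) * c1 n - cnj (mom1 (d n)) * c2 n)" for n
    using Lagrange_identity[OF d w, of n n] by (simp add: mw algebra_simps)
  have "(\<lambda>n. L2_inner M (d n) (G (d n)) + (L2_inner M (G (d n)) (w n) - (cnj (mom2 (d n)) * c1 n - cnj (mom1 (d n)) * c2 n))
      + (L2_inner M (w n) (G (d n)) + L2_inner M (w n) (G (w n)))) \<longlonglongrightarrow> k0 + (0 - (cnj m2 * 0 - cnj m1 * 0)) + (0 + 0)"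
    by (intro tendsto_intros k0 1 2 3 m c)
  moreover have "L2_inner M (k n) (G (k n)) = L2_inner M (d n) (G (d n)) + (L2_inner M (G (d n)) (w n) - (cnj (mom2 (d n)) * c1 n - cnj (mom1 (d n)) * c2 n))
      + (L2_inner M (w n) (G (d n)) + L2_inner M (w n) (G (w n)))" for n
  proof -
    have kn: "k n = (\<lambda>x. d n x + w n x)" by (simp add: k_def)
    have "L2_inner M (k n) (G (k n)) = L2_inner M (\<lambda>x. d n x + w n x) (\<lambda>x. G (d n) x + G (w n) x)"
      unfolding Gk unfolding kn ..
    also have "\<dots> = (L2_inner M (d n) (G (d n)) + L2_inner M (d n) (G (w n))) + (L2_inner M (w n) (G (d n)) + L2_inner M (w n) (G (w n)))"
      by (simp only: L2_inner_add_left[OF L2_add[OF G_L2[OF d] G_L2[OF w]] d w] L2_inner_add_right[OF d G_L2[OF d] G_L2[OF w]] L2_inner_add_right[OF w G_L2[OF d] G_L2[OF w]])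
    finally show ?thesis unfolding 4 .
  qed
  ultimately have "(\<lambda>n. L2_inner M (k n) (G (k n))) \<longlonglongrightarrow> k0" by simp
  with that[of k] k mk conv show ?thesis by blast
qed

text \<open>Two superposed sources, the first to the left of the second. The self-energies vanish in
  the limit, the solution of the right source vanishes on the support of the left one, and the
  Lagrange identity evaluates the remaining mixed term from the moments alone.\<close>

lemma steering:
  fixes \<mu> \<mu>' :: complex
  assumes D: "delta_at \<theta> Y1 Y2 \<delta>" and D': "delta_at \<theta>' Y1' Y2' \<delta>'"
    and sep: "\<forall>\<^sub>F n in sequentially. \<forall>x. \<delta> n x \<noteq> 0 \<longrightarrow> x < m" "\<forall>\<^sub>F n in sequentially. \<forall>x. \<delta>' n x \<noteq> 0 \<longrightarrow> m \<le> x"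
  defines "g \<equiv> \<lambda>x. \<mu> * (if x \<in> \<theta> then y1 x * Y2 - y2 x * Y1 else 0) + \<mu>' * (if x \<in> \<theta>' then y1 x * Y2' - y2 x * Y1' else 0)"
  obtains k where "\<And>n. k n \<in> L2 M" "\<And>n. mom1 (k n) = \<mu> * Y1 + \<mu>' * Y1'" "\<And>n. mom2 (k n) = \<mu> * Y2 + \<mu>' * Y2'"
    "g \<in> L2 M" "(\<lambda>n. L2_norm M (\<lambda>x. G (k n) x - g x)) \<longlonglongrightarrow> 0"
    "(\<lambda>n. L2_inner M (k n) (G (k n))) \<longlonglongrightarrow> cnj \<mu>' * \<mu> * (cnj Y1' * Y2 - cnj Y2' * Y1)"
proof -
  define g1 where "g1 = (\<lambda>x. if x \<in> \<theta> then y1 x * Y2 - y2 x * Y1 else 0)"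
  define g2 where "g2 = (\<lambda>x. if x \<in> \<theta>' then y1 x * Y2' - y2 x * Y1' else 0)"
  have \<delta>: "\<And>n. \<delta> n \<in> L2 M" "(\<lambda>n. mom1 (\<delta> n)) \<longlonglongrightarrow> Y1" "(\<lambda>n. mom2 (\<delta> n)) \<longlonglongrightarrow> Y2"
    "(\<lambda>n. L2_norm M (\<lambda>x. G (\<delta> n) x - g1 x)) \<longlonglongrightarrow> 0" "g1 \<in> L2 M" "(\<lambda>n. L2_inner M (\<delta> n) (G (\<delta> n))) \<longlonglongrightarrow> 0"
    using D unfolding delta_at_def g1_def by blast+
  have \<delta>': "\<And>n. \<delta>' n \<in> L2 M" "(\<lambda>n. mom1 (\<delta>' n)) \<longlonglongrightarrow> Y1'" "(\<lambda>n. mom2 (\<delta>' n)) \<longlonglongrightarrow> Y2'"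
    "(\<lambda>n. L2_norm M (\<lambda>x. G (\<delta>' n) x - g2 x)) \<longlonglongrightarrow> 0" "g2 \<in> L2 M" "(\<lambda>n. L2_inner M (\<delta>' n) (G (\<delta>' n))) \<longlonglongrightarrow> 0"
    using D' unfolding delta_at_def g2_def by blast+
  have g_eq: "g = (\<lambda>x. \<mu> * g1 x + \<mu>' * g2 x)" by (simp add: g_def g1_def g2_def)
  have g: "g \<in> L2 M" unfolding g_eq by (intro L2_add L2_scale \<delta>(5) \<delta>'(5))
  define d where "d n = (\<lambda>x. \<mu> * \<delta> n x + \<mu>' * \<delta>' n x)" for n
  have d: "d n \<in> L2 M" for n unfolding d_def by (intro L2_add L2_scale \<delta>(1) \<delta>'(1))
  have md: "mom1 (d n) = \<mu> * mom1 (\<delta> n) + \<mu>' * mom1 (\<delta>' n)" "mom2 (d n) = \<mu> * mom2 (\<delta> n) + \<mu>' * mom2 (\<delta>' n)" for n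
    unfolding d_def mom_linear[OF L2_scale[OF \<delta>(1)] \<delta>'(1)] using mom_linear[OF L2_zero \<delta>(1), of \<mu>] by simp_all
  have m: "(\<lambda>n. mom1 (d n)) \<longlonglongrightarrow> \<mu> * Y1 + \<mu>' * Y1'" "(\<lambda>n. mom2 (d n)) \<longlonglongrightarrow> \<mu> * Y2 + \<mu>' * Y2'"
    unfolding md by (intro tendsto_intros \<delta> \<delta>')+
  have Gd: "G (d n) = (\<lambda>x. \<mu> * G (\<delta> n) x + \<mu>' * G (\<delta>' n) x)" for n
    unfolding d_def using G_linear[OF L2_scale[OF \<delta>(1)] \<delta>'(1)] G_linear[OF L2_zero \<delta>(1), of \<mu>]
    by (simp add: fun_eq_iff sol_homogeneous)
  have conv: "(\<lambda>n. L2_norm M (\<lambda>x. G (d n) x - g x)) \<longlonglongrightarrow> 0"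
  proof (rule Lim_null_comparison[OF always_eventually])
    show "\<forall>n. norm (L2_norm M (\<lambda>x. G (d n) x - g x)) \<le> cmod \<mu> * L2_norm M (\<lambda>x. G (\<delta> n) x - g1 x) + cmod \<mu>' * L2_norm M (\<lambda>x. G (\<delta>' n) x - g2 x)"
    proof
      fix n
      have "(\<lambda>x. G (d n) x - g x) = (\<lambda>x. \<mu> * (G (\<delta> n) x - g1 x) + \<mu>' * (G (\<delta>' n) x - g2 x))"
        unfolding Gd g_eq by (simp add: fun_eq_iff algebra_simps)
      then show "norm (L2_norm M (\<lambda>x. G (d n) x - g x)) \<le> cmod \<mu> * L2_norm M (\<lambda>x. G (\<delta> n) x - g1 x) + cmod \<mu>' * L2_norm M (\<lambda>x. G (\<delta>' n) x - g2 x)"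
        using L2_triangle[OF L2_scale[OF L2_diff[OF G_L2[OF \<delta>(1)] \<delta>(5)]] L2_scale[OF L2_diff[OF G_L2[OF \<delta>'(1)] \<delta>'(5)]], of \<mu> n \<mu>' n]
        by (simp add: L2_norm_scale)
    qed
    show "(\<lambda>n. cmod \<mu> * L2_norm M (\<lambda>x. G (\<delta> n) x - g1 x) + cmod \<mu>' * L2_norm M (\<lambda>x. G (\<delta>' n) x - g2 x)) \<longlonglongrightarrow> 0"
      using tendsto_add[OF tendsto_mult[OF tendsto_const \<delta>(4), of "cmod \<mu>"] tendsto_mult[OF tendsto_const \<delta>'(4), of "cmod \<mu>'"]] by simp
  qed
  have cross: "\<forall>\<^sub>F n in sequentially. L2_inner M (\<delta> n) (G (\<delta>' n)) = 0"
    using sep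
  proof eventually_elim
    case (elim n)
    have "cnj (\<delta> n x) * G (\<delta>' n) x = 0" for x
    proof (cases "\<delta> n x = 0")
      case False
      then have "x < m" using elim(1) by blast
      then have "\<delta>' n t = 0" if "t < x" for t using elim(2) that by force
      then have "G (\<delta>' n) x = 0" using prim12_zero_left[of x "\<delta>' n"] by (simp add: sol_def)
      then show ?thesis by simp
    qed simp
    then have "(\<lambda>x. cnj (\<delta> n x) * G (\<delta>' n) x) = (\<lambda>x. 0)" by (rule ext)
    then show ?case unfolding L2_inner_def by (simp only: Bochner_Integration.integral_zero)
  qed
  have "(\<lambda>n. \<mu> * cnj \<mu> * L2_inner M (\<delta> n) (G (\<delta> n)) + cnj \<mu>' * \<mu> * (cnj (mom1 (\<delta>' n)) * mom2 (\<delta> n) - cnj (mom2 (\<delta>' n)) * mom1 (\<delta> n))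
      + \<mu>' * cnj \<mu>' * L2_inner M (\<delta>' n) (G (\<delta>' n)))
    \<longlonglongrightarrow> \<mu> * cnj \<mu> * 0 + cnj \<mu>' * \<mu> * (cnj Y1' * Y2 - cnj Y2' * Y1) + \<mu>' * cnj \<mu>' * 0"
    by (intro tendsto_intros \<delta> \<delta>')
  moreover have "\<forall>\<^sub>F n in sequentially. \<mu> * cnj \<mu> * L2_inner M (\<delta> n) (G (\<delta> n)) + cnj \<mu>' * \<mu> * (cnj (mom1 (\<delta>' n)) * mom2 (\<delta> n) - cnj (mom2 (\<delta>' n)) * mom1 (\<delta> n))
      + \<mu>' * cnj \<mu>' * L2_inner M (\<delta>' n) (G (\<delta>' n)) = L2_inner M (d n) (G (d n))"
    using cross
  proof eventually_elim
    case (elim n)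
    have e: "L2_inner M (\<delta>' n) (G (\<delta> n)) = cnj (mom1 (\<delta>' n)) * mom2 (\<delta> n) - cnj (mom2 (\<delta>' n)) * mom1 (\<delta> n)"
      using Lagrange_identity[OF \<delta>'(1) \<delta>(1), of n n] L2_inner_cnj[of M "G (\<delta>' n)" "\<delta> n"] elim by (simp add: algebra_simps)
    note S = L2_scale[OF \<delta>(1), of \<mu> n] L2_scale[OF \<delta>'(1), of \<mu>' n]
    note T = L2_scale[OF G_L2[OF \<delta>(1)], of \<mu> n] L2_scale[OF G_L2[OF \<delta>'(1)], of \<mu>' n]
    have "L2_inner M (d n) (G (d n)) = (L2_inner M (\<lambda>x. \<mu> * \<delta> n x) (\<lambda>x. \<mu> * G (\<delta> n) x) + L2_inner M (\<lambda>x. \<mu> * \<delta> n x) (\<lambda>x. \<mu>' * G (\<delta>' n) x))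
      + (L2_inner M (\<lambda>x. \<mu>' * \<delta>' n x) (\<lambda>x. \<mu> * G (\<delta> n) x) + L2_inner M (\<lambda>x. \<mu>' * \<delta>' n x) (\<lambda>x. \<mu>' * G (\<delta>' n) x))"
      unfolding Gd unfolding d_def L2_inner_add_left[OF L2_add[OF T] S] L2_inner_add_right[OF S(1) T] L2_inner_add_right[OF S(2) T] ..
    then show ?case unfolding L2_inner_scale_left L2_inner_scale_right elim e by (simp add: algebra_simps)
  qed
  ultimately have k0: "(\<lambda>n. L2_inner M (d n) (G (d n))) \<longlonglongrightarrow> cnj \<mu>' * \<mu> * (cnj Y1' * Y2 - cnj Y2' * Y1)"
    by (simp add: tendsto_cong)
  show ?thesis by (rule moment_correction[OF d m g conv k0]) (rule that[OF _ _ _ g])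
qed

end

section \<open>Positivity of the Dirichlet solutions\<close>

lemma L2_norm_convergent:
  assumes f: "\<And>n. f n \<in> L2 M" and g: "g \<in> L2 M" and lim: "(\<lambda>n. L2_norm M (\<lambda>x. f n x - g x)) \<longlonglongrightarrow> 0"
  shows "(\<lambda>n. L2_norm M (f n)) \<longlonglongrightarrow> L2_norm M g"
proof (rule LIM_zero_cancel, rule Lim_null_comparison[OF always_eventually lim], rule allI)
  fix n
  have "L2_norm M (f n) \<le> L2_norm M (\<lambda>x. f n x - g x) + L2_norm M g"
    using L2_triangle[OF L2_diff[OF f g] g, of n] by simp
  moreover have "L2_norm M g \<le> L2_norm M (\<lambda>x. g x - f n x) + L2_norm M (f n)"
    using L2_triangle[OF L2_diff[OF g f] f, of n n] by simp
  ultimately show "norm (L2_norm M (f n) - L2_norm M g) \<le> L2_norm M (\<lambda>x. f n x - g x)"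
    unfolding L2_norm_minus_commute[of M g] by simp
qed

lemma connected_einterval: "connected (einterval a b)"
  unfolding is_interval_connected_1[symmetric] is_interval_1
proof (intro ballI allI impI)
  fix x y z assume "x \<in> einterval a b" "y \<in> einterval a b" "x \<le> z \<and> z \<le> y"
  then show "z \<in> einterval a b" using Icc_subset_einterval[of x a b y] by auto
qed

lemma real_nonvanishing_positive:
  assumes "connected S" "continuous_on S f" "\<And>x. x \<in> S \<Longrightarrow> f x \<in> \<real>" "\<And>x. x \<in> S \<Longrightarrow> f x \<noteq> 0"
    and d: "d \<in> S" "0 < Re (f d)" and c: "c \<in> S"
  shows "0 < Re (f c)"
proof (rule ccontr)
  assume "\<not> 0 < Re (f c)"
  moreover have "connected ((\<lambda>x. Re (f x)) ` S)"
    by (intro connected_continuous_image continuous_on_Re assms)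
  ultimately have "0 \<in> (\<lambda>x. Re (f x)) ` S"
    using connectedD_interval[of "(\<lambda>x. Re (f x)) ` S" "Re (f c)" "Re (f d)" 0] c d by auto
  then obtain x where "x \<in> S" "Re (f x) = 0" by auto
  then show False using assms(3,4)[of x] by (auto elim!: Reals_cases)
qed

locale positive_sturm_liouville_system = sturm_liouville_system +
  assumes positive: "strictly_positive_op (weighted_measure a b r) (T_min a b p q r s)"
begin

lemma form_lower_bound:
  obtains \<epsilon> where "0 < \<epsilon>" "\<And>h. h \<in> L2 M \<Longrightarrow> mom1 h = 0 \<Longrightarrow> mom2 h = 0 \<Longrightarrow> \<epsilon> * (L2_norm M (G h))\<^sup>2 \<le> Re (L2_inner M h (G h))"
proof -
  obtain \<epsilon> where \<epsilon>: "0 < \<epsilon>" "\<And>f h. (f, h) \<in> graph_of T_min_data \<Longrightarrow> \<epsilon> * Re (L2_inner M f f) \<le> Re (L2_inner M h f)"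
    using positive unfolding strictly_positive_op_def T_min_eq by blast
  have "\<epsilon> * (L2_norm M (G h))\<^sup>2 \<le> Re (L2_inner M h (G h))" if h: "h \<in> L2 M" "mom1 h = 0" "mom2 h = 0" for h
  proof -
    have "(G h, h) \<in> graph_of T_min_data" by (rule graph_of_sol) (use h in auto)
    from \<epsilon>(2)[OF this] show ?thesis by (simp add: L2_inner_self)
  qed
  then show ?thesis using that \<epsilon>(1) by blast
qed

text \<open>
  A vanishing Wronskian between two points would make a Dirichlet solution vanish at both; cutting it
  off there produces, in the limit, a nonzero function in the form domain of \<open>T_min\<close> of energy zero.
\<close>

lemma nonconjugate:
  assumes D: "delta_at \<theta> Y1 Y2 \<delta>" and D': "delta_at \<theta>' Y1' Y2' \<delta>'"
    and sep: "\<forall>\<^sub>F n in sequentially. \<forall>x. \<delta> n x \<noteq> 0 \<longrightarrow> x < m" "\<forall>\<^sub>F n in sequentially. \<forall>x. \<delta>' n x \<noteq> 0 \<longrightarrow> m \<le> x"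
    and real: "cnj Y1' = Y1'" "cnj Y2' = Y2'"
    and nz: "Y1 \<noteq> 0 \<or> Y2 \<noteq> 0" "Y1' \<noteq> 0 \<or> Y2' \<noteq> 0"
    and S: "open S" "S \<subseteq> I" "S \<noteq> {}" "S \<subseteq> \<theta>" "S \<inter> \<theta>' = {}"
  shows "Y1' * Y2 - Y2' * Y1 \<noteq> 0"
proof
  assume K: "Y1' * Y2 - Y2' * Y1 = 0"
  \<comment> \<open>The vanishing determinant makes the pair \<open>Y1\<close>, \<open>Y2\<close> a
    multiple of the pair \<open>Y1'\<close>, \<open>Y2'\<close>; the factor is taken from a nonzero
    component.\<close>
  define l where "l = (if Y1' = 0 then Y2 / Y2' else Y1 / Y1')"
  have l: "Y1 = l * Y1'" "Y2 = l * Y2'"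
    using K nz(2) by (auto simp: l_def field_simps)
  let ?g = "\<lambda>x. 1 * (if x \<in> \<theta> then y1 x * Y2 - y2 x * Y1 else 0) + (- l) * (if x \<in> \<theta>' then y1 x * Y2' - y2 x * Y1' else 0)"
  \<comment> \<open>With weights 1 and \<open>- l\<close> the moments are exactly 0, so every
    \<open>k n\<close> obeys the lower bound for \<open>T_min\<close>, while the limiting energy is
    a multiple of the determinant and hence 0.\<close>
  show False
  proof (rule steering[OF D D' sep, of 1 "- l"])
    fix k
    assume k: "\<And>n. k n \<in> L2 M" "\<And>n. mom1 (k n) = 1 * Y1 + (- l) * Y1'" "\<And>n. mom2 (k n) = 1 * Y2 + (- l) * Y2'"
      and g: "?g \<in> L2 M" "(\<lambda>n. L2_norm M (\<lambda>x. G (k n) x - ?g x)) \<longlonglongrightarrow> 0"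
      and lim: "(\<lambda>n. L2_inner M (k n) (G (k n))) \<longlonglongrightarrow> cnj (- l) * 1 * (cnj Y1' * Y2 - cnj Y2' * Y1)"
    obtain \<epsilon> where \<epsilon>: "0 < \<epsilon>" "\<And>h. h \<in> L2 M \<Longrightarrow> mom1 h = 0 \<Longrightarrow> mom2 h = 0 \<Longrightarrow> \<epsilon> * (L2_norm M (G h))\<^sup>2 \<le> Re (L2_inner M h (G h))"
      by (rule form_lower_bound) blast
    have "(\<lambda>n. Re (L2_inner M (k n) (G (k n)))) \<longlonglongrightarrow> Re 0"
      using tendsto_Re[OF lim] K by (simp add: real)
    moreover have "(\<lambda>n. \<epsilon> * (L2_norm M (G (k n)))\<^sup>2) \<longlonglongrightarrow> \<epsilon> * (L2_norm M ?g)\<^sup>2"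
      by (intro tendsto_intros L2_norm_convergent G_L2 k g)
    ultimately have "\<epsilon> * (L2_norm M ?g)\<^sup>2 \<le> Re 0"
      by (rule tendsto_le[OF sequentially_bot]) (use \<epsilon>(2)[OF k(1)] k(2,3) l in simp)
    then have "L2_norm M ?g = 0" using \<epsilon>(1) by (simp add: mult_le_0_iff)
    then have "AE x in leb. ?g x = 0" using L2_norm_eq_0_AE[OF g(1)] by (simp add: AE_M)
    \<comment> \<open>Between the two sources the second summand is absent, and the limit is a
      nontrivial homogeneous solution.\<close>
    then have "AE x in leb. x \<in> S \<longrightarrow> Y2 * y1 x + (- Y1) * y2 x = 0"
      by eventually_elim (use S(4,5) in \<open>auto simp: mult.commute subset_iff disjoint_iff split: if_splits\<close>)
    then have "Y2 = 0 \<and> - Y1 = 0" by (rule homogeneous_independent[OF S(1,2,3)])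
    then show False using nz(1) by simp
  qed
qed

text \<open>Sources at the two endpoints have determinant \<open>- y2b\<close>; its being nonzero
  makes the Dirichlet problem uniquely solvable.\<close>

lemma y2b_nonzero: "y2b \<noteq> 0"
proof -
  obtain m where m: "m \<in> I" using einterval_nonempty[OF ab] by blast
  obtain \<delta> where \<delta>: "delta_at UNIV 1 0 \<delta>" "\<And>m. m \<in> I \<Longrightarrow> \<forall>\<^sub>F n in sequentially. \<forall>x. \<delta> n x \<noteq> 0 \<longrightarrow> x < m"
    by (rule delta_at_left_end) blast
  obtain \<delta>' where \<delta>': "delta_at {} y1b y2b \<delta>'" "\<And>m. m \<in> I \<Longrightarrow> \<forall>\<^sub>F n in sequentially. \<forall>x. \<delta>' n x \<noteq> 0 \<longrightarrow> m \<le> x"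
    by (rule delta_at_right_end) blast
  have "y1b * 0 - y2b * 1 \<noteq> 0"
    by (rule nonconjugate[OF \<delta>(1) \<delta>'(1) \<delta>(2)[OF m] \<delta>'(2)[OF m], where S=I])
      (use m wronskian_b real_b in \<open>auto simp: Reals_cnj_iff\<close>)
  then show ?thesis by simp
qed

text \<open>A zero at \<open>c\<close> of the solution vanishing at \<open>a\<close> would make
  these two points conjugate.\<close>

lemma y2_nonzero:
  assumes c: "c \<in> I"
  shows "y2 c \<noteq> 0"
proof -
  obtain m where m: "m \<in> I" "m < c" using einterval_neighbourhood[OF c] by blast
  obtain \<delta> where \<delta>: "delta_at UNIV 1 0 \<delta>" "\<And>m. m \<in> I \<Longrightarrow> \<forall>\<^sub>F n in sequentially. \<forall>x. \<delta> n x \<noteq> 0 \<longrightarrow> x < m"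
    by (rule delta_at_left_end) blast
  obtain \<delta>' where \<delta>': "delta_at {c<..} (y1 c) (y2 c) \<delta>'" "\<And>n x. \<delta>' n x \<noteq> 0 \<Longrightarrow> c \<le> x"
    by (rule delta_at_interior[OF c]) blast
  have s: "\<forall>\<^sub>F n in sequentially. \<forall>x. \<delta>' n x \<noteq> 0 \<longrightarrow> c \<le> x" using \<delta>'(2) by (intro always_eventually) blast
  have "y1 c * 0 - y2 c * 1 \<noteq> 0"
  proof (rule nonconjugate[OF \<delta>(1) \<delta>'(1) \<delta>(2)[OF c] s, where S="I \<inter> {..<c}"])
    show "y1 c \<noteq> 0 \<or> y2 c \<noteq> 0" using wronskian[OF c] by auto
    show "I \<inter> {..<c} \<noteq> {}" using m by blast
    show "open (I \<inter> {..<c})" by (intro open_Int open_einterval open_lessThan)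
  qed (auto simp: cnj_y)
  then show ?thesis by simp
qed

text \<open>The mirror image: a zero at \<open>c\<close> of the solution vanishing at
  \<open>b\<close>.\<close>

lemma right_solution_nonzero:
  assumes c: "c \<in> I"
  shows "y1b * y2 c - y2b * y1 c \<noteq> 0"
proof -
  obtain m where m: "m \<in> I" "c < m" using einterval_neighbourhood[OF c] by blast
  obtain \<delta> where \<delta>: "delta_at {c<..} (y1 c) (y2 c) \<delta>" "\<And>m. c < m \<Longrightarrow> \<forall>\<^sub>F n in sequentially. \<forall>x. \<delta> n x \<noteq> 0 \<longrightarrow> x < m"
    by (rule delta_at_interior[OF c]) blast
  obtain \<delta>' where \<delta>': "delta_at {} y1b y2b \<delta>'" "\<And>m. m \<in> I \<Longrightarrow> \<forall>\<^sub>F n in sequentially. \<forall>x. \<delta>' n x \<noteq> 0 \<longrightarrow> m \<le> x"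
    by (rule delta_at_right_end) blast
  show ?thesis
  proof (rule nonconjugate[OF \<delta>(1) \<delta>'(1) \<delta>(2)[OF m(2)] \<delta>'(2)[OF m(1)], where S="I \<inter> {c<..}"])
    show "y1 c \<noteq> 0 \<or> y2 c \<noteq> 0" using wronskian[OF c] by auto
    show "y1b \<noteq> 0 \<or> y2b \<noteq> 0" using wronskian_b by auto
    show "I \<inter> {c<..} \<noteq> {}" using m by blast
    show "open (I \<inter> {c<..})" by (intro open_Int open_einterval open_greaterThan)
  qed (use real_b in \<open>auto simp: Reals_cnj_iff\<close>)
qed

definition "u1 x = y2 x / y2b"
definition "u2 x = y1 x - y1b / y2b * y2 x"

lemma u_real: "u1 x \<in> \<real>" "u2 x \<in> \<real>"
  unfolding u1_def u2_def by (intro Reals_divide Reals_diff Reals_mult real_solutions real_b)+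

text \<open>Near the endpoint with boundary value 1 the solution is positive; being real and without
  zeros on a connected set, it stays so.\<close>

lemma u_positive: "positive_on a b u1" "positive_on a b u2"
proof -
  have pos: "positive_on a b u"
    if u: "\<And>x. u x \<in> \<real>" "continuous_on I u" "\<And>x. x \<in> I \<Longrightarrow> u x \<noteq> 0" and d: "\<exists>d\<in>I. 0 < Re (u d)" for u
    unfolding positive_on_def using u d real_nonvanishing_positive[OF connected_einterval u(2,1,3)] by blast
  have near: "\<exists>d\<in>I. 0 < Re (u d)"
    if F: "F \<noteq> bot" "\<forall>\<^sub>F z in F. real_of_ereal z \<in> I" and lim: "((u \<circ> real_of_ereal) \<longlongrightarrow> 1) F" for u :: "real \<Rightarrow> complex" and F
  proof -
    have "\<forall>\<^sub>F z in F. 0 < Re ((u \<circ> real_of_ereal) z)" using order_tendstoD(1)[OF tendsto_Re[OF lim], of 0] by simp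
    with F(2) have "\<forall>\<^sub>F z in F. real_of_ereal z \<in> I \<and> 0 < Re (u (real_of_ereal z))" by eventually_elim simp
    from eventually_happens'[OF F(1) this] show ?thesis by blast
  qed
  note cy = has_prim_continuous_on[OF y1] has_prim_continuous_on[OF y2]
  show "positive_on a b u1"
  proof (rule pos)
    show "continuous_on I u1" unfolding u1_def by (intro continuous_intros cy) (use y2b_nonzero in auto)
    show "u1 x \<noteq> 0" if "x \<in> I" for x using y2_nonzero[OF that] y2b_nonzero by (simp add: u1_def)
    have "((u1 \<circ> real_of_ereal) \<longlongrightarrow> y2b / y2b) (at_left b)"
      using tendsto_divide[OF y_tendsto_right(2) tendsto_const y2b_nonzero] by (simp add: u1_def comp_def)
    then show "\<exists>d\<in>I. 0 < Re (u1 d)"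
      by (intro near[OF at_ends_nontrivial(2) eventually_in_einterval(2)]) (use y2b_nonzero in simp)
  qed (rule u_real)
  show "positive_on a b u2"
  proof (rule pos)
    show "continuous_on I u2" unfolding u2_def by (intro continuous_intros cy)
    show "u2 x \<noteq> 0" if "x \<in> I" for x using right_solution_nonzero[OF that] y2b_nonzero by (simp add: u2_def field_simps)
    have "((u2 \<circ> real_of_ereal) \<longlongrightarrow> 1 - y1b / y2b * 0) (at_right a)"
      using tendsto_diff[OF has_prim_tendsto_left[OF y1] tendsto_mult[OF tendsto_const[of "y1b / y2b"] has_prim_tendsto_left[OF y2]]]
      by (simp add: u2_def comp_def)
    then show "\<exists>d\<in>I. 0 < Re (u2 d)"
      by (intro near[OF at_ends_nontrivial(1) eventually_in_einterval(1)]) simp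
  qed (rule u_real)
qed

section \<open>Minimality\<close>

text \<open>The value \<beta> for which the solution starting with 0 at \<open>a\<close> also
  vanishes at \<open>b\<close>, from \<open>y1b * mom2 h + y2b * (\<beta> - mom1 h) = 0\<close>.
  Thus \<open>dirichlet\<close> solves the inhomogeneous Dirichlet problem.\<close>

definition "dcoef h = mom1 h - y1b / y2b * mom2 h"
definition "dirichlet h = sol 0 (dcoef h) h"

lemma dcoef_linear: "h \<in> L2 M \<Longrightarrow> k \<in> L2 M \<Longrightarrow> dcoef (\<lambda>x. h x + c * k x) = dcoef h + c * dcoef k"
  by (simp add: dcoef_def mom_linear algebra_simps)

lemma dirichlet_L2: "h \<in> L2 M \<Longrightarrow> dirichlet h \<in> L2 M"
  unfolding dirichlet_def by (rule sol_L2[OF L2_M_integrable])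

lemma dirichlet_linear:
  assumes "h \<in> L2 M" "k \<in> L2 M"
  shows "dirichlet (\<lambda>x. h x + c * k x) = (\<lambda>x. dirichlet h x + c * dirichlet k x)"
  unfolding dirichlet_def dcoef_linear[OF assms]
  using sol_linear[OF L2_M_integrable[OF assms(1)] L2_M_integrable[OF assms(2)], of 0 c 0 "dcoef h" "dcoef k"]
  by (simp add: fun_eq_iff)

lemma dirichlet_diff:
  "h \<in> L2 M \<Longrightarrow> k \<in> L2 M \<Longrightarrow> dirichlet (\<lambda>x. h x - k x) = (\<lambda>x. dirichlet h x - dirichlet k x)"
  using dirichlet_linear[of h k "- 1"] by simp

lemma inner_dirichlet:
  "k \<in> L2 M \<Longrightarrow> h \<in> L2 M \<Longrightarrow> L2_inner M k (dirichlet h) = dcoef h * cnj (mom2 k) + L2_inner M k (G h)"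
  unfolding dirichlet_def by (subst inner_sol) simp_all

text \<open>The terms with \<open>dcoef\<close> compensate the boundary term of the Lagrange
  identity; this uses that \<open>y1b\<close> and \<open>y2b\<close> are real.\<close>

lemma dirichlet_symmetric:
  assumes h: "h \<in> L2 M" and k: "k \<in> L2 M"
  shows "L2_inner M h (dirichlet k) = L2_inner M (dirichlet h) k"
proof -
  have "L2_inner M (dirichlet h) k = cnj (dcoef h) * mom2 k + L2_inner M (G h) k"
    using inner_dirichlet[OF k h] L2_inner_cnj[of M "dirichlet h" k] L2_inner_cnj[of M "G h" k] by simp
  moreover have "cnj y1b = y1b" "cnj y2b = y2b" using real_b by (simp_all add: Reals_cnj_iff)
  ultimately show ?thesis
    using inner_dirichlet[OF h k] Lagrange_identity[OF h k]
    by (simp add: dcoef_def algebra_simps) (metis add_right_cancel)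
qed

text \<open>Sources at the endpoints realise every pair of moments because \<open>(1, 0)\<close> and
  \<open>(y1b, y2b)\<close> are independent. Their Dirichlet solutions tend to 0 since the Dirichlet
  Green kernel vanishes at both ends.\<close>

lemma small_energy_source:
  assumes h: "h \<in> L2 M"
  obtains k where "\<And>n. k n \<in> L2 M" "\<And>n. mom1 (k n) = mom1 h" "\<And>n. mom2 (k n) = mom2 h"
    "(\<lambda>n. L2_norm M (dirichlet (k n))) \<longlonglongrightarrow> 0" "(\<lambda>n. L2_inner M (k n) (dirichlet (k n))) \<longlonglongrightarrow> 0"
proof -
  obtain m where m: "m \<in> I" using einterval_nonempty[OF ab] by blast
  obtain \<delta> where \<delta>: "delta_at UNIV 1 0 \<delta>" "\<And>m. m \<in> I \<Longrightarrow> \<forall>\<^sub>F n in sequentially. \<forall>x. \<delta> n x \<noteq> 0 \<longrightarrow> x < m"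
    by (rule delta_at_left_end) blast
  obtain \<delta>' where \<delta>': "delta_at {} y1b y2b \<delta>'" "\<And>m. m \<in> I \<Longrightarrow> \<forall>\<^sub>F n in sequentially. \<forall>x. \<delta>' n x \<noteq> 0 \<longrightarrow> m \<le> x"
    by (rule delta_at_right_end) blast
  \<comment> \<open>The weights solve \<open>\<mu> + \<mu>' * y1b = mom1 h\<close> and
    \<open>\<mu>' * y2b = mom2 h\<close>.\<close>
  let ?\<mu> = "dcoef h" and ?\<mu>' = "mom2 h / y2b"
  show thesis
  proof (rule steering[OF \<delta>(1) \<delta>'(1) \<delta>(2)[OF m] \<delta>'(2)[OF m], of ?\<mu> ?\<mu>'])
    fix k
    assume k: "\<And>n. k n \<in> L2 M" and m1: "\<And>n. mom1 (k n) = ?\<mu> * 1 + ?\<mu>' * y1b" and m2: "\<And>n. mom2 (k n) = ?\<mu> * 0 + ?\<mu>' * y2b"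
      and g: "(\<lambda>n. L2_norm M (\<lambda>x. G (k n) x - (?\<mu> * (if x \<in> UNIV then y1 x * 0 - y2 x * 1 else 0)
        + ?\<mu>' * (if x \<in> {} then y1 x * y2b - y2 x * y1b else 0)))) \<longlonglongrightarrow> 0"
      and lim: "(\<lambda>n. L2_inner M (k n) (G (k n))) \<longlonglongrightarrow> cnj ?\<mu>' * ?\<mu> * (cnj y1b * 0 - cnj y2b * 1)"
    have m: "mom1 (k n) = mom1 h" "mom2 (k n) = mom2 h" for n
      using y2b_nonzero unfolding m1 m2 by (simp_all add: dcoef_def)
    then have d: "dcoef (k n) = dcoef h" for n by (simp add: dcoef_def)
    have "dirichlet (k n) = (\<lambda>x. G (k n) x - (?\<mu> * (if x \<in> UNIV then y1 x * 0 - y2 x * 1 else 0)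
        + ?\<mu>' * (if x \<in> {} then y1 x * y2b - y2 x * y1b else 0)))" for n
      unfolding dirichlet_def d sol_decomp[of 0 "dcoef h" "k n"] by (simp add: fun_eq_iff)
    with g have "(\<lambda>n. L2_norm M (dirichlet (k n))) \<longlonglongrightarrow> 0" by simp
    moreover have "(\<lambda>n. L2_inner M (k n) (dirichlet (k n))) \<longlonglongrightarrow> 0"
    proof -
      \<comment> \<open>The boundary term with \<open>dcoef\<close> and the mixed energy of the two
        sources cancel in the limit.\<close>
      have "(\<lambda>n. dcoef h * cnj (mom2 h) + L2_inner M (k n) (G (k n)))
          \<longlonglongrightarrow> dcoef h * cnj (mom2 h) + cnj ?\<mu>' * ?\<mu> * (cnj y1b * 0 - cnj y2b * 1)"
        by (intro tendsto_intros lim)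
      then show ?thesis
        unfolding inner_dirichlet[OF k k] d m using y2b_nonzero by (simp add: field_simps)
    qed
    ultimately show thesis by (rule that[OF k m])
  qed
qed

lemma dirichlet_eq_G: "mom1 h = 0 \<Longrightarrow> mom2 h = 0 \<Longrightarrow> dirichlet h = G h"
  by (simp add: dirichlet_def dcoef_def)

lemma G_energy_nonneg:
  assumes "h \<in> L2 M" "mom1 h = 0" "mom2 h = 0"
  shows "0 \<le> Re (L2_inner M h (G h))"
proof -
  obtain \<epsilon> where \<epsilon>: "0 < \<epsilon>" "\<And>h. h \<in> L2 M \<Longrightarrow> mom1 h = 0 \<Longrightarrow> mom2 h = 0 \<Longrightarrow> \<epsilon> * (L2_norm M (G h))\<^sup>2 \<le> Re (L2_inner M h (G h))"
    by (rule form_lower_bound) blast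
  have "0 \<le> \<epsilon> * (L2_norm M (G h))\<^sup>2" using \<epsilon>(1) by simp
  also have "\<dots> \<le> Re (L2_inner M h (G h))" by (rule \<epsilon>(2)[OF assms])
  finally show ?thesis .
qed

text \<open>Subtracting a source with equal moments and vanishing energy leaves a source in the
  range of \<open>T_min\<close>, whose energy is nonnegative; the mixed terms tend to 0.\<close>

lemma dirichlet_nonneg:
  assumes h: "h \<in> L2 M"
  shows "0 \<le> Re (L2_inner M h (dirichlet h))"
proof -
  obtain k where k: "\<And>n. k n \<in> L2 M" "\<And>n. mom1 (k n) = mom1 h" "\<And>n. mom2 (k n) = mom2 h"
    "(\<lambda>n. L2_norm M (dirichlet (k n))) \<longlonglongrightarrow> 0" "(\<lambda>n. L2_inner M (k n) (dirichlet (k n))) \<longlonglongrightarrow> 0"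
    by (rule small_energy_source[OF h]) blast
  have cross: "(\<lambda>n. L2_inner M h (dirichlet (k n))) \<longlonglongrightarrow> 0"
    using L2_inner_tendsto_right[OF h dirichlet_L2[OF k(1)] L2_zero] k(4) by simp
  have e: "L2_inner M (\<lambda>x. h x - k n x) (dirichlet (\<lambda>x. h x - k n x))
      = L2_inner M h (dirichlet h) - L2_inner M h (dirichlet (k n)) - cnj (L2_inner M h (dirichlet (k n))) + L2_inner M (k n) (dirichlet (k n))" for n
  proof -
    have "L2_inner M (k n) (dirichlet h) = cnj (L2_inner M h (dirichlet (k n)))"
      using dirichlet_symmetric[OF k(1) h, of n] L2_inner_cnj[of M "dirichlet (k n)" h] by simp
    then show ?thesis
      unfolding dirichlet_diff[OF h k(1)]
      by (simp add: L2_inner_diff_left[OF L2_diff[OF dirichlet_L2[OF h] dirichlet_L2[OF k(1)]] h k(1)]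
          L2_inner_diff_right[OF h dirichlet_L2[OF h] dirichlet_L2[OF k(1)]] L2_inner_diff_right[OF k(1) dirichlet_L2[OF h] dirichlet_L2[OF k(1)]])
  qed
  have "(\<lambda>n. Re (L2_inner M (\<lambda>x. h x - k n x) (dirichlet (\<lambda>x. h x - k n x)))) \<longlonglongrightarrow> Re (L2_inner M h (dirichlet h) - 0 - cnj 0 + 0)"
    unfolding e by (intro tendsto_intros cross k(5))
  moreover have "0 \<le> Re (L2_inner M (\<lambda>x. h x - k n x) (dirichlet (\<lambda>x. h x - k n x)))" for n
  proof -
    have m: "mom1 (\<lambda>x. h x - k n x) = 0" "mom2 (\<lambda>x. h x - k n x) = 0" using k(2,3) by (simp_all add: mom_diff[OF h k(1)])
    then show ?thesis using G_energy_nonneg[OF L2_diff[OF h k(1)] m] by (simp add: dirichlet_eq_G)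
  qed
  ultimately show ?thesis using LIMSEQ_le_const[of _ "Re (L2_inner M h (dirichlet h))" 0] by simp
qed

text \<open>Supplies the triangle inequality for the Dirichlet energy of sources.\<close>

interpretation D: nonneg_symmetric_graph M "{(dirichlet h, h) |h. h \<in> L2 M}"
proof
  fix f h f' h' c
  let ?D = "{(dirichlet h, h) |h. h \<in> L2 M}"
  assume 1: "(f, h) \<in> ?D"
  then have h: "h \<in> L2 M" "f = dirichlet h" by auto
  show "f \<in> L2 M" "h \<in> L2 M" using h dirichlet_L2 by auto
  show "0 \<le> Re (L2_inner M h f)" unfolding h by (rule dirichlet_nonneg[OF h(1)])
  assume "(f', h') \<in> ?D"
  then have h': "h' \<in> L2 M" "f' = dirichlet h'" by auto
  show "L2_inner M h f' = L2_inner M f h'" unfolding h h' by (rule dirichlet_symmetric[OF h(1) h'(1)])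
  show "(\<lambda>x. f x + c * f' x, \<lambda>x. h x + c * h' x) \<in> ?D"
    using dirichlet_linear[OF h(1) h'(1), of c] L2_add[OF h(1) L2_scale[OF h'(1), of c]] h(2) h'(2) by auto
qed

definition "energy h = sqrt (Re (L2_inner M h (dirichlet h)))"

lemma energy_diff:
  assumes "h \<in> L2 M" "k \<in> L2 M"
  shows "energy (\<lambda>x. h x - k x) \<le> energy h + energy k"
  using D.form_triangle[of "(dirichlet h, h)" "(dirichlet k, k)" "- 1"] assms
  by (auto simp: D.form_def D.comb_def energy_def dirichlet_diff)

lemma Krein_nonneg: "nonneg_op M (graph_of Krein_data)"
  unfolding nonneg_op_def
proof clarify
  fix f h assume "(f, h) \<in> graph_of Krein_data"
  then have fh: "h \<in> L2 M" "mom1 h = 0" "mom2 h = 0" "(f, h) \<in> graph_of (\<lambda>_ _ _. True)" by (auto simp: graph_of_def)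
  show "0 \<le> Re (L2_inner M h f)" unfolding inner_Krein[OF fh(4,1,2,3)] by (rule G_energy_nonneg[OF fh(1,2,3)])
qed

text \<open>The kernel part of \<open>f\<close> drops out of the pairing, and for a source without
  moments \<open>G h\<close> is already the Dirichlet solution.\<close>

lemma Krein_energy:
  assumes "(f, h) \<in> graph_of Krein_data"
  shows "Re (L2_inner M h f) = (energy h)\<^sup>2"
proof -
  have fh: "h \<in> L2 M" "mom1 h = 0" "mom2 h = 0" "(f, h) \<in> graph_of (\<lambda>_ _ _. True)" using assms by (auto simp: graph_of_def)
  show ?thesis
    unfolding inner_Krein[OF fh(4,1,2,3)] energy_def using dirichlet_nonneg[OF fh(1)] dirichlet_eq_G[OF fh(2,3)] by simp
qed

text \<open>A self-adjoint extension lies below the adjoint of \<open>T_min\<close>, so each of its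
  members has data \<alpha> and \<beta>.\<close>

lemma extension_subset_maximal:
  assumes "self_adjoint M A" "T_min a b p q r s \<subseteq> A"
  shows "A \<subseteq> graph_of (\<lambda>_ _ _. True)"
proof (rule subrelI)
  fix f h assume "(f, h) \<in> A"
  then have "(f, h) \<in> op_adjoint M A" using assms(1) by (simp add: self_adjoint_def)
  then have "(f, h) \<in> op_adjoint M (graph_of T_min_data)" using op_adjoint_antimono assms(2) unfolding T_min_eq by blast
  then show "(f, h) \<in> graph_of (\<lambda>_ _ _. True)" by (rule T_min_adjoint)
qed

text \<open>Subtracting from \<open>(f, h)\<close> the pair of \<open>T_min\<close> with source
  \<open>h - k n\<close> leaves in \<open>A\<close> a pair with source \<open>k n\<close> and the
  same \<alpha>, \<beta>. Since the energy of \<open>k n\<close> tends to 0, nonnegativity becomes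
  an inequality between boundary terms alone, and their difference is the gap between the form of
  \<open>A\<close> and the Dirichlet energy.\<close>

lemma extension_energy_le:
  assumes A: "self_adjoint M A" "nonneg_op M A" "T_min a b p q r s \<subseteq> A" and fh: "(f, h) \<in> A"
  shows "(energy h)\<^sup>2 \<le> Re (L2_inner M h f)"
proof -
  interpret A: nonneg_symmetric_graph M A using A(1,2) by (rule self_adjoint_nonneg_imp_graph)
  have "(f, h) \<in> graph_of (\<lambda>_ _ _. True)" using extension_subset_maximal[OF A(1,3)] fh by blast
  then obtain \<alpha> \<beta> where f: "f \<in> L2 M" and h: "h \<in> L2 M" and sol: "AE x in leb. f x = sol \<alpha> \<beta> h x" by (auto simp: graph_of_def)
  obtain k where k: "\<And>n. k n \<in> L2 M" "\<And>n. mom1 (k n) = mom1 h" "\<And>n. mom2 (k n) = mom2 h"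
    "(\<lambda>n. L2_norm M (dirichlet (k n))) \<longlonglongrightarrow> 0" "(\<lambda>n. L2_inner M (k n) (dirichlet (k n))) \<longlonglongrightarrow> 0"
    by (rule small_energy_source[OF h]) blast
  \<comment> \<open>The contribution of the homogeneous part of \<open>f\<close>; it involves
    \<open>h\<close> only through moments, which \<open>k n\<close> shares.\<close>
  let ?e = "\<alpha> * cnj (mom1 h) + \<beta> * cnj (mom2 h)"
  have "0 \<le> Re (?e - dcoef h * cnj (mom2 h) + L2_inner M (k n) (dirichlet (k n)))" for n
  proof -
    let ?h' = "\<lambda>x. h x - k n x"
    have h': "?h' \<in> L2 M" by (rule L2_diff[OF h k(1)])
    have "(G ?h', ?h') \<in> graph_of T_min_data"
      by (rule graph_of_sol[OF h']) (use k(2,3) in \<open>simp add: mom_diff[OF h k(1)]\<close>)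
    then have "(G ?h', ?h') \<in> A" using A(3) unfolding T_min_eq by blast
    then have "(\<lambda>x. f x + (- 1) * G ?h' x, \<lambda>x. h x + (- 1) * ?h' x) \<in> A" by (rule A.linear[OF fh])
    then have 0: "0 \<le> Re (L2_inner M (\<lambda>x. h x + (- 1) * ?h' x) (\<lambda>x. f x + (- 1) * G ?h' x))" by (rule A.nonneg)
    have 1: "(\<lambda>x. h x + (- 1) * ?h' x) = k n" by simp
    have 2: "L2_inner M (k n) (\<lambda>x. f x + (- 1) * G ?h' x) = L2_inner M (k n) (sol \<alpha> \<beta> (k n))"
    proof (rule L2_inner_cong_AE[OF k(1) k(1)])
      show "(\<lambda>x. f x + (- 1) * G ?h' x) \<in> L2 M" by (intro L2_add L2_scale f G_L2 h')
      show "sol \<alpha> \<beta> (k n) \<in> L2 M" by (rule sol_L2[OF L2_M_integrable[OF k(1)]])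
      show "AE x in M. f x + (- 1) * G ?h' x = sol \<alpha> \<beta> (k n) x"
        unfolding AE_M using sol
      proof eventually_elim
        case (elim x)
        then show ?case unfolding G_diff[OF h k(1)] by (simp add: sol_decomp[of \<alpha> \<beta> h] sol_decomp[of \<alpha> \<beta> "k n"])
      qed
    qed simp
    have 3: "L2_inner M (k n) (sol \<alpha> \<beta> (k n)) = ?e + L2_inner M (k n) (G (k n))"
      using inner_sol[OF k(1) k(1), of n \<alpha> \<beta> n] unfolding k(2,3) .
    have "dcoef (k n) = dcoef h" by (simp add: dcoef_def k(2,3))
    then have 4: "L2_inner M (k n) (G (k n)) = L2_inner M (k n) (dirichlet (k n)) - dcoef h * cnj (mom2 h)"
      using inner_dirichlet[OF k(1) k(1), of n n] unfolding k(3) by simp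
    show ?thesis using 0 unfolding 1 2 3 4 by (simp add: algebra_simps)
  qed
  moreover have "(\<lambda>n. Re (?e - dcoef h * cnj (mom2 h) + L2_inner M (k n) (dirichlet (k n)))) \<longlonglongrightarrow> Re (?e - dcoef h * cnj (mom2 h) + 0)"
    by (intro tendsto_intros k(5))
  ultimately have "0 \<le> Re (?e - dcoef h * cnj (mom2 h) + 0)" by (intro LIMSEQ_le_const) auto
  then have 1: "Re (dcoef h * cnj (mom2 h)) \<le> Re ?e" by simp
  have "L2_inner M h f = L2_inner M h (sol \<alpha> \<beta> h)"
    by (rule L2_inner_cong_AE[OF h h f sol_L2[OF L2_M_integrable[OF h]]]) (use sol in \<open>simp_all add: AE_M\<close>)
  also have "\<dots> = ?e + L2_inner M h (G h)" by (rule inner_sol[OF h h])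
  finally have 2: "Re (L2_inner M h f) = Re ?e + Re (L2_inner M h (G h))" by simp
  have 3: "Re (L2_inner M h (dirichlet h)) = Re (dcoef h * cnj (mom2 h)) + Re (L2_inner M h (G h))"
    unfolding inner_dirichlet[OF h h] by simp
  have "(energy h)\<^sup>2 = Re (L2_inner M h (dirichlet h))" using dirichlet_nonneg[OF h] by (simp add: energy_def)
  then show ?thesis using 1 2 3 by simp
qed

lemma small_energy_correction:
  assumes h: "h \<in> L2 M" and e: "0 < e"
  obtains k where "k \<in> L2 M" "mom1 k = mom1 h" "mom2 k = mom2 h" "L2_norm M (dirichlet k) < e" "energy k < e"
proof -
  obtain k where k: "\<And>n. k n \<in> L2 M" "\<And>n. mom1 (k n) = mom1 h" "\<And>n. mom2 (k n) = mom2 h"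
    "(\<lambda>n. L2_norm M (dirichlet (k n))) \<longlonglongrightarrow> 0" "(\<lambda>n. L2_inner M (k n) (dirichlet (k n))) \<longlonglongrightarrow> 0"
    by (rule small_energy_source[OF h]) blast
  have "(\<lambda>n. energy (k n)) \<longlonglongrightarrow> sqrt (Re 0)"
    unfolding energy_def by (intro tendsto_real_sqrt tendsto_Re k(5))
  then have "\<forall>\<^sub>F n in sequentially. energy (k n) < e" using order_tendstoD(2)[of _ "0::real" _ e] e by simp
  moreover have "\<forall>\<^sub>F n in sequentially. L2_norm M (dirichlet (k n)) < e" using order_tendstoD(2)[OF k(4) e] .
  ultimately have "\<forall>\<^sub>F n in sequentially. L2_norm M (dirichlet (k n)) < e \<and> energy (k n) < e" by eventually_elim simp
  then obtain n where "L2_norm M (dirichlet (k n)) < e" "energy (k n) < e" using eventually_happens'[OF sequentially_bot] by blast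
  then show ?thesis using that[OF k(1,2,3)] by blast
qed

lemma energy_nonneg: "h \<in> L2 M \<Longrightarrow> 0 \<le> energy h"
  unfolding energy_def using dirichlet_nonneg by simp

text \<open>Subtracting a Dirichlet solution with the same moments changes the data at
  \<open>a\<close>, but these are free in the Krein graph.\<close>

lemma Krein_correction:
  assumes fh: "(f, h) \<in> graph_of (\<lambda>_ _ _. True)" and k: "k \<in> L2 M" "mom1 k = mom1 h" "mom2 k = mom2 h"
  shows "(\<lambda>x. f x - dirichlet k x, \<lambda>x. h x - k x) \<in> graph_of Krein_data"
proof -
  obtain \<alpha> \<beta> where f: "f \<in> L2 M" and h: "h \<in> L2 M" and sol: "AE x in leb. f x = sol \<alpha> \<beta> h x" using fh by (auto simp: graph_of_def)
  show ?thesis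
  proof (rule graph_ofI)
    show "(\<lambda>x. f x - dirichlet k x) \<in> L2 M" by (intro L2_diff f dirichlet_L2 k)
    show "(\<lambda>x. h x - k x) \<in> L2 M" by (intro L2_diff h k)
    show "AE x in leb. f x - dirichlet k x = sol (\<alpha> + (- 1) * 0) (\<beta> + (- 1) * dcoef k) (\<lambda>x. h x - k x) x"
      using sol
    proof eventually_elim
      case (elim x)
      then show ?case
        using sol_linear[OF L2_M_integrable[OF h] L2_M_integrable[OF k(1)], of \<alpha> "- 1" 0 \<beta> "dcoef k" x] by (simp add: dirichlet_def)
    qed
    show "mom1 (\<lambda>x. h x - k x) = 0 \<and> mom2 (\<lambda>x. h x - k x) = 0" using k by (simp add: mom_diff[OF h k(1)])
  qed
qed

text \<open>
  A form-convergent sequence in the graph of an arbitrary nonnegative extension is moved into the graph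
  of the Krein extension by subtracting sources of small Dirichlet energy; this does not increase the form.
\<close>

lemma Krein_form_le:
  assumes A: "self_adjoint M A" "nonneg_op M A" "T_min a b p q r s \<subseteq> A"
  shows "form_le M (graph_of Krein_data) A"
proof -
  interpret A: nonneg_symmetric_graph M A using A(1,2) by (rule self_adjoint_nonneg_imp_graph)
  interpret K: nonneg_symmetric_graph M "graph_of Krein_data"
    using Krein_self_adjoint Krein_nonneg by (rule self_adjoint_nonneg_imp_graph)
  have main: "u \<in> form_domain M (graph_of Krein_data) \<and> form_value M (graph_of Krein_data) u \<le> form_value M A u"
    if "u \<in> form_domain M A" for u
  proof -
    obtain w where w: "form_convergent M A w u" and u: "u \<in> L2 M" using \<open>u \<in> form_domain M A\<close> by (auto simp: form_domain_def)
    note W = w[unfolded A.form_convergent_iff]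
    define f where "f n = fst (w n)" for n
    define h where "h n = snd (w n)" for n
    have wA: "(f n, h n) \<in> A" for n using W by (simp add: f_def h_def)
    have fL: "f n \<in> L2 M" and hL: "h n \<in> L2 M" for n using A.L2[OF wA] by auto
    have diffA: "(\<lambda>x. f m x - f n x, \<lambda>x. h m x - h n x) \<in> A" for m n
      using A.linear[OF wA wA, of m "- 1" n] by simp
    \<comment> \<open>The corrections shrink both in L2, which keeps the limit \<open>u\<close>, and
      in energy, which keeps form convergence.\<close>
    have "\<exists>k. k \<in> L2 M \<and> mom1 k = mom1 (h n) \<and> mom2 k = mom2 (h n) \<and> L2_norm M (dirichlet k) < 1 / real (Suc n) \<and> energy k < 1 / real (Suc n)" for n
      by (rule small_energy_correction[OF hL[of n], of "1 / real (Suc n)"]) auto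
    then obtain k where k: "\<And>n. k n \<in> L2 M" "\<And>n. mom1 (k n) = mom1 (h n)" "\<And>n. mom2 (k n) = mom2 (h n)"
      "\<And>n. L2_norm M (dirichlet (k n)) < 1 / real (Suc n)" "\<And>n. energy (k n) < 1 / real (Suc n)"
      by metis
    define w' where "w' n = (\<lambda>x. f n x - dirichlet (k n) x, \<lambda>x. h n x - k n x)" for n
    have w'K: "w' n \<in> graph_of Krein_data" for n
      unfolding w'_def using extension_subset_maximal[OF A(1,3)] wA[of n] k(1,2,3)[of n] by (intro Krein_correction) auto
    have K_form: "K.form v v = (energy (snd v))\<^sup>2" if "v \<in> graph_of Krein_data" for v
      using Krein_energy[of "fst v" "snd v"] that by (simp add: K.form_def)
    have conv: "form_convergent M (graph_of Krein_data) w' u"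
      unfolding K.form_convergent_iff
    proof (intro conjI allI impI)
      show "w' n \<in> graph_of Krein_data" for n by (rule w'K)
      have lim: "(\<lambda>n. L2_norm M (\<lambda>x. f n x - u x) + 1 / real (Suc n)) \<longlonglongrightarrow> 0"
        using tendsto_add[OF _ inverse_Suc_null, of "\<lambda>n. L2_norm M (\<lambda>x. f n x - u x)" 0] W by (simp add: f_def)
      show "(\<lambda>n. L2_norm M (\<lambda>x. fst (w' n) x - u x)) \<longlonglongrightarrow> 0"
      proof (rule Lim_null_comparison[OF always_eventually lim], rule allI)
        fix n
        have "(\<lambda>x. fst (w' n) x - u x) = (\<lambda>x. (f n x - u x) + (- 1) * dirichlet (k n) x)" by (simp add: w'_def fun_eq_iff)
        then have "L2_norm M (\<lambda>x. fst (w' n) x - u x) \<le> L2_norm M (\<lambda>x. f n x - u x) + L2_norm M (dirichlet (k n))"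
          using L2_triangle[OF L2_diff[OF fL u] L2_scale[OF dirichlet_L2[OF k(1)]], of n "- 1" n] L2_norm_scale[of M "- 1" "dirichlet (k n)"]
          by simp
        then show "norm (L2_norm M (\<lambda>x. fst (w' n) x - u x)) \<le> L2_norm M (\<lambda>x. f n x - u x) + 1 / real (Suc n)"
          using k(4)[of n] by simp
      qed
      fix e :: real assume e: "0 < e"
      \<comment> \<open>Three contributions below \<open>d\<close>: the energy of
        \<open>h m - h n\<close>, controlled by the form of \<open>A\<close>, and the energies of
        the two corrections.\<close>
      define d where "d = sqrt e / 3"
      have d: "0 < d" "(3 * d)\<^sup>2 = e" using e by (simp_all add: d_def)
      have "0 < d\<^sup>2" using d(1) by simp
      then obtain N1 where N1: "\<And>m n. m \<ge> N1 \<Longrightarrow> n \<ge> N1 \<Longrightarrow> A.form (A.comb (- 1) (w m) (w n)) (A.comb (- 1) (w m) (w n)) < d\<^sup>2"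
        using W by blast
      obtain N2 where N2: "\<And>n. n \<ge> N2 \<Longrightarrow> 1 / real (Suc n) < d"
        using order_tendstoD(2)[OF inverse_Suc_null d(1)] unfolding eventually_sequentially by blast
      have "K.form (K.comb (- 1) (w' m) (w' n)) (K.comb (- 1) (w' m) (w' n)) < e" if mn: "m \<ge> max N1 N2" "n \<ge> max N1 N2" for m n
      proof -
        have "(energy (\<lambda>x. h m x - h n x))\<^sup>2 \<le> Re (L2_inner M (\<lambda>x. h m x - h n x) (\<lambda>x. f m x - f n x))"
          by (rule extension_energy_le[OF A diffA])
        also have "\<dots> < d\<^sup>2"
          using N1[of m n] mn by (simp add: A.form_def A.comb_def f_def h_def)
        finally have 1: "energy (\<lambda>x. h m x - h n x) < d" by (rule power_less_imp_less_base) (use d in simp)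
        have "energy (k m) < d" "energy (k n) < d" using k(5)[of m] k(5)[of n] N2[of m] N2[of n] mn by auto
        then have 2: "energy (\<lambda>x. k m x - k n x) < 2 * d" using energy_diff[OF k(1) k(1), of m n] by linarith
        have "snd (K.comb (- 1) (w' m) (w' n)) = (\<lambda>x. (h m x - h n x) - (k m x - k n x))"
          by (simp add: K.comb_def w'_def fun_eq_iff)
        then have "energy (snd (K.comb (- 1) (w' m) (w' n))) < 3 * d"
          using energy_diff[OF L2_diff[OF hL hL] L2_diff[OF k(1) k(1)], of m n m n] 1 2 by simp
        moreover have "0 \<le> energy (snd (K.comb (- 1) (w' m) (w' n)))"
          by (rule energy_nonneg[OF K.L2'(2)[OF K.comb_in[OF w'K w'K]]])
        ultimately have "(energy (snd (K.comb (- 1) (w' m) (w' n))))\<^sup>2 < (3 * d)\<^sup>2" by (intro power_strict_mono) auto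
        then show ?thesis unfolding d(2) K_form[OF K.comb_in[OF w'K w'K]] .
      qed
      then show "\<exists>N. \<forall>m\<ge>N. \<forall>n\<ge>N. K.form (K.comb (- 1) (w' m) (w' n)) (K.comb (- 1) (w' m) (w' n)) < e" by blast
    qed
    have limK: "(\<lambda>n. K.form (w' n) (w' n)) \<longlonglongrightarrow> form_value M (graph_of Krein_data) u" by (rule K.form_value_tendsto[OF conv u])
    have limA: "(\<lambda>n. A.form (w n) (w n)) \<longlonglongrightarrow> form_value M A u" by (rule A.form_value_tendsto[OF w u])
    have A0: "0 \<le> A.form (w n) (w n)" for n using A.form_nonneg W by blast
    \<comment> \<open>The comparison is made between square roots, where a correction costs only an
      additive \<open>1 / real (Suc n)\<close>.\<close>
    have "(\<lambda>n. (sqrt (A.form (w n) (w n)) + 1 / real (Suc n))\<^sup>2) \<longlonglongrightarrow> (sqrt (form_value M A u) + 0)\<^sup>2"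
      by (intro tendsto_intros tendsto_real_sqrt limA inverse_Suc_null)
    moreover have "0 \<le> form_value M A u" using LIMSEQ_le_const[OF limA] A0 by blast
    ultimately have "(\<lambda>n. (sqrt (A.form (w n) (w n)) + 1 / real (Suc n))\<^sup>2) \<longlonglongrightarrow> form_value M A u" by simp
    moreover have "K.form (w' n) (w' n) \<le> (sqrt (A.form (w n) (w n)) + 1 / real (Suc n))\<^sup>2" for n
    proof -
      have "(energy (h n))\<^sup>2 \<le> A.form (w n) (w n)"
        using extension_energy_le[OF A wA, of n] by (simp add: A.form_def f_def h_def)
      then have "energy (h n) \<le> sqrt (A.form (w n) (w n))" by (rule real_le_rsqrt)
      then have "energy (\<lambda>x. h n x - k n x) \<le> sqrt (A.form (w n) (w n)) + 1 / real (Suc n)"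
        using energy_diff[OF hL k(1), of n n] k(5)[of n] by linarith
      then show ?thesis
        unfolding K_form[OF w'K] using energy_nonneg[OF L2_diff[OF hL k(1)], of n n] by (intro power_mono) (simp_all add: w'_def)
    qed
    ultimately have "form_value M (graph_of Krein_data) u \<le> form_value M A u"
      by (intro LIMSEQ_le[OF limK]) auto
    moreover have "u \<in> form_domain M (graph_of Krein_data)" using conv u by (auto simp: form_domain_def)
    ultimately show ?thesis by blast
  qed
  then show ?thesis unfolding form_le_def by blast
qed

text \<open>Minimality of the Krein graph gives existence, antisymmetry of the form order gives
  uniqueness.\<close>

theorem is_Krein_iff:
  "is_Krein_von_Neumann_extension M (T_min a b p q r s) S \<longleftrightarrow> S = graph_of Krein_data"
proof
  have sub: "T_min a b p q r s \<subseteq> graph_of Krein_data" unfolding T_min_eq by (rule graph_of_mono) simp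
  show "is_Krein_von_Neumann_extension M (T_min a b p q r s) S" if "S = graph_of Krein_data"
    unfolding is_Krein_von_Neumann_extension_def that using Krein_self_adjoint Krein_nonneg sub Krein_form_le by blast
  assume S: "is_Krein_von_Neumann_extension M (T_min a b p q r s) S"
  show "S = graph_of Krein_data"
    using S unfolding is_Krein_von_Neumann_extension_def
    by (intro form_le_antisym) (use Krein_self_adjoint Krein_nonneg sub Krein_form_le in blast)+
qed

section \<open>Boundary conditions\<close>

lemma u_sol: "u1 x = sol 0 (1 / y2b) (\<lambda>x. 0) x" "u2 x = sol 1 (- y1b / y2b) (\<lambda>x. 0) x"
  by (simp_all add: sol_homogeneous u1_def u2_def)

lemma u_solves_bvp: "solves_bvp a b p q r s 0 1 u1" "solves_bvp a b p q r s 1 0 u2"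
  using sol_quasi_deriv(1,3,4,6)[OF wint_zero u_sol(1)] sol_quasi_deriv(1,3,4,6)[OF wint_zero u_sol(2)] y2b_nonzero
  by (simp_all add: solves_bvp_def)

text \<open>The source vanishes almost everywhere, so \<open>v\<close> is homogeneous, and two
  boundary values determine its data because \<open>y2b\<close> is nonzero.\<close>

lemma bvp_unique:
  assumes v: "solves_bvp a b p q r s \<alpha> \<beta> v" and x: "x \<in> I"
  shows "v x = \<alpha> * y1 x + (\<beta> - y1b * \<alpha>) / y2b * y2 x"
proof -
  let ?h = "tau a b p q r s v"
  have z: "AE t in leb. ?h t = 0" using v by (simp add: solves_bvp_def)
  \<comment> \<open>Measurability of the source is inherited from the zero function along almost
    everywhere equality.\<close>
  have "AE t in leb. 0 = complex_of_real (r t) * ?h t" using z by eventually_elim simp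
  moreover from this have "(\<lambda>t. complex_of_real (r t) * ?h t) \<in> borel_measurable leb"
    by (rule leb_borel_measurable_AE[rotated]) simp
  ultimately have w: "wint ?h" by (intro integrable_cong_AE_imp[OF Bochner_Integration.integrable_zero]) (auto elim: eventually_mono)
  obtain \<alpha>' \<beta>' where s: "\<And>x. x \<in> I \<Longrightarrow> v x = sol \<alpha>' \<beta>' ?h x"
    by (rule D_tau_eq_sol[of v]) (use v w in \<open>auto simp: solves_bvp_def\<close>)
  have s': "v x = sol \<alpha>' \<beta>' (\<lambda>x. 0) x" if "x \<in> I" for x
    using s[OF that] sol_cong_AE(3)[OF w wint_zero z] by simp
  have "\<alpha>' = \<alpha>" using sol_quasi_deriv(4)[OF wint_zero s'] v by (simp add: solves_bvp_def)
  moreover have "y1b * \<alpha>' + y2b * \<beta>' = \<beta>" using sol_quasi_deriv(6)[OF wint_zero s'] v by (simp add: solves_bvp_def)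
  ultimately have "\<beta>' = (\<beta> - y1b * \<alpha>) / y2b" using y2b_nonzero by (simp add: field_simps)
  then show ?thesis using s'[OF x] \<open>\<alpha>' = \<alpha>\<close> by (simp add: sol_homogeneous)
qed

lemma u_quasi_deriv_ends:
  "left_value a (quasi_deriv a b p s u1) = 1 / y2b" "right_value b (quasi_deriv a b p s u1) = z2b / y2b"
  "left_value a (quasi_deriv a b p s u2) = - y1b / y2b" "right_value b (quasi_deriv a b p s u2) = z1b - z2b * y1b / y2b"
  using sol_quasi_deriv(5,7)[OF wint_zero u_sol(1)] sol_quasi_deriv(5,7)[OF wint_zero u_sol(2)] by simp_all

text \<open>In terms of the fundamental system the matrix is the transfer matrix, which carries the
  data of a homogeneous solution from \<open>a\<close> to \<open>b\<close>; its determinant is the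
  Wronskian at \<open>b\<close>.\<close>

lemma Krein_matrix_eq: "Krein_matrix a b p s u1 u2 = vector [vector [y1b, y2b], vector [z1b, z2b]]"
  unfolding Krein_matrix_def u_quasi_deriv_ends Let_def
  using y2b_nonzero by (simp add: vec_eq_iff forall_2 map_matrix_def field_simps)

lemma Krein_matrix_SL2: "Krein_matrix a b p s u1 u2 \<in> SL2_real"
proof -
  let ?A = "vector [vector [Re y1b, Re y2b], vector [Re z1b, Re z2b]] :: real^2^2"
  have e: "complex_of_real (Re y1b) = y1b" "complex_of_real (Re y2b) = y2b" "complex_of_real (Re z1b) = z1b" "complex_of_real (Re z2b) = z2b"
    using real_b by simp_all
  have "map_matrix complex_of_real ?A = vector [vector [y1b, y2b], vector [z1b, z2b]]"
    by (simp add: vec_eq_iff forall_2 map_matrix_def e)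
  moreover have "det ?A = 1"
  proof -
    have "complex_of_real (det ?A) = y1b * z2b - y2b * z1b" by (simp add: det_2 e)
    then show ?thesis using wronskian_b by (metis of_real_eq_1_iff)
  qed
  ultimately show ?thesis unfolding Krein_matrix_eq SL2_real_def by (metis (mono_tags, lifting) mem_Collect_eq)
qed

text \<open>The data at \<open>b\<close> are those transferred from \<open>a\<close> plus a linear
  expression in the moments, whose coefficient matrix is invertible by the Wronskian at
  \<open>b\<close>.\<close>

lemma Krein_boundary_condition:
  assumes h: "h \<in> L2 M" and g: "\<And>x. x \<in> I \<Longrightarrow> g x = sol \<alpha> \<beta> h x"
  shows "vector [right_value b g, right_value b (quasi_deriv a b p s g)] =
     Krein_matrix a b p s u1 u2 *v (vector [left_value a g, left_value a (quasi_deriv a b p s g)] :: complex^2)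
     \<longleftrightarrow> mom1 h = 0 \<and> mom2 h = 0"
proof -
  note Q = sol_quasi_deriv(4-7)[OF L2_M_integrable[OF h] g]
  have "vector [right_value b g, right_value b (quasi_deriv a b p s g)] =
     Krein_matrix a b p s u1 u2 *v (vector [left_value a g, left_value a (quasi_deriv a b p s g)] :: complex^2)
     \<longleftrightarrow> y1b * mom2 h - y2b * mom1 h = 0 \<and> z1b * mom2 h - z2b * mom1 h = 0"
    unfolding Krein_matrix_eq
    by (simp add: vec_eq_iff forall_2 matrix_vector_mult_def sum_2 Q algebra_simps)
  also have "\<dots> \<longleftrightarrow> mom1 h = 0 \<and> mom2 h = 0"
  proof
    assume e: "y1b * mom2 h - y2b * mom1 h = 0 \<and> z1b * mom2 h - z2b * mom1 h = 0"
    have eqs: "(y1b * z2b - y2b * z1b) * mom1 h = z1b * (y1b * mom2 h - y2b * mom1 h) - y1b * (z1b * mom2 h - z2b * mom1 h)"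
      "(y1b * z2b - y2b * z1b) * mom2 h = z2b * (y1b * mom2 h - y2b * mom1 h) - y2b * (z1b * mom2 h - z2b * mom1 h)"
      by (simp_all add: algebra_simps)
    show "mom1 h = 0 \<and> mom2 h = 0"
      using eqs[unfolded wronskian_b conjunct1[OF e] conjunct2[OF e]] by simp
  qed simp
  finally show ?thesis .
qed

lemma tau_op_dom_Krein: "tau_op a b p q r s (dom_Krein a b p q r s (Krein_matrix a b p s u1 u2)) = graph_of Krein_data"
proof (rule tau_op_eq_graph_of)
  show "dom_Krein a b p q r s (Krein_matrix a b p s u1 u2) \<subseteq> dom_max a b p q r s" by (auto simp: dom_Krein_def)
  show "mom1 h = 0 \<and> mom2 h = 0"
    if "g \<in> dom_Krein a b p q r s (Krein_matrix a b p s u1 u2)" "h \<in> L2 M" "\<And>x. x \<in> I \<Longrightarrow> g x = sol \<alpha> \<beta> h x" for g \<alpha> \<beta> h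
    using that(1) Krein_boundary_condition[OF that(2,3)] by (simp add: dom_Krein_def)
  show "sol \<alpha> \<beta> h \<in> dom_Krein a b p q r s (Krein_matrix a b p s u1 u2)" if "h \<in> L2 M" "mom1 h = 0 \<and> mom2 h = 0" for \<alpha> \<beta> h
    using sol_dom_max[OF that(1)] Krein_boundary_condition[OF that(1) refl] that(2) by (simp add: dom_Krein_def)
qed

end

theorem theorem12p3:
  fixes a b :: ereal and p q r s :: "real \<Rightarrow> real"
  assumes "a < b"
    and "p \<in> borel_measurable (lebesgue_on (einterval a b))"
    and "integrable (lebesgue_on (einterval a b)) (\<lambda>x. 1 / p x)"
    and "integrable (lebesgue_on (einterval a b)) q"
    and "integrable (lebesgue_on (einterval a b)) r"
    and "integrable (lebesgue_on (einterval a b)) s"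
    and "AE x in lebesgue_on (einterval a b). 0 < p x"
    and "AE x in lebesgue_on (einterval a b). 0 < r x"
    and "strictly_positive_op (weighted_measure a b r) (T_min a b p q r s)"
  shows "\<exists>u1 u2.
      solves_bvp a b p q r s 0 1 u1 \<and> positive_on a b u1 \<and>
      (\<forall>v. solves_bvp a b p q r s 0 1 v \<longrightarrow> (\<forall>x\<in>einterval a b. v x = u1 x)) \<and>
      solves_bvp a b p q r s 1 0 u2 \<and> positive_on a b u2 \<and>
      (\<forall>v. solves_bvp a b p q r s 1 0 v \<longrightarrow> (\<forall>x\<in>einterval a b. v x = u2 x)) \<and>
      left_value a (quasi_deriv a b p s u1) \<noteq> 0 \<and>
      Krein_matrix a b p s u1 u2 \<in> SL2_real \<and>
      (\<forall>S. is_Krein_von_Neumann_extension (weighted_measure a b r) (T_min a b p q r s) S \<longleftrightarrow>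
           S = tau_op a b p q r s (dom_Krein a b p q r s (Krein_matrix a b p s u1 u2)))"
proof -
  interpret sturm_liouville a b p q r s using assms by unfold_locales
  obtain y1 z1 y2 z2 where "sturm_liouville_system a b p q r s y1 z1 y2 z2" using system_exists by blast
  then interpret sturm_liouville_system a b p q r s y1 z1 y2 z2 .
  interpret positive_sturm_liouville_system a b p q r s y1 z1 y2 z2 using assms(9) by unfold_locales
  show ?thesis
  proof (rule exI[of _ u1], rule exI[of _ u2], intro conjI allI impI ballI)
    show "left_value a (quasi_deriv a b p s u1) \<noteq> 0" using y2b_nonzero by (simp add: u_quasi_deriv_ends)
    show "v x = u1 x" if "solves_bvp a b p q r s 0 1 v" "x \<in> einterval a b" for v x
      using bvp_unique[OF that] by (simp add: u1_def)
    show "v x = u2 x" if "solves_bvp a b p q r s 1 0 v" "x \<in> einterval a b" for v x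
      using bvp_unique[OF that] by (simp add: u2_def)
  qed (use u_solves_bvp u_positive Krein_matrix_SL2 is_Krein_iff tau_op_dom_Krein in simp_all)
qed

end
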